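(* Let $X=\mathbb{Q}_p$ with Haar measure $m$, let $\gamma>0$, $L=\mathfrak D^{\gamma}$, and let $V:X\to\mathbb R$ be a measurable function with $V\in L^{q}+L^\infty$ for some $q\ge 1$ with $q>1/\gamma$. Let $Q=Q_L+Q_V$ with $dom(Q)=dom(Q_L)\cap dom(Q_V)$. Then: 1. $Q$ is a densely defined, closed and bounded below form, whence it is associated with a bounded below self-adjoint operator $H$. 2. If $2\le 1/\gamma<q$ then $dom(H)=dom(\mathfrak D^{\gamma})$. The same is true if $1/\gamma<2$ and $q=2$.
   Context: $\mathbb{Q}_p$ is the $p$-adic numbers with norm $\|\cdot\|_p$ and Haar measure $m$ normalized by $m(\mathbb Z_p)=1$; $\mathbb Q_p$ is identified with its dual group and $\widehat f$ denotes the Fourier transform. $\mathfrak D^{\gamma}$ is the Taibleson–Vladimirov operator: the non-negative self-adjoint operator in $L^2(\mathbb Q_p,m)$ defined as the Fourier multiplier $\widehat{\mathfrak D^{\gamma}f}(\xi)=\|\xi\|_p^{\gamma}\widehat f(\xi)$. $Q_L(u,u)=(L^{1/2}u,L^{1/2}u)$ with $dom(Q_L)=dom(L^{1/2})$, and $Q_V(u,u)=\int_X V|u|^2dm$ with $dom(Q_V)=\{u\in L^2(X,m):\int_X|V||u|^2dm<\infty\}$. For $q\ge1$, $V\in L^q+L^\infty$ means $V=V'+V''$ with $V'\in L^q(X,m)$ and $V''\in L^\infty(X,m)$. Here $p$ is prime. *)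

theory Defs
  imports
    "HOL-Analysis.Analysis"
    Berlekamp_Zassenhaus.Finite_Field
begin

section \<open>The p-adic absolute value on the rationals\<close>

definition padic_abs :: "nat \<Rightarrow> rat \<Rightarrow> real" where
  "padic_abs p r = (if r = 0 then 0 else
     real p powi (int (multiplicity (int p) (snd (quotient_of r)))
                - int (multiplicity (int p) (fst (quotient_of r)))))"

lemma padic_abs_0 [simp]: "padic_abs p 0 = 0"
  by (simp add: padic_abs_def)

lemma padic_abs_1 [simp]: "padic_abs p 1 = 1"
  by (simp add: padic_abs_def)

lemma padic_abs_nonneg [simp]: "padic_abs p r \<ge> 0"
  by (simp add: padic_abs_def)

lemma padic_abs_divide:
  assumes p: "prime p" and a: "a \<noteq> 0" and b: "b \<noteq> 0"
  shows "padic_abs p (of_int a / of_int b)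
       = real p powi (int (multiplicity (int p) b) - int (multiplicity (int p) a))"
proof -
  let ?r = "of_int a / of_int b :: rat"
  obtain c d where q: "quotient_of ?r = (c, d)"
    by (cases "quotient_of ?r") auto
  have d: "d > 0"
    using q by (rule quotient_of_denom_pos)
  have r: "?r = of_int c / of_int d"
    using q by (rule quotient_of_div)
  have r0: "?r \<noteq> 0"
    using a b by simp
  have c: "c \<noteq> 0"
    using r r0 by auto
  have "(of_int (a * d) :: rat) = of_int (c * b)"
    using r b d by (simp add: field_simps)
  then have eq: "a * d = c * b"
    using of_int_eq_iff by blast
  have pe: "prime_elem (int p)"
    using p by (simp add: prime_nat_int_transfer)
  have "multiplicity (int p) a + multiplicity (int p) d
      = multiplicity (int p) c + multiplicity (int p) b"
    using eq pe a b c d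
    by (metis less_irrefl prime_elem_multiplicity_mult_distrib)
  then have "int (multiplicity (int p) d) - int (multiplicity (int p) c)
      = int (multiplicity (int p) b) - int (multiplicity (int p) a)"
    by linarith
  then show ?thesis
    using r0 q by (simp add: padic_abs_def)
qed

lemma rat_as_quotient:
  obtains a b :: int where "(r::rat) = of_int a / of_int b" "b \<noteq> 0"
  by (metis less_irrefl quotient_of_denom_pos quotient_of_div surj_pair)

lemma padic_abs_eq_0 [simp]: "prime p \<Longrightarrow> padic_abs p r = 0 \<longleftrightarrow> r = 0"
  by (auto simp: padic_abs_def power_int_eq_0_iff)

lemma padic_abs_mult:
  assumes p: "prime p"
  shows "padic_abs p (r * s) = padic_abs p r * padic_abs p s"
proof (cases "r = 0 \<or> s = 0")
  case False
  obtain a b where r: "r = of_int a / of_int b" "b \<noteq> 0"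
    by (rule rat_as_quotient)
  obtain c d where s: "s = of_int c / of_int d" "d \<noteq> 0"
    by (rule rat_as_quotient)
  have ac: "a \<noteq> 0" "c \<noteq> 0"
    using False r s by auto
  have pe: "prime_elem (int p)"
    using p by (simp add: prime_nat_int_transfer)
  have rs: "r * s = of_int (a * c) / of_int (b * d)"
    using r s by simp
  show ?thesis
    unfolding rs using r s ac p pe prime_gt_0_nat[OF p]
    by (simp add: padic_abs_divide prime_elem_multiplicity_mult_distrib
        power_int_add[symmetric] algebra_simps del: of_int_mult)
qed auto

lemma padic_abs_minus [simp]:
  assumes "prime p" shows "padic_abs p (- r) = padic_abs p r"
proof -
  have "(padic_abs p (-1))\<^sup>2 = 1"
    using padic_abs_mult[OF assms, of "-1" "-1"] by (simp add: power2_eq_square)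
  then have "padic_abs p (-1) = 1 \<or> padic_abs p (-1) = -1"
    by (simp add: power2_eq_1_iff)
  moreover have "padic_abs p (-1) \<ge> 0"
    by simp
  ultimately have "padic_abs p (-1) = 1"
    by linarith
  then show ?thesis
    using padic_abs_mult[OF assms, of "-1" r] by simp
qed

lemma padic_abs_add:
  assumes p: "prime p"
  shows "padic_abs p (r + s) \<le> max (padic_abs p r) (padic_abs p s)"
proof (cases "r = 0 \<or> s = 0 \<or> r + s = 0")
  case False
  obtain a0 b where r: "r = of_int a0 / of_int b" "b \<noteq> 0"
    by (rule rat_as_quotient)
  obtain c0 d where s: "s = of_int c0 / of_int d" "d \<noteq> 0"
    by (rule rat_as_quotient)
  define a c e where "a = a0 * d" and "c = c0 * b" and "e = b * d"
  have e: "e \<noteq> 0" using r s by (simp add: e_def)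
  have r': "r = of_int a / of_int e" and s': "s = of_int c / of_int e"
    using r s by (simp_all add: a_def c_def e_def)
  have rs': "r + s = of_int (a + c) / of_int e"
    using r' s' by (simp add: add_divide_distrib)
  have nz: "a \<noteq> 0" "c \<noteq> 0" "a + c \<noteq> 0"
    using False r' s' rs' by auto
  let ?m = "multiplicity (int p)"
  have "int p ^ min (?m a) (?m c) dvd a + c"
    by (intro dvd_add multiplicity_dvd') auto
  moreover have "\<not> is_unit (int p)"
    using p prime_gt_1_nat[OF p] by simp
  ultimately have "min (?m a) (?m c) \<le> ?m (a + c)"
    using nz by (intro multiplicity_geI) auto
  then have "int (?m e) - int (?m (a + c)) \<le> int (?m e) - int (?m a)
      \<or> int (?m e) - int (?m (a + c)) \<le> int (?m e) - int (?m c)"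
    by linarith
  moreover have "real p \<ge> 1"
    using prime_gt_0_nat[OF p] by simp
  ultimately show ?thesis
    unfolding rs' unfolding r' s'
    using padic_abs_divide[OF p nz(1) e] padic_abs_divide[OF p nz(2) e]
      padic_abs_divide[OF p nz(3) e]
    by (auto simp: le_max_iff_disj simp del: of_int_add intro: power_int_increasing)
qed (auto simp: le_max_iff_disj)

lemma padic_abs_triangle:
  assumes "prime p"
  shows "padic_abs p (r + s) \<le> padic_abs p r + padic_abs p s"
  using padic_abs_add[OF assms, of r s] padic_abs_nonneg[of p r] padic_abs_nonneg[of p s]
  by linarith

lemma padic_abs_diff_commute:
  "prime p \<Longrightarrow> padic_abs p (r - s) = padic_abs p (s - r)"
  by (metis minus_diff_eq padic_abs_minus)

lemma padic_abs_reverse_triangle: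
  assumes "prime p"
  shows "\<bar>padic_abs p r - padic_abs p s\<bar> \<le> padic_abs p (r - s)"
  using padic_abs_triangle[OF assms, of "r - s" s] padic_abs_triangle[OF assms, of "s - r" r]
    padic_abs_diff_commute[OF assms, of r s]
  by simp

lemma padic_abs_inverse:
  assumes "prime p" shows "padic_abs p (inverse r) = inverse (padic_abs p r)"
proof (cases "r = 0")
  case False
  have "padic_abs p r * padic_abs p (inverse r) = 1"
    using padic_abs_mult[OF assms, of r "inverse r"] False by simp
  then show ?thesis
    by (metis inverse_unique)
qed auto


section \<open>The field of p-adic numbers\<close>

text \<open>
  The prime \<open>p\<close> is the cardinality of the parameter type \<open>'p :: prime_card\<close>; the field
  \<open>'p padic\<close> is the completion of the rationals with respect to the p-adic absolute value,
  constructed from Cauchy sequences.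
\<close>

definition padic_cauchy :: "nat \<Rightarrow> (nat \<Rightarrow> rat) \<Rightarrow> bool" where
  "padic_cauchy p X \<longleftrightarrow> (\<forall>e>0. \<exists>N. \<forall>m\<ge>N. \<forall>n\<ge>N. padic_abs p (X m - X n) < e)"

definition padic_null :: "nat \<Rightarrow> (nat \<Rightarrow> rat) \<Rightarrow> bool" where
  "padic_null p X \<longleftrightarrow> (\<lambda>n. padic_abs p (X n)) \<longlonglongrightarrow> 0"

definition padic_rel :: "nat \<Rightarrow> (nat \<Rightarrow> rat) \<Rightarrow> (nat \<Rightarrow> rat) \<Rightarrow> bool" where
  "padic_rel p X Y \<longleftrightarrow> padic_cauchy p X \<and> padic_cauchy p Y \<and> padic_null p (\<lambda>n. X n - Y n)"

lemma padic_cauchy_const [simp]: "padic_cauchy p (\<lambda>_. c)"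
  by (simp add: padic_cauchy_def)

lemma padic_null_zero [simp]: "padic_null p (\<lambda>_. 0)"
  by (simp add: padic_null_def)

lemma padic_nullI:
  assumes "\<And>n. n \<ge> N \<Longrightarrow> padic_abs p (X n) \<le> g n" and "g \<longlonglongrightarrow> 0"
  shows "padic_null p X"
  unfolding padic_null_def
proof (rule tendsto_sandwich[OF _ _ tendsto_const assms(2)])
  show "\<forall>\<^sub>F n in sequentially. 0 \<le> padic_abs p (X n)"
    by simp
  show "\<forall>\<^sub>F n in sequentially. padic_abs p (X n) \<le> g n"
    using assms(1) eventually_sequentially by blast
qed

lemma padic_null_add:
  assumes p: "prime p" and "padic_null p X" "padic_null p Y"
  shows "padic_null p (\<lambda>n. X n + Y n)"
proof -
  have "(\<lambda>n. padic_abs p (X n) + padic_abs p (Y n)) \<longlonglongrightarrow> 0"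
    using assms unfolding padic_null_def by (intro tendsto_add_zero)
  then show ?thesis
    by (rule padic_nullI[rotated]) (rule padic_abs_triangle[OF p])
qed

lemma padic_null_minus: "prime p \<Longrightarrow> padic_null p X \<Longrightarrow> padic_null p (\<lambda>n. - X n)"
  by (simp add: padic_null_def)

lemma padic_cauchy_add:
  assumes p: "prime p" and X: "padic_cauchy p X" and Y: "padic_cauchy p Y"
  shows "padic_cauchy p (\<lambda>n. X n + Y n)"
  unfolding padic_cauchy_def
proof (intro allI impI)
  fix e :: real assume e: "e > 0"
  obtain M where M: "\<forall>m\<ge>M. \<forall>n\<ge>M. padic_abs p (X m - X n) < e"
    using X e unfolding padic_cauchy_def by blast
  obtain N where N: "\<forall>m\<ge>N. \<forall>n\<ge>N. padic_abs p (Y m - Y n) < e"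
    using Y e unfolding padic_cauchy_def by blast
  have "padic_abs p (X m + Y m - (X n + Y n)) < e" if "m \<ge> max M N" "n \<ge> max M N" for m n
  proof -
    have "padic_abs p (X m - X n) < e" "padic_abs p (Y m - Y n) < e"
      using M N that by simp_all
    then show ?thesis
      using padic_abs_add[OF p, of "X m - X n" "Y m - Y n"] by (simp add: add_diff_add)
  qed
  then show "\<exists>N. \<forall>m\<ge>N. \<forall>n\<ge>N. padic_abs p (X m + Y m - (X n + Y n)) < e"
    by blast
qed

lemma padic_cauchy_minus:
  assumes p: "prime p" and X: "padic_cauchy p X"
  shows "padic_cauchy p (\<lambda>n. - X n)"
proof -
  have "padic_abs p (- X m - - X n) = padic_abs p (X m - X n)" for m n
    using padic_abs_minus[OF p, of "X m - X n"] by simp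
  then show ?thesis using X by (simp only: padic_cauchy_def)
qed

lemma padic_cauchy_abs_convergent:
  assumes p: "prime p" and X: "padic_cauchy p X"
  shows "convergent (\<lambda>n. padic_abs p (X n))"
proof -
  have "Cauchy (\<lambda>n. padic_abs p (X n))"
    unfolding Cauchy_def dist_real_def
  proof (intro allI impI)
    fix e :: real assume "e > 0"
    then obtain N where N: "\<forall>m\<ge>N. \<forall>n\<ge>N. padic_abs p (X m - X n) < e"
      using X unfolding padic_cauchy_def by blast
    have "\<bar>padic_abs p (X m) - padic_abs p (X n)\<bar> < e" if "m \<ge> N" "n \<ge> N" for m n
      using N that padic_abs_reverse_triangle[OF p, of "X m" "X n"] by fastforce
    then show "\<exists>N. \<forall>m\<ge>N. \<forall>n\<ge>N. \<bar>padic_abs p (X m) - padic_abs p (X n)\<bar> < e"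
      by blast
  qed
  then show ?thesis
    by (rule real_Cauchy_convergent)
qed

lemma padic_cauchy_bounded:
  assumes "prime p" "padic_cauchy p X"
  obtains B where "B > 0" "\<And>n. padic_abs p (X n) \<le> B"
proof -
  have "Bseq (\<lambda>n. padic_abs p (X n))"
    using padic_cauchy_abs_convergent[OF assms] by (rule convergent_imp_Bseq)
  then show ?thesis
    unfolding Bseq_def using that by auto
qed

lemma padic_null_mult_bounded:
  assumes p: "prime p" and X: "padic_cauchy p X" and Y: "padic_null p Y"
  shows "padic_null p (\<lambda>n. X n * Y n)"
proof -
  obtain B where B: "B > 0" "\<And>n. padic_abs p (X n) \<le> B"
    by (rule padic_cauchy_bounded[OF p X]) blast
  have "(\<lambda>n. B * padic_abs p (Y n)) \<longlonglongrightarrow> 0"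
    using Y unfolding padic_null_def by (rule tendsto_mult_right_zero)
  moreover have "padic_abs p (X n * Y n) \<le> B * padic_abs p (Y n)" for n
    unfolding padic_abs_mult[OF p] using B by (intro mult_right_mono) simp_all
  ultimately show ?thesis
    by (intro padic_nullI)
qed

lemma padic_cauchy_mult:
  assumes p: "prime p" and X: "padic_cauchy p X" and Y: "padic_cauchy p Y"
  shows "padic_cauchy p (\<lambda>n. X n * Y n)"
  unfolding padic_cauchy_def
proof (intro allI impI)
  fix e :: real assume e: "e > 0"
  obtain B where B: "B > 0" "\<And>n. padic_abs p (X n) \<le> B"
    by (rule padic_cauchy_bounded[OF p X]) blast
  obtain C where C: "C > 0" "\<And>n. padic_abs p (Y n) \<le> C"
    by (rule padic_cauchy_bounded[OF p Y]) blast
  obtain M where M: "\<forall>m\<ge>M. \<forall>n\<ge>M. padic_abs p (X m - X n) < e / C"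
    using X e C unfolding padic_cauchy_def by (meson divide_pos_pos)
  obtain N where N: "\<forall>m\<ge>N. \<forall>n\<ge>N. padic_abs p (Y m - Y n) < e / B"
    using Y e B unfolding padic_cauchy_def by (meson divide_pos_pos)
  have "padic_abs p (X m * Y m - X n * Y n) < e" if mn: "m \<ge> max M N" "n \<ge> max M N" for m n
  proof -
    have "padic_abs p (X m * (Y m - Y n)) \<le> B * padic_abs p (Y m - Y n)"
      unfolding padic_abs_mult[OF p] using B by (intro mult_right_mono) simp_all
    also have "\<dots> < B * (e / B)"
      using N mn B by (intro mult_strict_left_mono) auto
    finally have 1: "padic_abs p (X m * (Y m - Y n)) < e" using B by simp
    have "padic_abs p ((X m - X n) * Y n) \<le> padic_abs p (X m - X n) * C"
      unfolding padic_abs_mult[OF p] using C by (intro mult_left_mono) simp_all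
    also have "\<dots> < (e / C) * C"
      using M mn C by (intro mult_strict_right_mono) auto
    finally have 2: "padic_abs p ((X m - X n) * Y n) < e" using C by simp
    have "X m * Y m - X n * Y n = X m * (Y m - Y n) + (X m - X n) * Y n"
      by (simp add: algebra_simps)
    then show ?thesis
      using padic_abs_add[OF p, of "X m * (Y m - Y n)" "(X m - X n) * Y n"] 1 2 by simp
  qed
  then show "\<exists>N. \<forall>m\<ge>N. \<forall>n\<ge>N. padic_abs p (X m * Y m - X n * Y n) < e"
    by blast
qed

lemma padic_cauchy_not_null:
  assumes p: "prime p" and X: "padic_cauchy p X" and nn: "\<not> padic_null p X"
  obtains b N where "b > 0" "\<And>n. n \<ge> N \<Longrightarrow> padic_abs p (X n) > b"
proof -
  obtain L where L: "(\<lambda>n. padic_abs p (X n)) \<longlonglongrightarrow> L"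
    using padic_cauchy_abs_convergent[OF p X] unfolding convergent_def by blast
  have "L \<ge> 0"
    using L by (rule LIMSEQ_le_const) auto
  moreover have "L \<noteq> 0"
    using L nn unfolding padic_null_def by auto
  ultimately have "L / 2 > 0" "L / 2 < L" by auto
  then show ?thesis
    using order_tendstoD(1)[OF L, of "L / 2"] that unfolding eventually_sequentially by blast
qed

lemma padic_abs_inverse_diff:
  assumes p: "prime p" and "x \<noteq> 0" "y \<noteq> 0"
  shows "padic_abs p (inverse x - inverse y)
       = inverse (padic_abs p x) * padic_abs p (x - y) * inverse (padic_abs p y)"
proof -
  have "inverse x - inverse y = - (inverse x * (x - y) * inverse y)"
    using assms(2,3) by (rule inverse_diff_inverse)
  then show ?thesis
    by (simp only: padic_abs_minus[OF p] padic_abs_mult[OF p] padic_abs_inverse[OF p])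
qed

lemma padic_abs_inverse_diff_le:
  assumes p: "prime p" and b: "b > 0" "padic_abs p x > b" "padic_abs p y > b"
  shows "padic_abs p (inverse x - inverse y) \<le> padic_abs p (x - y) / (b * b)"
proof -
  have xy: "x \<noteq> 0" "y \<noteq> 0" using b by auto
  have "b * b \<le> padic_abs p x * padic_abs p y"
    using b by (intro mult_mono) auto
  then have "padic_abs p (x - y) / (padic_abs p x * padic_abs p y) \<le> padic_abs p (x - y) / (b * b)"
    using b by (intro divide_left_mono mult_pos_pos) simp_all
  moreover have "padic_abs p (inverse x - inverse y)
      = padic_abs p (x - y) / (padic_abs p x * padic_abs p y)"
    unfolding padic_abs_inverse_diff[OF p xy] by (simp add: divide_inverse)
  ultimately show ?thesis
    by simp
qed

lemma padic_cauchy_inverse: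
  assumes p: "prime p" and X: "padic_cauchy p X" and nn: "\<not> padic_null p X"
  shows "padic_cauchy p (\<lambda>n. inverse (X n))"
  unfolding padic_cauchy_def
proof (intro allI impI)
  fix e :: real assume e: "e > 0"
  obtain b M where b: "b > 0" "\<And>n. n \<ge> M \<Longrightarrow> padic_abs p (X n) > b"
    by (rule padic_cauchy_not_null[OF assms]) blast
  obtain N where N: "\<forall>m\<ge>N. \<forall>n\<ge>N. padic_abs p (X m - X n) < e * (b * b)"
    using X e b unfolding padic_cauchy_def by (meson mult_pos_pos)
  have "padic_abs p (inverse (X m) - inverse (X n)) < e" if mn: "m \<ge> max M N" "n \<ge> max M N" for m n
  proof -
    have "padic_abs p (inverse (X m) - inverse (X n)) \<le> padic_abs p (X m - X n) / (b * b)"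
      using b mn by (intro padic_abs_inverse_diff_le[OF p]) auto
    also have "\<dots> < e"
      using N mn b by (simp add: divide_less_eq)
    finally show ?thesis .
  qed
  then show "\<exists>N. \<forall>m\<ge>N. \<forall>n\<ge>N. padic_abs p (inverse (X m) - inverse (X n)) < e"
    by blast
qed

lemma padic_null_inverse_diff:
  assumes p: "prime p" and X: "padic_cauchy p X" "\<not> padic_null p X"
    and Y: "padic_cauchy p Y" "\<not> padic_null p Y" and XY: "padic_null p (\<lambda>n. X n - Y n)"
  shows "padic_null p (\<lambda>n. inverse (X n) - inverse (Y n))"
proof -
  obtain b M where b: "b > 0" "\<And>n. n \<ge> M \<Longrightarrow> padic_abs p (X n) > b"
    by (rule padic_cauchy_not_null[OF p X]) blast
  obtain c N where c: "c > 0" "\<And>n. n \<ge> N \<Longrightarrow> padic_abs p (Y n) > c"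
    by (rule padic_cauchy_not_null[OF p Y]) blast
  define d where "d = min b c"
  have "(\<lambda>n. padic_abs p (X n - Y n) / (d * d)) \<longlonglongrightarrow> 0"
    using XY tendsto_divide_zero unfolding padic_null_def by blast
  moreover have "padic_abs p (inverse (X n) - inverse (Y n)) \<le> padic_abs p (X n - Y n) / (d * d)"
    if "n \<ge> max M N" for n
    using b(1) b(2)[of n] c(1) c(2)[of n] that
    by (intro padic_abs_inverse_diff_le[OF p]) (auto simp: d_def)
  ultimately show ?thesis
    by (intro padic_nullI)
qed

lemma padic_null_diff_cong:
  assumes p: "prime p" and XY: "padic_null p (\<lambda>n. X n - Y n)"
  shows "padic_null p X \<longleftrightarrow> padic_null p Y"
proof
  assume "padic_null p X"
  from padic_null_add[OF p this padic_null_minus[OF p XY]] show "padic_null p Y" by simp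
next
  assume "padic_null p Y"
  from padic_null_add[OF p this XY] show "padic_null p X" by simp
qed

lemma padic_rel_refl: "padic_cauchy p X \<Longrightarrow> padic_rel p X X"
  by (simp add: padic_rel_def)

lemma padic_rel_sym: "prime p \<Longrightarrow> padic_rel p X Y \<Longrightarrow> padic_rel p Y X"
  using padic_null_minus[of p "\<lambda>n. X n - Y n"] by (simp add: padic_rel_def)

lemma padic_rel_trans: "prime p \<Longrightarrow> padic_rel p X Y \<Longrightarrow> padic_rel p Y Z \<Longrightarrow> padic_rel p X Z"
  using padic_null_add[of p "\<lambda>n. X n - Y n" "\<lambda>n. Y n - Z n"] by (simp add: padic_rel_def)

typedef (overloaded) 'a padic =
  "{S. \<exists>X. padic_cauchy (CARD('a::prime_card)) X \<and> S = Collect (padic_rel (CARD('a)) X)}"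
  by (auto intro!: exI[of _ "\<lambda>_. 0"])

definition padic_of_seq :: "(nat \<Rightarrow> rat) \<Rightarrow> 'a::prime_card padic" where
  "padic_of_seq X = Abs_padic (Collect (padic_rel (CARD('a)) X))"

definition seq_of_padic :: "'a::prime_card padic \<Rightarrow> nat \<Rightarrow> rat" where
  "seq_of_padic x = (SOME X. X \<in> Rep_padic x)"

definition padic_limit :: "(nat \<Rightarrow> rat) \<Rightarrow> 'a::prime_card padic \<Rightarrow> bool" where
  "padic_limit X x \<longleftrightarrow> padic_rel (CARD('a)) X X \<and> padic_of_seq X = x"

lemma padic_rel_class_eq:
  assumes p: "prime p" and X: "padic_cauchy p X"
  shows "Collect (padic_rel p X) = Collect (padic_rel p Y) \<longleftrightarrow> padic_rel p X Y"
  using padic_rel_refl[OF X] padic_rel_sym[OF p] padic_rel_trans[OF p]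
  by blast

lemma padic_of_seq_eq_iff:
  assumes X: "padic_cauchy (CARD('a)) X" and Y: "padic_cauchy (CARD('a)) Y"
  shows "(padic_of_seq X :: 'a::prime_card padic) = padic_of_seq Y \<longleftrightarrow> padic_rel (CARD('a)) X Y"
proof -
  have "(padic_of_seq X :: 'a padic) = padic_of_seq Y
      \<longleftrightarrow> Collect (padic_rel (CARD('a)) X) = Collect (padic_rel (CARD('a)) Y)"
    unfolding padic_of_seq_def using X Y by (subst Abs_padic_inject) auto
  then show ?thesis
    using padic_rel_class_eq[OF prime_card X] by simp
qed

lemma seq_of_padic:
  "padic_cauchy (CARD('a)) (seq_of_padic x)" "padic_of_seq (seq_of_padic x) = (x :: 'a::prime_card padic)"
proof -
  obtain X where X: "padic_cauchy (CARD('a)) X" "Rep_padic x = Collect (padic_rel (CARD('a)) X)"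
    using Rep_padic[of x] by auto
  have "X \<in> Rep_padic x"
    using X padic_rel_refl by auto
  then have "seq_of_padic x \<in> Rep_padic x"
    unfolding seq_of_padic_def by (rule someI[where P="\<lambda>X. X \<in> Rep_padic x"])
  then have r: "padic_rel (CARD('a)) X (seq_of_padic x)"
    using X by simp
  then show c: "padic_cauchy (CARD('a)) (seq_of_padic x)"
    by (simp add: padic_rel_def)
  have "padic_of_seq X = (x :: 'a padic)"
    unfolding padic_of_seq_def X(2)[symmetric] by (rule Rep_padic_inverse)
  with r X(1) c show "padic_of_seq (seq_of_padic x) = x"
    using padic_of_seq_eq_iff by metis
qed

lemma Quotient_padic:
  "Quotient (padic_rel (CARD('a::prime_card))) padic_of_seq seq_of_padic
     (padic_limit :: _ \<Rightarrow> 'a padic \<Rightarrow> bool)"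
proof (rule QuotientI)
  show "padic_of_seq (seq_of_padic a) = a" for a :: "'a padic"
    by (rule seq_of_padic)
  show "padic_rel (CARD('a)) (seq_of_padic a) (seq_of_padic a)" for a :: "'a padic"
    by (intro padic_rel_refl seq_of_padic)
  show "padic_rel (CARD('a)) r s \<longleftrightarrow> padic_rel (CARD('a)) r r \<and> padic_rel (CARD('a)) s s \<and>
      (padic_of_seq r :: 'a padic) = padic_of_seq s" for r s
    using padic_of_seq_eq_iff[where 'a='a, of r s] by (auto simp: padic_rel_def)
  show "(padic_limit :: _ \<Rightarrow> 'a padic \<Rightarrow> bool)
      = (\<lambda>x y. padic_rel (CARD('a)) x x \<and> padic_of_seq x = y)"
    by (simp add: padic_limit_def fun_eq_iff)
qed

setup_lifting Quotient_padic

instantiation padic :: (prime_card) field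
begin

lift_definition zero_padic :: "'a padic" is "\<lambda>_. 0"
  by (simp add: padic_rel_refl)

lift_definition one_padic :: "'a padic" is "\<lambda>_. 1"
  by (simp add: padic_rel_refl)

lift_definition plus_padic :: "'a padic \<Rightarrow> 'a padic \<Rightarrow> 'a padic" is "\<lambda>X Y n. X n + Y n"
  unfolding padic_rel_def add_diff_add
  by (simp add: padic_cauchy_add padic_null_add prime_card)

lift_definition uminus_padic :: "'a padic \<Rightarrow> 'a padic" is "\<lambda>X n. - X n"
  unfolding padic_rel_def minus_diff_minus
  by (simp only: padic_cauchy_minus padic_null_minus prime_card simp_thms)

lift_definition times_padic :: "'a padic \<Rightarrow> 'a padic \<Rightarrow> 'a padic" is "\<lambda>X Y n. X n * Y n"
proof -
  fix X X' Y Y'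
  assume *: "padic_rel CARD('a) X X'" "padic_rel CARD('a) Y Y'"
  have "padic_null CARD('a) (\<lambda>n. X n * (Y n - Y' n) + Y' n * (X n - X' n))"
    using * unfolding padic_rel_def
    by (intro padic_null_add padic_null_mult_bounded prime_card) auto
  then show "padic_rel CARD('a) (\<lambda>n. X n * Y n) (\<lambda>n. X' n * Y' n)"
    using * by (simp add: padic_rel_def padic_cauchy_mult prime_card algebra_simps)
qed

lift_definition inverse_padic :: "'a padic \<Rightarrow> 'a padic"
  is "\<lambda>X. if padic_null CARD('a) X then (\<lambda>_. 0) else (\<lambda>n. inverse (X n))"
proof -
  fix X Y assume *: "padic_rel CARD('a) X Y"
  then have "padic_null CARD('a) X \<longleftrightarrow> padic_null CARD('a) Y"
    unfolding padic_rel_def by (intro padic_null_diff_cong prime_card) auto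
  then show "padic_rel CARD('a) (if padic_null CARD('a) X then (\<lambda>_. 0) else (\<lambda>n. inverse (X n)))
      (if padic_null CARD('a) Y then (\<lambda>_. 0) else (\<lambda>n. inverse (Y n)))"
    using * unfolding padic_rel_def
    by (auto intro!: padic_cauchy_inverse padic_null_inverse_diff prime_card)
qed

definition "x - y = x + - (y :: 'a padic)"

definition "x div y = x * inverse (y :: 'a padic)"

instance
proof
  fix a b c :: "'a padic"
  show "a + b = b + a"
    by transfer (simp add: ac_simps padic_rel_def padic_cauchy_add prime_card)
  show "(a + b) + c = a + (b + c)"
    by transfer (simp add: ac_simps padic_rel_def padic_cauchy_add prime_card)
  show "0 + a = a"
    by transfer (simp add: padic_rel_def)
  show "- a + a = 0"
    by transfer (simp add: padic_rel_def)
  show "a - b = a + - b"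
    by (rule minus_padic_def)
  show "(a * b) * c = a * (b * c)"
    by transfer (simp add: ac_simps padic_rel_def padic_cauchy_mult prime_card)
  show "a * b = b * a"
    by transfer (simp add: ac_simps padic_rel_def padic_cauchy_mult prime_card)
  show "1 * a = a"
    by transfer (simp add: padic_rel_def)
  show "(a + b) * c = a * c + b * c"
    by transfer (simp add: padic_rel_def padic_cauchy_add padic_cauchy_mult distrib_right prime_card)
  show "(0 :: 'a padic) \<noteq> 1"
    by transfer (simp add: padic_rel_def padic_null_def prime_card LIMSEQ_const_iff)
  show "a \<noteq> 0 \<Longrightarrow> inverse a * a = 1"
  proof transfer
    fix X assume X: "padic_rel CARD('a) X X" and nz: "\<not> padic_rel CARD('a) X (\<lambda>_. 0)"
    then have c: "padic_cauchy CARD('a) X" and nn: "\<not> padic_null CARD('a) X"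
      by (auto simp: padic_rel_def)
    obtain b N where b: "b > 0" "\<And>n. n \<ge> N \<Longrightarrow> padic_abs CARD('a) (X n) > b"
      by (rule padic_cauchy_not_null[OF prime_card c nn]) blast
    then have "inverse (X n) * X n - 1 = 0" if "n \<ge> N" for n
      using that by (metis left_inverse less_asym padic_abs_0 diff_self)
    then have "padic_abs CARD('a) (inverse (X n) * X n - 1) \<le> 0" if "n \<ge> N" for n
      using that by simp
    then have "padic_null CARD('a) (\<lambda>n. inverse (X n) * X n - 1)"
      by (rule padic_nullI) auto
    then show "padic_rel CARD('a)
        (\<lambda>n. (if padic_null CARD('a) X then \<lambda>_. 0 else (\<lambda>n. inverse (X n))) n * X n) (\<lambda>_. 1)"
      using c nn by (simp add: padic_rel_def padic_cauchy_mult padic_cauchy_inverse prime_card)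
  qed
  show "a div b = a * inverse b"
    by (rule divide_padic_def)
  show "inverse (0 :: 'a padic) = 0"
    by transfer (simp add: padic_rel_def)
qed

end

lemma of_nat_padic: "(of_nat k :: 'a::prime_card padic) = padic_of_seq (\<lambda>_. of_nat k :: rat)"
proof (induction k)
  case 0
  show ?case
    by (simp only: of_nat_0 zero_padic.abs_eq)
next
  case (Suc k)
  have "(of_nat (Suc k) :: 'a padic) = 1 + of_nat k"
    by (rule of_nat_Suc)
  also have "\<dots> = padic_of_seq (\<lambda>_. 1) + padic_of_seq (\<lambda>_. of_nat k)"
    unfolding Suc.IH one_padic.abs_eq ..
  also have "\<dots> = padic_of_seq (\<lambda>_. 1 + of_nat k)"
    by (intro plus_padic.abs_eq padic_rel_refl padic_cauchy_const)
  finally show ?case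
    by (simp only: of_nat_Suc)
qed

instance padic :: (prime_card) field_char_0
proof
  show "inj (of_nat :: nat \<Rightarrow> 'a padic)"
  proof (rule injI)
    fix x y :: nat
    assume "(of_nat x :: 'a padic) = of_nat y"
    then have "padic_rel CARD('a) (\<lambda>_. of_nat x) (\<lambda>_. of_nat y)"
      unfolding of_nat_padic by (subst (asm) padic_of_seq_eq_iff) simp_all
    then have "(of_nat x - of_nat y :: rat) = 0"
      by (simp add: padic_rel_def padic_null_def prime_card LIMSEQ_const_iff)
    then show "x = y" by simp
  qed
qed

text \<open>The p-adic absolute value extends by continuity. (The library constant \<open>norm\<close> is reserved
  for real normed vector spaces.)\<close>

lift_definition norm_padic :: "'a::prime_card padic \<Rightarrow> real" is "\<lambda>X. lim (\<lambda>n. padic_abs CARD('a) (X n))"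
proof -
  fix X Y assume *: "padic_rel CARD('a) X Y"
  then have "convergent (\<lambda>n. padic_abs CARD('a) (Y n))"
    unfolding padic_rel_def by (intro padic_cauchy_abs_convergent prime_card) auto
  then have lim: "(\<lambda>n. padic_abs CARD('a) (Y n)) \<longlonglongrightarrow> lim (\<lambda>n. padic_abs CARD('a) (Y n))"
    by (simp add: convergent_LIMSEQ_iff)
  have "(\<lambda>n. padic_abs CARD('a) (X n - Y n)) \<longlonglongrightarrow> 0"
    using * by (simp add: padic_rel_def padic_null_def)
  then have "(\<lambda>n. padic_abs CARD('a) (X n) - padic_abs CARD('a) (Y n)) \<longlonglongrightarrow> 0"
    by (rule Lim_null_comparison[rotated])
       (auto simp: padic_abs_reverse_triangle prime_card)
  from tendsto_add[OF this lim]
  have "(\<lambda>n. padic_abs CARD('a) (X n)) \<longlonglongrightarrow> lim (\<lambda>n. padic_abs CARD('a) (Y n))"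
    by simp
  then show "lim (\<lambda>n. padic_abs CARD('a) (X n)) = lim (\<lambda>n. padic_abs CARD('a) (Y n))"
    by (rule limI)
qed

lemma norm_padic_lim:
  assumes "padic_rel (CARD('a::prime_card)) X X"
  shows "(\<lambda>n. padic_abs CARD('a) (X n)) \<longlonglongrightarrow> lim (\<lambda>n. padic_abs CARD('a) (X n))"
  using assms padic_cauchy_abs_convergent[OF prime_card, of X]
  by (simp add: convergent_LIMSEQ_iff padic_rel_def)

lemma norm_padic_eq_0: "norm_padic (x :: 'a::prime_card padic) = 0 \<longleftrightarrow> x = 0"
proof transfer
  fix X assume X: "padic_rel CARD('a) X X"
  let ?L = "lim (\<lambda>n. padic_abs CARD('a) (X n))"
  have "?L = 0 \<longleftrightarrow> padic_null CARD('a) X"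
    unfolding padic_null_def using norm_padic_lim[OF X] LIMSEQ_unique by metis
  then show "?L = 0 \<longleftrightarrow> padic_rel CARD('a) X (\<lambda>_. 0)"
    using X by (simp add: padic_rel_def)
qed

lemma norm_padic_minus: "norm_padic (- x :: 'a::prime_card padic) = norm_padic x"
  by transfer (simp add: prime_card)

lemma norm_padic_triangle: "norm_padic (x + y :: 'a::prime_card padic) \<le> norm_padic x + norm_padic y"
proof transfer
  fix X Y assume X: "padic_rel CARD('a) X X" and Y: "padic_rel CARD('a) Y Y"
  then have XY: "padic_rel CARD('a) (\<lambda>n. X n + Y n) (\<lambda>n. X n + Y n)"
    by (simp add: padic_rel_def padic_cauchy_add prime_card)
  show "lim (\<lambda>n. padic_abs CARD('a) (X n + Y n))
      \<le> lim (\<lambda>n. padic_abs CARD('a) (X n)) + lim (\<lambda>n. padic_abs CARD('a) (Y n))"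
    by (rule LIMSEQ_le[OF norm_padic_lim[OF XY]
          tendsto_add[OF norm_padic_lim[OF X] norm_padic_lim[OF Y]]])
       (auto simp: padic_abs_triangle prime_card)
qed

instantiation padic :: (prime_card) metric_space
begin

definition dist_padic :: "'a padic \<Rightarrow> 'a padic \<Rightarrow> real" where
  "dist_padic x y = norm_padic (x - y)"

definition uniformity_padic :: "('a padic \<times> 'a padic) filter" where
  "uniformity_padic = (INF e\<in>{0 <..}. principal {(x, y). dist x y < e})"

definition open_padic :: "'a padic set \<Rightarrow> bool" where
  "open_padic U \<longleftrightarrow> (\<forall>x\<in>U. eventually (\<lambda>(x', y). x' = x \<longrightarrow> y \<in> U) uniformity)"

instance
proof
  fix x y z :: "'a padic"
  show "(dist x y = 0) = (x = y)"
    by (simp add: dist_padic_def norm_padic_eq_0)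
  show "dist x y \<le> dist x z + dist y z"
    using norm_padic_triangle[of "x - z" "z - y"] norm_padic_minus[of "y - z"]
    by (simp add: dist_padic_def)
qed (simp_all add: uniformity_padic_def open_padic_def)

end

lemma of_int_padic: "(of_int k :: 'a::prime_card padic) = padic_of_seq (\<lambda>_. of_int k :: rat)"
proof (cases k)
  case (nonneg n)
  then show ?thesis
    by (simp only: of_int_of_nat_eq of_nat_padic)
next
  case (neg n)
  have "- padic_of_seq (\<lambda>_. of_nat (Suc n) :: rat)
      = (padic_of_seq (\<lambda>_. - of_nat (Suc n)) :: 'a padic)"
    by (intro uminus_padic.abs_eq padic_rel_refl padic_cauchy_const)
  then show ?thesis
    unfolding neg by (simp only: of_int_minus of_int_of_nat_eq of_nat_padic)
qed

lemma of_rat_padic: "(of_rat r :: 'a::prime_card padic) = padic_of_seq (\<lambda>_. r)"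
proof -
  obtain a b where r: "r = of_int a / of_int b" "b \<noteq> 0"
    by (rule rat_as_quotient)
  then have a: "r * of_int b = of_int a"
    by simp
  have "padic_of_seq (\<lambda>_. r) * (of_int b :: 'a padic) = padic_of_seq (\<lambda>_. r * of_int b)"
    unfolding of_int_padic by (intro times_padic.abs_eq padic_rel_refl padic_cauchy_const)
  also have "\<dots> = (of_int a :: 'a padic)"
    unfolding a of_int_padic ..
  finally have 1: "padic_of_seq (\<lambda>_. r) * (of_int b :: 'a padic) = of_int a" .
  have 2: "of_rat r * (of_int b :: 'a padic) = of_int a"
    using arg_cong[OF a, of "of_rat :: rat \<Rightarrow> 'a padic"] by (simp only: of_rat_mult of_rat_of_int_eq)
  have "(of_int b :: 'a padic) \<noteq> 0"
    using r(2) by simp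
  with 1 2 show ?thesis
    by (metis mult_right_cancel)
qed

lemma norm_of_rat_padic: "norm_padic (of_rat r :: 'p::prime_card padic) = padic_abs CARD('p) r"
  by (simp add: of_rat_padic norm_padic.abs_eq padic_rel_refl)

definition padic_ints :: "'p::prime_card padic set" where
  "padic_ints = {x. norm_padic x \<le> 1}"

definition normalized_haar_measure :: "'p::prime_card padic measure \<Rightarrow> bool" where
  "normalized_haar_measure m \<longleftrightarrow>
     sets m = sets borel \<and> (\<forall>a. distr m borel (\<lambda>x. a + x) = m) \<and> emeasure m padic_ints = 1"


section \<open>The Hilbert space of square-integrable functions\<close>

text \<open>
  Elements of the Hilbert space are represented by measurable square-integrable functions;
  subspaces and operators are closed under almost everywhere equality. An operator is given by
  its graph, so its domain is the \<open>Domain\<close> of that relation.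
\<close>

definition L2 :: "'a measure \<Rightarrow> ('a \<Rightarrow> complex) set" where
  "L2 M = {f \<in> borel_measurable M. integrable M (\<lambda>x. (cmod (f x))\<^sup>2)}"

definition inner_L2 :: "'a measure \<Rightarrow> ('a \<Rightarrow> complex) \<Rightarrow> ('a \<Rightarrow> complex) \<Rightarrow> complex" where
  "inner_L2 M f g = (\<integral>x. f x * cnj (g x) \<partial>M)"

definition norm_L2 :: "'a measure \<Rightarrow> ('a \<Rightarrow> complex) \<Rightarrow> real" where
  "norm_L2 M f = sqrt (\<integral>x. (cmod (f x))\<^sup>2 \<partial>M)"

definition tendsto_L2 :: "'a measure \<Rightarrow> (nat \<Rightarrow> 'a \<Rightarrow> complex) \<Rightarrow> ('a \<Rightarrow> complex) \<Rightarrow> bool" where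
  "tendsto_L2 M u f \<longleftrightarrow> (\<lambda>n. norm_L2 M (\<lambda>x. u n x - f x)) \<longlonglongrightarrow> 0"

definition subspace_L2 :: "'a measure \<Rightarrow> ('a \<Rightarrow> complex) set \<Rightarrow> bool" where
  "subspace_L2 M D \<longleftrightarrow> D \<subseteq> L2 M \<and> (\<lambda>_. 0) \<in> D \<and>
     (\<forall>u\<in>D. \<forall>v\<in>D. \<forall>a b. (\<lambda>x. a * u x + b * v x) \<in> D) \<and>
     (\<forall>u\<in>D. \<forall>v\<in>borel_measurable M. (AE x in M. u x = v x) \<longrightarrow> v \<in> D)"

definition dense_L2 :: "'a measure \<Rightarrow> ('a \<Rightarrow> complex) set \<Rightarrow> bool" where
  "dense_L2 M D \<longleftrightarrow> (\<forall>f\<in>L2 M. \<forall>e>0. \<exists>u\<in>D. norm_L2 M (\<lambda>x. f x - u x) < e)"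

type_synonym 'a operator = "(('a \<Rightarrow> complex) \<times> ('a \<Rightarrow> complex)) set"

definition linear_operator :: "'a measure \<Rightarrow> 'a operator \<Rightarrow> bool" where
  "linear_operator M T \<longleftrightarrow> T \<subseteq> L2 M \<times> L2 M \<and> ((\<lambda>_. 0), (\<lambda>_. 0)) \<in> T \<and>
     (\<forall>(u, w)\<in>T. \<forall>(u', w')\<in>T. \<forall>a b.
        ((\<lambda>x. a * u x + b * u' x), (\<lambda>x. a * w x + b * w' x)) \<in> T) \<and>
     (\<forall>(u, w)\<in>T. \<forall>(u', w')\<in>T. (AE x in M. u x = u' x) \<longrightarrow> (AE x in M. w x = w' x)) \<and>
     (\<forall>(u, w)\<in>T. \<forall>u'\<in>borel_measurable M. \<forall>w'\<in>borel_measurable M.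
        (AE x in M. u x = u' x) \<longrightarrow> (AE x in M. w x = w' x) \<longrightarrow> (u', w') \<in> T)"

text \<open>The value of an operator, determined up to almost everywhere equality.\<close>

definition op_app :: "'a operator \<Rightarrow> ('a \<Rightarrow> complex) \<Rightarrow> ('a \<Rightarrow> complex)" where
  "op_app T u = (SOME w. (u, w) \<in> T)"

definition adjoint_op :: "'a measure \<Rightarrow> 'a operator \<Rightarrow> 'a operator" where
  "adjoint_op M T =
     {(v, w). v \<in> L2 M \<and> w \<in> L2 M \<and> (\<forall>(u, z)\<in>T. inner_L2 M z v = inner_L2 M u w)}"

definition self_adjoint :: "'a measure \<Rightarrow> 'a operator \<Rightarrow> bool" where
  "self_adjoint M T \<longleftrightarrow>
     linear_operator M T \<and> dense_L2 M (Domain T) \<and> adjoint_op M T = T"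

definition op_bounded_below :: "'a measure \<Rightarrow> 'a operator \<Rightarrow> bool" where
  "op_bounded_below M T \<longleftrightarrow>
     (\<exists>c::real. \<forall>(u, w)\<in>T. c * (norm_L2 M u)\<^sup>2 \<le> Re (inner_L2 M w u))"

definition op_nonneg :: "'a measure \<Rightarrow> 'a operator \<Rightarrow> bool" where
  "op_nonneg M T \<longleftrightarrow> (\<forall>(u, w)\<in>T. 0 \<le> Re (inner_L2 M w u))"

text \<open>The square root of a non-negative self-adjoint operator. The relational composition
  \<open>S O S\<close> is the operator square, with its natural domain.\<close>

definition op_sqrt :: "'a measure \<Rightarrow> 'a operator \<Rightarrow> 'a operator" where
  "op_sqrt M T = (THE S. self_adjoint M S \<and> op_nonneg M S \<and> S O S = T)"


section \<open>Quadratic forms\<close>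

text \<open>
  A form is given by its domain \<open>D\<close> and by its polarization \<open>Q u v\<close> (linear in \<open>u\<close>, conjugate
  linear in \<open>v\<close>), which the quadratic form \<open>Q u u\<close> determines.
\<close>

definition hermitian_form ::
  "'a measure \<Rightarrow> ('a \<Rightarrow> complex) set \<Rightarrow> (('a \<Rightarrow> complex) \<Rightarrow> ('a \<Rightarrow> complex) \<Rightarrow> complex) \<Rightarrow> bool" where
  "hermitian_form M D Q \<longleftrightarrow> subspace_L2 M D \<and>
     (\<forall>u\<in>D. \<forall>u'\<in>D. \<forall>v\<in>D. \<forall>a b. Q (\<lambda>x. a * u x + b * u' x) v = a * Q u v + b * Q u' v) \<and>
     (\<forall>u\<in>D. \<forall>v\<in>D. Q v u = cnj (Q u v)) \<and>
     (\<forall>u\<in>D. \<forall>u'\<in>D. \<forall>v\<in>D. (AE x in M. u x = u' x) \<longrightarrow> Q u v = Q u' v)"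

definition form_bounded_below ::
  "'a measure \<Rightarrow> ('a \<Rightarrow> complex) set \<Rightarrow> (('a \<Rightarrow> complex) \<Rightarrow> ('a \<Rightarrow> complex) \<Rightarrow> complex) \<Rightarrow> bool" where
  "form_bounded_below M D Q \<longleftrightarrow> (\<exists>c::real. \<forall>u\<in>D. c * (norm_L2 M u)\<^sup>2 \<le> Re (Q u u))"

text \<open>A form bounded below is closed if its domain is complete in the form norm. In terms of
  sequences: if \<open>u n \<in> D\<close>, \<open>u n\<close> tends to \<open>f\<close> in the Hilbert space and \<open>Q[u k - u n]\<close> tends to 0,
  then \<open>f \<in> D\<close> and \<open>Q[u n - f]\<close> tends to 0.\<close>

definition form_closed ::
  "'a measure \<Rightarrow> ('a \<Rightarrow> complex) set \<Rightarrow> (('a \<Rightarrow> complex) \<Rightarrow> ('a \<Rightarrow> complex) \<Rightarrow> complex) \<Rightarrow> bool" where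
  "form_closed M D Q \<longleftrightarrow>
     (\<forall>u f. (\<forall>n. u n \<in> D) \<longrightarrow> f \<in> L2 M \<longrightarrow> tendsto_L2 M u f \<longrightarrow>
        (\<forall>e>0. \<exists>N. \<forall>k\<ge>N. \<forall>n\<ge>N. cmod (Q (\<lambda>x. u k x - u n x) (\<lambda>x. u k x - u n x)) < e) \<longrightarrow>
        f \<in> D \<and> (\<lambda>n. Q (\<lambda>x. u n x - f x) (\<lambda>x. u n x - f x)) \<longlonglongrightarrow> 0)"

definition form_operator ::
  "'a measure \<Rightarrow> ('a \<Rightarrow> complex) set \<Rightarrow> (('a \<Rightarrow> complex) \<Rightarrow> ('a \<Rightarrow> complex) \<Rightarrow> complex) \<Rightarrow> 'a operator"
  where
  "form_operator M D Q = {(u, w). u \<in> D \<and> w \<in> L2 M \<and> (\<forall>v\<in>D. Q u v = inner_L2 M w v)}"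


section \<open>The Fourier transform and the Taibleson--Vladimirov operator\<close>

text \<open>The fractional part of \<open>x\<close> is the unique \<open>r \<in> \<int>[1/p] \<inter> [0,1)\<close> with \<open>x - r\<close> a p-adic
  integer.\<close>

definition padic_frac :: "'p::prime_card padic \<Rightarrow> rat" where
  "padic_frac x = (THE r. 0 \<le> r \<and> r < 1 \<and> (\<exists>k. of_nat CARD('p) ^ k * r \<in> \<int>) \<and>
     x - of_rat r \<in> padic_ints)"

definition padic_char :: "'p::prime_card padic \<Rightarrow> complex" where
  "padic_char x = cis (2 * pi * of_rat (padic_frac x))"

text \<open>The dual group is identified with the field itself: \<open>\<xi>\<close> stands for the character
  \<open>x \<mapsto> padic_char (\<xi> * x)\<close>.\<close>

definition fourier_L1 ::
  "'p::prime_card padic measure \<Rightarrow> ('p padic \<Rightarrow> complex) \<Rightarrow> 'p padic \<Rightarrow> complex" where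
  "fourier_L1 m f \<xi> = (\<integral>x. padic_char (\<xi> * x) * f x \<partial>m)"

text \<open>The transform on square-integrable functions is the continuous extension of the integral
  transform from the integrable ones; the graph of the extension is the closure of the graph.\<close>

definition has_fourier_L2 ::
  "'p::prime_card padic measure \<Rightarrow> ('p padic \<Rightarrow> complex) \<Rightarrow> ('p padic \<Rightarrow> complex) \<Rightarrow> bool" where
  "has_fourier_L2 m f F \<longleftrightarrow> f \<in> L2 m \<and> F \<in> L2 m \<and>
     (\<exists>g. (\<forall>n. g n \<in> L2 m \<and> integrable m (g n) \<and> fourier_L1 m (g n) \<in> L2 m) \<and>
        tendsto_L2 m g f \<and> tendsto_L2 m (\<lambda>n. fourier_L1 m (g n)) F)"

definition taibleson_vladimirov :: "'p::prime_card padic measure \<Rightarrow> real \<Rightarrow> 'p padic operator" where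
  "taibleson_vladimirov m \<gamma> =
     {(f, g). \<exists>F G. has_fourier_L2 m f F \<and> has_fourier_L2 m g G \<and>
        (AE \<xi> in m. G \<xi> = complex_of_real (norm_padic \<xi> powr \<gamma>) * F \<xi>)}"


section \<open>Schroedinger forms\<close>

definition in_Lq_plus_Linf :: "'a measure \<Rightarrow> real \<Rightarrow> ('a \<Rightarrow> real) \<Rightarrow> bool" where
  "in_Lq_plus_Linf M q V \<longleftrightarrow>
     (\<exists>V' V''. V' \<in> borel_measurable M \<and> integrable M (\<lambda>x. \<bar>V' x\<bar> powr q) \<and>
        V'' \<in> borel_measurable M \<and> (\<exists>C. AE x in M. \<bar>V'' x\<bar> \<le> C) \<and>
        (AE x in M. V x = V' x + V'' x))"

definition dom_QL :: "'a measure \<Rightarrow> 'a operator \<Rightarrow> ('a \<Rightarrow> complex) set" where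
  "dom_QL M L = Domain (op_sqrt M L)"

definition QL :: "'a measure \<Rightarrow> 'a operator \<Rightarrow> ('a \<Rightarrow> complex) \<Rightarrow> ('a \<Rightarrow> complex) \<Rightarrow> complex" where
  "QL M L u v = inner_L2 M (op_app (op_sqrt M L) u) (op_app (op_sqrt M L) v)"

definition dom_QV :: "'a measure \<Rightarrow> ('a \<Rightarrow> real) \<Rightarrow> ('a \<Rightarrow> complex) set" where
  "dom_QV M V = {u \<in> L2 M. integrable M (\<lambda>x. \<bar>V x\<bar> * (cmod (u x))\<^sup>2)}"

definition QV :: "'a measure \<Rightarrow> ('a \<Rightarrow> real) \<Rightarrow> ('a \<Rightarrow> complex) \<Rightarrow> ('a \<Rightarrow> complex) \<Rightarrow> complex" where
  "QV M V u v = (\<integral>x. complex_of_real (V x) * u x * cnj (v x) \<partial>M)"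

definition dom_Q :: "'a measure \<Rightarrow> 'a operator \<Rightarrow> ('a \<Rightarrow> real) \<Rightarrow> ('a \<Rightarrow> complex) set" where
  "dom_Q M L V = dom_QL M L \<inter> dom_QV M V"

definition Q_form ::
  "'a measure \<Rightarrow> 'a operator \<Rightarrow> ('a \<Rightarrow> real) \<Rightarrow> ('a \<Rightarrow> complex) \<Rightarrow> ('a \<Rightarrow> complex) \<Rightarrow> complex" where
  "Q_form M L V u v = QL M L u v + QV M V u v"

end

theory Submission
  imports Defs
begin

text \<open>
  The Fourier transform diagonalises \<open>L\<close>. Plancherel's theorem comes from the identity that the inverse transform of the
  Fourier transform of \<open>f\<close>, restricted to the ball of radius \<open>p\<^sup>n\<close>, is the average of \<open>f\<close> over balls of radius \<open>p\<^sup>-\<^sup>n\<close>.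
  Since \<open>\<parallel>\<xi>\<parallel>\<close> takes only the values \<open>p\<^sup>k\<close> off a null set, \<open>L\<close> has pure point spectrum, and this identifies its
  non-negative square root without the spectral theorem.

  Frequency pieces \<open>u\<^sub>k\<close> living on \<open>\<parallel>\<xi>\<parallel> = p\<^sup>k\<close> satisfy Bernstein's inequality
  \<open>\<bar>u\<^sub>k\<bar>\<^sup>2 \<le> p\<^sup>k \<parallel>u\<^sub>k\<parallel>\<^sup>2\<close>. Together with \<open>W \<le> t + t\<^sup>1\<^sup>-\<^sup>r W\<^sup>r\<close> at \<open>t = p\<^sup>k\<^sup>/\<^sup>r\<close> this gives
  \<open>\<integral> W \<bar>u\<^sub>k\<bar>\<^sup>2 \<le> C p\<^sup>k\<^sup>/\<^sup>r \<parallel>u\<^sub>k\<parallel>\<^sup>2\<close>, and summing over \<open>k\<close> shows that \<open>W \<in> L\<^sup>r\<close>, \<open>r > 1/\<alpha>\<close>, is form bounded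
  relative to \<open>\<parallel>\<xi>\<parallel>\<^sup>\<alpha>\<close> with arbitrarily small bound. With \<open>W = \<bar>V\<bar>\<close> and \<open>\<alpha> = \<gamma>\<close> this makes \<open>Q\<close> closed and bounded
  below; minimising \<open>Q[u] + \<kappa> \<parallel>u\<parallel>\<^sup>2 - 2 Re (f, u)\<close> over the form domain then inverts \<open>H + \<kappa>\<close>, which yields
  self-adjointness. With \<open>W = V\<^sup>2\<close>, \<open>\<alpha> = 2 \<gamma>\<close> and exponent \<open>q / 2\<close> it makes \<open>V\<close> operator bounded relative to \<open>L\<close> with
  bound less than 1, so \<open>L + V + \<kappa>\<close> is already onto and \<open>H\<close> has the domain of \<open>L\<close>.
\<close>

section \<open>Square-integrable functions\<close>

text \<open>Two definitions shape the proof. The square root of \<open>L\<close> is a definite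
  description over all non-negative self-adjoint \<open>S\<close> with \<open>S O S = L\<close>, so
  no value of \<open>Q\<close> can be computed until every such \<open>S\<close> has been shown to
  be the multiplier with exponent \<open>\<gamma> / 2\<close>. Of \<open>m\<close> only translation
  invariance and the mass of the unit ball are known, so the volumes of balls, and from them the
  cancellation of characters, have to be derived.

  The strict inequality between \<open>q\<close> and \<open>1 / \<gamma>\<close> is the source of
  smallness. A sphere of radius \<open>p^k\<close> costs \<open>p^(k / r)\<close> while the operator
  offers \<open>p^(\<alpha> k)\<close>; the quotient is geometric in \<open>k\<close>, and all
  frequencies below a cut-off \<open>p^K\<close> are charged to the plain norm.

  The domain statement lies beyond form methods, which only place the domain of \<open>H\<close>
  inside the form domain. It is obtained by letting two facts meet: \<open>L + V + \<kappa>\<close>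
  is onto and \<open>H + \<kappa>\<close>, which extends it, is injective.\<close>

lemma L2_I: "f \<in> borel_measurable M \<Longrightarrow> integrable M (\<lambda>x. (cmod (f x))\<^sup>2) \<Longrightarrow> f \<in> L2 M"
  by (simp add: L2_def)

lemma L2_measurable: "f \<in> L2 M \<Longrightarrow> f \<in> borel_measurable M"
  by (simp add: L2_def)

lemma L2_integrable: "f \<in> L2 M \<Longrightarrow> integrable M (\<lambda>x. (cmod (f x))\<^sup>2)"
  by (simp add: L2_def)

lemma L2_zero [simp]: "(\<lambda>_. 0) \<in> L2 M"
  by (simp add: L2_def)

lemma norm_L2_nonneg [simp]: "norm_L2 M f \<ge> 0"
  by (simp add: norm_L2_def)

lemma norm_L2_zero [simp]: "norm_L2 M (\<lambda>_. 0) = 0"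
  by (simp add: norm_L2_def)

lemma norm_L2_power2: "(norm_L2 M f)\<^sup>2 = (\<integral>x. (cmod (f x))\<^sup>2 \<partial>M)"
  by (simp add: norm_L2_def)

lemma cmod_lincomb_power2_le:
  "(cmod (a * z + b * w))\<^sup>2 \<le> 2 * (cmod a)\<^sup>2 * (cmod z)\<^sup>2 + 2 * (cmod b)\<^sup>2 * (cmod w)\<^sup>2"
proof -
  have "(cmod (a * z + b * w))\<^sup>2 \<le> (cmod a * cmod z + cmod b * cmod w)\<^sup>2"
    by (intro power_mono) (metis norm_mult norm_triangle_ineq, simp)
  also have "\<dots> \<le> 2 * (cmod a * cmod z)\<^sup>2 + 2 * (cmod b * cmod w)\<^sup>2"
    using zero_le_power2[of "cmod a * cmod z - cmod b * cmod w"]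
    by (simp add: power2_sum power2_diff)
  finally show ?thesis by (simp add: power_mult_distrib)
qed

lemma L2_lincomb:
  assumes f: "f \<in> L2 M" and g: "g \<in> L2 M"
  shows "(\<lambda>x. a * f x + b * g x) \<in> L2 M"
proof (rule L2_I)
  note [measurable] = L2_measurable[OF f] L2_measurable[OF g]
  show "(\<lambda>x. a * f x + b * g x) \<in> borel_measurable M" by measurable
  show "integrable M (\<lambda>x. (cmod (a * f x + b * g x))\<^sup>2)"
  proof (rule Bochner_Integration.integrable_bound)
    show "integrable M (\<lambda>x. 2 * (cmod a)\<^sup>2 * (cmod (f x))\<^sup>2 + 2 * (cmod b)\<^sup>2 * (cmod (g x))\<^sup>2)"
      using L2_integrable[OF f] L2_integrable[OF g] by auto
    show "AE x in M. norm ((cmod (a * f x + b * g x))\<^sup>2)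
       \<le> norm (2 * (cmod a)\<^sup>2 * (cmod (f x))\<^sup>2 + 2 * (cmod b)\<^sup>2 * (cmod (g x))\<^sup>2)"
      using cmod_lincomb_power2_le by (auto simp del: norm_mult)
  qed measurable
qed

lemma L2_diff: "f \<in> L2 M \<Longrightarrow> g \<in> L2 M \<Longrightarrow> (\<lambda>x. f x - g x) \<in> L2 M"
  using L2_lincomb[of f M g 1 "-1"] by simp

lemma L2_add: "f \<in> L2 M \<Longrightarrow> g \<in> L2 M \<Longrightarrow> (\<lambda>x. f x + g x) \<in> L2 M"
  using L2_lincomb[of f M g 1 1] by simp

lemma L2_scale: "f \<in> L2 M \<Longrightarrow> (\<lambda>x. c * f x) \<in> L2 M"
  using L2_lincomb[of f M f c 0] by simp

lemma L2_sum: "finite I \<Longrightarrow> (\<And>i. i \<in> I \<Longrightarrow> f i \<in> L2 M) \<Longrightarrow> (\<lambda>x. \<Sum>i\<in>I. f i x) \<in> L2 M"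
  by (induction I rule: finite_induct) (auto intro: L2_add)

text \<open>Multipliers, truncations, conjugation and passage to the modulus are all controlled
  through this pointwise comparison; it delivers membership and the bound at once.\<close>

lemma L2_dominated:
  assumes f: "f \<in> L2 M" and g: "g \<in> borel_measurable M"
    and le: "AE x in M. cmod (g x) \<le> C * cmod (f x)"
  shows "g \<in> L2 M" "(norm_L2 M g)\<^sup>2 \<le> C\<^sup>2 * (norm_L2 M f)\<^sup>2"
proof -
  have le': "AE x in M. (cmod (g x))\<^sup>2 \<le> C\<^sup>2 * (cmod (f x))\<^sup>2"
    using le
  proof eventually_elim
    case (elim x)
    then have "(cmod (g x))\<^sup>2 \<le> (C * cmod (f x))\<^sup>2" by (intro power_mono) auto
    then show ?case by (simp add: power_mult_distrib)
  qed
  have i: "integrable M (\<lambda>x. C\<^sup>2 * (cmod (f x))\<^sup>2)" using L2_integrable[OF f] by simp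
  have j: "integrable M (\<lambda>x. (cmod (g x))\<^sup>2)"
    by (rule Bochner_Integration.integrable_bound[OF i]) (use g le' in \<open>auto\<close>)
  then show "g \<in> L2 M" using g by (simp add: L2_I)
  show "(norm_L2 M g)\<^sup>2 \<le> C\<^sup>2 * (norm_L2 M f)\<^sup>2"
    unfolding norm_L2_power2 using integral_mono_AE[OF j i le'] by simp
qed

lemma L2_cong_AE:
  assumes "f \<in> L2 M" "g \<in> borel_measurable M" "AE x in M. f x = g x"
  shows "g \<in> L2 M"
  by (rule L2_dominated(1)[where C = 1, OF assms(1,2)]) (use assms(3) in auto)

lemma norm_L2_cong_AE:
  assumes "f \<in> borel_measurable M" "g \<in> borel_measurable M" "AE x in M. f x = g x"
  shows "norm_L2 M f = norm_L2 M g"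
  unfolding norm_L2_def
  by (intro arg_cong[where f = sqrt] integral_cong_AE) (use assms in auto)

lemma borel_measurable_cnj [measurable]: "f \<in> borel_measurable M \<Longrightarrow> (\<lambda>x. cnj (f x)) \<in> borel_measurable M"
  by (rule borel_measurable_continuous_on[of cnj]) (auto intro: continuous_intros)

lemma integrable_L2_mult_cnj:
  assumes f: "f \<in> L2 M" and g: "g \<in> L2 M"
  shows "integrable M (\<lambda>x. f x * cnj (g x))"
proof (rule Bochner_Integration.integrable_bound)
  note [measurable] = L2_measurable[OF f] L2_measurable[OF g]
  show "integrable M (\<lambda>x. (cmod (f x))\<^sup>2 + (cmod (g x))\<^sup>2)"
    using L2_integrable[OF f] L2_integrable[OF g] by auto
  have "cmod (f x) * cmod (g x) \<le> (cmod (f x))\<^sup>2 + (cmod (g x))\<^sup>2" for x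
    using sum_squares_bound[of "cmod (f x)" "cmod (g x)"]
      mult_nonneg_nonneg[OF norm_ge_zero[of "f x"] norm_ge_zero[of "g x"]] by linarith
  then show "AE x in M. norm (f x * cnj (g x)) \<le> norm ((cmod (f x))\<^sup>2 + (cmod (g x))\<^sup>2)"
    by (simp add: norm_mult)
  show "(\<lambda>x. f x * cnj (g x)) \<in> borel_measurable M"
    by measurable
qed

lemma inner_L2_self: "inner_L2 M f f = complex_of_real ((norm_L2 M f)\<^sup>2)"
  unfolding inner_L2_def norm_L2_power2 complex_norm_square[symmetric] by (rule integral_complex_of_real)

lemma inner_L2_cnj: "inner_L2 M g f = cnj (inner_L2 M f g)"
  unfolding inner_L2_def by (subst Bochner_Integration.integral_cnj[symmetric]) (simp add: mult.commute)

lemma inner_L2_cong_AE: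
  assumes "f \<in> borel_measurable M" "f' \<in> borel_measurable M" "g \<in> borel_measurable M"
    "g' \<in> borel_measurable M" "AE x in M. f x = f' x" "AE x in M. g x = g' x"
  shows "inner_L2 M f g = inner_L2 M f' g'"
  unfolding inner_L2_def by (rule integral_cong_AE) (use assms in auto)

lemma inner_L2_lincomb_left:
  assumes "f \<in> L2 M" "f' \<in> L2 M" "g \<in> L2 M"
  shows "inner_L2 M (\<lambda>x. a * f x + b * f' x) g = a * inner_L2 M f g + b * inner_L2 M f' g"
proof -
  have "inner_L2 M (\<lambda>x. a * f x + b * f' x) g
      = (\<integral>x. a * (f x * cnj (g x)) + b * (f' x * cnj (g x)) \<partial>M)"
    by (simp add: inner_L2_def algebra_simps)
  also have "\<dots> = a * inner_L2 M f g + b * inner_L2 M f' g"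
    using integrable_L2_mult_cnj[OF assms(1,3)] integrable_L2_mult_cnj[OF assms(2,3)]
    by (simp add: inner_L2_def)
  finally show ?thesis .
qed

section \<open>Hermitian forms and the Cauchy-Schwarz inequality\<close>

lemma subspace_L2_L2: "subspace_L2 M (L2 M)"
  unfolding subspace_L2_def
  by (intro conjI ballI allI impI) (simp_all add: L2_lincomb, erule (2) L2_cong_AE)

lemma hermitian_form_inner_L2: "hermitian_form M (L2 M) (inner_L2 M)"
  unfolding hermitian_form_def
proof (intro conjI ballI allI impI)
  fix u v :: "'a \<Rightarrow> complex" assume "u \<in> L2 M" "v \<in> L2 M"
  show "inner_L2 M v u = cnj (inner_L2 M u v)" by (rule inner_L2_cnj)
next
  fix u u' v :: "'a \<Rightarrow> complex" assume "u \<in> L2 M" "u' \<in> L2 M" "v \<in> L2 M" "AE x in M. u x = u' x"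
  then show "inner_L2 M u v = inner_L2 M u' v"
    by (intro inner_L2_cong_AE) (auto dest: L2_measurable)
qed (use subspace_L2_L2 inner_L2_lincomb_left in blast)+

lemma norm_L2_eq_0_iff:
  assumes "f \<in> L2 M" shows "norm_L2 M f = 0 \<longleftrightarrow> (AE x in M. f x = 0)"
  using integral_nonneg_eq_0_iff_AE[OF L2_integrable[OF assms]] by (simp add: norm_L2_def)

text \<open>The algebra of expanding a Hermitian form on \<open>a u + b v\<close>: \<open>r\<close>
  and \<open>s\<close> stand for the diagonal values, which are real by symmetry, and
  \<open>p\<close> for \<open>Q u v\<close>.\<close>

lemma Re_sesquilinear:
  assumes "Im r = 0" "Im s = 0"
  shows "Re (a * cnj (a * r + b * cnj p) + b * cnj (a * p + b * s))
    = (cmod a)\<^sup>2 * Re r + 2 * Re (a * cnj b * p) + (cmod b)\<^sup>2 * Re s"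
proof -
  define z where "z = a * cnj b * p"
  obtain r' s' where rs: "r = of_real r'" "s = of_real s'"
    using assms by (metis complex_is_Real_iff Reals_cases)
  have "a * cnj (a * r + b * cnj p) + b * cnj (a * p + b * s)
      = (a * cnj a) * of_real r' + (b * cnj b) * of_real s' + (z + cnj z)"
    unfolding rs z_def by (simp add: distrib_left mult_ac)
  also have "\<dots> = of_real ((cmod a)\<^sup>2 * r') + of_real ((cmod b)\<^sup>2 * s') + of_real (2 * Re z)"
    unfolding complex_norm_square[symmetric] complex_add_cnj by simp
  finally show ?thesis by (simp add: rs z_def)
qed

text \<open>No positivity is built in, since \<open>Q\<close> is only bounded below; the
  Cauchy-Schwarz inequality takes it as a premise. The inner product is itself an instance, so its
  expansion rules come from the same lemmas.\<close>

locale hform =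
  fixes M :: "'a measure" and D :: "('a \<Rightarrow> complex) set" and Q
  assumes herm: "hermitian_form M D Q"
begin

lemma D_sub: "D \<subseteq> L2 M"
  and D_0: "(\<lambda>_. 0) \<in> D"
  and D_lincomb: "u \<in> D \<Longrightarrow> v \<in> D \<Longrightarrow> (\<lambda>x. a * u x + b * v x) \<in> D"
  and D_cong_AE: "u \<in> D \<Longrightarrow> v \<in> borel_measurable M \<Longrightarrow> AE x in M. u x = v x \<Longrightarrow> v \<in> D"
  using herm unfolding hermitian_form_def subspace_L2_def by auto

lemma D_L2: "u \<in> D \<Longrightarrow> u \<in> L2 M"
  using D_sub by auto

lemma D_diff: "u \<in> D \<Longrightarrow> v \<in> D \<Longrightarrow> (\<lambda>x. u x - v x) \<in> D"
  using D_lincomb[of u v 1 "-1"] by simp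

lemma D_scale: "u \<in> D \<Longrightarrow> (\<lambda>x. a * u x) \<in> D"
  using D_lincomb[of u u a 0] by simp

lemma D_add: "u \<in> D \<Longrightarrow> v \<in> D \<Longrightarrow> (\<lambda>x. u x + v x) \<in> D"
  using D_lincomb[of u v 1 1] by simp

lemma Q_left: "u \<in> D \<Longrightarrow> u' \<in> D \<Longrightarrow> v \<in> D \<Longrightarrow> Q (\<lambda>x. a * u x + b * u' x) v = a * Q u v + b * Q u' v"
  and Q_cnj: "u \<in> D \<Longrightarrow> v \<in> D \<Longrightarrow> Q v u = cnj (Q u v)"
  and Q_cong_AE: "u \<in> D \<Longrightarrow> u' \<in> D \<Longrightarrow> v \<in> D \<Longrightarrow> AE x in M. u x = u' x \<Longrightarrow> Q u v = Q u' v"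
  using herm unfolding hermitian_form_def by blast+

lemma Q_diff_left: "u \<in> D \<Longrightarrow> u' \<in> D \<Longrightarrow> v \<in> D \<Longrightarrow> Q (\<lambda>x. u x - u' x) v = Q u v - Q u' v"
  using Q_left[of u u' v 1 "-1"] by simp

lemma Q_scale_right: "u \<in> D \<Longrightarrow> v \<in> D \<Longrightarrow> Q u (\<lambda>x. a * v x) = cnj a * Q u v"
  using Q_left[of v v u a 0] Q_cnj[of v u] Q_cnj[of "\<lambda>x. a * v x" u] D_scale[of v a] by simp

lemma Im_Q_self: "u \<in> D \<Longrightarrow> Im (Q u u) = 0"
  by (metis Q_cnj Reals_cnj_iff complex_is_Real_iff)

lemma Q_expand:
  assumes "u \<in> D" "v \<in> D"
  shows "Re (Q (\<lambda>x. a * u x + b * v x) (\<lambda>x. a * u x + b * v x))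
    = (cmod a)\<^sup>2 * Re (Q u u) + 2 * Re (a * cnj b * Q u v) + (cmod b)\<^sup>2 * Re (Q v v)"
proof -
  let ?w = "\<lambda>x. a * u x + b * v x"
  have w: "?w \<in> D" using assms by (rule D_lincomb)
  have "Q ?w ?w = a * cnj (Q ?w u) + b * cnj (Q ?w v)"
    unfolding Q_left[OF assms w] Q_cnj[OF w assms(1)] Q_cnj[OF w assms(2)] ..
  also have "\<dots> = a * cnj (a * Q u u + b * cnj (Q u v)) + b * cnj (a * Q u v + b * Q v v)"
    unfolding Q_left[OF assms(1,2,1)] Q_left[OF assms(1,2,2)] Q_cnj[OF assms] ..
  also have "Re \<dots> = (cmod a)\<^sup>2 * Re (Q u u) + 2 * Re (a * cnj b * Q u v) + (cmod b)\<^sup>2 * Re (Q v v)"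
    using Im_Q_self[OF assms(1)] Im_Q_self[OF assms(2)] by (rule Re_sesquilinear)
  finally show ?thesis .
qed

text \<open>The form is non-negative at \<open>u - t b v\<close> with \<open>b = Q u v\<close>; the
  factor \<open>b\<close> turns the mixed term into the squared modulus of \<open>b\<close>, so real
  \<open>t\<close> suffice and a real quadratic remains.\<close>

lemma Cauchy_Schwarz:
  assumes psd: "\<And>w. w \<in> D \<Longrightarrow> 0 \<le> Re (Q w w)" and u: "u \<in> D" and v: "v \<in> D"
  shows "(cmod (Q u v))\<^sup>2 \<le> Re (Q u u) * Re (Q v v)"
proof -
  define b where "b = Q u v"
  have pos: "0 \<le> Re (Q u u) - 2 * t * (cmod b)\<^sup>2 + t\<^sup>2 * (cmod b)\<^sup>2 * Re (Q v v)" for t :: real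
  proof -
    have "0 \<le> Re (Q (\<lambda>x. 1 * u x + (- of_real t * b) * v x) (\<lambda>x. 1 * u x + (- of_real t * b) * v x))"
      by (rule psd) (rule D_lincomb[OF u v])
    also have "\<dots> = Re (Q u u) - 2 * t * (cmod b)\<^sup>2 + t\<^sup>2 * (cmod b)\<^sup>2 * Re (Q v v)"
      unfolding Q_expand[OF u v] b_def[symmetric]
      by (simp add: norm_mult power_mult_distrib cmod_power2) (simp add: algebra_simps power2_eq_square)
    finally show ?thesis .
  qed
  show ?thesis
  proof (cases "Re (Q v v) = 0")
    case True
    have "(cmod b)\<^sup>2 = 0"
    proof (rule ccontr)
      assume "(cmod b)\<^sup>2 \<noteq> 0"
      then have "(cmod b)\<^sup>2 > 0" by simp
      \<comment> \<open>The quadratic has degenerated to an affine function of \<open>t\<close>;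
        this \<open>t\<close> gives it the value -1.\<close>
      then show False
        using pos[of "(Re (Q u u) + 1) / (2 * (cmod b)\<^sup>2)"] True by (simp add: field_simps)
    qed
    then show ?thesis using True by (simp add: b_def)
  next
    case False
    then have "Re (Q v v) > 0" using psd[OF v] by simp
    \<comment> \<open>\<open>t = 1 / Re (Q v v)\<close> minimises the quadratic.\<close>
    then show ?thesis
      using pos[of "1 / Re (Q v v)"] by (simp add: b_def field_simps power2_eq_square)
  qed
qed

end

lemma hform_L2: "hform M (L2 M) (inner_L2 M)"
  by (rule hform.intro) (rule hermitian_form_inner_L2)

lemma cmod_inner_L2_le:
  assumes "f \<in> L2 M" "g \<in> L2 M"
  shows "cmod (inner_L2 M f g) \<le> norm_L2 M f * norm_L2 M g"
proof -
  have "(cmod (inner_L2 M f g))\<^sup>2 \<le> (norm_L2 M f * norm_L2 M g)\<^sup>2"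
    using hform.Cauchy_Schwarz[OF hform_L2[of M], of f g] assms by (simp add: inner_L2_self power_mult_distrib)
  then show ?thesis
    by (rule power2_le_imp_le) simp
qed

section \<open>Triangle inequalities for the norm\<close>

lemma norm_L2_scale: "norm_L2 M (\<lambda>x. c * f x) = cmod c * norm_L2 M f"
  by (simp add: norm_L2_def norm_mult power_mult_distrib real_sqrt_mult)

lemma norm_L2_add_le:
  assumes "f \<in> L2 M" "g \<in> L2 M"
  shows "norm_L2 M (\<lambda>x. f x + g x) \<le> norm_L2 M f + norm_L2 M g"
proof (rule power2_le_imp_le)
  have "(norm_L2 M (\<lambda>x. f x + g x))\<^sup>2
      = (norm_L2 M f)\<^sup>2 + 2 * Re (inner_L2 M f g) + (norm_L2 M g)\<^sup>2"
    using hform.Q_expand[OF hform_L2 assms, of 1 1] by (simp add: inner_L2_self)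
  also have "\<dots> \<le> (norm_L2 M f + norm_L2 M g)\<^sup>2"
    using cmod_inner_L2_le[OF assms] complex_Re_le_cmod[of "inner_L2 M f g"]
    by (simp add: power2_sum)
  finally show "(norm_L2 M (\<lambda>x. f x + g x))\<^sup>2 \<le> (norm_L2 M f + norm_L2 M g)\<^sup>2" .
qed simp

lemma norm_L2_diff_commute: "norm_L2 M (\<lambda>x. f x - g x) = norm_L2 M (\<lambda>x. g x - f x)"
  by (simp add: norm_L2_def norm_minus_commute)

lemma norm_L2_triangle:
  assumes "f \<in> L2 M" "g \<in> L2 M" "h \<in> L2 M"
  shows "norm_L2 M (\<lambda>x. f x - h x) \<le> norm_L2 M (\<lambda>x. f x - g x) + norm_L2 M (\<lambda>x. g x - h x)"
  using norm_L2_add_le[OF L2_diff[OF assms(1,2)] L2_diff[OF assms(2,3)]] by simp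

lemma norm_L2_reverse_triangle:
  assumes "f \<in> L2 M" "g \<in> L2 M"
  shows "\<bar>norm_L2 M f - norm_L2 M g\<bar> \<le> norm_L2 M (\<lambda>x. f x - g x)"
  using norm_L2_triangle[OF assms L2_zero] norm_L2_triangle[OF assms(2,1) L2_zero]
    norm_L2_diff_commute[of M f g] by simp

lemma norm_L2_add_power2_le:
  assumes "f \<in> L2 M" "g \<in> L2 M"
  shows "(norm_L2 M (\<lambda>x. f x + g x))\<^sup>2 \<le> 2 * (norm_L2 M f)\<^sup>2 + 2 * (norm_L2 M g)\<^sup>2"
proof -
  have "(norm_L2 M (\<lambda>x. f x + g x))\<^sup>2 \<le> (norm_L2 M f + norm_L2 M g)\<^sup>2"
    by (intro power_mono norm_L2_add_le assms) simp
  also have "\<dots> \<le> 2 * (norm_L2 M f)\<^sup>2 + 2 * (norm_L2 M g)\<^sup>2"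
    using zero_le_power2[of "norm_L2 M f - norm_L2 M g"] by (simp add: power2_sum power2_diff)
  finally show ?thesis .
qed

section \<open>Fatou's lemma and completeness\<close>

lemma nn_integral_L2: "f \<in> L2 M \<Longrightarrow> (\<integral>\<^sup>+x. ennreal ((cmod (f x))\<^sup>2) \<partial>M) = ennreal ((norm_L2 M f)\<^sup>2)"
  unfolding norm_L2_power2 by (rule nn_integral_eq_integral) (auto simp: L2_def)

lemma L2_nn_integralI:
  assumes f: "f \<in> borel_measurable M" and c: "c \<ge> 0"
    and le: "(\<integral>\<^sup>+x. ennreal ((cmod (f x))\<^sup>2) \<partial>M) \<le> ennreal c"
  shows "f \<in> L2 M" "(norm_L2 M f)\<^sup>2 \<le> c"
proof -
  have "integrable M (\<lambda>x. (cmod (f x))\<^sup>2)"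
    by (rule integrableI_bounded) (use f le in \<open>auto intro: le_less_trans\<close>)
  then show *: "f \<in> L2 M" using f by (simp add: L2_I)
  show "(norm_L2 M f)\<^sup>2 \<le> c"
    using nn_integral_L2[OF *] le c by simp
qed

text \<open>Fatou's lemma as lower semicontinuity of the norm: a.e. convergence with bounded norms
  is enough to put the limit into the space. The bound is required only eventually, so that Cauchy
  estimates can be fed in directly.\<close>

lemma L2_Fatou:
  assumes u: "\<And>n. u n \<in> L2 M" and f: "f \<in> borel_measurable M"
    and lim: "AE x in M. (\<lambda>n. u n x) \<longlonglongrightarrow> f x"
    and le: "eventually (\<lambda>n. (norm_L2 M (u n))\<^sup>2 \<le> c) sequentially"
  shows "f \<in> L2 M" "(norm_L2 M f)\<^sup>2 \<le> c"
proof -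
  note [measurable] = f L2_measurable[OF u]
  obtain n0 where "(norm_L2 M (u n0))\<^sup>2 \<le> c" using eventually_happens[OF le] by auto
  then have c: "c \<ge> 0" using order_trans[OF zero_le_power2] by blast
  have "(\<integral>\<^sup>+x. ennreal ((cmod (f x))\<^sup>2) \<partial>M)
      = (\<integral>\<^sup>+x. liminf (\<lambda>n. ennreal ((cmod (u n x))\<^sup>2)) \<partial>M)"
  proof (rule nn_integral_cong_AE, use lim in eventually_elim)
    case (elim x)
    then have "(\<lambda>n. ennreal ((cmod (u n x))\<^sup>2)) \<longlonglongrightarrow> ennreal ((cmod (f x))\<^sup>2)"
      by (intro tendsto_ennrealI tendsto_intros)
    from lim_imp_Liminf[OF sequentially_bot this] show ?case by (rule sym)
  qed
  also have "\<dots> \<le> liminf (\<lambda>n. (\<integral>\<^sup>+x. ennreal ((cmod (u n x))\<^sup>2) \<partial>M))"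
    by (rule nn_integral_liminf) measurable
  also have "\<dots> \<le> liminf (\<lambda>n. ennreal c)"
    by (rule Liminf_mono, use le in eventually_elim) (simp add: nn_integral_L2[OF u] ennreal_leI)
  also have "\<dots> = ennreal c" by (simp add: Liminf_const)
  finally have *: "(\<integral>\<^sup>+x. ennreal ((cmod (f x))\<^sup>2) \<partial>M) \<le> ennreal c" .
  show "f \<in> L2 M" "(norm_L2 M f)\<^sup>2 \<le> c" by (rule L2_nn_integralI[OF f c *])+
qed

lemma tendsto_L2_AE_subseq:
  assumes u: "\<And>n. u n \<in> L2 M" and f: "f \<in> L2 M" and lim: "tendsto_L2 M u f"
  obtains r where "strict_mono r" "AE x in M. (\<lambda>n. u (r n) x) \<longlonglongrightarrow> f x"
proof -
  have "\<exists>r. strict_mono r \<and> (AE x in M. (\<lambda>n. (cmod (u (r n) x - f x))\<^sup>2) \<longlonglongrightarrow> 0)"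
  proof (rule tendsto_L1_AE_subseq)
    show "integrable M (\<lambda>x. (cmod (u n x - f x))\<^sup>2)" for n
      using L2_integrable[OF L2_diff[OF u f]] .
    have "(\<lambda>n. (norm_L2 M (\<lambda>x. u n x - f x))\<^sup>2) \<longlonglongrightarrow> 0\<^sup>2"
      using lim unfolding tendsto_L2_def by (intro tendsto_power)
    then show "(\<lambda>n. \<integral>x. norm ((cmod (u n x - f x))\<^sup>2) \<partial>M) \<longlonglongrightarrow> 0"
      by (simp add: norm_L2_power2)
  qed
  then obtain r where r: "strict_mono r" "AE x in M. (\<lambda>n. (cmod (u (r n) x - f x))\<^sup>2) \<longlonglongrightarrow> 0" by blast
  have "AE x in M. (\<lambda>n. u (r n) x) \<longlonglongrightarrow> f x"
    using r(2)
  proof eventually_elim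
    case (elim x)
    then have "(\<lambda>n. cmod (u (r n) x - f x)) \<longlonglongrightarrow> 0" by simp
    then show ?case using LIM_zero_cancel tendsto_norm_zero_iff by blast
  qed
  then show ?thesis using that r by blast
qed

text \<open>The Riesz-Fischer argument: a fast subsequence converges a.e., and Fatou applied to
  \<open>u n - u (r j)\<close> for growing \<open>j\<close> turns the Cauchy bound into convergence
  of the whole sequence in norm.\<close>

lemma L2_complete:
  assumes u: "\<And>n. u n \<in> L2 M"
    and cau: "\<And>e. e > 0 \<Longrightarrow> \<exists>N. \<forall>k\<ge>N. \<forall>n\<ge>N. norm_L2 M (\<lambda>x. u k x - u n x) < e"
  obtains f where "f \<in> L2 M" "tendsto_L2 M u f"
proof -
  note [measurable] = L2_measurable[OF u]
  have "\<forall>j. \<exists>N. \<forall>k\<ge>N. \<forall>n\<ge>N. norm_L2 M (\<lambda>x. u k x - u n x) < (1/2) ^ j"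
    by (intro allI cau) simp
  from choice[OF this] obtain N where N: "\<And>j k n. k \<ge> N j \<Longrightarrow> n \<ge> N j \<Longrightarrow> norm_L2 M (\<lambda>x. u k x - u n x) < (1/2) ^ j"
    by blast
  \<comment> \<open>Jumping to at least \<open>N j\<close> at stage \<open>j\<close> bounds the
    increments; the \<open>Suc\<close> keeps the subsequence strictly increasing.\<close>
  define r where "r = rec_nat (N 0) (\<lambda>j a. max (Suc a) (N (Suc j)))"
  have r_simps: "r 0 = N 0" "r (Suc j) = max (Suc (r j)) (N (Suc j))" for j
    by (simp_all add: r_def)
  have rN: "r j \<ge> N j" for j by (cases j) (simp_all add: r_simps)
  have rm: "strict_mono r" by (rule strict_monoI_Suc) (simp add: r_simps)
  define d where "d j x = (cmod (u (r (Suc j)) x - u (r j) x))\<^sup>2" for j x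
  have dn: "d j x \<ge> 0" for j x by (simp add: d_def)
  have [measurable]: "d j \<in> borel_measurable M" for j unfolding d_def by measurable
  have dle: "(\<integral>\<^sup>+x. ennreal (d j x) \<partial>M) \<le> ennreal ((1/4) ^ j)" for j
  proof -
    have "r (Suc j) \<ge> r j" using rm by (simp add: strict_mono_less_eq)
    then have "norm_L2 M (\<lambda>x. u (r (Suc j)) x - u (r j) x) \<le> (1/2) ^ j"
      using rN[of j] by (intro less_imp_le[OF N]) auto
    then have "(norm_L2 M (\<lambda>x. u (r (Suc j)) x - u (r j) x))\<^sup>2 \<le> ((1/2) ^ j)\<^sup>2"
      by (intro power_mono) auto
    also have "\<dots> = (1/4) ^ j" by (simp add: power2_eq_square flip: power_mult_distrib)
    finally show ?thesis
      unfolding d_def nn_integral_L2[OF L2_diff[OF u u]] by (rule ennreal_leI)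
  qed
  \<comment> \<open>The weight \<open>2 ^ j\<close> spends the surplus between
    \<open>(1/4) ^ j\<close> and \<open>(1/2) ^ j\<close>: finiteness of the weighted sum makes the
    increments themselves at most a constant times \<open>sqrt (1/2) ^ j\<close>, hence summable, at
    almost every point.\<close>
  have "(\<integral>\<^sup>+x. (\<Sum>j. ennreal (2 ^ j) * ennreal (d j x)) \<partial>M)
      = (\<Sum>j. \<integral>\<^sup>+x. ennreal (2 ^ j) * ennreal (d j x) \<partial>M)"
    by (rule nn_integral_suminf) measurable
  also have "\<dots> = (\<Sum>j. ennreal (2 ^ j) * (\<integral>\<^sup>+x. ennreal (d j x) \<partial>M))"
    by (intro suminf_cong nn_integral_cmult) measurable
  also have "\<dots> \<le> (\<Sum>j. ennreal ((1/2) ^ j))"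
  proof (intro suminf_le summableI)
    fix j :: nat
    have "ennreal (2 ^ j) * (\<integral>\<^sup>+x. ennreal (d j x) \<partial>M) \<le> ennreal (2 ^ j) * ennreal ((1/4) ^ j)"
      by (intro mult_left_mono dle) simp
    also have "\<dots> = ennreal ((1/2) ^ j)" by (simp add: ennreal_mult[symmetric] flip: power_mult_distrib)
    finally show "ennreal (2 ^ j) * (\<integral>\<^sup>+x. ennreal (d j x) \<partial>M) \<le> ennreal ((1/2) ^ j)" .
  qed
  also have "\<dots> < \<infinity>"
    by (subst suminf_ennreal2) (auto intro: summable_geometric)
  finally have "(\<integral>\<^sup>+x. (\<Sum>j. ennreal (2 ^ j) * ennreal (d j x)) \<partial>M) \<noteq> \<infinity>" by simp
  then have "AE x in M. (\<Sum>j. ennreal (2 ^ j) * ennreal (d j x)) \<noteq> \<infinity>"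
    by (intro nn_integral_PInf_AE) measurable
  then have conv: "AE x in M. convergent (\<lambda>j. u (r j) x)"
  proof eventually_elim
    case (elim x)
    have eq: "ennreal (2 ^ j) * ennreal (d j x) = ennreal (2 ^ j * d j x)" for j
      using dn by (simp add: ennreal_mult)
    from elim obtain C where C: "C \<ge> 0" "(\<Sum>j. ennreal (2 ^ j * d j x)) = ennreal C"
      unfolding eq by (cases "\<Sum>j. ennreal (2 ^ j * d j x)") auto
    have "2 ^ j * d j x \<le> C" for j
    proof -
      have "ennreal (2 ^ j * d j x) \<le> (\<Sum>j. ennreal (2 ^ j * d j x))"
        using sum_le_suminf[of "\<lambda>j. ennreal (2 ^ j * d j x)" "{j}"] by simp
      then show ?thesis using C by simp
    qed
    then have le: "d j x \<le> C * (1/2) ^ j" for j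
      by (simp add: field_simps)
    have "summable (\<lambda>j. u (r (Suc j)) x - u (r j) x)"
    proof (rule summable_comparison_test'[where N = 0])
      show "summable (\<lambda>j. sqrt C * (sqrt (1/2)) ^ j)"
        by (intro summable_mult summable_geometric) (simp add: real_sqrt_divide)
      show "norm (u (r (Suc j)) x - u (r j) x) \<le> sqrt C * (sqrt (1/2)) ^ j" for j
      proof -
        have "norm (u (r (Suc j)) x - u (r j) x) = sqrt (d j x)" by (simp add: d_def)
        also have "\<dots> \<le> sqrt (C * (1/2) ^ j)" using le by simp
        finally show ?thesis by (simp only: real_sqrt_mult real_sqrt_power)
      qed
    qed
    then have "convergent (\<lambda>n. \<Sum>j<n. u (r (Suc j)) x - u (r j) x)"
      by (simp add: summable_iff_convergent)
    then have "convergent (\<lambda>n. u (r n) x - u (r 0) x)"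
      by (simp only: sum_lessThan_telescope[of "\<lambda>n. u (r n) x"])
    from convergent_add[OF this convergent_const[of "u (r 0) x"]]
    show ?case by simp
  qed
  define f where "f x = lim (\<lambda>j. u (r j) x)" for x
  have f: "f \<in> borel_measurable M"
    unfolding f_def by (rule borel_measurable_lim_metric) measurable
  have lim: "AE x in M. (\<lambda>j. u (r j) x) \<longlonglongrightarrow> f x"
    using conv by eventually_elim (simp add: f_def convergent_LIMSEQ_iff)
  have main: "\<exists>K. \<forall>n\<ge>K. (\<lambda>x. u n x - f x) \<in> L2 M \<and> (norm_L2 M (\<lambda>x. u n x - f x))\<^sup>2 \<le> e\<^sup>2" if e: "e > 0" for e
  proof -
    obtain K where K: "\<And>k n. k \<ge> K \<Longrightarrow> n \<ge> K \<Longrightarrow> norm_L2 M (\<lambda>x. u k x - u n x) < e" using cau[OF e] by blast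
    show ?thesis
    proof (intro exI[of _ K] allI impI)
      fix n assume n: "n \<ge> K"
      have a: "AE x in M. (\<lambda>j. u n x - u (r j) x) \<longlonglongrightarrow> u n x - f x"
        using lim by eventually_elim (intro tendsto_intros)
      have b: "eventually (\<lambda>j. (norm_L2 M (\<lambda>x. u n x - u (r j) x))\<^sup>2 \<le> e\<^sup>2) sequentially"
        using eventually_ge_at_top[of K]
      proof eventually_elim
        case (elim j)
        then have "r j \<ge> K" using seq_suble[OF rm, of j] by linarith
        then show ?case using K[OF n, of "r j"] by (intro power_mono) auto
      qed
      have d': "(\<lambda>x. u n x - u (r j) x) \<in> L2 M" for j by (intro L2_diff u)
      have m: "(\<lambda>x. u n x - f x) \<in> borel_measurable M" using f by measurable
      show "(\<lambda>x. u n x - f x) \<in> L2 M \<and> (norm_L2 M (\<lambda>x. u n x - f x))\<^sup>2 \<le> e\<^sup>2"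
        using L2_Fatou[OF d' m a b] by blast
    qed
  qed
  obtain K where "(\<lambda>x. u K x - f x) \<in> L2 M" using main[OF zero_less_one] by blast
  from L2_diff[OF u[of K] this] have fL: "f \<in> L2 M" by simp
  have "tendsto_L2 M u f" unfolding tendsto_L2_def
  proof (rule LIMSEQ_I)
    fix e :: real assume e: "e > 0"
    obtain K where K: "\<forall>n\<ge>K. (norm_L2 M (\<lambda>x. u n x - f x))\<^sup>2 \<le> (e/2)\<^sup>2" using main[of "e/2"] e by (meson half_gt_zero)
    have "norm (norm_L2 M (\<lambda>x. u n x - f x) - 0) < e" if "n \<ge> K" for n
    proof -
      have "norm_L2 M (\<lambda>x. u n x - f x) \<le> e / 2"
        by (rule power2_le_imp_le) (use K that e in auto)
      then show ?thesis using e by simp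
    qed
    then show "\<exists>no. \<forall>n\<ge>no. norm (norm_L2 M (\<lambda>x. u n x - f x) - 0) < e" by blast
  qed
  with fL show ?thesis by (rule that)
qed

lemma tendsto_L2_Cauchy:
  assumes u: "\<And>n. u n \<in> L2 M" and f: "f \<in> L2 M" and lim: "tendsto_L2 M u f" and e: "e > 0"
  shows "\<exists>N. \<forall>k\<ge>N. \<forall>n\<ge>N. norm_L2 M (\<lambda>x. u k x - u n x) < e"
proof -
  obtain N where N: "\<And>n. n \<ge> N \<Longrightarrow> norm_L2 M (\<lambda>x. u n x - f x) < e / 2"
    using order_tendstoD(2)[OF lim[unfolded tendsto_L2_def], of "e/2"] e
    unfolding eventually_sequentially by auto
  have "norm_L2 M (\<lambda>x. u k x - u n x) < e" if "k \<ge> N" "n \<ge> N" for k n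
    using norm_L2_triangle[OF u f u, of k n] N[OF that(1)] N[OF that(2)] norm_L2_diff_commute[of M f "u n"]
    by simp
  then show ?thesis by blast
qed

section \<open>Limits in the norm\<close>

lemma tendsto_L2_unique:
  assumes u: "\<And>n. u n \<in> L2 M" and f: "f \<in> L2 M" "tendsto_L2 M u f" and g: "g \<in> L2 M" "tendsto_L2 M u g"
  shows "AE x in M. f x = g x"
proof -
  have "(\<lambda>n. norm_L2 M (\<lambda>x. u n x - f x) + norm_L2 M (\<lambda>x. u n x - g x)) \<longlonglongrightarrow> 0 + 0"
    using f(2) g(2) unfolding tendsto_L2_def by (rule tendsto_add)
  moreover have "norm_L2 M (\<lambda>x. f x - g x) \<le> norm_L2 M (\<lambda>x. u n x - f x) + norm_L2 M (\<lambda>x. u n x - g x)" for n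
    using norm_L2_triangle[OF f(1) u[of n] g(1)] norm_L2_diff_commute[of M f "u n"] by simp
  ultimately have "norm_L2 M (\<lambda>x. f x - g x) \<le> 0"
    by (intro LIMSEQ_le_const[where X = "\<lambda>n. norm_L2 M (\<lambda>x. u n x - f x) + norm_L2 M (\<lambda>x. u n x - g x)"]) auto
  then have "norm_L2 M (\<lambda>x. f x - g x) = 0" by (simp add: antisym)
  then show ?thesis using norm_L2_eq_0_iff[OF L2_diff[OF f(1) g(1)]] by simp
qed

lemma tendsto_norm_L2:
  assumes u: "\<And>n. u n \<in> L2 M" and f: "f \<in> L2 M" "tendsto_L2 M u f"
  shows "(\<lambda>n. norm_L2 M (u n)) \<longlonglongrightarrow> norm_L2 M f"
proof (rule LIM_zero_cancel, rule Lim_null_comparison)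
  show "(\<lambda>n. norm_L2 M (\<lambda>x. u n x - f x)) \<longlonglongrightarrow> 0" using f(2) by (simp add: tendsto_L2_def)
  show "eventually (\<lambda>n. norm (norm_L2 M (u n) - norm_L2 M f) \<le> norm_L2 M (\<lambda>x. u n x - f x)) sequentially"
    using norm_L2_reverse_triangle[OF u f(1)] by simp
qed

lemma tendsto_L2_lincomb:
  assumes "\<And>n. u n \<in> L2 M" "f \<in> L2 M" "tendsto_L2 M u f"
    and "\<And>n. v n \<in> L2 M" "g \<in> L2 M" "tendsto_L2 M v g"
  shows "tendsto_L2 M (\<lambda>n x. a * u n x + b * v n x) (\<lambda>x. a * f x + b * g x)"
  unfolding tendsto_L2_def
proof (rule Lim_null_comparison)
  have "norm_L2 M (\<lambda>x. a * u n x + b * v n x - (a * f x + b * g x))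
      \<le> cmod a * norm_L2 M (\<lambda>x. u n x - f x) + cmod b * norm_L2 M (\<lambda>x. v n x - g x)" for n
    using norm_L2_add_le[OF L2_scale[OF L2_diff[OF assms(1,2)], of a] L2_scale[OF L2_diff[OF assms(4,5)], of b], of n n]
    unfolding norm_L2_scale by (simp add: algebra_simps)
  then show "eventually (\<lambda>n. norm (norm_L2 M (\<lambda>x. a * u n x + b * v n x - (a * f x + b * g x)))
      \<le> cmod a * norm_L2 M (\<lambda>x. u n x - f x) + cmod b * norm_L2 M (\<lambda>x. v n x - g x)) sequentially"
    by simp
  have "(\<lambda>n. cmod a * norm_L2 M (\<lambda>x. u n x - f x) + cmod b * norm_L2 M (\<lambda>x. v n x - g x))
      \<longlonglongrightarrow> cmod a * 0 + cmod b * 0"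
    using assms(3,6) unfolding tendsto_L2_def by (intro tendsto_intros)
  then show "(\<lambda>n. cmod a * norm_L2 M (\<lambda>x. u n x - f x) + cmod b * norm_L2 M (\<lambda>x. v n x - g x)) \<longlonglongrightarrow> 0"
    by simp
qed

lemma tendsto_L2_dominated:
  assumes u: "\<And>n. u n \<in> borel_measurable M" and f: "f \<in> L2 M" and w: "w \<in> L2 M"
    and le: "\<And>n. AE x in M. cmod (u n x) \<le> cmod (w x)"
    and lim: "AE x in M. (\<lambda>n. u n x) \<longlonglongrightarrow> f x"
  shows "tendsto_L2 M u f"
proof -
  note [measurable] = u L2_measurable[OF f] L2_measurable[OF w]
  have "(\<lambda>n. \<integral>x. (cmod (u n x - f x))\<^sup>2 \<partial>M) \<longlonglongrightarrow> (\<integral>x. 0 \<partial>M)"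
  proof (rule integral_dominated_convergence)
    show "integrable M (\<lambda>x. 2 * (cmod (w x))\<^sup>2 + 2 * (cmod (f x))\<^sup>2)"
      using L2_integrable[OF f] L2_integrable[OF w] by auto
    show "AE x in M. (\<lambda>n. (cmod (u n x - f x))\<^sup>2) \<longlonglongrightarrow> 0"
      using lim
    proof eventually_elim
      case (elim x)
      then have "(\<lambda>n. (cmod (u n x - f x))\<^sup>2) \<longlonglongrightarrow> (cmod (f x - f x))\<^sup>2" by (intro tendsto_intros)
      then show ?case by simp
    qed
    show "AE x in M. norm ((cmod (u n x - f x))\<^sup>2) \<le> 2 * (cmod (w x))\<^sup>2 + 2 * (cmod (f x))\<^sup>2" for n
      using le[of n]
    proof eventually_elim
      case (elim x)
      then have "(cmod (u n x))\<^sup>2 \<le> (cmod (w x))\<^sup>2" by (intro power_mono) auto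
      moreover have "(cmod (u n x - f x))\<^sup>2 \<le> 2 * (cmod (u n x))\<^sup>2 + 2 * (cmod (f x))\<^sup>2"
        using cmod_lincomb_power2_le[of 1 "u n x" "-1" "f x"] by simp
      ultimately show ?case unfolding real_norm_def abs_power2 by linarith
    qed
  qed measurable
  then have "(\<lambda>n. sqrt (\<integral>x. (cmod (u n x - f x))\<^sup>2 \<partial>M)) \<longlonglongrightarrow> sqrt 0"
    by (intro tendsto_real_sqrt) simp
  then show ?thesis by (simp add: tendsto_L2_def norm_L2_def)
qed

section \<open>Indicator functions\<close>

lemma L2_indicator_mult:
  assumes f: "f \<in> L2 M" and A: "A \<in> sets M"
  shows "(\<lambda>x. indicator A x * f x) \<in> L2 M"
proof (rule L2_dominated(1)[OF f, of _ 1])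
  show "(\<lambda>x. indicator A x * f x) \<in> borel_measurable M" using L2_measurable[OF f] A by measurable
qed (auto simp: indicator_def)

lemma indicator_L2:
  assumes "A \<in> sets M" "emeasure M A < \<infinity>"
  shows "(indicator A :: _ \<Rightarrow> complex) \<in> L2 M"
proof (rule L2_I)
  have "(\<lambda>x. (cmod (indicator A x))\<^sup>2) = indicator A" by (auto simp: indicator_def)
  then show "integrable M (\<lambda>x. (cmod (indicator A x))\<^sup>2)" using assms by simp
qed (use assms in simp)

lemma integral_indicator_complex:
  assumes "A \<in> sets M"
  shows "(\<integral>x. (indicator A x :: complex) \<partial>M) = of_real (measure M A)"
proof -
  have "(\<integral>x. (indicator A x :: complex) \<partial>M) = (\<integral>x. complex_of_real (indicator A x) \<partial>M)"
    by (intro Bochner_Integration.integral_cong) (auto simp: indicator_def)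
  also have "\<dots> = of_real (\<integral>x. indicator A x \<partial>M)" by (rule integral_complex_of_real)
  finally show ?thesis using assms by (simp add: sets.Int_space_eq2)
qed

lemma norm_L2_indicator: "A \<in> sets M \<Longrightarrow> (norm_L2 M (indicator A))\<^sup>2 = measure M A"
proof -
  assume A: "A \<in> sets M"
  have "(norm_L2 M (indicator A))\<^sup>2 = (\<integral>x. indicator A x \<partial>M)"
    unfolding norm_L2_power2 by (intro Bochner_Integration.integral_cong) (auto simp: indicator_def)
  then show ?thesis using A by (simp add: sets.Int_space_eq2)
qed

text \<open>Banach's fixed point theorem. \<open>T\<close> acts on representatives, so the fixed
  point equation can only hold almost everywhere. It will solve the perturbed resolvent equation for
  \<open>L + V\<close>.\<close>

lemma L2_contraction_fixpoint:
  assumes T: "\<And>g. g \<in> L2 M \<Longrightarrow> T g \<in> L2 M" and \<rho>: "0 \<le> \<rho>" "\<rho> < 1"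
    and le: "\<And>g h. g \<in> L2 M \<Longrightarrow> h \<in> L2 M \<Longrightarrow>
      norm_L2 M (\<lambda>x. T g x - T h x) \<le> \<rho> * norm_L2 M (\<lambda>x. g x - h x)"
  obtains g where "g \<in> L2 M" "AE x in M. T g x = g x"
proof -
  define u where "u n = (T ^^ n) (\<lambda>_. 0)" for n
  have us: "u (Suc n) = T (u n)" for n by (simp add: u_def)
  have u: "u n \<in> L2 M" for n by (induction n) (auto simp: u_def intro: T)
  define c where "c = norm_L2 M (\<lambda>x. u 1 x - u 0 x)"
  have step: "norm_L2 M (\<lambda>x. u (Suc n) x - u n x) \<le> \<rho> ^ n * c" for n
  proof (induction n)
    case (Suc n)
    have "norm_L2 M (\<lambda>x. u (Suc (Suc n)) x - u (Suc n) x) \<le> \<rho> * norm_L2 M (\<lambda>x. u (Suc n) x - u n x)"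
      unfolding us[of "Suc n"] us[of n] using le[OF T[OF u] u] us by metis
    also have "\<dots> \<le> \<rho> * (\<rho> ^ n * c)" by (intro mult_left_mono Suc \<rho>)
    finally show ?case by (simp add: mult.assoc)
  qed (simp add: c_def)
  have tele: "norm_L2 M (\<lambda>x. u (n + j) x - u n x) \<le> \<rho> ^ n * c / (1 - \<rho>)" for n j
  proof -
    have "norm_L2 M (\<lambda>x. u (n + j) x - u n x) \<le> (\<Sum>i<j. \<rho> ^ (n + i) * c)"
    proof (induction j)
      case (Suc j)
      have "norm_L2 M (\<lambda>x. u (n + Suc j) x - u n x)
          \<le> norm_L2 M (\<lambda>x. u (Suc (n + j)) x - u (n + j) x) + norm_L2 M (\<lambda>x. u (n + j) x - u n x)"
        using norm_L2_triangle[OF u u u, of "n + Suc j" n "n + j"] by simp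
      then show ?case using Suc step[of "n + j"] by simp
    qed simp
    also have "\<dots> = \<rho> ^ n * c * (\<Sum>i<j. \<rho> ^ i)" by (simp add: sum_distrib_left power_add mult_ac)
    also have "\<dots> \<le> \<rho> ^ n * c * (1 / (1 - \<rho>))"
      using \<rho> by (intro mult_left_mono) (auto simp: sum_gp_strict c_def divide_right_mono)
    finally show ?thesis by simp
  qed
  have "(\<lambda>n. \<rho> ^ n * c / (1 - \<rho>)) \<longlonglongrightarrow> 0 * c / (1 - \<rho>)"
    using \<rho> by (intro tendsto_intros LIMSEQ_power_zero) auto
  then have t0: "(\<lambda>n. \<rho> ^ n * c / (1 - \<rho>)) \<longlonglongrightarrow> 0" by simp
  have cau: "\<exists>N. \<forall>k\<ge>N. \<forall>n\<ge>N. norm_L2 M (\<lambda>x. u k x - u n x) < e" if e: "e > 0" for e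
  proof -
    obtain N where N: "\<rho> ^ N * c / (1 - \<rho>) < e / 2"
      using order_tendstoD(2)[OF t0, of "e/2"] e by (auto simp: eventually_sequentially)
    have a: "norm_L2 M (\<lambda>x. u k x - u N x) < e / 2" if "k \<ge> N" for k
      by (rule le_less_trans[OF _ N]) (use tele[of N "k - N"] that in simp)
    have "norm_L2 M (\<lambda>x. u k x - u n x) < e" if "k \<ge> N" "n \<ge> N" for k n
      using norm_L2_triangle[OF u u u, of k n N] a[OF that(1)] a[OF that(2)]
        norm_L2_diff_commute[of M "u N" "u n"] by simp
    then show ?thesis by blast
  qed
  obtain g where g: "g \<in> L2 M" "tendsto_L2 M u g"
    by (rule L2_complete[OF u cau]) blast+
  have "(\<lambda>n. \<rho> * norm_L2 M (\<lambda>x. u n x - g x)) \<longlonglongrightarrow> \<rho> * 0"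
    using g(2) unfolding tendsto_L2_def by (intro tendsto_intros)
  then have "(\<lambda>n. \<rho> * norm_L2 M (\<lambda>x. u n x - g x)) \<longlonglongrightarrow> 0" by simp
  then have 1: "tendsto_L2 M (\<lambda>n. u (Suc n)) (T g)"
    unfolding tendsto_L2_def us
    by (rule Lim_null_comparison[rotated]) (simp add: le[OF u g(1)])
  have 2: "tendsto_L2 M (\<lambda>n. u (Suc n)) g"
    using g(2) unfolding tendsto_L2_def by (rule LIMSEQ_Suc)
  have "AE x in M. T g x = g x"
    by (rule tendsto_L2_unique[OF _ T[OF g(1)] 1 g(1) 2]) (rule u)
  with g(1) show ?thesis by (rule that)
qed

section \<open>Closed forms and self-adjoint operators\<close>

lemma inner_L2_lincomb_right:
  assumes "f \<in> L2 M" "g \<in> L2 M" "h \<in> L2 M"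
  shows "inner_L2 M f (\<lambda>x. a * g x + b * h x) = cnj a * inner_L2 M f g + cnj b * inner_L2 M f h"
proof -
  have "inner_L2 M f (\<lambda>x. a * g x + b * h x) = cnj (a * inner_L2 M g f + b * inner_L2 M h f)"
    unfolding inner_L2_lincomb_left[OF assms(2,3,1), symmetric] by (rule inner_L2_cnj)
  also have "\<dots> = cnj a * inner_L2 M f g + cnj b * inner_L2 M f h"
    unfolding inner_L2_cnj[of M f g] inner_L2_cnj[of M f h] by simp
  finally show ?thesis .
qed

lemma inner_L2_diff_right:
  assumes "f \<in> L2 M" "g \<in> L2 M" "h \<in> L2 M"
  shows "inner_L2 M f (\<lambda>x. g x - h x) = inner_L2 M f g - inner_L2 M f h"
  using inner_L2_lincomb_right[OF assms, of 1 "-1"] by simp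

lemma inner_L2_diff_left:
  assumes "f \<in> L2 M" "g \<in> L2 M" "h \<in> L2 M"
  shows "inner_L2 M (\<lambda>x. f x - g x) h = inner_L2 M f h - inner_L2 M g h"
  using inner_L2_lincomb_left[OF assms, of 1 "-1"] by simp

text \<open>The first-order condition at a minimum. The choice \<open>t = - R / (N + 1)\<close>
  makes the quadratic strictly negative unless \<open>R = 0\<close>; the denominator is
  \<open>N + 1\<close> because \<open>N\<close> may vanish.\<close>

lemma quadratic_nonneg_imp_zero:
  fixes R N :: real
  assumes "N \<ge> 0" and "\<And>t. 0 \<le> 2 * t * R + t\<^sup>2 * N"
  shows "R = 0"
proof (rule ccontr)
  assume "R \<noteq> 0"
  define s where "s = R / (N + 1)"
  have R: "R = s * (N + 1)" using assms(1) by (simp add: s_def)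
  with \<open>R \<noteq> 0\<close> have "s\<^sup>2 > 0" by auto
  then have "s\<^sup>2 * (N + 2) > 0" using assms(1) by simp
  moreover have "0 \<le> 2 * (- s) * R + (- s)\<^sup>2 * N" by (rule assms(2))
  then have "s\<^sup>2 * (N + 2) \<le> 0"
    by (simp add: R algebra_simps power2_eq_square)
  ultimately show False by simp
qed

section \<open>Representation by minimisation and resolvents of a closed form\<close>

context hform
begin

text \<open>The direct method in place of the Riesz theorem on the form domain: coercivity bounds
  \<open>J\<close> from below, closedness takes the part of completeness, and the Euler-Lagrange
  equation of \<open>J\<close> is the representation sought.\<close>

lemma coercive_form_Riesz:
  assumes \<delta>: "\<delta> > 0" and co: "\<And>u. u \<in> D \<Longrightarrow> \<delta> * (norm_L2 M u)\<^sup>2 \<le> Re (Q u u)"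
    and cl: "form_closed M D Q" and f: "f \<in> L2 M"
  obtains u where "u \<in> D" "\<And>v. v \<in> D \<Longrightarrow> Q u v = inner_L2 M f v"
proof -
  define N where "N u = Re (Q u u)" for u
  define J where "J u = N u - 2 * Re (inner_L2 M f u)" for u
  have N0: "N u \<ge> 0" if "u \<in> D" for u
    using co[OF that] \<delta> unfolding N_def
    by (meson mult_nonneg_nonneg order_trans zero_le_power2 less_imp_le)
  have cQ: "cmod (Q u u) = N u" if "u \<in> D" for u
    using N0[OF that] Im_Q_self[OF that] by (simp add: cmod_eq_Re N_def)
  \<comment> \<open>Completing the square in \<open>norm_L2 M u\<close>.\<close>
  have low: "- ((norm_L2 M f)\<^sup>2 / \<delta>) \<le> J u" if u: "u \<in> D" for u
  proof -
    have "0 \<le> (\<delta> * norm_L2 M u - norm_L2 M f)\<^sup>2 / \<delta>" using \<delta> by simp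
    also have "\<dots> = \<delta> * (norm_L2 M u)\<^sup>2 - 2 * (norm_L2 M f * norm_L2 M u) + (norm_L2 M f)\<^sup>2 / \<delta>"
      using \<delta> by (simp add: power2_diff field_simps power2_eq_square)
    also have "\<dots> \<le> N u - 2 * Re (inner_L2 M f u) + (norm_L2 M f)\<^sup>2 / \<delta>"
      using co[OF u] cmod_inner_L2_le[OF f D_L2[OF u]] complex_Re_le_cmod[of "inner_L2 M f u"]
      unfolding N_def by linarith
    finally show ?thesis by (simp add: J_def)
  qed
  have bdd: "bdd_below (J ` D)"
    using low by (intro bdd_belowI2[where m = "- ((norm_L2 M f)\<^sup>2 / \<delta>)"]) auto
  define j where "j = Inf (J ` D)"
  have jle: "j \<le> J u" if "u \<in> D" for u
    unfolding j_def using that bdd by (intro cINF_lower)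
  have "\<exists>u\<in>D. J u < j + 1 / real (Suc n)" for n
  proof -
    have "Inf (J ` D) < j + 1 / real (Suc n)" by (simp add: j_def)
    then show ?thesis using D_0 bdd by (subst (asm) cINF_less_iff) auto
  qed
  then obtain u where uD: "\<And>n. u n \<in> D" and Ju: "\<And>n. J (u n) < j + 1 / real (Suc n)"
    by metis
  have J_exp: "J (\<lambda>x. a x + of_real t * b x) = J a + 2 * t * Re (Q a b - inner_L2 M f b) + t\<^sup>2 * N b"
    if "a \<in> D" "b \<in> D" for a b and t :: real
    using Q_expand[OF that, of 1 "of_real t"]
      inner_L2_lincomb_right[OF f D_L2[OF that(1)] D_L2[OF that(2)], of 1 "of_real t"]
    by (simp add: J_def N_def algebra_simps)
  \<comment> \<open>The parallelogram law at the midpoint, where \<open>J\<close> is still at least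
    \<open>j\<close>; it makes every minimising sequence Cauchy for the form.\<close>
  have par: "N (\<lambda>x. a x - b x) \<le> 2 * J a + 2 * J b - 4 * j" if "a \<in> D" "b \<in> D" for a b
  proof -
    define m where "m x = (1/2) * a x + (1/2) * b x" for x
    have "j \<le> J m" unfolding m_def[abs_def] by (intro jle D_lincomb that)
    also have "J m = J a / 2 + J b / 2 - N (\<lambda>x. a x - b x) / 4"
    proof -
      have 1: "N m = N a / 4 + Re (Q a b) / 2 + N b / 4"
        using Q_expand[OF that, of "1/2" "1/2"] unfolding N_def m_def[abs_def]
        by (simp add: power2_eq_square)
      have 2: "N (\<lambda>x. a x - b x) = N a - 2 * Re (Q a b) + N b"
        using Q_expand[OF that, of 1 "-1"] unfolding N_def by simp
      have 3: "Re (inner_L2 M f m) = Re (inner_L2 M f a) / 2 + Re (inner_L2 M f b) / 2"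
        using arg_cong[OF inner_L2_lincomb_right[OF f D_L2[OF that(1)] D_L2[OF that(2)], of "1/2" "1/2"], of Re]
        unfolding m_def[abs_def] by simp
      show ?thesis unfolding J_def 1 2 3 by (simp add: field_simps)
    qed
    finally show ?thesis by simp
  qed
  have Nuu: "N (\<lambda>x. u k x - u n x) \<le> 2 / real (Suc k) + 2 / real (Suc n)" for k n
    using par[OF uD uD, of k n] Ju[of k] Ju[of n] by simp
  have Ncau: "\<exists>K. \<forall>k\<ge>K. \<forall>n\<ge>K. N (\<lambda>x. u k x - u n x) < e" if e: "e > 0" for e
  proof -
    obtain K where K: "4 / e < real K" using reals_Archimedean2 by blast
    have "N (\<lambda>x. u k x - u n x) < e" if "k \<ge> K" "n \<ge> K" for k n
    proof -
      have K0: "real K > 0" using K e by (meson divide_pos_pos less_trans zero_less_numeral)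
      have "2 / real (Suc k) \<le> 2 / real K" "2 / real (Suc n) \<le> 2 / real K"
        using that K0 by (auto intro!: divide_left_mono)
      moreover have "4 / real K < e" using K e K0 by (simp add: field_simps)
      ultimately show ?thesis using Nuu[of k n] by linarith
    qed
    then show ?thesis by blast
  qed
  have cau: "\<exists>K. \<forall>k\<ge>K. \<forall>n\<ge>K. norm_L2 M (\<lambda>x. u k x - u n x) < e" if e: "e > 0" for e
  proof -
    have "\<delta> * e\<^sup>2 > 0" using \<delta> e by simp
    from Ncau[OF this] obtain K where
      K: "\<And>k n. k \<ge> K \<Longrightarrow> n \<ge> K \<Longrightarrow> N (\<lambda>x. u k x - u n x) < \<delta> * e\<^sup>2" by blast
    have "norm_L2 M (\<lambda>x. u k x - u n x) < e" if "k \<ge> K" "n \<ge> K" for k n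
    proof -
      have "\<delta> * (norm_L2 M (\<lambda>x. u k x - u n x))\<^sup>2 < \<delta> * e\<^sup>2"
        using co[OF D_diff[OF uD uD], of k n] K[OF that] unfolding N_def by linarith
      then have "(norm_L2 M (\<lambda>x. u k x - u n x))\<^sup>2 < e\<^sup>2" using \<delta> by simp
      then show ?thesis by (rule power2_less_imp_less) (use e in simp)
    qed
    then show ?thesis by blast
  qed
  obtain w where w: "w \<in> L2 M" "tendsto_L2 M u w"
    by (rule L2_complete[OF D_L2[OF uD] cau]) blast+
  have "w \<in> D \<and> (\<lambda>n. Q (\<lambda>x. u n x - w x) (\<lambda>x. u n x - w x)) \<longlonglongrightarrow> 0"
  proof (rule cl[unfolded form_closed_def, rule_format])
    show "\<And>n. u n \<in> D" by (rule uD)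
    show "w \<in> L2 M" "tendsto_L2 M u w" by (fact w)+
    fix e :: real assume "e > 0"
    from Ncau[OF this]
    show "\<exists>N. \<forall>k\<ge>N. \<forall>n\<ge>N. cmod (Q (\<lambda>x. u k x - u n x) (\<lambda>x. u k x - u n x)) < e"
      using cQ[OF D_diff[OF uD uD]] by simp
  qed
  then have wD: "w \<in> D" and Qw: "(\<lambda>n. Q (\<lambda>x. u n x - w x) (\<lambda>x. u n x - w x)) \<longlonglongrightarrow> 0" by auto
  have Nw: "(\<lambda>n. N (\<lambda>x. u n x - w x)) \<longlonglongrightarrow> 0"
    using tendsto_Re[OF Qw] by (simp add: N_def)
  \<comment> \<open>\<open>J (u n + t v)\<close> cannot fall below \<open>j\<close>, while
    \<open>J (u n)\<close> exceeds \<open>j\<close> by less than \<open>1 / (n + 1)\<close>; letting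
    \<open>n\<close> grow leaves a non-negative quadratic in \<open>t\<close> without constant
    term.\<close>
  have Re0: "Re (Q w v - inner_L2 M f v) = 0" if v: "v \<in> D" for v
  proof (rule quadratic_nonneg_imp_zero[OF N0[OF v]])
    fix t :: real
    have "(\<lambda>n. Q (u n) v - Q w v) \<longlonglongrightarrow> 0"
    proof (rule Lim_null_comparison)
      have "cmod (Q (u n) v - Q w v) \<le> sqrt (N (\<lambda>x. u n x - w x) * N v)" for n
      proof (rule real_le_rsqrt)
        show "(cmod (Q (u n) v - Q w v))\<^sup>2 \<le> N (\<lambda>x. u n x - w x) * N v"
          using Cauchy_Schwarz[OF N0[unfolded N_def] D_diff[OF uD wD] v, of n]
          unfolding Q_diff_left[OF uD wD v] N_def by simp
      qed
      then show "eventually (\<lambda>n. norm (Q (u n) v - Q w v) \<le> sqrt (N (\<lambda>x. u n x - w x) * N v)) sequentially"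
        by simp
      have "(\<lambda>n. sqrt (N (\<lambda>x. u n x - w x) * N v)) \<longlonglongrightarrow> sqrt (0 * N v)"
        by (intro tendsto_intros Nw)
      then show "(\<lambda>n. sqrt (N (\<lambda>x. u n x - w x) * N v)) \<longlonglongrightarrow> 0" by simp
    qed
    then have "(\<lambda>n. Q (u n) v) \<longlonglongrightarrow> Q w v" by (rule LIM_zero_cancel)
    then have l1: "(\<lambda>n. 1 / real (Suc n) + 2 * t * Re (Q (u n) v - inner_L2 M f v) + t\<^sup>2 * N v)
        \<longlonglongrightarrow> 0 + 2 * t * Re (Q w v - inner_L2 M f v) + t\<^sup>2 * N v"
      by (intro tendsto_intros LIMSEQ_Suc[OF lim_1_over_n])
    have "0 \<le> 1 / real (Suc n) + 2 * t * Re (Q (u n) v - inner_L2 M f v) + t\<^sup>2 * N v" for n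
      using jle[OF D_add[OF uD D_scale[OF v]], of n "of_real t"] J_exp[OF uD v, of n t] Ju[of n] by simp
    from LIMSEQ_le_const[OF l1, of 0] this
    show "0 \<le> 2 * t * Re (Q w v - inner_L2 M f v) + t\<^sup>2 * N v" by auto
  qed
  \<comment> \<open>Real perturbations only see the real part; replacing \<open>v\<close> by
    \<open>\<i> v\<close> recovers the imaginary part.\<close>
  have "Q w v = inner_L2 M f v" if v: "v \<in> D" for v
  proof -
    have "Re (Q w (\<lambda>x. \<i> * v x) - inner_L2 M f (\<lambda>x. \<i> * v x)) = 0"
      by (intro Re0 D_scale v)
    moreover have "Q w (\<lambda>x. \<i> * v x) = - \<i> * Q w v"
      using Q_scale_right[OF wD v, of \<i>] by simp
    moreover have "inner_L2 M f (\<lambda>x. \<i> * v x) = - \<i> * inner_L2 M f v"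
      using inner_L2_lincomb_right[OF f D_L2[OF v] D_L2[OF v], of \<i> 0] by simp
    ultimately show ?thesis using Re0[OF v] by (simp add: complex_eq_iff)
  qed
  with wD show ?thesis by (rule that)
qed

lemma hform_shift: "hform M D (\<lambda>u v. Q u v + of_real \<kappa> * inner_L2 M u v)"
  unfolding hform_def hermitian_form_def
proof (intro conjI ballI allI impI)
  show "subspace_L2 M D" using herm by (simp add: hermitian_form_def)
  fix u u' v a b assume D: "u \<in> D" "u' \<in> D" "v \<in> D"
  show "Q (\<lambda>x. a * u x + b * u' x) v + of_real \<kappa> * inner_L2 M (\<lambda>x. a * u x + b * u' x) v
      = a * (Q u v + of_real \<kappa> * inner_L2 M u v) + b * (Q u' v + of_real \<kappa> * inner_L2 M u' v)"
    unfolding Q_left[OF D] inner_L2_lincomb_left[OF D[THEN D_L2]] by (simp add: algebra_simps)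
next
  fix u v assume D: "u \<in> D" "v \<in> D"
  show "Q v u + of_real \<kappa> * inner_L2 M v u = cnj (Q u v + of_real \<kappa> * inner_L2 M u v)"
    unfolding Q_cnj[OF D] inner_L2_cnj[of M v u] by simp
next
  fix u u' v assume D: "u \<in> D" "u' \<in> D" "v \<in> D" and ae: "AE x in M. u x = u' x"
  have "inner_L2 M u v = inner_L2 M u' v"
    by (rule inner_L2_cong_AE) (use D[THEN D_L2, THEN L2_measurable] ae in auto)
  then show "Q u v + of_real \<kappa> * inner_L2 M u v = Q u' v + of_real \<kappa> * inner_L2 M u' v"
    using Q_cong_AE[OF D ae] by simp
qed

text \<open>The added form is bounded on L2, where \<open>u\<close> converges anyway, so form-Cauchy
  sequences and their limits are the same before and after the shift.\<close>

lemma form_closed_shift: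
  assumes cl: "form_closed M D Q"
  shows "form_closed M D (\<lambda>u v. Q u v + of_real \<kappa> * inner_L2 M u v)"
  unfolding form_closed_def
proof (intro allI impI)
  fix u f assume uD: "\<forall>n. u n \<in> D" and f: "f \<in> L2 M" and lim: "tendsto_L2 M u f"
    and cau: "\<forall>e>0. \<exists>N. \<forall>k\<ge>N. \<forall>n\<ge>N. cmod (Q (\<lambda>x. u k x - u n x) (\<lambda>x. u k x - u n x)
      + of_real \<kappa> * inner_L2 M (\<lambda>x. u k x - u n x) (\<lambda>x. u k x - u n x)) < e"
  have uL: "u n \<in> L2 M" for n using uD D_L2 by blast
  have "f \<in> D \<and> (\<lambda>n. Q (\<lambda>x. u n x - f x) (\<lambda>x. u n x - f x)) \<longlonglongrightarrow> 0"
  proof (rule cl[unfolded form_closed_def, rule_format])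
    show "\<And>n. u n \<in> D" using uD by blast
    show "f \<in> L2 M" "tendsto_L2 M u f" by (fact f lim)+
    fix e :: real assume e: "e > 0"
    obtain K where K: "\<And>k n. k \<ge> K \<Longrightarrow> n \<ge> K \<Longrightarrow> cmod (Q (\<lambda>x. u k x - u n x) (\<lambda>x. u k x - u n x)
      + of_real \<kappa> * inner_L2 M (\<lambda>x. u k x - u n x) (\<lambda>x. u k x - u n x)) < e / 2"
      using cau e by (meson half_gt_zero)
    \<comment> \<open>Chosen so that
      \<open>\<bar>\<kappa>\<bar> * (norm_L2 M w)\<^sup>2 < e / 2\<close>; the summand 1 covers
      \<open>\<kappa> = 0\<close>.\<close>
    have "sqrt (e / (2 * (\<bar>\<kappa>\<bar> + 1))) > 0" using e by simp
    from tendsto_L2_Cauchy[OF uL f lim this] obtain K' where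
      K': "\<And>k n. k \<ge> K' \<Longrightarrow> n \<ge> K' \<Longrightarrow> norm_L2 M (\<lambda>x. u k x - u n x) < sqrt (e / (2 * (\<bar>\<kappa>\<bar> + 1)))"
      by blast
    have "cmod (Q (\<lambda>x. u k x - u n x) (\<lambda>x. u k x - u n x)) < e" if kn: "k \<ge> max K K'" "n \<ge> max K K'" for k n
    proof -
      define w where "w x = u k x - u n x" for x
      have "(norm_L2 M w)\<^sup>2 < (sqrt (e / (2 * (\<bar>\<kappa>\<bar> + 1))))\<^sup>2"
        unfolding w_def by (rule power_strict_mono) (use K'[of k n] kn in auto)
      then have "(norm_L2 M w)\<^sup>2 * (2 * (\<bar>\<kappa>\<bar> + 1)) < e"
        using e by (simp add: field_simps)
      moreover have "\<bar>\<kappa>\<bar> * (norm_L2 M w)\<^sup>2 * 2 \<le> (norm_L2 M w)\<^sup>2 * (2 * (\<bar>\<kappa>\<bar> + 1))"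
        by (simp add: algebra_simps)
      ultimately have "cmod (of_real \<kappa> * inner_L2 M w w) < e / 2"
        unfolding inner_L2_self norm_mult norm_of_real by simp
      moreover have "cmod (Q w w + of_real \<kappa> * inner_L2 M w w) < e / 2"
        using K[of k n] kn unfolding w_def by simp
      ultimately have "cmod (Q w w) < e"
        using norm_triangle_ineq4[of "Q w w + of_real \<kappa> * inner_L2 M w w" "of_real \<kappa> * inner_L2 M w w"] by simp
      then show ?thesis unfolding w_def .
    qed
    then show "\<exists>N. \<forall>k\<ge>N. \<forall>n\<ge>N. cmod (Q (\<lambda>x. u k x - u n x) (\<lambda>x. u k x - u n x)) < e" by blast
  qed
  then have fD: "f \<in> D" and q: "(\<lambda>n. Q (\<lambda>x. u n x - f x) (\<lambda>x. u n x - f x)) \<longlonglongrightarrow> 0" by auto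
  have "(\<lambda>n. of_real ((norm_L2 M (\<lambda>x. u n x - f x))\<^sup>2) :: complex) \<longlonglongrightarrow> of_real (0\<^sup>2)"
    using lim unfolding tendsto_L2_def by (intro tendsto_intros)
  from tendsto_add[OF q tendsto_mult[OF tendsto_const[of "of_real \<kappa>"] this]]
  show "f \<in> D \<and> (\<lambda>n. Q (\<lambda>x. u n x - f x) (\<lambda>x. u n x - f x)
      + of_real \<kappa> * inner_L2 M (\<lambda>x. u n x - f x) (\<lambda>x. u n x - f x)) \<longlonglongrightarrow> 0"
    using fD by (simp add: inner_L2_self)
qed

text \<open>Surjectivity of \<open>H + \<kappa>\<close>, phrased through the graph: the shifted form
  is coercive with constant \<open>\<kappa> + c\<close>, and representing \<open>f\<close> by it is
  the equation \<open>H u = f - \<kappa> u\<close>.\<close>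

lemma form_operator_resolvent:
  assumes low: "\<And>u. u \<in> D \<Longrightarrow> c * (norm_L2 M u)\<^sup>2 \<le> Re (Q u u)" and \<kappa>: "\<kappa> + c > 0"
    and cl: "form_closed M D Q" and f: "f \<in> L2 M"
  obtains u where "(u, \<lambda>x. f x - of_real \<kappa> * u x) \<in> form_operator M D Q"
proof -
  let ?B = "\<lambda>u v. Q u v + of_real \<kappa> * inner_L2 M u v"
  obtain u where u: "u \<in> D" "\<And>v. v \<in> D \<Longrightarrow> ?B u v = inner_L2 M f v"
  proof (rule hform.coercive_form_Riesz[OF hform_shift \<kappa> _ form_closed_shift[OF cl] f])
    fix u assume "u \<in> D"
    from low[OF this] show "(\<kappa> + c) * (norm_L2 M u)\<^sup>2 \<le> Re (?B u u)"
      by (simp add: inner_L2_self algebra_simps)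
  qed blast
  have uL: "u \<in> L2 M" by (rule D_L2[OF u(1)])
  have "(u, \<lambda>x. f x - of_real \<kappa> * u x) \<in> form_operator M D Q"
    unfolding form_operator_def
  proof (clarsimp simp: u(1), intro conjI ballI)
    show "(\<lambda>x. f x - of_real \<kappa> * u x) \<in> L2 M"
      using L2_lincomb[OF f uL, of 1 "- of_real \<kappa>"] by simp
    fix v assume v: "v \<in> D"
    show "Q u v = inner_L2 M (\<lambda>x. f x - of_real \<kappa> * u x) v"
    proof -
      have "Q u v = inner_L2 M f v - of_real \<kappa> * inner_L2 M u v"
        using u(2)[OF v] by (simp add: eq_diff_eq)
      then show ?thesis
        using inner_L2_lincomb_left[OF f uL D_L2[OF v], of 1 "- of_real \<kappa>"] by simp
    qed
  qed
  then show ?thesis by (rule that)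
qed

text \<open>This is what makes the relation \<open>form_operator\<close> single-valued: two values
  at the same \<open>u\<close> differ by a vector orthogonal to a dense set.\<close>

lemma dense_orthogonal:
  assumes dense: "dense_L2 M D" and f: "f \<in> L2 M" and orth: "\<And>v. v \<in> D \<Longrightarrow> inner_L2 M f v = 0"
  shows "AE x in M. f x = 0"
proof -
  have "norm_L2 M f \<le> e" if e: "e > 0" for e
  proof -
    obtain v where v: "v \<in> D" "norm_L2 M (\<lambda>x. f x - v x) < e"
      using dense f e unfolding dense_L2_def by blast
    have "of_real ((norm_L2 M f)\<^sup>2) = inner_L2 M f (\<lambda>x. f x - v x)"
      using inner_L2_diff_right[OF f f D_L2[OF v(1)]] orth[OF v(1)] by (simp add: inner_L2_self)
    then have "(norm_L2 M f)\<^sup>2 = cmod (inner_L2 M f (\<lambda>x. f x - v x))"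
      by (metis abs_of_nonneg norm_of_real zero_le_power2)
    also have "\<dots> \<le> norm_L2 M f * norm_L2 M (\<lambda>x. f x - v x)"
      by (rule cmod_inner_L2_le[OF f L2_diff[OF f D_L2[OF v(1)]]])
    also have "\<dots> \<le> norm_L2 M f * e" using v(2) by (intro mult_left_mono) auto
    finally have "norm_L2 M f * norm_L2 M f \<le> norm_L2 M f * e" by (simp add: power2_eq_square)
    then show ?thesis using e norm_L2_nonneg[of M f]
      by (metis less_eq_real_def mult_le_cancel_left_pos)
  qed
  then have "norm_L2 M f = 0"
    by (metis field_le_epsilon add_0 antisym norm_L2_nonneg)
  then show ?thesis using norm_L2_eq_0_iff[OF f] by simp
qed

section \<open>The operator associated with the form\<close>

lemma form_operator_AE_cong:
  assumes "(u, w) \<in> form_operator M D Q" "u' \<in> borel_measurable M" "w' \<in> borel_measurable M"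
    "AE x in M. u x = u' x" "AE x in M. w x = w' x"
  shows "(u', w') \<in> form_operator M D Q"
proof -
  have u: "u \<in> D" and w: "w \<in> L2 M" and q: "\<And>v. v \<in> D \<Longrightarrow> Q u v = inner_L2 M w v"
    using assms(1) by (auto simp: form_operator_def)
  have u': "u' \<in> D" by (rule D_cong_AE[OF u assms(2,4)])
  have w': "w' \<in> L2 M" by (rule L2_cong_AE[OF w assms(3,5)])
  have "Q u' v = inner_L2 M w' v" if v: "v \<in> D" for v
    using Q_cong_AE[OF u u' v assms(4)] q[OF v]
      inner_L2_cong_AE[OF L2_measurable[OF w] assms(3) L2_measurable[OF D_L2[OF v]] L2_measurable[OF D_L2[OF v]] assms(5)]
    by simp
  then show ?thesis using u' w' by (simp add: form_operator_def)
qed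

lemma linear_form_operator:
  assumes dense: "dense_L2 M D"
  shows "linear_operator M (form_operator M D Q)"
  unfolding linear_operator_def
proof (intro conjI)
  show "form_operator M D Q \<subseteq> L2 M \<times> L2 M" using D_L2 by (auto simp: form_operator_def)
  have "Q (\<lambda>_. 0) v = inner_L2 M (\<lambda>_. 0) v" if "v \<in> D" for v
    using Q_left[OF D_0 D_0 that, of 0 0] by (simp add: inner_L2_def)
  then show "((\<lambda>_. 0), (\<lambda>_. 0)) \<in> form_operator M D Q" by (simp add: form_operator_def D_0)
  show "\<forall>(u, w)\<in>form_operator M D Q. \<forall>(u', w')\<in>form_operator M D Q. \<forall>a b.
        ((\<lambda>x. a * u x + b * u' x), (\<lambda>x. a * w x + b * w' x)) \<in> form_operator M D Q"
    by (auto simp: form_operator_def intro!: D_lincomb L2_lincomb)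
       (simp add: Q_left inner_L2_lincomb_left D_L2)
  have main: "AE x in M. w x = w' x" if uw: "(u, w) \<in> form_operator M D Q" "(u', w') \<in> form_operator M D Q"
      and ae: "AE x in M. u x = u' x" for u w u' w'
  proof -
    have u: "u \<in> D" "u' \<in> D" and w: "w \<in> L2 M" "w' \<in> L2 M"
      and q: "\<And>v. v \<in> D \<Longrightarrow> Q u v = inner_L2 M w v" "\<And>v. v \<in> D \<Longrightarrow> Q u' v = inner_L2 M w' v"
      using uw by (auto simp: form_operator_def)
    have "AE x in M. w x - w' x = 0"
    proof (rule dense_orthogonal[OF dense L2_diff[OF w]])
      fix v assume v: "v \<in> D"
      show "inner_L2 M (\<lambda>x. w x - w' x) v = 0"
        using inner_L2_diff_left[OF w D_L2[OF v]] q(1)[OF v] q(2)[OF v] Q_cong_AE[OF u v ae] by simp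
    qed
    then show ?thesis by simp
  qed
  show "\<forall>(u, w)\<in>form_operator M D Q. \<forall>(u', w')\<in>form_operator M D Q.
      (AE x in M. u x = u' x) \<longrightarrow> (AE x in M. w x = w' x)"
    unfolding Ball_def split_paired_All case_prod_conv by (intro allI impI) (rule main)
  show "\<forall>(u, w)\<in>form_operator M D Q. \<forall>u'\<in>borel_measurable M. \<forall>w'\<in>borel_measurable M.
      (AE x in M. u x = u' x) \<longrightarrow> (AE x in M. w x = w' x) \<longrightarrow> (u', w') \<in> form_operator M D Q"
    using form_operator_AE_cong by blast
qed

text \<open>The elements \<open>n (H + n)\<inverse> g\<close> of the operator domain approximate \<open>g\<close> as \<open>n\<close> grows.\<close>

lemma form_operator_dense:
  assumes dense: "dense_L2 M D" and cl: "form_closed M D Q" and bb: "form_bounded_below M D Q"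
  shows "dense_L2 M (Domain (form_operator M D Q))"
  unfolding dense_L2_def
proof (intro ballI allI impI)
  fix f and e :: real assume f: "f \<in> L2 M" and e: "e > 0"
  obtain c where c: "\<And>u. u \<in> D \<Longrightarrow> c * (norm_L2 M u)\<^sup>2 \<le> Re (Q u u)"
    using bb unfolding form_bounded_below_def by blast
  \<comment> \<open>Chosen so that the shifted form \<open>B\<close> dominates the squared
    norm.\<close>
  define \<kappa> where "\<kappa> = \<bar>c\<bar> + 1"
  have \<kappa>: "\<kappa> + c \<ge> 1" by (simp add: \<kappa>_def)
  define B where "B u v = Q u v + of_real \<kappa> * inner_L2 M u v" for u v
  have hB: "hform M D B" unfolding B_def by (rule hform_shift)
  have Bge: "(norm_L2 M u)\<^sup>2 \<le> Re (B u u)" if "u \<in> D" for u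
  proof -
    have "1 * (norm_L2 M u)\<^sup>2 \<le> (\<kappa> + c) * (norm_L2 M u)\<^sup>2" by (intro mult_right_mono \<kappa>) simp
    also have "\<dots> \<le> Re (B u u)" using c[OF that] by (simp add: B_def inner_L2_self algebra_simps)
    finally show ?thesis by simp
  qed
  obtain g where g: "g \<in> D" "norm_L2 M (\<lambda>x. f x - g x) < e / 2"
    using dense f e unfolding dense_L2_def by (meson half_gt_zero)
  \<comment> \<open>A bound for \<open>n * (norm_L2 M w)\<^sup>2\<close> that does not depend on
    \<open>n\<close>. It remains after half of \<open>B w w\<close> and half of the squared norm of
    \<open>w\<close> have been absorbed on the left.\<close>
  define K where "K = (Re (B g g) + \<kappa>\<^sup>2 * (norm_L2 M g)\<^sup>2) / 2"
  obtain n :: nat where n: "K / (e / 2)\<^sup>2 < real n" "n > 0"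
    by (metis reals_Archimedean2 gr0I less_trans of_nat_0 of_nat_0_less_iff zero_less_Suc lessI of_nat_less_iff)
  define \<mu> where "\<mu> = \<kappa> + real n"
  have "\<mu> + c > 0" using \<kappa> by (simp add: \<mu>_def)
  from form_operator_resolvent[OF c this cl L2_scale[OF D_L2[OF g(1)], of "of_real \<mu>"]]
  obtain u where u: "(u, \<lambda>x. of_real \<mu> * g x - of_real \<mu> * u x) \<in> form_operator M D Q" by blast
  then have uD: "u \<in> D" by (simp add: form_operator_def)
  note L = D_L2[OF uD] D_L2[OF g(1)]
  define w where "w x = u x - g x" for x
  have wD: "w \<in> D" unfolding w_def by (rule D_diff[OF uD g(1)])
  have wL: "w \<in> L2 M" by (rule D_L2[OF wD])
  \<comment> \<open>The resolvent equation is tested against the error \<open>w\<close>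
    itself.\<close>
  have "Q u w = inner_L2 M (\<lambda>x. of_real \<mu> * g x - of_real \<mu> * u x) w"
    using u wD by (simp add: form_operator_def)
  also have "(\<lambda>x. of_real \<mu> * g x - of_real \<mu> * u x) = (\<lambda>x. (- of_real \<mu>) * w x + 0 * w x)"
    by (auto simp: w_def algebra_simps)
  also have "inner_L2 M \<dots> w = - of_real (\<mu> * (norm_L2 M w)\<^sup>2)"
    unfolding inner_L2_lincomb_left[OF wL wL wL] by (simp add: inner_L2_self)
  finally have Quw: "Q u w = - of_real (\<mu> * (norm_L2 M w)\<^sup>2)" .
  have "Q w w = Q u w - Q g w" unfolding w_def[abs_def] by (rule Q_diff_left[OF uD g(1)]) (use wD in \<open>simp add: w_def[abs_def]\<close>)
  then have "Re (Q w w) = - \<mu> * (norm_L2 M w)\<^sup>2 - Re (Q g w)" unfolding Quw by simp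
  then have eq: "Re (B w w) + real n * (norm_L2 M w)\<^sup>2 = - Re (B g w) + \<kappa> * Re (inner_L2 M g w)"
    unfolding B_def \<mu>_def by (simp add: inner_L2_self algebra_simps)
  have "(cmod (B g w))\<^sup>2 \<le> Re (B g g) * Re (B w w)"
    using hform.Cauchy_Schwarz[OF hB _ g(1) wD] Bge by (meson order_trans zero_le_power2)
  also have "\<dots> \<le> ((Re (B g g) + Re (B w w)) / 2)\<^sup>2"
    using zero_le_power2[of "Re (B g g) - Re (B w w)"] by (simp add: power2_eq_square field_simps)
  finally have "cmod (B g w) \<le> (Re (B g g) + Re (B w w)) / 2"
    by (rule power2_le_imp_le)
       (use order_trans[OF zero_le_power2 Bge[OF g(1)]] order_trans[OF zero_le_power2 Bge[OF wD]] in simp)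
  then have 1: "- Re (B g w) \<le> (Re (B g g) + Re (B w w)) / 2"
    using abs_Re_le_cmod[of "B g w"] by linarith
  have "\<kappa> * Re (inner_L2 M g w) \<le> \<kappa> * (norm_L2 M g * norm_L2 M w)"
    using cmod_inner_L2_le[OF L(2) wL] complex_Re_le_cmod[of "inner_L2 M g w"]
    by (intro mult_left_mono) (auto simp: \<kappa>_def)
  also have "\<dots> \<le> (\<kappa>\<^sup>2 * (norm_L2 M g)\<^sup>2 + (norm_L2 M w)\<^sup>2) / 2"
    using sum_squares_bound[of "\<kappa> * norm_L2 M g" "norm_L2 M w"] by (simp add: power_mult_distrib)
  finally have 2: "\<kappa> * Re (inner_L2 M g w) \<le> (\<kappa>\<^sup>2 * (norm_L2 M g)\<^sup>2 + (norm_L2 M w)\<^sup>2) / 2" .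
  have "real n * (norm_L2 M w)\<^sup>2 \<le> K"
    using eq 1 2 Bge[OF wD] unfolding K_def by (simp add: field_simps)
  also have "K < real n * (e / 2)\<^sup>2" using n e by (simp add: field_simps)
  finally have "(norm_L2 M w)\<^sup>2 < (e / 2)\<^sup>2" using n by simp
  then have "norm_L2 M w < e / 2" by (rule power2_less_imp_less) (use e in simp)
  then have "norm_L2 M (\<lambda>x. f x - u x) < e"
    using norm_L2_triangle[OF f L(2) L(1)] g(2) norm_L2_diff_commute[of M g u] by (simp add: w_def[abs_def])
  then show "\<exists>u\<in>Domain (form_operator M D Q). norm_L2 M (\<lambda>x. f x - u x) < e"
    using u by (intro bexI[of _ u]) auto
qed

lemma form_operator_symmetric:
  assumes "(u, z) \<in> form_operator M D Q" "(v, w) \<in> form_operator M D Q"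
  shows "inner_L2 M z v = inner_L2 M u w"
proof -
  have "inner_L2 M z v = Q u v" "cnj (inner_L2 M w u) = cnj (Q v u)" "u \<in> D" "v \<in> D"
    using assms by (auto simp: form_operator_def)
  then show ?thesis using Q_cnj[of v u] inner_L2_cnj[of M u w] by simp
qed

text \<open>Injectivity of \<open>H + \<kappa>\<close>: the lower bound, applied to the difference
  of the two solutions, leaves \<open>\<kappa> + c\<close> times its squared norm
  non-positive.\<close>

lemma form_operator_resolvent_unique:
  assumes low: "\<And>u. u \<in> D \<Longrightarrow> c * (norm_L2 M u)\<^sup>2 \<le> Re (Q u u)" and \<kappa>: "\<kappa> + c > 0"
    and u: "(u, w) \<in> form_operator M D Q" and u': "(u', w') \<in> form_operator M D Q"
    and ae: "AE x in M. w x + of_real \<kappa> * u x = w' x + of_real \<kappa> * u' x"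
  shows "AE x in M. u x = u' x"
proof -
  have D: "u \<in> D" "u' \<in> D" and w: "w \<in> L2 M" "w' \<in> L2 M"
    and q: "\<And>v. v \<in> D \<Longrightarrow> Q u v = inner_L2 M w v" "\<And>v. v \<in> D \<Longrightarrow> Q u' v = inner_L2 M w' v"
    using u u' by (auto simp: form_operator_def)
  define d where "d x = u x - u' x" for x
  have dD: "d \<in> D" unfolding d_def by (rule D_diff[OF D])
  note dL = D_L2[OF dD]
  have "Q d d = Q u d - Q u' d" using Q_diff_left[OF D dD] by (simp add: d_def[abs_def])
  also have "\<dots> = inner_L2 M (\<lambda>x. w x - w' x) d"
    using inner_L2_diff_left[OF w dL] q dD by simp
  also have "\<dots> = inner_L2 M (\<lambda>x. (- of_real \<kappa>) * d x + 0 * d x) d"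
  proof (rule inner_L2_cong_AE)
    show "AE x in M. w x - w' x = (- of_real \<kappa>) * d x + 0 * d x"
      using ae by eventually_elim (simp add: d_def algebra_simps)
  qed (use L2_measurable[OF L2_diff[OF w]] L2_measurable[OF dL] in auto)
  also have "\<dots> = - of_real (\<kappa> * (norm_L2 M d)\<^sup>2)"
    unfolding inner_L2_lincomb_left[OF dL dL dL] by (simp add: inner_L2_self)
  finally have "c * (norm_L2 M d)\<^sup>2 \<le> - (\<kappa> * (norm_L2 M d)\<^sup>2)" using low[OF dD] by simp
  then have "(\<kappa> + c) * (norm_L2 M d)\<^sup>2 \<le> 0" by (simp add: algebra_simps)
  then have "norm_L2 M d = 0" using \<kappa> by (simp add: mult_le_0_iff)
  then have "AE x in M. d x = 0" using norm_L2_eq_0_iff[OF dL] by simp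
  then show ?thesis by eventually_elim (simp add: d_def)
qed

text \<open>A symmetric \<open>H\<close> is self-adjoint as soon as \<open>H + \<kappa>\<close> is
  onto for one real \<open>\<kappa>\<close>. For \<open>(v, w)\<close> in the adjoint, solve
  \<open>(H + \<kappa>) u = w + \<kappa> v\<close>; then \<open>h = v - u\<close> is orthogonal to
  the range of \<open>H + \<kappa>\<close>, which is everything, so \<open>v\<close> equals
  \<open>u\<close> a.e. and lies in the domain.\<close>

theorem form_operator_self_adjoint:
  assumes dense: "dense_L2 M D" and cl: "form_closed M D Q" and bb: "form_bounded_below M D Q"
  shows "self_adjoint M (form_operator M D Q)" "op_bounded_below M (form_operator M D Q)"
proof -
  let ?H = "form_operator M D Q"
  obtain c where c: "\<And>u. u \<in> D \<Longrightarrow> c * (norm_L2 M u)\<^sup>2 \<le> Re (Q u u)"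
    using bb unfolding form_bounded_below_def by blast
  define \<kappa> where "\<kappa> = \<bar>c\<bar> + 1"
  have \<kappa>: "\<kappa> + c > 0" by (simp add: \<kappa>_def)
  have "adjoint_op M ?H = ?H"
  proof (intro equalityI subrelI)
    fix v w assume "(v, w) \<in> ?H"
    then show "(v, w) \<in> adjoint_op M ?H"
      using form_operator_symmetric[of _ _ v w] D_L2 by (auto simp: adjoint_op_def form_operator_def)
  next
    fix v w assume "(v, w) \<in> adjoint_op M ?H"
    then have v: "v \<in> L2 M" and w: "w \<in> L2 M"
      and adj: "\<And>u z. (u, z) \<in> ?H \<Longrightarrow> inner_L2 M z v = inner_L2 M u w"
      by (auto simp: adjoint_op_def)
    define g where "g x = w x + of_real \<kappa> * v x" for x
    have g: "g \<in> L2 M" unfolding g_def using L2_lincomb[OF w v, of 1] by simp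
    obtain u where u: "(u, \<lambda>x. g x - of_real \<kappa> * u x) \<in> ?H"
      using form_operator_resolvent[OF c \<kappa> cl g] by blast
    define w' where "w' x = g x - of_real \<kappa> * u x" for x
    have uL: "u \<in> L2 M" and w'L: "w' \<in> L2 M"
      using u D_L2 by (auto simp: form_operator_def w'_def[abs_def])
    define h where "h x = v x - u x" for x
    have h: "h \<in> L2 M" unfolding h_def by (rule L2_diff[OF v uL])
    \<comment> \<open>Writing \<open>h\<close> itself as \<open>(H + \<kappa>) y\<close> turns the
      orthogonality into \<open>inner_L2 M h h = 0\<close>.\<close>
    obtain y where y: "(y, \<lambda>x. h x - of_real \<kappa> * y x) \<in> ?H"
      using form_operator_resolvent[OF c \<kappa> cl h] by blast
    define z where "z x = h x - of_real \<kappa> * y x" for x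
    have yL: "y \<in> L2 M" and zL: "z \<in> L2 M"
      using y D_L2 by (auto simp: form_operator_def z_def[abs_def])
    have 1: "inner_L2 M z v = inner_L2 M y w" using adj y by (simp add: z_def[abs_def])
    have 2: "inner_L2 M z u = inner_L2 M y w'"
      using form_operator_symmetric[OF y u] by (simp add: z_def[abs_def] w'_def[abs_def])
    have "h = (\<lambda>x. 1 * z x + of_real \<kappa> * y x)" by (auto simp: z_def)
    then have "inner_L2 M h h = inner_L2 M z h + of_real \<kappa> * inner_L2 M y h"
      using inner_L2_lincomb_left[OF zL yL h, of 1 "of_real \<kappa>"] by simp
    also have "\<dots> = (inner_L2 M y w - inner_L2 M y w') + of_real \<kappa> * inner_L2 M y h"
      unfolding h_def[abs_def] inner_L2_diff_right[OF zL v uL] 1 2 ..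
    also have "inner_L2 M y w - inner_L2 M y w' = inner_L2 M y (\<lambda>x. w x - w' x)"
      by (rule inner_L2_diff_right[OF yL w w'L, symmetric])
    also have "(\<lambda>x. w x - w' x) = (\<lambda>x. (- of_real \<kappa>) * h x + 0 * h x)"
      by (auto simp: w'_def g_def h_def algebra_simps)
    also have "inner_L2 M y \<dots> = - of_real \<kappa> * inner_L2 M y h"
      unfolding inner_L2_lincomb_right[OF yL h h] by simp
    finally have "norm_L2 M h = 0" by (simp add: inner_L2_self)
    then have "AE x in M. h x = 0" using norm_L2_eq_0_iff[OF h] by simp
    then have ae: "AE x in M. u x = v x" by eventually_elim (simp add: h_def)
    then have "AE x in M. g x - of_real \<kappa> * u x = w x"
      by eventually_elim (simp add: g_def)
    with u ae show "(v, w) \<in> ?H"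
      using form_operator_AE_cong L2_measurable[OF v] L2_measurable[OF w] by blast
  qed
  then show "self_adjoint M ?H"
    unfolding self_adjoint_def using linear_form_operator[OF dense] form_operator_dense[OF assms] by simp
  show "op_bounded_below M ?H"
    unfolding op_bounded_below_def
  proof (intro exI[of _ c], clarify)
    fix u w assume "(u, w) \<in> ?H"
    then have "u \<in> D" "Q u u = inner_L2 M w u" by (auto simp: form_operator_def)
    then show "c * (norm_L2 M u)\<^sup>2 \<le> Re (inner_L2 M w u)" using c[of u] by simp
  qed
qed

end

section \<open>Arithmetic of the p-adic numbers\<close>

lemma tendsto_padic_abs_norm:
  "padic_cauchy CARD('a) X \<Longrightarrow>
    (\<lambda>n. padic_abs CARD('a) (X n)) \<longlonglongrightarrow> norm_padic (padic_of_seq X :: 'a::prime_card padic)"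
  using norm_padic_lim[where 'a = 'a, of X] padic_rel_refl[of _ X] norm_padic.abs_eq[where 'a = 'a, of X] by simp

lemma padic_of_seq_exhaust:
  obtains X where "padic_cauchy CARD('a) X" "x = (padic_of_seq X :: 'a::prime_card padic)"
  using seq_of_padic[of x] by metis

lemma norm_padic_nonneg [simp]: "norm_padic (x :: 'a::prime_card padic) \<ge> 0"
proof -
  obtain X where X: "padic_cauchy CARD('a) X" "x = padic_of_seq X" by (rule padic_of_seq_exhaust)
  show ?thesis unfolding X(2)
    by (rule LIMSEQ_le_const[OF tendsto_padic_abs_norm[OF X(1)]]) auto
qed

lemma norm_padic_0 [simp]: "norm_padic (0 :: 'a::prime_card padic) = 0"
  by (simp add: norm_padic_eq_0)

lemma norm_padic_pos: "x \<noteq> 0 \<Longrightarrow> norm_padic (x :: 'a::prime_card padic) > 0"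
  using norm_padic_nonneg[of x] norm_padic_eq_0[of x] by linarith

lemma norm_padic_mult: "norm_padic (x * y :: 'a::prime_card padic) = norm_padic x * norm_padic y"
proof -
  obtain X where X: "padic_cauchy CARD('a) X" "x = padic_of_seq X" by (rule padic_of_seq_exhaust)
  obtain Y where Y: "padic_cauchy CARD('a) Y" "y = padic_of_seq Y" by (rule padic_of_seq_exhaust)
  have xy: "x * y = padic_of_seq (\<lambda>n. X n * Y n)"
    unfolding X(2) Y(2) by (intro times_padic.abs_eq padic_rel_refl X(1) Y(1))
  have "(\<lambda>n. padic_abs CARD('a) (X n * Y n)) \<longlonglongrightarrow> norm_padic x * norm_padic y"
    unfolding padic_abs_mult[OF prime_card] X(2) Y(2)
    by (intro tendsto_mult tendsto_padic_abs_norm X(1) Y(1))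
  moreover have "(\<lambda>n. padic_abs CARD('a) (X n * Y n)) \<longlonglongrightarrow> norm_padic (x * y)"
    unfolding xy by (intro tendsto_padic_abs_norm padic_cauchy_mult prime_card X(1) Y(1))
  ultimately show ?thesis by (rule LIMSEQ_unique[symmetric])
qed

lemma norm_padic_ultra: "norm_padic (x + y :: 'a::prime_card padic) \<le> max (norm_padic x) (norm_padic y)"
proof -
  obtain X where X: "padic_cauchy CARD('a) X" "x = padic_of_seq X" by (rule padic_of_seq_exhaust)
  obtain Y where Y: "padic_cauchy CARD('a) Y" "y = padic_of_seq Y" by (rule padic_of_seq_exhaust)
  have xy: "x + y = padic_of_seq (\<lambda>n. X n + Y n)"
    unfolding X(2) Y(2) by (intro plus_padic.abs_eq padic_rel_refl X(1) Y(1))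
  have 1: "(\<lambda>n. max (padic_abs CARD('a) (X n)) (padic_abs CARD('a) (Y n)))
      \<longlonglongrightarrow> max (norm_padic x) (norm_padic y)"
    unfolding X(2) Y(2) by (intro tendsto_max tendsto_padic_abs_norm X(1) Y(1))
  have 2: "(\<lambda>n. padic_abs CARD('a) (X n + Y n)) \<longlonglongrightarrow> norm_padic (x + y)"
    unfolding xy by (intro tendsto_padic_abs_norm padic_cauchy_add prime_card X(1) Y(1))
  show ?thesis
    by (rule LIMSEQ_le[OF 2 1]) (use padic_abs_add[OF prime_card] in blast)
qed

lemma norm_padic_diff_ultra: "norm_padic (x - y :: 'a::prime_card padic) \<le> max (norm_padic x) (norm_padic y)"
  using norm_padic_ultra[of x "- y"] by (simp add: norm_padic_minus)

lemma norm_padic_minus_commute: "norm_padic (x - y :: 'a::prime_card padic) = norm_padic (y - x)"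
  using norm_padic_minus[of "x - y"] by simp

text \<open>A late term of a representing Cauchy sequence is the approximation; \<open>e / 2\<close>
  is used because limits preserve only weak inequalities.\<close>

lemma norm_padic_of_rat_approx:
  assumes e: "e > 0"
  obtains r where "norm_padic (x - of_rat r :: 'a::prime_card padic) < e"
proof -
  obtain X where X: "padic_cauchy CARD('a) X" "x = padic_of_seq X" by (rule padic_of_seq_exhaust)
  have "e / 2 > 0" using e by simp
  then obtain N where N: "\<forall>m\<ge>N. \<forall>n\<ge>N. padic_abs CARD('a) (X m - X n) < e / 2"
    using X(1) unfolding padic_cauchy_def by blast
  have "- of_rat (X N) = (padic_of_seq (\<lambda>_. - X N) :: 'a padic)"
    unfolding of_rat_padic by (intro uminus_padic.abs_eq padic_rel_refl padic_cauchy_const)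
  then have eq: "x - of_rat (X N) = padic_of_seq (\<lambda>n. X n + - X N)"
    unfolding diff_conv_add_uminus X(2) by (simp only:) (intro plus_padic.abs_eq padic_rel_refl padic_cauchy_const X(1))
  have c: "padic_cauchy CARD('a) (\<lambda>n. X n + - X N)"
    by (intro padic_cauchy_add prime_card X(1) padic_cauchy_const)
  have "norm_padic (x - of_rat (X N)) \<le> e / 2"
    unfolding eq by (rule LIMSEQ_le_const2[OF tendsto_padic_abs_norm[OF c]])
      (use N less_imp_le in \<open>auto intro!: exI[of _ N]\<close>)
  then show ?thesis using e by (intro that[of "X N"]) simp
qed

section \<open>The value group\<close>

lemma CARD_gt_1: "real CARD('a::prime_card) > 1"
  using prime_gt_1_nat[OF prime_card[where 'a = 'a]] by simp

lemma padic_abs_powi: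
  assumes "r \<noteq> 0" obtains k where "padic_abs p r = real p powi k"
  using assms that unfolding padic_abs_def by metis

text \<open>If \<open>r\<close> is closer to \<open>x\<close> than 0 is, the ultrametric inequality
  forces equal norms, and nonzero rationals have powers of \<open>p\<close> as absolute
  values.\<close>

lemma norm_padic_powi:
  assumes x: "x \<noteq> 0"
  obtains k where "norm_padic (x :: 'a::prime_card padic) = real CARD('a) powi k"
proof -
  obtain r where r: "norm_padic (x - of_rat r) < norm_padic x"
    using norm_padic_of_rat_approx[OF norm_padic_pos[OF x]] by blast
  have "norm_padic x \<le> max (norm_padic (x - of_rat r)) (norm_padic (of_rat r :: 'a padic))"
    using norm_padic_ultra[of "x - of_rat r" "of_rat r"] by simp
  moreover have "norm_padic (of_rat r :: 'a padic) \<le> max (norm_padic x) (norm_padic (x - of_rat r))"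
    using norm_padic_diff_ultra[of x "x - of_rat r"] by simp
  ultimately have eq: "norm_padic x = norm_padic (of_rat r :: 'a padic)" using r by (auto simp: max_def split: if_splits)
  then have "padic_abs CARD('a) r \<noteq> 0" using norm_padic_pos[OF x] by (simp add: norm_of_rat_padic)
  then have "r \<noteq> 0" by auto
  then show ?thesis using that eq unfolding norm_of_rat_padic by (metis padic_abs_powi)
qed

lemma powi_less_iff: "real CARD('a::prime_card) powi j < real CARD('a) powi k \<longleftrightarrow> j < k"
  using power_int_strict_increasing[OF _ CARD_gt_1[where 'a = 'a], of j k]
    power_int_increasing[OF _ less_imp_le[OF CARD_gt_1[where 'a = 'a]], of k j] by linarith

lemma powi_le_iff: "real CARD('a::prime_card) powi j \<le> real CARD('a) powi k \<longleftrightarrow> j \<le> k"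
  using powi_less_iff[where 'a = 'a, of k j] by linarith

lemma powi_pos [simp]: "real CARD('a::prime_card) powi k > 0"
  using CARD_gt_1[where 'a = 'a] by simp

text \<open>The norm takes no value strictly between \<open>p^k\<close> and \<open>p^(k+1)\<close>;
  this discreteness settles the off-by-one steps with balls and spheres.\<close>

lemma norm_padic_less_powi_iff:
  "norm_padic (x :: 'a::prime_card padic) < real CARD('a) powi (k + 1) \<longleftrightarrow> norm_padic x \<le> real CARD('a) powi k"
proof (cases "x = 0")
  case False
  then obtain j where "norm_padic x = real CARD('a) powi j" by (rule norm_padic_powi)
  then show ?thesis by (simp only: powi_le_iff powi_less_iff) auto
qed simp

lemma powi_arbitrarily_small:
  assumes "e > 0" obtains n :: nat where "real CARD('a::prime_card) powi (- int n) < e"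
proof -
  obtain n where "(1 / real CARD('a)) ^ n < e"
    using real_arch_pow_inv[OF assms, of "1 / real CARD('a)"] CARD_gt_1[where 'a = 'a] by auto
  then show ?thesis by (intro that[of n]) (simp add: power_int_minus power_inverse divide_inverse)
qed

lemma powi_arbitrarily_large:
  obtains n :: nat where "C < real CARD('a::prime_card) powi (int n)"
  using real_arch_pow[OF CARD_gt_1[where 'a = 'a], of C] that by auto

text \<open>The intersection of \<open>\<int>[1/p]\<close> with the p-adic integers is
  \<open>\<int>\<close>: the bound on the absolute value means that the numerator absorbs the whole
  power of \<open>p\<close>.\<close>

lemma of_rat_in_padic_ints_int:
  assumes "of_nat CARD('a::prime_card) ^ k * t \<in> \<int>" and "padic_abs CARD('a) t \<le> 1"
  shows "t \<in> \<int>"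
proof (cases "t = 0")
  case False
  let ?p = "CARD('a)"
  have p: "prime ?p" by (rule prime_card)
  obtain n :: int where n: "of_nat ?p ^ k * t = of_int n" using assms(1) by (auto elim: Ints_cases)
  have p0: "(of_nat ?p :: rat) \<noteq> 0" using prime_gt_0_nat[OF p] by simp
  have t: "t = of_int n / of_int (int ?p ^ k)" using n p0 by (simp add: field_simps)
  have n0: "n \<noteq> 0" using False t by auto
  have "int ?p ^ k \<noteq> 0" using prime_gt_0_nat[OF p] by simp
  then have abs: "padic_abs ?p t = real ?p powi (int (multiplicity (int ?p) (int ?p ^ k)) - int (multiplicity (int ?p) n))"
    unfolding t by (intro padic_abs_divide[OF p n0])
  have pe: "prime_elem (int ?p)" using p by (simp add: prime_nat_int_transfer)
  have "multiplicity (int ?p) (int ?p ^ k) = k" using pe by (simp add: prime_elem_not_unit)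
  with abs assms(2) have "real ?p powi (int k - int (multiplicity (int ?p) n)) \<le> real ?p powi 0" by simp
  then have "k \<le> multiplicity (int ?p) n" unfolding powi_le_iff by simp
  then have "int ?p ^ k dvd n" by (rule multiplicity_dvd')
  then obtain d where "n = int ?p ^ k * d" by (auto elim: dvdE)
  then have "t = of_int d" using t p0 by simp
  then show ?thesis by simp
qed simp

text \<open>The p-part of a partial fraction decomposition of \<open>r\<close>: with
  \<open>b = p^k b'\<close>, invert \<open>b'\<close> modulo \<open>p^k\<close>; what remains has
  the denominator \<open>b'\<close>, a p-adic unit.\<close>

lemma rat_padic_fraction:
  obtains s :: rat where "0 \<le> s" "s < 1" "\<exists>k. of_nat CARD('a::prime_card) ^ k * s \<in> \<int>" "padic_abs CARD('a) (r - s) \<le> 1"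
proof -
  let ?p = "CARD('a)"
  have p: "prime ?p" by (rule prime_card)
  have p0: "?p > 0" by (rule prime_gt_0_nat[OF p])
  obtain a b where r: "r = of_int a / of_int b" "b \<noteq> 0" by (rule rat_as_quotient)
  have pe: "prime_elem (int ?p)" using p by (simp add: prime_nat_int_transfer)
  then have nu: "\<not> is_unit (int ?p)" by (rule prime_elem_not_unit)
  define k where "k = multiplicity (int ?p) b"
  obtain b' where b': "b = int ?p ^ k * b'" "\<not> int ?p dvd b'"
    unfolding k_def using multiplicity_decompose'[OF r(2) nu] by blast
  have "coprime b' (int ?p ^ k)"
    using b'(2) pe by (metis coprime_commute coprime_power_left_iff prime_card_int prime_imp_coprime)
  then obtain x where x: "[b' * x = 1] (mod int ?p ^ k)" using cong_solve_coprime_int by blast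
  define c where "c = (a * x) mod int ?p ^ k"
  have pk: "int ?p ^ k > 0" using p0 by simp
  have c: "0 \<le> c" "c < int ?p ^ k" using pk by (auto simp: c_def)
  have "[c * b' = a * x * b'] (mod int ?p ^ k)" unfolding c_def by (intro cong_mult cong_refl cong_mod_left) simp
  also have "[a * x * b' = a * (b' * x)] (mod int ?p ^ k)" by (simp add: mult_ac)
  also have "[a * (b' * x) = a * 1] (mod int ?p ^ k)" by (intro cong_mult cong_refl x)
  finally have "int ?p ^ k dvd a - c * b'" by (simp add: cong_iff_dvd_diff dvd_diff_commute)
  then obtain d where d: "a - c * b' = int ?p ^ k * d" by (auto elim: dvdE)
  define s :: rat where "s = of_int c / of_nat ?p ^ k"
  have pr0: "(of_nat ?p :: rat) \<noteq> 0" using p0 by simp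
  have prk: "(of_nat ?p :: rat) ^ k = of_int (int ?p ^ k)" by simp
  have b'0: "b' \<noteq> 0" using b'(2) by auto
  have "r - s = of_int (a - c * b') / of_int (int ?p ^ k * b')"
    using pr0 b'0 unfolding r s_def b'(1) by (simp add: field_simps)
  also have "\<dots> = of_int d / of_int b'" using pr0 unfolding d by simp
  finally have rs: "r - s = of_int d / of_int b'" .
  show ?thesis
  proof (rule that[of s])
    show "0 \<le> s" using c by (simp add: s_def)
    have "(of_int c :: rat) < of_int (int ?p ^ k)" using c by (simp only: of_int_less_iff)
    then show "s < 1" using p0 by (simp add: s_def)
    show "\<exists>k. of_nat CARD('a) ^ k * s \<in> \<int>" by (intro exI[of _ k]) (use pr0 in \<open>simp add: s_def\<close>)
    show "padic_abs CARD('a) (r - s) \<le> 1"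
    proof (cases "d = 0")
      case False
      have "multiplicity (int ?p) b' = 0" using b'(2) by (rule not_dvd_imp_multiplicity_0)
      then have "padic_abs ?p (r - s) = real ?p powi (- int (multiplicity (int ?p) d))"
        unfolding rs padic_abs_divide[OF p False b'0] by simp
      also have "\<dots> \<le> real ?p powi 0" unfolding powi_le_iff by simp
      finally show ?thesis by simp
    qed (simp add: rs)
  qed
qed

lemma padic_fraction_diff_int:
  assumes "\<exists>k. of_nat CARD('a::prime_card) ^ k * r \<in> \<int>" "\<exists>k. of_nat CARD('a) ^ k * s \<in> \<int>"
    and "(x :: 'a padic) - of_rat r \<in> padic_ints" "x - of_rat s \<in> padic_ints"
  shows "r - s \<in> \<int>"
proof -
  obtain j k where jk: "of_nat CARD('a) ^ j * r \<in> \<int>" "of_nat CARD('a) ^ k * s \<in> \<int>" using assms by blast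
  have "of_nat CARD('a) ^ (j + k) * (r - s)
      = of_nat CARD('a) ^ k * (of_nat CARD('a) ^ j * r) - of_nat CARD('a) ^ j * (of_nat CARD('a) ^ k * s)"
    by (simp add: power_add algebra_simps)
  also have "\<dots> \<in> \<int>" by (intro Ints_diff Ints_mult[OF _ jk(1)] Ints_mult[OF _ jk(2)] Ints_power Ints_of_nat)
  finally have 1: "of_nat CARD('a) ^ (j + k) * (r - s) \<in> \<int>" .
  have "norm_padic (of_rat (r - s) :: 'a padic) \<le> max (norm_padic (x - of_rat s)) (norm_padic (x - of_rat r))"
    using norm_padic_diff_ultra[of "x - of_rat s" "x - of_rat r"] by (simp add: of_rat_diff)
  also have "\<dots> \<le> 1" using assms(3,4) by (simp add: padic_ints_def)
  finally have "padic_abs CARD('a) (r - s) \<le> 1" by (simp add: norm_of_rat_padic)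
  with 1 show ?thesis by (rule of_rat_in_padic_ints_int)
qed

text \<open>Justifies the definite description in \<open>padic_frac\<close>. Existence comes from a
  rational approximation and its p-part; two solutions differ by an integer of absolute value below
  1.\<close>

lemma padic_frac_ex1:
  "\<exists>!r. 0 \<le> r \<and> r < 1 \<and> (\<exists>k. of_nat CARD('a) ^ k * r \<in> \<int>) \<and> (x :: 'a::prime_card padic) - of_rat r \<in> padic_ints"
proof (rule ex_ex1I)
  obtain r where r: "norm_padic (x - of_rat r) < 1" by (rule norm_padic_of_rat_approx[OF zero_less_one])
  obtain s where s: "0 \<le> s" "s < 1" "\<exists>k. of_nat CARD('a) ^ k * s \<in> \<int>" "padic_abs CARD('a) (r - s) \<le> 1"
    by (rule rat_padic_fraction)
  have "norm_padic (x - of_rat s) \<le> max (norm_padic (x - of_rat r)) (norm_padic (of_rat (r - s) :: 'a padic))"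
    using norm_padic_ultra[of "x - of_rat r" "of_rat (r - s)"] by (simp add: of_rat_diff)
  also have "\<dots> \<le> 1" using r s(4) by (simp add: norm_of_rat_padic)
  finally show "\<exists>r. 0 \<le> r \<and> r < 1 \<and> (\<exists>k. of_nat CARD('a) ^ k * r \<in> \<int>) \<and> x - of_rat r \<in> padic_ints"
    using s by (auto simp: padic_ints_def)
next
  fix r s
  assume r: "0 \<le> r \<and> r < 1 \<and> (\<exists>k. of_nat CARD('a) ^ k * r \<in> \<int>) \<and> x - of_rat r \<in> padic_ints"
    and s: "0 \<le> s \<and> s < 1 \<and> (\<exists>k. of_nat CARD('a) ^ k * s \<in> \<int>) \<and> x - of_rat s \<in> padic_ints"
  have "r - s \<in> \<int>" using r s by (intro padic_fraction_diff_int[where x = x]) auto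
  then obtain d where "r - s = of_int d" by (auto elim: Ints_cases)
  moreover have "\<bar>r - s\<bar> < 1" using r s by (simp add: abs_less_iff)
  ultimately have "d = 0" by (metis of_int_abs of_int_less_1_iff zabs_less_one_iff)
  then show "r = s" using \<open>r - s = of_int d\<close> by simp
qed

section \<open>The standard additive character\<close>

lemma padic_frac:
  fixes x :: "'a::prime_card padic"
  shows "0 \<le> padic_frac x" "padic_frac x < 1" "\<exists>k. of_nat CARD('a) ^ k * padic_frac x \<in> \<int>"
    "x - of_rat (padic_frac x) \<in> padic_ints"
  using theI'[OF padic_frac_ex1[of x]] unfolding padic_frac_def[symmetric] by auto

text \<open>The value may be computed from any representative in \<open>\<int>[1/p]\<close>, not
  only from the one in \<open>[0,1)\<close>. Additivity rests on this, since the sum of two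
  fractional parts may leave the interval.\<close>

lemma padic_char_eq:
  fixes x :: "'a::prime_card padic"
  assumes "\<exists>k. of_nat CARD('a) ^ k * r \<in> \<int>" and "x - of_rat r \<in> padic_ints"
  shows "padic_char x = cis (2 * pi * of_rat r)"
proof -
  have "r - padic_frac x \<in> \<int>"
    by (rule padic_fraction_diff_int[OF assms(1) padic_frac(3) assms(2) padic_frac(4)])
  then obtain n where "r = padic_frac x + of_int n" by (auto elim!: Ints_cases simp: algebra_simps)
  then have "2 * pi * of_rat r = 2 * pi * of_rat (padic_frac x) + 2 * pi * of_int n"
    by (simp add: of_rat_add distrib_left)
  then have "cis (2 * pi * of_rat r) = padic_char x * cis (2 * pi * of_int n)"
    by (simp add: padic_char_def cis_mult[symmetric])
  then show ?thesis by (simp add: cis_multiple_2pi)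
qed

lemma padic_ints_add: "x \<in> padic_ints \<Longrightarrow> y \<in> padic_ints \<Longrightarrow> x + y \<in> padic_ints"
  using norm_padic_ultra[of x y] by (auto simp: padic_ints_def)

lemma padic_char_add: "padic_char (x + y :: 'a::prime_card padic) = padic_char x * padic_char y"
proof -
  obtain j k where jk: "of_nat CARD('a) ^ j * padic_frac x \<in> \<int>" "of_nat CARD('a) ^ k * padic_frac y \<in> \<int>"
    using padic_frac(3)[of x] padic_frac(3)[of y] by blast
  have "of_nat CARD('a) ^ (j + k) * (padic_frac x + padic_frac y)
      = of_nat CARD('a) ^ k * (of_nat CARD('a) ^ j * padic_frac x) + of_nat CARD('a) ^ j * (of_nat CARD('a) ^ k * padic_frac y)"
    by (simp add: power_add algebra_simps)
  also have "\<dots> \<in> \<int>" by (intro Ints_add Ints_mult[OF _ jk(1)] Ints_mult[OF _ jk(2)] Ints_power Ints_of_nat)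
  finally have 1: "\<exists>i. of_nat CARD('a) ^ i * (padic_frac x + padic_frac y) \<in> \<int>" by blast
  have eq: "x + y - of_rat (padic_frac x + padic_frac y) = (x - of_rat (padic_frac x)) + (y - of_rat (padic_frac y))"
    by (simp add: of_rat_add)
  have "x + y - of_rat (padic_frac x + padic_frac y) \<in> padic_ints"
    unfolding eq by (intro padic_ints_add padic_frac(4))
  from padic_char_eq[OF 1 this] show ?thesis
    by (simp add: padic_char_def cis_mult of_rat_add distrib_left)
qed

lemma padic_char_int: "x \<in> padic_ints \<Longrightarrow> padic_char (x :: 'a::prime_card padic) = 1"
  using padic_char_eq[of 0 x] by simp

lemma padic_char_0 [simp]: "padic_char (0 :: 'a::prime_card padic) = 1"
  by (rule padic_char_int) (simp add: padic_ints_def)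

lemma norm_padic_char [simp]: "cmod (padic_char x) = 1"
  by (simp add: padic_char_def)

lemma padic_char_minus: "padic_char (- x :: 'a::prime_card padic) = cnj (padic_char x)"
proof -
  have "padic_char (- x) * padic_char x = 1" using padic_char_add[of "- x" x] by simp
  moreover have "cnj (padic_char x) * padic_char x = 1"
    using complex_norm_square[of "padic_char x"] by (simp add: mult.commute)
  ultimately show ?thesis
    by (metis mult_cancel_right mult_zero_left zero_neq_one mult_not_zero)
qed

lemma padic_char_diff: "padic_char (x - y :: 'a::prime_card padic) = padic_char x * cnj (padic_char y)"
  using padic_char_add[of x "- y"] by (simp add: padic_char_minus)

lemma norm_of_nat_card: "norm_padic (of_nat CARD('a) :: 'a::prime_card padic) = 1 / real CARD('a)"
proof -
  let ?p = "CARD('a)"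
  have pe: "prime_elem (int ?p)" using prime_card[where 'a = 'a] by (simp add: prime_nat_int_transfer)
  have "int ?p \<noteq> 0" using prime_gt_0_nat[OF prime_card[where 'a = 'a]] by simp
  from padic_abs_divide[OF prime_card[where 'a = 'a] this one_neq_zero]
  have "padic_abs ?p (of_nat ?p) = real ?p powi (- 1)"
    using pe by (simp add: prime_elem_not_unit)
  then have "norm_padic (of_rat (of_nat ?p) :: 'a padic) = real ?p powi (- 1)"
    by (simp del: of_rat_of_nat_eq add: norm_of_rat_padic)
  then show ?thesis by (simp add: power_int_minus divide_inverse)
qed

lemma norm_padic_powi_card: "norm_padic ((of_nat CARD('a) :: 'a::prime_card padic) powi k) = real CARD('a) powi (- k)"
proof -
  have pw: "norm_padic (x ^ n :: 'a padic) = norm_padic x ^ n" for x n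
  proof (induction n)
    case 0
    show ?case using norm_of_rat_padic[of 1, where 'p = 'a] by simp
  qed (simp add: norm_padic_mult)
  have n0: "(of_nat CARD('a) :: 'a padic) \<noteq> 0" by simp
  have inv: "norm_padic (inverse x :: 'a padic) = inverse (norm_padic x)" if "x \<noteq> 0" for x
    using norm_padic_mult[of x "inverse x"] that norm_of_rat_padic[of 1, where 'p = 'a]
    by (simp add: inverse_unique)
  show ?thesis
  proof (cases "k \<ge> 0")
    case True
    then obtain n where "k = int n" by (metis nonneg_int_cases)
    then show ?thesis by (simp add: pw norm_of_nat_card power_int_minus power_one_over divide_inverse power_inverse)
  next
    case False
    then obtain n where "k = - int n" by (metis int_cases4 of_nat_0_le_iff neg_le_0_iff_le linorder_not_le less_le_not_le)
    then show ?thesis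
      using n0 by (simp add: power_int_minus inv pw norm_of_nat_card power_one_over divide_inverse power_inverse)
  qed
qed

text \<open>At \<open>1 / p\<close> the character equals \<open>cis (2 * pi / p)\<close>, which is
  not 1 because \<open>1 / p\<close> is not an integer. All cancellation in the Fourier integrals
  comes from this nontriviality.\<close>

lemma padic_char_inverse_card: "padic_char (1 / of_nat CARD('a) :: 'a::prime_card padic) \<noteq> 1"
proof
  let ?p = "CARD('a)"
  assume "padic_char (1 / of_nat ?p :: 'a padic) = 1"
  moreover have "padic_char (1 / of_nat ?p :: 'a padic) = cis (2 * pi * of_rat (1 / of_nat ?p))"
    by (rule padic_char_eq) (auto intro!: exI[of _ 1] simp: of_rat_divide padic_ints_def)
  ultimately have "cis (2 * pi / real ?p) = 1" by (simp add: of_rat_divide)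
  then have "cos (2 * pi / real ?p) = 1" by (simp add: complex_eq_iff)
  then obtain n :: int where "2 * pi / real ?p = of_int n * 2 * pi" using cos_one_2pi_int by blast
  then have "1 / real ?p = of_int n" by (simp add: field_simps)
  moreover have "0 < 1 / real ?p" "1 / real ?p < 1" using CARD_gt_1[where 'a = 'a] by auto
  ultimately show False by (metis of_int_0_less_iff of_int_less_1_iff zero_less_one int_one_le_iff_zero_less not_less)
qed

section \<open>Topology and measurability\<close>

lemma dist_padic: "dist x y = norm_padic (x - y :: 'a::prime_card padic)"
  by (simp add: dist_padic_def)

instance padic :: (prime_card) topological_ab_group_add
proof
  fix a b :: "'a padic"
  show "LIM x (nhds a \<times>\<^sub>F nhds b). fst x + snd x :> nhds (a + b)"
  proof (rule tendstoI)
    fix e :: real assume e: "e > 0"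
    have "\<forall>\<^sub>F x in nhds a \<times>\<^sub>F nhds b. dist (fst x) a < e \<and> dist (snd x) b < e"
      unfolding eventually_prod_filter
      using e by (intro exI[of _ "\<lambda>x. dist x a < e"] exI[of _ "\<lambda>x. dist x b < e"])
        (auto simp: eventually_nhds_metric)
    then show "\<forall>\<^sub>F x in nhds a \<times>\<^sub>F nhds b. dist (fst x + snd x) (a + b) < e"
    proof eventually_elim
      case (elim x)
      have eq: "fst x + snd x - (a + b) = (fst x - a) + (snd x - b)" by simp
      then show ?case
        using elim norm_padic_ultra[of "fst x - a" "snd x - b"] unfolding dist_padic eq by (auto simp: max_def split: if_splits)
    qed
  qed
  show "(uminus \<longlongrightarrow> - a) (nhds a)"
  proof (rule tendstoI)
    fix e :: real assume e: "e > 0"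
    have "dist (- x) (- a) = dist x a" for x :: "'a padic"
      using norm_padic_minus_commute[of x a] by (simp add: dist_padic)
    then show "\<forall>\<^sub>F x in nhds a. dist (- x) (- a) < e"
      using e by (auto simp: eventually_nhds_metric)
  qed
qed

instance padic :: (prime_card) topological_semigroup_mult
proof
  fix a b :: "'a padic"
  show "LIM x (nhds a \<times>\<^sub>F nhds b). fst x * snd x :> nhds (a * b)"
  proof (rule tendstoI)
    fix e :: real assume e: "e > 0"
    define C where "C = norm_padic a + norm_padic b + 1"
    have C: "C \<ge> 1" by (simp add: C_def)
    \<comment> \<open>The cap 1 keeps \<open>norm_padic (snd x) \<le> C\<close>; the other bound
      allots \<open>e / 2\<close> to each of the two terms.\<close>
    define d where "d = min 1 (e / (2 * C))"
    have d: "d > 0" using e C by (simp add: d_def)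
    have "\<forall>\<^sub>F x in nhds a \<times>\<^sub>F nhds b. dist (fst x) a < d \<and> dist (snd x) b < d"
      unfolding eventually_prod_filter
      using d by (intro exI[of _ "\<lambda>x. dist x a < d"] exI[of _ "\<lambda>x. dist x b < d"])
        (auto simp: eventually_nhds_metric)
    then show "\<forall>\<^sub>F x in nhds a \<times>\<^sub>F nhds b. dist (fst x * snd x) (a * b) < e"
    proof eventually_elim
      case (elim x)
      have eq: "fst x * snd x - a * b = (fst x - a) * snd x + a * (snd x - b)" by (simp add: algebra_simps)
      have "norm_padic (snd x) \<le> norm_padic (snd x - b) + norm_padic b"
        using norm_padic_triangle[of "snd x - b" b] by simp
      also have "\<dots> \<le> C" using elim by (simp add: C_def d_def dist_padic add_increasing)
      finally have s: "norm_padic (snd x) \<le> C" .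
      have "norm_padic (fst x * snd x - a * b) \<le> norm_padic (fst x - a) * norm_padic (snd x) + norm_padic a * norm_padic (snd x - b)"
        unfolding eq using norm_padic_triangle by (metis norm_padic_mult)
      also have "\<dots> \<le> norm_padic (fst x - a) * C + C * norm_padic (snd x - b)"
        using s by (intro add_mono mult_left_mono mult_right_mono) (auto simp: C_def)
      also have "\<dots> < d * C + C * d"
        using elim C by (intro add_strict_mono mult_strict_left_mono mult_strict_right_mono) (auto simp: dist_padic)
      also have "\<dots> \<le> e / (2 * C) * C + C * (e / (2 * C))"
        using C by (intro add_mono mult_left_mono mult_right_mono) (auto simp: d_def)
      also have "\<dots> = e" using C by simp
      finally show ?case by (simp add: dist_padic)
    qed
  qed
qed

text \<open>Rational centres and radii \<open>1 / (n + 1)\<close> give a countable base. Second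
  countability is what yields joint measurability of differences and products with respect to
  product sigma-algebras.\<close>

instance padic :: (prime_card) second_countable_topology
proof
  let ?B = "(\<lambda>(r, n). ball (of_rat r :: 'a padic) (1 / real (Suc n))) ` UNIV"
  have "topological_basis ?B"
  proof (rule topological_basisI)
    fix U and x :: "'a padic" assume "open U" "x \<in> U"
    then obtain e where e: "e > 0" "ball x e \<subseteq> U" by (rule openE)
    obtain n where n: "1 / real (Suc n) < e / 2" using nat_approx_posE[of "e / 2"] e by auto
    obtain r where r: "norm_padic (x - of_rat r :: 'a padic) < 1 / real (Suc n)"
      by (rule norm_padic_of_rat_approx[of "1 / real (Suc n)"]) auto
    have "ball (of_rat r :: 'a padic) (1 / real (Suc n)) \<subseteq> ball x e"
    proof
      fix y assume "y \<in> ball (of_rat r :: 'a padic) (1 / real (Suc n))"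
      then have "dist x y < e" using r n dist_triangle[of x y "of_rat r"] by (simp add: dist_padic)
      then show "y \<in> ball x e" by simp
    qed
    moreover have "x \<in> ball (of_rat r :: 'a padic) (1 / real (Suc n))" using r by (simp add: dist_padic norm_padic_minus_commute)
    ultimately show "\<exists>B'\<in>?B. x \<in> B' \<and> B' \<subseteq> U"
      using e by (intro bexI[of _ "ball (of_rat r :: 'a padic) (1 / real (Suc n))"]) auto
  qed auto
  then show "\<exists>B::'a padic set set. countable B \<and> open = generate_topology B"
    using topological_basis_imp_subbasis by (intro exI[of _ ?B]) auto
qed

lemma padic_char_locally_constant:
  assumes "dist y x \<le> 1" shows "padic_char (y :: 'a::prime_card padic) = padic_char x"
proof -
  have "padic_char (x + (y - x)) = padic_char x"
    using assms padic_char_int[of "y - x"] unfolding padic_char_add by (simp add: padic_ints_def dist_padic)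
  then show ?thesis by simp
qed

lemma continuous_padic_char: "continuous_on UNIV (padic_char :: 'a::prime_card padic \<Rightarrow> complex)"
  unfolding continuous_on_iff
proof (intro ballI allI impI)
  fix x :: "'a padic" and e :: real assume "e > 0"
  then have "dist (padic_char y) (padic_char x) < e" if "dist y x < 1" for y
    unfolding padic_char_locally_constant[OF less_imp_le[OF that]] by simp
  then show "\<exists>d>0. \<forall>x'\<in>UNIV. dist x' x < d \<longrightarrow> dist (padic_char x') (padic_char x) < e"
    by (intro exI[of _ 1]) simp
qed

lemma continuous_norm_padic: "continuous_on UNIV (norm_padic :: 'a::prime_card padic \<Rightarrow> real)"
  unfolding continuous_on_iff
proof (intro ballI allI impI)
  fix x :: "'a padic" and e :: real assume e: "e > 0"
  have "\<bar>norm_padic y - norm_padic x\<bar> \<le> dist y x" for y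
    using norm_padic_triangle[of "y - x" x] norm_padic_triangle[of "x - y" y] norm_padic_minus_commute[of x y]
    by (simp add: dist_padic)
  then show "\<exists>d>0. \<forall>x'\<in>UNIV. dist x' x < d \<longrightarrow> dist (norm_padic x') (norm_padic x) < e"
    using e by (intro exI[of _ e]) (auto simp: dist_real_def intro: le_less_trans)
qed

lemma measurable_padic_char [measurable]: "padic_char \<in> borel_measurable (borel :: 'a::prime_card padic measure)"
  by (rule borel_measurable_continuous_onI[OF continuous_padic_char])

lemma measurable_norm_padic [measurable]: "norm_padic \<in> borel_measurable (borel :: 'a::prime_card padic measure)"
  by (rule borel_measurable_continuous_onI[OF continuous_norm_padic])

lemma borel_measurable_padic_diff [measurable]:
  fixes f g :: "'b \<Rightarrow> 'a::prime_card padic"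
  assumes "f \<in> borel_measurable M" "g \<in> borel_measurable M"
  shows "(\<lambda>x. f x - g x) \<in> borel_measurable M"
  using assms by (rule borel_measurable_continuous_Pair) (intro continuous_intros)

lemma borel_measurable_padic_mult [measurable]:
  fixes f g :: "'b \<Rightarrow> 'a::prime_card padic"
  assumes "f \<in> borel_measurable M" "g \<in> borel_measurable M"
  shows "(\<lambda>x. f x * g x) \<in> borel_measurable M"
  using assms by (rule borel_measurable_continuous_Pair) (intro continuous_intros)

section \<open>Balls and the Borel sets they generate\<close>

definition padic_ball :: "'a::prime_card padic \<Rightarrow> int \<Rightarrow> 'a padic set" where
  "padic_ball a n = {x. norm_padic (x - a) \<le> real CARD('a) powi n}"

lemma padic_ball_borel [measurable, simp]: "padic_ball a n \<in> sets borel"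
  unfolding padic_ball_def by measurable

lemma padic_ball_center [simp]: "a \<in> padic_ball a n"
  by (simp add: padic_ball_def)

lemma padic_ball_eq: "b \<in> padic_ball a n \<Longrightarrow> padic_ball b n = padic_ball (a :: 'a::prime_card padic) n"
proof -
  have *: "x \<in> padic_ball a n" if "b \<in> padic_ball a n" "x \<in> padic_ball b n" for a b x :: "'a padic"
    using that norm_padic_ultra[of "x - b" "b - a"] by (auto simp: padic_ball_def max_def split: if_splits)
  assume b: "b \<in> padic_ball a n"
  then have "a \<in> padic_ball b n" by (simp add: padic_ball_def norm_padic_minus_commute)
  with b * show ?thesis by blast
qed

lemma padic_ball_mono: "j \<le> k \<Longrightarrow> padic_ball (a :: 'a::prime_card padic) j \<subseteq> padic_ball a k"
  unfolding padic_ball_def by (auto intro: order_trans simp: powi_le_iff)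

text \<open>Ultrametric balls are nested or disjoint, because every point of a ball is a centre of
  it.\<close>

lemma padic_ball_Int:
  assumes "j \<le> k"
  shows "padic_ball a j \<inter> padic_ball (b :: 'a::prime_card padic) k = (if a \<in> padic_ball b k then padic_ball a j else {})"
proof (cases "a \<in> padic_ball b k")
  case True
  then show ?thesis using padic_ball_eq[OF True] padic_ball_mono[OF assms, of a] by auto
next
  case False
  have "a \<in> padic_ball b k" if x: "x \<in> padic_ball a j" "x \<in> padic_ball b k" for x
  proof -
    have "padic_ball x k = padic_ball b k" using padic_ball_eq[OF x(2)] .
    moreover have "padic_ball x k = padic_ball a k" using padic_ball_eq padic_ball_mono[OF assms, of a] x(1) by blast
    ultimately show ?thesis using padic_ball_center by blast
  qed
  with False show ?thesis by auto
qed

text \<open>Each open set is a union of balls with rational centres and integer exponents, a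
  countable family. The empty set is added so that the generator is stable under
  intersection.\<close>

lemma borel_eq_padic_balls:
  "sets (borel :: 'a::prime_card padic measure) = sigma_sets UNIV (insert {} (range (\<lambda>(a, n). padic_ball a n)))"
proof (intro equalityI)
  let ?G = "insert {} (range (\<lambda>(a :: 'a padic, n). padic_ball a n))"
  have "U \<in> sigma_sets UNIV ?G" if U: "open U" for U :: "'a padic set"
  proof -
    define I where "I = {(r :: rat, n). padic_ball (of_rat r :: 'a padic) n \<subseteq> U}"
    have "U = (\<Union>(r, n)\<in>I. padic_ball (of_rat r) n)"
    proof (intro equalityI subsetI)
      fix x assume "x \<in> U"
      then obtain e where e: "e > 0" "ball x e \<subseteq> U" using U by (meson openE)
      obtain n where n: "real CARD('a) powi (- int n) < e" by (rule powi_arbitrarily_small[OF e(1)])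
      obtain r where "norm_padic (x - of_rat r) < real CARD('a) powi (- int n)"
        using norm_padic_of_rat_approx[OF powi_pos] by blast
      then have r: "x \<in> padic_ball (of_rat r) (- int n)" by (simp add: padic_ball_def)
      have "padic_ball x (- int n) \<subseteq> ball x e"
        using n by (auto simp: padic_ball_def dist_padic norm_padic_minus_commute)
      then have "(r, - int n) \<in> I" using padic_ball_eq[OF r] e by (auto simp: I_def)
      then show "x \<in> (\<Union>(r, n)\<in>I. padic_ball (of_rat r) n)" using r by blast
    qed (auto simp: I_def)
    also have "\<dots> \<in> sigma_sets UNIV ?G"
      by (rule sigma_sets_UNION) (auto intro!: sigma_sets.Basic countable_image)
    finally show ?thesis .
  qed
  then show "sets (borel :: 'a padic measure) \<subseteq> sigma_sets UNIV ?G"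
    unfolding borel_def by (subst sets_measure_of) (auto intro!: sigma_sets_mono)
  have "sigma_sets (space borel) ?G \<subseteq> sets (borel :: 'a padic measure)"
    by (rule sets.sigma_sets_subset) auto
  then show "sigma_sets UNIV ?G \<subseteq> sets borel" by simp
qed

section \<open>Haar measure\<close>

text \<open>The leading digit of \<open>y\<close> is \<open>p\<close> times the fractional part of
  \<open>y / p\<close>: this product is an integer because it lies in \<open>\<int>[1/p]\<close> and
  has absolute value at most 1.\<close>

lemma padic_digit:
  assumes y: "norm_padic (y :: 'a::prime_card padic) \<le> 1"
  obtains j where "j < CARD('a)" "norm_padic (y - of_nat j) \<le> 1 / real CARD('a)"
proof -
  let ?p = "CARD('a)"
  define r where "r = padic_frac (y / of_nat ?p)"
  have p1: "real ?p > 1" by (rule CARD_gt_1)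
  have n0: "(of_nat ?p :: 'a padic) \<noteq> 0" by simp
  obtain k where k: "of_nat ?p ^ k * r \<in> \<int>" using padic_frac(3)[of "y / of_nat ?p"] by (auto simp: r_def)
  have "norm_padic (y / of_nat ?p - of_rat r) \<le> 1"
    using padic_frac(4)[of "y / of_nat ?p"] by (simp add: r_def padic_ints_def)
  moreover have "y - of_rat (of_nat ?p * r) = of_nat ?p * (y / of_nat ?p - of_rat r)"
    using n0 by (simp add: of_rat_mult right_diff_distrib)
  ultimately have d: "norm_padic (y - of_rat (of_nat ?p * r)) \<le> 1 / real ?p"
    using p1 by (simp add: norm_padic_mult norm_of_nat_card divide_right_mono)
  have "norm_padic (of_rat (of_nat ?p * r) :: 'a padic) \<le> max (norm_padic y) (norm_padic (y - of_rat (of_nat ?p * r)))"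
    using norm_padic_diff_ultra[of y "y - of_rat (of_nat ?p * r)"] by simp
  also have "\<dots> \<le> 1" using y order_trans[OF d, of 1] p1 by simp
  finally have "padic_abs ?p (of_nat ?p * r) \<le> 1" unfolding norm_of_rat_padic .
  moreover have "of_nat ?p ^ k * (of_nat ?p * r) \<in> \<int>"
    using Ints_mult[OF Ints_of_nat[of ?p] k] by (simp add: mult_ac)
  ultimately have "of_nat ?p * r \<in> \<int>" by (rule of_rat_in_padic_ints_int[where 'a = 'a, rotated])
  then obtain i where i: "of_nat ?p * r = of_int i" by (auto elim: Ints_cases)
  have r01: "0 \<le> r" "r < 1" using padic_frac(1,2)[of "y / of_nat ?p"] by (auto simp: r_def)
  have pr: "(of_nat ?p :: rat) > 0" using p1 by simp
  have "(of_int 0 :: rat) \<le> of_int i" using r01 pr by (simp flip: i)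
  then have i0: "i \<ge> 0" by (simp only: of_int_le_iff)
  have "(of_int i :: rat) < of_int (int ?p)" using r01 pr by (simp flip: i)
  then have ip: "i < int ?p" by (simp only: of_int_less_iff)
  have "of_rat (of_nat ?p * r) = (of_nat (nat i) :: 'a padic)" unfolding i using i0 by simp
  then show ?thesis using that[of "nat i"] d i0 ip by simp
qed

lemma norm_padic_of_nat_diff:
  assumes "i < CARD('a::prime_card)" "j < CARD('a)" "i \<noteq> j"
  shows "norm_padic (of_nat i - of_nat j :: 'a padic) = 1"
proof -
  let ?p = "CARD('a)"
  have ne: "int i - int j \<noteq> 0" using assms by simp
  have "\<not> int ?p dvd int i - int j"
  proof
    assume "int ?p dvd int i - int j"
    then have "int ?p \<le> \<bar>int i - int j\<bar>" using ne zdvd_imp_le[of "int ?p" "\<bar>int i - int j\<bar>"] by simp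
    then show False using assms by linarith
  qed
  then have "multiplicity (int ?p) (int i - int j) = 0" by (rule not_dvd_imp_multiplicity_0)
  then have "padic_abs ?p (of_int (int i - int j)) = 1"
    using padic_abs_divide[OF prime_card[where 'a = 'a] ne one_neq_zero] by simp
  then have "norm_padic (of_rat (of_int (int i - int j)) :: 'a padic) = 1" by (simp only: norm_of_rat_padic)
  then show ?thesis by (simp add: of_rat_diff)
qed

locale haar =
  fixes m :: "'p::prime_card padic measure"
  assumes haar: "normalized_haar_measure m"
begin

lemma sets_m [measurable_cong, simp]: "sets m = sets borel"
  using haar by (simp add: normalized_haar_measure_def)

lemma space_m [simp]: "space m = UNIV"
  using sets_eq_imp_space_eq[OF sets_m] by simp

lemma distr_translate: "distr m borel (\<lambda>x. a + x) = m"
  using haar by (simp add: normalized_haar_measure_def)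

lemma measurable_m_iff [simp]: "measurable m = measurable borel"
  by (intro ext) (simp add: measurable_def)

lemma integral_translate:
  fixes f :: "'p padic \<Rightarrow> complex"
  assumes "f \<in> borel_measurable borel"
  shows "(\<integral>x. f (a + x) \<partial>m) = (\<integral>x. f x \<partial>m)"
  using integral_distr[of "\<lambda>x. a + x" m borel f] assms by (simp add: distr_translate)

lemma emeasure_translate: "A \<in> sets borel \<Longrightarrow> emeasure m ((\<lambda>x. a + x) -` A) = emeasure m A"
  using emeasure_distr[of "\<lambda>x. a + x" m borel A] by (simp add: distr_translate)

lemma emeasure_ball_center: "emeasure m (padic_ball a n) = emeasure m (padic_ball 0 n)"
proof -
  have "(\<lambda>x. a + x) -` padic_ball a n = padic_ball 0 n" by (auto simp: padic_ball_def)
  then show ?thesis using emeasure_translate[of "padic_ball a n" a] by simp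
qed

text \<open>The cosets of a ball in the next larger one are represented by the digits, scaled by an
  element of norm \<open>p^(n+1)\<close>; by translation invariance they all have the same
  volume.\<close>

lemma emeasure_ball_Suc: "emeasure m (padic_ball 0 (n + 1)) = of_nat CARD('p) * emeasure m (padic_ball 0 n)"
proof -
  let ?p = "CARD('p)"
  have p1: "real ?p > 1" by (rule CARD_gt_1)
  \<comment> \<open>The exponent is negative because \<open>p\<close> itself has norm
    \<open>1 / p\<close>.\<close>
  define c :: "'p padic" where "c = of_nat ?p powi (- (n + 1))"
  have c: "norm_padic c = real ?p powi (n + 1)" unfolding c_def norm_padic_powi_card minus_minus ..
  then have c0: "c \<noteq> 0" by (metis norm_padic_0 powi_pos less_irrefl)
  have split: "real ?p powi (n + 1) = real ?p powi n * real ?p" using p1 by (simp add: power_int_add)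
  have "padic_ball 0 (n + 1) = (\<Union>j<?p. padic_ball (of_nat j * c) n)"
  proof (intro equalityI subsetI)
    fix x :: "'p padic" assume "x \<in> padic_ball 0 (n + 1)"
    then have x: "norm_padic x \<le> real ?p powi (n + 1)" by (simp add: padic_ball_def)
    have xc: "x = (x / c) * c" using c0 by simp
    have "norm_padic (x / c) * norm_padic c \<le> 1 * norm_padic c" using x xc c by (metis mult_1 norm_padic_mult)
    then have "norm_padic (x / c) \<le> 1" using norm_padic_pos[OF c0] by simp
    then obtain j where j: "j < ?p" "norm_padic (x / c - of_nat j) \<le> 1 / real ?p" by (rule padic_digit)
    have "norm_padic (x - of_nat j * c) = norm_padic (x / c - of_nat j) * norm_padic c"
      using c0 by (simp add: norm_padic_mult[symmetric] left_diff_distrib)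
    also have "\<dots> \<le> 1 / real ?p * (real ?p powi n * real ?p)" unfolding c split by (intro mult_right_mono j) simp
    also have "\<dots> = real ?p powi n" using p1 by simp
    finally show "x \<in> (\<Union>j<?p. padic_ball (of_nat j * c) n)" using j by (auto simp: padic_ball_def)
  next
    fix x assume "x \<in> (\<Union>j<?p. padic_ball (of_nat j * c) n)"
    then obtain j where j: "j < ?p" "norm_padic (x - of_nat j * c) \<le> real ?p powi n" by (auto simp: padic_ball_def)
    have "norm_padic (of_nat j :: 'p padic) \<le> 1"
      using norm_padic_of_nat_diff[of j 0, where 'a = 'p] j p1 by (cases "j = 0") auto
    then have "norm_padic (of_nat j * c) \<le> real ?p powi (n + 1)"
      unfolding norm_padic_mult c by (simp add: mult_left_le_one_le)
    moreover have "real ?p powi n \<le> real ?p powi (n + 1)" unfolding powi_le_iff by simp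
    ultimately have "norm_padic x \<le> real ?p powi (n + 1)"
      using j(2) norm_padic_ultra[of "x - of_nat j * c" "of_nat j * c"] by (auto simp: max_def split: if_splits)
    then show "x \<in> padic_ball 0 (n + 1)" by (simp add: padic_ball_def)
  qed
  moreover have "disjoint_family_on (\<lambda>j. padic_ball (of_nat j * c) n) {..<?p}"
  proof (unfold disjoint_family_on_def, intro ballI impI)
    fix i j assume ij: "i \<in> {..<?p}" "j \<in> {..<?p}" "i \<noteq> j"
    have "norm_padic (of_nat i * c - of_nat j * c) = real ?p powi (n + 1)"
      using norm_padic_of_nat_diff[of i j, where 'a = 'p] ij c by (simp add: norm_padic_mult flip: left_diff_distrib)
    also have "\<dots> > real ?p powi n" unfolding powi_less_iff by simp
    finally have "of_nat i * c \<notin> padic_ball (of_nat j * c) n" by (simp add: padic_ball_def)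
    then show "padic_ball (of_nat i * c) n \<inter> padic_ball (of_nat j * c) n = {}"
      by (simp add: padic_ball_Int)
  qed
  ultimately have "emeasure m (padic_ball 0 (n + 1)) = (\<Sum>j<?p. emeasure m (padic_ball (of_nat j * c) n))"
    by (simp add: sum_emeasure[symmetric] image_subset_iff)
  also have "\<dots> = (\<Sum>j<?p. emeasure m (padic_ball 0 n))"
    by (intro sum.cong emeasure_ball_center) auto
  finally show ?thesis by simp
qed

text \<open>Normalisation fixes the unit ball; the scaling relation is run upwards and downwards
  from exponent 0.\<close>

lemma emeasure_ball [simp]: "emeasure m (padic_ball a n) = ennreal (real CARD('p) powi n)"
proof -
  let ?p = "CARD('p)"
  have p1: "real ?p > 1" by (rule CARD_gt_1)
  have "padic_ints = padic_ball (0 :: 'p padic) 0" by (simp add: padic_ints_def padic_ball_def)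
  then have z: "emeasure m (padic_ball 0 0) = 1" using haar by (simp add: normalized_haar_measure_def)
  have "emeasure m (padic_ball 0 n) = ennreal (real ?p powi n)"
  proof (induction n rule: int_induct[where k = 0])
    case base
    show ?case using z by simp
  next
    case (step1 i)
    have "real ?p powi (i + 1) = real ?p * real ?p powi i" using p1 by (simp add: power_int_add)
    then show ?case using step1 by (simp add: emeasure_ball_Suc ennreal_mult ennreal_of_nat_eq_real_of_nat)
  next
    case (step2 i)
    have eq: "real ?p powi i = real ?p * real ?p powi (i - 1)" using p1 by (simp add: power_int_diff)
    have "of_nat ?p * emeasure m (padic_ball 0 (i - 1)) = of_nat ?p * ennreal (real ?p powi (i - 1))"
      using step2 emeasure_ball_Suc[of "i - 1"] eq by (simp add: ennreal_mult ennreal_of_nat_eq_real_of_nat)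
    then show ?case using p1 by (subst (asm) ennreal_mult_cancel_left) auto
  qed
  then show ?thesis by (simp only: emeasure_ball_center[of a])
qed

lemma measure_ball [simp]: "measure m (padic_ball a n) = real CARD('p) powi n"
  by (simp add: measure_def)

lemma ball_exhaust: obtains n :: nat where "x \<in> padic_ball (0 :: 'p padic) (int n)"
proof -
  obtain n where "norm_padic x < real CARD('p) powi int n" by (rule powi_arbitrarily_large)
  then show ?thesis using that[of n] by (simp add: padic_ball_def)
qed

lemma UN_ball: "(\<Union>n. padic_ball (0 :: 'p padic) (int n)) = UNIV"
  by (auto intro: ball_exhaust)

lemma indicator_ball_tendsto:
  "(\<lambda>n. indicator (padic_ball (0 :: 'p padic) (int n)) x :: 'b :: {zero_neq_one, topological_space}) \<longlonglongrightarrow> 1"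
proof -
  obtain N where N: "x \<in> padic_ball 0 (int N)" by (rule ball_exhaust)
  have "x \<in> padic_ball 0 (int n)" if "n \<ge> N" for n using padic_ball_mono[of "int N" "int n" 0] N that by auto
  then show ?thesis
    by (intro tendsto_eventually) (auto simp: eventually_sequentially intro!: exI[of _ N])
qed

sublocale sigma_finite_measure m
proof
  show "\<exists>A. countable A \<and> A \<subseteq> sets m \<and> \<Union> A = space m \<and> (\<forall>a\<in>A. emeasure m a \<noteq> \<infinity>)"
    using UN_ball by (intro exI[of _ "range (\<lambda>n. padic_ball 0 (int n))"]) auto
qed

sublocale pair: pair_sigma_finite m m ..

text \<open>The integral is invariant under \<open>\<xi> \<mapsto> \<xi>\<^sub>0 + \<xi>\<close>, which multiplies the integrand by \<open>padic_char (\<xi>\<^sub>0 * x) \<noteq> 1\<close>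
  for a suitable \<open>\<xi>\<^sub>0\<close> in the ball.\<close>

lemma integral_char_ball:
  "(\<integral>\<xi>. indicator (padic_ball 0 n) \<xi> * padic_char (\<xi> * x) \<partial>m)
    = (if norm_padic x \<le> real CARD('p) powi (- n) then of_real (real CARD('p) powi n) else 0)"
proof (cases "norm_padic x \<le> real CARD('p) powi (- n)")
  case True
  have "indicator (padic_ball 0 n) \<xi> * padic_char (\<xi> * x) = (indicator (padic_ball 0 n) \<xi> :: complex)" for \<xi>
  proof (cases "\<xi> \<in> padic_ball 0 n")
    case xi: True
    have "norm_padic (\<xi> * x) \<le> real CARD('p) powi n * real CARD('p) powi (- n)"
      unfolding norm_padic_mult using xi True by (intro mult_mono) (auto simp: padic_ball_def)
    also have "\<dots> = 1" using CARD_gt_1[where 'a = 'p] by (simp add: power_int_minus)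
    finally show ?thesis using padic_char_int[of "\<xi> * x"] by (simp add: padic_ints_def)
  qed simp
  then have "(\<integral>\<xi>. indicator (padic_ball 0 n) \<xi> * padic_char (\<xi> * x) \<partial>m)
      = (\<integral>\<xi>. indicator (padic_ball 0 n) \<xi> \<partial>m)" by (simp only:)
  also have "\<dots> = complex_of_real (\<integral>\<xi>. indicator (padic_ball 0 n) \<xi> \<partial>m)"
    unfolding integral_complex_of_real[symmetric]
    by (intro Bochner_Integration.integral_cong) (auto simp: indicator_def)
  also have "\<dots> = complex_of_real (real CARD('p) powi n)" by simp
  finally show ?thesis using True by simp
next
  case False
  then have x0: "x \<noteq> 0" by (auto simp: less_imp_le)
  let ?p = "real CARD('p)"
  have p1: "?p > 1" by (rule CARD_gt_1)
  define \<xi>\<^sub>0 where "\<xi>\<^sub>0 = 1 / (of_nat CARD('p) * x)"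
  have x\<xi>: "\<xi>\<^sub>0 * x = 1 / of_nat CARD('p)" using x0 by (simp add: \<xi>\<^sub>0_def)
  have n1: "norm_padic (1 :: 'p padic) = 1" using norm_of_rat_padic[of 1, where 'p = 'p] by simp
  \<comment> \<open>\<open>\<xi>\<^sub>0 * x\<close> is \<open>1 / p\<close>, where the character is
    not 1. That \<open>\<xi>\<^sub>0\<close> still lies in the ball uses the discreteness of the
    norm: since \<open>norm_padic x\<close> exceeds \<open>p^(-n)\<close>, it is at least
    \<open>p^(-n+1)\<close>.\<close>
  have "\<not> norm_padic x < ?p powi (- n + 1)" unfolding norm_padic_less_powi_iff by (rule False)
  then have xge: "?p powi (- n + 1) \<le> norm_padic x" by simp
  have "\<xi>\<^sub>0 * (of_nat CARD('p) * x) = 1" using x0 by (simp add: \<xi>\<^sub>0_def)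
  from arg_cong[OF this, of norm_padic] have A: "norm_padic \<xi>\<^sub>0 * (1 / ?p * norm_padic x) = 1"
    by (simp only: norm_padic_mult norm_of_nat_card n1)
  have B: "norm_padic \<xi>\<^sub>0 * (?p powi (- n + 1) / ?p) \<le> norm_padic \<xi>\<^sub>0 * (1 / ?p * norm_padic x)"
    using xge p1 by (intro mult_left_mono) (auto simp: divide_right_mono)
  have C: "?p powi (- n + 1) / ?p = inverse (?p powi n)"
    by (subst power_int_add) (use p1 in \<open>auto simp: power_int_minus\<close>)
  have "norm_padic \<xi>\<^sub>0 * inverse (?p powi n) \<le> 1" using B unfolding A C .
  then have "norm_padic \<xi>\<^sub>0 \<le> ?p powi n"
    using powi_pos[where 'a = 'p, of n] by (simp add: field_simps)
  then have b: "padic_ball \<xi>\<^sub>0 n = padic_ball 0 n" by (intro padic_ball_eq) (simp add: padic_ball_def)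
  let ?I = "\<integral>\<xi>. indicator (padic_ball 0 n) \<xi> * padic_char (\<xi> * x) \<partial>m"
  have "?I = (\<integral>\<xi>. indicator (padic_ball 0 n) (\<xi>\<^sub>0 + \<xi>) * padic_char ((\<xi>\<^sub>0 + \<xi>) * x) \<partial>m)"
    by (rule integral_translate[symmetric]) measurable
  also have "\<dots> = (\<integral>\<xi>. padic_char (\<xi>\<^sub>0 * x) * (indicator (padic_ball 0 n) \<xi> * padic_char (\<xi> * x)) \<partial>m)"
  proof (intro Bochner_Integration.integral_cong refl)
    fix \<xi>
    have "\<xi>\<^sub>0 + \<xi> \<in> padic_ball \<xi>\<^sub>0 n \<longleftrightarrow> \<xi> \<in> padic_ball 0 n" by (simp add: padic_ball_def)
    then have "\<xi>\<^sub>0 + \<xi> \<in> padic_ball 0 n \<longleftrightarrow> \<xi> \<in> padic_ball 0 n" unfolding b .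
    then show "indicator (padic_ball 0 n) (\<xi>\<^sub>0 + \<xi>) * padic_char ((\<xi>\<^sub>0 + \<xi>) * x)
        = padic_char (\<xi>\<^sub>0 * x) * (indicator (padic_ball 0 n) \<xi> * padic_char (\<xi> * x))"
      by (simp add: indicator_def distrib_right padic_char_add)
  qed
  also have "\<dots> = padic_char (\<xi>\<^sub>0 * x) * ?I" by simp
  finally have "(padic_char (\<xi>\<^sub>0 * x) - 1) * ?I = 0" by (simp add: left_diff_distrib)
  moreover have "padic_char (\<xi>\<^sub>0 * x) - 1 \<noteq> 0" unfolding x\<xi> using padic_char_inverse_card[where 'a = 'p] by simp
  ultimately have "?I = 0" by simp
  with False show ?thesis by simp
qed

end

section \<open>Averages over balls\<close>

context haar
begin

text \<open>The mean of \<open>g\<close> over the ball of radius \<open>p^(-n)\<close> around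
  \<open>x\<close>, whose volume is \<open>p^(-n)\<close>; as an inner product it inherits linearity
  and the Cauchy-Schwarz inequality.\<close>

definition avg :: "int \<Rightarrow> ('p padic \<Rightarrow> complex) \<Rightarrow> 'p padic \<Rightarrow> complex" where
  "avg n g x = of_real (real CARD('p) powi n) * inner_L2 m g (indicator (padic_ball x (- n)))"

lemma ball_indicator_L2 [simp]: "indicator (padic_ball a n) \<in> L2 m"
  by (intro indicator_L2) auto

lemma indicator_ball_commute:
  "indicator (padic_ball x n) y = (indicator (padic_ball y n) x :: 'b::zero_neq_one)"
  by (auto simp: indicator_def padic_ball_def norm_padic_minus_commute)

lemma measurable_pred_ball [measurable]:
  assumes [measurable]: "f \<in> borel_measurable N" "g \<in> borel_measurable N"
  shows "Measurable.pred N (\<lambda>z. g z \<in> padic_ball (f z :: 'p padic) n)"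
  unfolding padic_ball_def by measurable

lemma avg_measurable:
  assumes "g \<in> L2 m" shows "avg n g \<in> borel_measurable borel"
proof -
  have [measurable]: "g \<in> borel_measurable borel" using L2_measurable[OF assms] by simp
  have "(\<lambda>x. \<integral>y. g y * cnj (indicator (padic_ball x (- n)) y) \<partial>m) \<in> borel_measurable borel"
    by measurable
  then show ?thesis unfolding avg_def[abs_def] inner_L2_def by measurable
qed

lemma avg_lincomb:
  "f \<in> L2 m \<Longrightarrow> g \<in> L2 m \<Longrightarrow> avg n (\<lambda>x. a * f x + b * g x) = (\<lambda>x. a * avg n f x + b * avg n g x)"
  by (auto simp: avg_def inner_L2_lincomb_left algebra_simps)

lemma avg_pointwise:
  assumes g: "g \<in> L2 m"
  shows "(cmod (avg n g x))\<^sup>2 \<le> real CARD('p) powi n * (norm_L2 m (\<lambda>y. indicator (padic_ball x (- n)) y * g y))\<^sup>2"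
proof -
  let ?B = "padic_ball x (- n)" and ?p = "real CARD('p) powi n"
  have gi: "(\<lambda>y. indicator ?B y * g y) \<in> L2 m" by (rule L2_indicator_mult[OF g]) simp
  have "inner_L2 m g (indicator ?B) = inner_L2 m (\<lambda>y. indicator ?B y * g y) (indicator ?B)"
    unfolding inner_L2_def by (intro Bochner_Integration.integral_cong) (auto simp: indicator_def)
  then have "cmod (inner_L2 m g (indicator ?B)) \<le> norm_L2 m (\<lambda>y. indicator ?B y * g y) * norm_L2 m (indicator ?B)"
    using cmod_inner_L2_le[OF gi] by simp
  then have "(cmod (inner_L2 m g (indicator ?B)))\<^sup>2 \<le> (norm_L2 m (\<lambda>y. indicator ?B y * g y))\<^sup>2 * (norm_L2 m (indicator ?B))\<^sup>2"
    unfolding power_mult_distrib[symmetric] by (intro power_mono) auto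
  also have "(norm_L2 m (indicator ?B))\<^sup>2 = inverse ?p" by (simp add: norm_L2_indicator power_int_minus)
  finally have "?p\<^sup>2 * (cmod (inner_L2 m g (indicator ?B)))\<^sup>2
      \<le> ?p\<^sup>2 * ((norm_L2 m (\<lambda>y. indicator ?B y * g y))\<^sup>2 * inverse ?p)"
    by (intro mult_left_mono) auto
  also have "\<dots> = ?p * (norm_L2 m (\<lambda>y. indicator ?B y * g y))\<^sup>2"
    using powi_pos[where 'a = 'p, of n] by (simp add: power2_eq_square field_simps)
  finally show ?thesis by (simp only: avg_def norm_mult power_mult_distrib norm_of_real power2_abs)
qed

text \<open>Averaging is a contraction by the pointwise bound and Tonelli's theorem:
  \<open>y\<close> lies in the ball around \<open>x\<close> exactly when \<open>x\<close> lies in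
  the ball around \<open>y\<close>, and the volume cancels the factor.\<close>

lemma avg_L2:
  assumes g: "g \<in> L2 m"
  shows "avg n g \<in> L2 m" "norm_L2 m (avg n g) \<le> norm_L2 m g"
proof -
  note [measurable] = L2_measurable[OF g]
  let ?p = "real CARD('p) powi n"
  have "(\<integral>\<^sup>+x. ennreal ((cmod (avg n g x))\<^sup>2) \<partial>m)
      \<le> (\<integral>\<^sup>+x. \<integral>\<^sup>+y. ennreal ?p * (indicator (padic_ball x (- n)) y * ennreal ((cmod (g y))\<^sup>2)) \<partial>m \<partial>m)"
  proof (rule nn_integral_mono)
    fix x :: "'p padic"
    let ?B = "padic_ball x (- n)"
    have gi: "(\<lambda>y. indicator ?B y * g y) \<in> L2 m" by (rule L2_indicator_mult[OF g]) simp
    have "ennreal ((cmod (avg n g x))\<^sup>2) \<le> ennreal ?p * ennreal ((norm_L2 m (\<lambda>y. indicator ?B y * g y))\<^sup>2)"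
      using avg_pointwise[OF g, of n x] by (subst ennreal_mult[symmetric]) (auto intro: ennreal_leI)
    also have "ennreal ((norm_L2 m (\<lambda>y. indicator ?B y * g y))\<^sup>2) = (\<integral>\<^sup>+y. ennreal ((cmod (indicator ?B y * g y))\<^sup>2) \<partial>m)"
      by (rule nn_integral_L2[OF gi, symmetric])
    also have "\<dots> = (\<integral>\<^sup>+y. indicator ?B y * ennreal ((cmod (g y))\<^sup>2) \<partial>m)"
      by (intro nn_integral_cong) (auto simp: indicator_def)
    also have "ennreal ?p * \<dots> = (\<integral>\<^sup>+y. ennreal ?p * (indicator ?B y * ennreal ((cmod (g y))\<^sup>2)) \<partial>m)"
      by (rule nn_integral_cmult[symmetric]) simp
    finally show "ennreal ((cmod (avg n g x))\<^sup>2)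
      \<le> (\<integral>\<^sup>+y. ennreal ?p * (indicator ?B y * ennreal ((cmod (g y))\<^sup>2)) \<partial>m)" .
  qed
  also have "\<dots> = (\<integral>\<^sup>+y. \<integral>\<^sup>+x. ennreal ?p * (indicator (padic_ball x (- n)) y * ennreal ((cmod (g y))\<^sup>2)) \<partial>m \<partial>m)"
    by (rule pair.Fubini') measurable
  also have "\<dots> = (\<integral>\<^sup>+y. ennreal ((cmod (g y))\<^sup>2) \<partial>m)"
  proof (rule nn_integral_cong)
    fix y :: "'p padic"
    have "(\<integral>\<^sup>+x. ennreal ?p * (indicator (padic_ball x (- n)) y * ennreal ((cmod (g y))\<^sup>2)) \<partial>m)
        = (\<integral>\<^sup>+x. (ennreal ?p * ennreal ((cmod (g y))\<^sup>2)) * indicator (padic_ball y (- n)) x \<partial>m)"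
      by (intro nn_integral_cong) (auto simp: indicator_ball_commute[of _ _ y] mult_ac)
    also have "\<dots> = (ennreal ?p * ennreal ((cmod (g y))\<^sup>2)) * ennreal (real CARD('p) powi (- n))"
      by (subst nn_integral_cmult_indicator) auto
    also have "\<dots> = ennreal (?p * real CARD('p) powi (- n)) * ennreal ((cmod (g y))\<^sup>2)"
      by (simp add: ennreal_mult mult_ac)
    also have "?p * real CARD('p) powi (- n) = 1"
      using powi_pos[where 'a = 'p, of n] by (simp add: power_int_minus)
    finally show "(\<integral>\<^sup>+x. ennreal ?p * (indicator (padic_ball x (- n)) y * ennreal ((cmod (g y))\<^sup>2)) \<partial>m)
        = ennreal ((cmod (g y))\<^sup>2)" by simp
  qed
  finally have *: "(\<integral>\<^sup>+x. ennreal ((cmod (avg n g x))\<^sup>2) \<partial>m) \<le> ennreal ((norm_L2 m g)\<^sup>2)"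
    by (simp only: nn_integral_L2[OF g])
  have meas: "avg n g \<in> borel_measurable m" using avg_measurable[OF g] by simp
  show "avg n g \<in> L2 m" by (rule L2_nn_integralI(1)[OF meas _ *]) simp
  have "(norm_L2 m (avg n g))\<^sup>2 \<le> (norm_L2 m g)\<^sup>2" by (rule L2_nn_integralI(2)[OF meas _ *]) simp
  then show "norm_L2 m (avg n g) \<le> norm_L2 m g" by (rule power2_le_imp_le) simp
qed

text \<open>Membership in L2 is bundled in, so that a single predicate can be carried through the
  inductions over sets and functions.\<close>

definition avg_converges :: "('p padic \<Rightarrow> complex) \<Rightarrow> bool" where
  "avg_converges g \<longleftrightarrow> g \<in> L2 m \<and> tendsto_L2 m (\<lambda>n. avg (int n) g) g"

lemma avg_converges_lincomb:
  "avg_converges f \<Longrightarrow> avg_converges g \<Longrightarrow> avg_converges (\<lambda>x. a * f x + b * g x)"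
  unfolding avg_converges_def by (auto simp: avg_lincomb intro!: L2_lincomb tendsto_L2_lincomb avg_L2)

text \<open>An \<open>e / 3\<close> argument; the contraction property makes the first error term
  uniform in \<open>n\<close>.\<close>

lemma avg_converges_limit:
  assumes u: "\<And>k. avg_converges (u k)" and g: "g \<in> L2 m" and lim: "tendsto_L2 m u g"
  shows "avg_converges g"
  unfolding avg_converges_def
proof
  show "tendsto_L2 m (\<lambda>n. avg (int n) g) g"
    unfolding tendsto_L2_def
  proof (rule LIMSEQ_I)
    fix e :: real assume e: "e > 0"
    have uL: "u k \<in> L2 m" for k using u by (auto simp: avg_converges_def)
    obtain k where k: "norm_L2 m (\<lambda>x. u k x - g x) < e / 3"
      using order_tendstoD(2)[OF lim[unfolded tendsto_L2_def], of "e/3"] e eventually_happens'[OF sequentially_bot] by force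
    have "(\<lambda>n. norm_L2 m (\<lambda>x. avg (int n) (u k) x - u k x)) \<longlonglongrightarrow> 0"
      using u[of k] by (auto simp: avg_converges_def tendsto_L2_def)
    from order_tendstoD(2)[OF this, of "e/3"] e obtain N where
      N: "\<And>n. n \<ge> N \<Longrightarrow> norm_L2 m (\<lambda>x. avg (int n) (u k) x - u k x) < e / 3"
      by (auto simp: eventually_sequentially)
    have "norm_L2 m (\<lambda>x. avg (int n) g x - g x) < e" if n: "n \<ge> N" for n
    proof -
      have 1: "norm_L2 m (\<lambda>x. avg (int n) g x - avg (int n) (u k) x) < e / 3"
        using avg_L2(2)[OF L2_diff[OF uL g], of "int n" k] avg_lincomb[OF uL g, of "int n" 1 k "-1"] k
        by (simp add: norm_L2_diff_commute[of m "avg (int n) g"])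
      have "norm_L2 m (\<lambda>x. avg (int n) g x - g x)
          \<le> norm_L2 m (\<lambda>x. avg (int n) g x - avg (int n) (u k) x) + norm_L2 m (\<lambda>x. avg (int n) (u k) x - g x)"
        by (rule norm_L2_triangle) (intro avg_L2 g uL)+
      moreover have "norm_L2 m (\<lambda>x. avg (int n) (u k) x - g x)
          \<le> norm_L2 m (\<lambda>x. avg (int n) (u k) x - u k x) + norm_L2 m (\<lambda>x. u k x - g x)"
        by (rule norm_L2_triangle) (intro avg_L2 g uL)+
      ultimately show ?thesis using 1 N[OF n] k by simp
    qed
    then show "\<exists>N. \<forall>n\<ge>N. norm (norm_L2 m (\<lambda>x. avg (int n) g x - g x) - 0) < e" by auto
  qed
qed (rule g)

text \<open>Once the averaging radius does not exceed that of the ball, every averaging ball lies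
  inside or outside it, so the average reproduces the indicator and the sequence is eventually
  constant.\<close>

lemma avg_converges_ball: "avg_converges (indicator (padic_ball a k))"
  unfolding avg_converges_def
proof
  have "avg (int n) (indicator (padic_ball a k)) = indicator (padic_ball a k)" if n: "int n \<ge> - k" for n
  proof
    fix x :: "'p padic"
    have "inner_L2 m (indicator (padic_ball a k)) (indicator (padic_ball x (- int n)))
        = (\<integral>y. indicator (padic_ball x (- int n) \<inter> padic_ball a k) y \<partial>m)"
      unfolding inner_L2_def by (intro Bochner_Integration.integral_cong) (auto simp: indicator_def)
    also have "\<dots> = of_real (measure m (padic_ball x (- int n) \<inter> padic_ball a k))"
      by (rule integral_indicator_complex) simp
    also have "padic_ball x (- int n) \<inter> padic_ball a k = (if x \<in> padic_ball a k then padic_ball x (- int n) else {})"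
      by (rule padic_ball_Int) (use n in simp)
    finally show "avg (int n) (indicator (padic_ball a k)) x = indicator (padic_ball a k) x"
      using CARD_gt_1[where 'a = 'p] by (simp add: avg_def power_int_minus of_real_power)
  qed
  then show "tendsto_L2 m (\<lambda>n. avg (int n) (indicator (padic_ball a k))) (indicator (padic_ball a k))"
    unfolding tendsto_L2_def
    by (intro tendsto_eventually) (auto simp: eventually_sequentially intro!: exI[of _ "nat (- k)"])
qed simp

lemma avg_converges_zero: "avg_converges (\<lambda>_. 0)"
  using avg_converges_lincomb[OF avg_converges_ball avg_converges_ball, of 0 undefined undefined 0] by simp

text \<open>Balls are stable under intersection and generate the Borel sets.\<close>

lemma avg_converges_indicator_Int_ball:
  assumes "A \<in> sets borel"
  shows "avg_converges (indicator (A \<inter> padic_ball a k))"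
proof -
  \<comment> \<open>Intersecting with a fixed ball keeps complements and countable unions
    square-integrable throughout the induction on sets.\<close>
  let ?K = "padic_ball a k"
  let ?G = "insert {} (range (\<lambda>(a, n). padic_ball (a :: 'p padic) n))"
  have stable: "Int_stable ?G"
  proof (rule Int_stableI)
    fix X Y assume XY: "X \<in> ?G" "Y \<in> ?G"
    show "X \<inter> Y \<in> ?G"
    proof (cases "X = {} \<or> Y = {}")
      case False
      then obtain a j b k where ab: "X = padic_ball a j" "Y = padic_ball b k" using XY by auto
      show ?thesis
      proof (cases "j \<le> k")
        case True
        then show ?thesis unfolding ab padic_ball_Int[OF True] by auto
      next
        case False
        then have "k \<le> j" by simp
        from padic_ball_Int[OF this, of b a] show ?thesis unfolding ab by (auto simp: Int_commute)
      qed
    qed auto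
  qed
  have sub: "?G \<subseteq> Pow UNIV" by simp
  have "A \<in> sigma_sets UNIV ?G" using assms by (simp only: borel_eq_padic_balls)
  from stable sub this show ?thesis
  proof (rule sigma_sets_induct_disjoint)
    fix X assume "X \<in> ?G"
    then consider "X = {}" | b j where "X = padic_ball b j" by auto
    then show "avg_converges (indicator (X \<inter> ?K))"
    proof cases
      case 1
      have "indicator ({} \<inter> ?K) = (\<lambda>_. 0 :: complex)" by auto
      then show ?thesis using avg_converges_zero 1 by simp
    next
      case 2
      show ?thesis
      proof (cases "j \<le> k")
        case True
        show ?thesis unfolding 2 padic_ball_Int[OF True]
          using avg_converges_zero avg_converges_ball by (auto simp: indicator_def[abs_def])
      next
        case False
        then have "k \<le> j" by simp
        show ?thesis unfolding 2 Int_commute[of _ ?K] padic_ball_Int[OF \<open>k \<le> j\<close>]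
          using avg_converges_zero avg_converges_ball by (auto simp: indicator_def[abs_def])
      qed
    qed
  next
    have "indicator ({} \<inter> ?K) = (\<lambda>_. 0 :: complex)" by auto
    then show "avg_converges (indicator ({} \<inter> ?K))" using avg_converges_zero by simp
  next
    fix X assume "avg_converges (indicator (X \<inter> ?K))"
    from avg_converges_lincomb[OF avg_converges_ball[of a k] this, of 1 "-1"]
    have "avg_converges (\<lambda>x. indicator ?K x - indicator (X \<inter> ?K) x)" by simp
    also have "(\<lambda>x. indicator ?K x - indicator (X \<inter> ?K) x) = (indicator ((UNIV - X) \<inter> ?K) :: _ \<Rightarrow> complex)"
      by (auto simp: indicator_def)
    finally show "avg_converges (indicator ((UNIV - X) \<inter> ?K))" .
  next
    fix X :: "nat \<Rightarrow> 'p padic set"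
    assume dj: "disjoint_family X" and rX: "range X \<subseteq> sigma_sets UNIV ?G"
      and IH: "\<And>i. avg_converges (indicator (X i \<inter> ?K))"
    have Xb [measurable]: "X i \<in> sets borel" for i using rX borel_eq_padic_balls by blast
    have UXb [measurable]: "(\<Union>i. X i) \<in> sets borel" by (intro sets.countable_UN) auto
    have part: "avg_converges (\<lambda>x. \<Sum>i<n. indicator (X i \<inter> ?K) x)" for n
    proof (induction n)
      case (Suc n)
      from avg_converges_lincomb[OF Suc IH, of 1 1 n] show ?case by simp
    qed (simp add: avg_converges_zero)
    have fin: "(indicator ((\<Union>i. X i) \<inter> ?K) :: _ \<Rightarrow> complex) \<in> L2 m"
      by (rule L2_dominated(1)[OF ball_indicator_L2[of a k], of _ 1]) (auto simp: indicator_def)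
    have sumeq: "(\<Sum>i<n. indicator (X i \<inter> ?K) x) = (indicator ((\<Union>i<n. X i) \<inter> ?K) x :: complex)" for n x
    proof -
      have "indicator ((\<Union>i<n. X i) \<inter> ?K) x = (\<Sum>i<n. indicator (X i \<inter> ?K) x :: complex)"
        unfolding UN_simps(4)[symmetric]
        by (rule indicator_UN_disjoint) (use dj in \<open>auto simp: disjoint_family_on_def\<close>)
      then show ?thesis by simp
    qed
    show "avg_converges (indicator ((\<Union>i. X i) \<inter> ?K))"
    proof (rule avg_converges_limit[OF part fin], rule tendsto_L2_dominated[OF _ fin ball_indicator_L2[of a k]])
      show "(\<lambda>x. \<Sum>i<n. indicator (X i \<inter> ?K) x :: complex) \<in> borel_measurable m" for n
        by simp
      show "AE x in m. cmod (\<Sum>i<n. indicator (X i \<inter> ?K) x) \<le> cmod (indicator ?K x)" for n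
        unfolding sumeq by (auto simp: indicator_def)
      show "AE x in m. (\<lambda>n. \<Sum>i<n. indicator (X i \<inter> ?K) x) \<longlonglongrightarrow> (indicator ((\<Union>i. X i) \<inter> ?K) x :: complex)"
      proof (rule AE_I2)
        fix x :: "'p padic"
        show "(\<lambda>n. \<Sum>i<n. indicator (X i \<inter> ?K) x) \<longlonglongrightarrow> (indicator ((\<Union>i. X i) \<inter> ?K) x :: complex)"
        proof (cases "x \<in> (\<Union>i. X i)")
          case True
          then obtain i where i: "x \<in> X i" by blast
          have "x \<in> (\<Union>i<n. X i)" if "n \<ge> Suc i" for n using i that by (auto intro!: bexI[of _ i])
          then have "eventually (\<lambda>n. (\<Sum>i<n. indicator (X i \<inter> ?K) x) = (indicator ((\<Union>i. X i) \<inter> ?K) x :: complex)) sequentially"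
            unfolding sumeq eventually_sequentially by (intro exI[of _ "Suc i"]) (auto simp: indicator_def)
          then show ?thesis by (rule tendsto_eventually)
        qed (simp add: indicator_def)
      qed
    qed
  qed
qed

text \<open>Induction over the construction of measurable functions. Every constituent is dominated
  by the function being built, up to the scalar in the scaling step, so membership in L2 passes down
  to the constituents, and linearity and dominated convergence carry the conclusion back up.\<close>

lemma avg_tendsto_nonneg:
  assumes u: "u \<in> borel_measurable borel" and u0: "\<And>x. u x \<ge> (0::real)"
    and uL: "(\<lambda>x. complex_of_real (u x)) \<in> L2 m"
  shows "avg_converges (\<lambda>x. complex_of_real (u x))"
  using u u0 uL
proof (induction u rule: borel_measurable_induct_real)
  case (set A)
  have eq: "complex_of_real (indicator A x) = indicator A x" for x by (simp add: indicator_def)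
  show ?case
    unfolding eq
  proof (rule avg_converges_limit[of "\<lambda>n. indicator (A \<inter> padic_ball 0 (int n))"])
    show "avg_converges (indicator (A \<inter> padic_ball 0 (int n)))" for n
      by (rule avg_converges_indicator_Int_ball) (use set in simp)
    show L: "indicator A \<in> L2 m" using set unfolding eq by (simp add: eta_contract_eq)
    show "tendsto_L2 m (\<lambda>n. indicator (A \<inter> padic_ball 0 (int n))) (indicator A)"
    proof (rule tendsto_L2_dominated[OF _ L L])
      show "AE x in m. (\<lambda>n. indicator (A \<inter> padic_ball 0 (int n)) x) \<longlonglongrightarrow> (indicator A x :: complex)"
      proof (rule AE_I2)
        fix x :: "'p padic"
        show "(\<lambda>n. indicator (A \<inter> padic_ball 0 (int n)) x) \<longlonglongrightarrow> (indicator A x :: complex)"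
          using tendsto_mult[OF tendsto_const[of "indicator A x :: complex"] indicator_ball_tendsto[of x]]
          by (simp add: indicator_inter_arith)
      qed
    qed (use set in \<open>auto simp: indicator_def\<close>)
  qed
next
  case (mult u c)
  show ?case
  proof (cases "c = 0")
    case False
    have "(\<lambda>x. complex_of_real (u x)) \<in> L2 m"
      using L2_scale[OF mult.prems, of "inverse (of_real c)"] False by (simp add: mult.assoc[symmetric])
    from avg_converges_lincomb[OF mult.IH[OF this] mult.IH[OF this], of "of_real c" 0] show ?thesis by simp
  qed (simp add: avg_converges_zero)
next
  case (add u v)
  have "(\<lambda>x. complex_of_real (u x)) \<in> L2 m" "(\<lambda>x. complex_of_real (v x)) \<in> L2 m"
    by (rule L2_dominated(1)[OF add.prems, of _ 1]; use add in \<open>auto simp flip: of_real_add\<close>)+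
  from avg_converges_lincomb[OF add.IH(2)[OF this(2)] add.IH(1)[OF this(1)], of 1 1] show ?case by simp
next
  case (seq U)
  have le: "U i x \<le> u x" for i x
    using seq.hyps(3) seq.hyps(4)[of x] by (intro incseq_le[of "\<lambda>i. U i x"]) (auto simp: incseq_def le_fun_def)
  have ule: "cmod (complex_of_real (U i x)) \<le> cmod (complex_of_real (u x))" for i x
    using le[of i x] seq.hyps(2)[of i x] by simp
  have L: "(\<lambda>x. complex_of_real (U i x)) \<in> L2 m" for i
    by (rule L2_dominated(1)[OF seq.prems, of _ 1]) (use seq.hyps(1) ule in auto)
  show ?case
  proof (rule avg_converges_limit[OF seq.IH[OF L] seq.prems], rule tendsto_L2_dominated[OF _ seq.prems seq.prems])
    show "(\<lambda>x. complex_of_real (U i x)) \<in> borel_measurable m" for i using seq.hyps(1) by simp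
    show "AE x in m. cmod (complex_of_real (U i x)) \<le> cmod (complex_of_real (u x))" for i
      using ule by simp
    show "AE x in m. (\<lambda>n. complex_of_real (U n x)) \<longlonglongrightarrow> complex_of_real (u x)"
      by (rule AE_I2) (intro tendsto_of_real seq.hyps(4), simp)
  qed
qed

text \<open>Differentiation in the mean; it becomes Fourier inversion once truncated inversion
  integrals are recognised as averages. A complex function is split into the positive and negative
  parts of its real and imaginary parts.\<close>

theorem avg_tendsto:
  assumes g: "g \<in> L2 m"
  shows "tendsto_L2 m (\<lambda>n. avg (int n) g) g"
proof -
  have gm [measurable]: "g \<in> borel_measurable borel" using L2_measurable[OF g] by simp
  have part: "avg_converges (\<lambda>x. complex_of_real (h (g x)))"
    if h: "h \<in> borel_measurable borel" "\<And>z. 0 \<le> h z" "\<And>z. h z \<le> cmod z" for h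
  proof (rule avg_tendsto_nonneg)
    show "(\<lambda>x. h (g x)) \<in> borel_measurable borel" using h(1) by measurable
    show "(\<lambda>x. complex_of_real (h (g x))) \<in> L2 m"
      by (rule L2_dominated(1)[OF g, of _ 1]) (use h in auto)
  qed (rule h)
  have Rp: "avg_converges (\<lambda>x. complex_of_real (max 0 (Re (g x))))"
    by (rule part) (auto intro: order_trans[OF complex_Re_le_cmod])
  have Rn: "avg_converges (\<lambda>x. complex_of_real (max 0 (- Re (g x))))"
    by (rule part) (auto intro: order_trans[OF _ abs_Re_le_cmod])
  have Ip: "avg_converges (\<lambda>x. complex_of_real (max 0 (Im (g x))))"
    by (rule part) (auto intro: order_trans[OF _ abs_Im_le_cmod])
  have In: "avg_converges (\<lambda>x. complex_of_real (max 0 (- Im (g x))))"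
    by (rule part) (auto intro: order_trans[OF _ abs_Im_le_cmod])
  have "avg_converges (\<lambda>x. 1 * (1 * complex_of_real (max 0 (Re (g x))) + (-1) * complex_of_real (max 0 (- Re (g x))))
      + \<i> * (1 * complex_of_real (max 0 (Im (g x))) + (-1) * complex_of_real (max 0 (- Im (g x)))))"
    by (intro avg_converges_lincomb Rp Rn Ip In)
  also have "(\<lambda>x. 1 * (1 * complex_of_real (max 0 (Re (g x))) + (-1) * complex_of_real (max 0 (- Re (g x))))
      + \<i> * (1 * complex_of_real (max 0 (Im (g x))) + (-1) * complex_of_real (max 0 (- Im (g x))))) = g"
    by (auto simp: complex_eq_iff max_def)
  finally show ?thesis by (simp add: avg_converges_def)
qed

end

section \<open>The Fourier transform\<close>

context haar
begin

lemma cnj_indicator [simp]: "cnj (indicator A x) = indicator A x"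
  by (simp add: indicator_def)

text \<open>The kernel is bounded by 1, so the double integral is dominated by a product of two
  integrable functions. The inversion formula and the Plancherel identity are both exchanges of this
  kind.\<close>

lemma Fubini_bounded_kernel:
  fixes K :: "'p padic \<Rightarrow> 'p padic \<Rightarrow> complex"
  assumes \<phi>: "integrable m \<phi>" and g: "integrable m g"
    and K [measurable]: "(\<lambda>(x, y). K x y) \<in> borel_measurable (borel \<Otimes>\<^sub>M borel)"
    and K1: "\<And>x y. cmod (K x y) \<le> 1"
  shows "(\<integral>x. \<phi> x * (\<integral>y. K x y * g y \<partial>m) \<partial>m) = (\<integral>y. (\<integral>x. \<phi> x * K x y \<partial>m) * g y \<partial>m)"
proof -
  note [measurable] = borel_measurable_integrable[OF \<phi>] borel_measurable_integrable[OF g]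
  have Km [measurable]: "(\<lambda>(x, y). K x y) \<in> borel_measurable (m \<Otimes>\<^sub>M m)"
    using K by (simp cong: measurable_cong_sets sets_pair_measure_cong)
  have int: "integrable (m \<Otimes>\<^sub>M m) (\<lambda>(x, y). \<phi> x * (K x y * g y))"
  proof (rule Bochner_Integration.integrable_bound)
    show "integrable (m \<Otimes>\<^sub>M m) (\<lambda>(x, y). \<phi> x * g y)"
    proof (rule pair.Fubini_integrable)
      show "(\<lambda>(x, y). \<phi> x * g y) \<in> borel_measurable (m \<Otimes>\<^sub>M m)" by measurable
      have "integrable m (\<lambda>x. cmod (\<phi> x) * (\<integral>y. cmod (g y) \<partial>m))" using \<phi> by simp
      then show "integrable m (\<lambda>x. \<integral>y. norm (case (x, y) of (x, y) \<Rightarrow> \<phi> x * g y) \<partial>m)"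
        by (simp add: norm_mult)
      show "AE x in m. integrable m (\<lambda>y. case (x, y) of (x, y) \<Rightarrow> \<phi> x * g y)" using g by simp
    qed
    show "(\<lambda>(x, y). \<phi> x * (K x y * g y)) \<in> borel_measurable (m \<Otimes>\<^sub>M m)" by measurable
    have "cmod (\<phi> x * (K x y * g y)) \<le> cmod (\<phi> x * g y)" for x y
      using mult_right_mono[OF K1[of x y], of "cmod (g y)"]
      by (simp add: norm_mult mult_left_mono)
    then show "AE z in m \<Otimes>\<^sub>M m. norm (case z of (x, y) \<Rightarrow> \<phi> x * (K x y * g y)) \<le> norm (case z of (x, y) \<Rightarrow> \<phi> x * g y)"
      by (auto simp: case_prod_beta)
  qed
  have "(\<integral>x. \<phi> x * (\<integral>y. K x y * g y \<partial>m) \<partial>m) = (\<integral>x. (\<integral>y. \<phi> x * (K x y * g y) \<partial>m) \<partial>m)"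
    by simp
  also have "\<dots> = (\<integral>y. (\<integral>x. \<phi> x * (K x y * g y) \<partial>m) \<partial>m)"
    by (rule pair.Fubini_integral[OF int, symmetric])
  also have "\<dots> = (\<integral>y. (\<integral>x. (\<phi> x * K x y) * g y \<partial>m) \<partial>m)" by (simp add: mult.assoc)
  finally show ?thesis by simp
qed

lemma integrable_char_mult:
  assumes "integrable m g"
  shows "integrable m (\<lambda>x. padic_char (\<xi> * x) * g x)"
proof (rule Bochner_Integration.integrable_bound[OF assms])
  note [measurable] = borel_measurable_integrable[OF assms]
  show "(\<lambda>x. padic_char (\<xi> * x) * g x) \<in> borel_measurable m" by measurable
qed (simp add: norm_mult)

lemma measurable_fourier_L1:
  assumes "integrable m g"
  shows "fourier_L1 m g \<in> borel_measurable borel"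
proof -
  note [measurable] = borel_measurable_integrable[OF assms]
  have "(\<lambda>\<xi>. \<integral>x. padic_char (\<xi> * x) * g x \<partial>m) \<in> borel_measurable borel" by measurable
  then show ?thesis by (simp add: fourier_L1_def[abs_def])
qed

lemma cmod_fourier_L1_le: "cmod (fourier_L1 m g \<xi>) \<le> (\<integral>x. cmod (g x) \<partial>m)"
  unfolding fourier_L1_def by (rule order_trans[OF integral_norm_bound]) (simp add: norm_mult)

lemma fourier_L1_lincomb:
  assumes "integrable m f" "integrable m g"
  shows "fourier_L1 m (\<lambda>x. a * f x + b * g x) = (\<lambda>\<xi>. a * fourier_L1 m f \<xi> + b * fourier_L1 m g \<xi>)"
proof
  fix \<xi> :: "'p padic"
  have "fourier_L1 m (\<lambda>x. a * f x + b * g x) \<xi>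
      = (\<integral>x. a * (padic_char (\<xi> * x) * f x) + b * (padic_char (\<xi> * x) * g x) \<partial>m)"
    by (simp add: fourier_L1_def algebra_simps)
  also have "\<dots> = a * fourier_L1 m f \<xi> + b * fourier_L1 m g \<xi>"
    using integrable_char_mult[OF assms(1)] integrable_char_mult[OF assms(2)] by (simp add: fourier_L1_def)
  finally show "fourier_L1 m (\<lambda>x. a * f x + b * g x) \<xi> = a * fourier_L1 m f \<xi> + b * fourier_L1 m g \<xi>" .
qed

lemma integrable_indicator_ball: "integrable m (indicator (padic_ball a n) :: _ \<Rightarrow> complex)"
proof -
  have "integrable m (\<lambda>x. indicator (padic_ball a n) x * cnj (indicator (padic_ball a n) x) :: complex)"
    by (rule integrable_L2_mult_cnj) simp_all
  moreover have "(\<lambda>x. indicator (padic_ball a n) x * cnj (indicator (padic_ball a n) x)) = (indicator (padic_ball a n) :: _ \<Rightarrow> complex)"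
    by (auto simp: indicator_def)
  ultimately show ?thesis by simp
qed

lemma integrable_ball_mult:
  assumes "f \<in> L2 m" shows "integrable m (\<lambda>x. indicator (padic_ball a n) x * f x)"
proof -
  have "(\<lambda>x. f x * cnj (indicator (padic_ball a n) x)) = (\<lambda>x. indicator (padic_ball a n) x * f x)"
    by (auto simp: indicator_def)
  then show ?thesis using integrable_L2_mult_cnj[OF assms ball_indicator_L2[of a n]] by simp
qed

text \<open>The Dirichlet kernel is harmless here: the integral of the character over a ball is
  \<open>p^n\<close> times the indicator of the dual ball of radius \<open>p^(-n)\<close>, so
  truncating frequencies is the same as averaging.\<close>

lemma truncated_inversion:
  assumes g: "integrable m g"
  shows "(\<integral>\<xi>. indicator (padic_ball 0 n) \<xi> * fourier_L1 m g \<xi> * cnj (padic_char (\<xi> * x)) \<partial>m) = avg n g x"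
proof -
  define \<phi> where "\<phi> \<xi> = indicator (padic_ball 0 n) \<xi> * cnj (padic_char (\<xi> * x))" for \<xi> :: "'p padic"
  have \<phi>: "integrable m \<phi>"
    unfolding \<phi>_def
    by (rule Bochner_Integration.integrable_bound[OF integrable_indicator_ball[of 0 n]])
       (auto simp: norm_mult)
  have "(\<integral>\<xi>. indicator (padic_ball 0 n) \<xi> * fourier_L1 m g \<xi> * cnj (padic_char (\<xi> * x)) \<partial>m)
      = (\<integral>\<xi>. \<phi> \<xi> * (\<integral>y. padic_char (\<xi> * y) * g y \<partial>m) \<partial>m)"
    by (simp add: \<phi>_def fourier_L1_def mult_ac)
  also have "\<dots> = (\<integral>y. (\<integral>\<xi>. \<phi> \<xi> * padic_char (\<xi> * y) \<partial>m) * g y \<partial>m)"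
  proof (rule Fubini_bounded_kernel[OF \<phi> g])
    have "(\<lambda>z. padic_char (fst z * snd z :: 'p padic)) \<in> borel_measurable (borel \<Otimes>\<^sub>M borel)" by measurable
    then show "(\<lambda>(\<xi>, y). padic_char (\<xi> * y :: 'p padic)) \<in> borel_measurable (borel \<Otimes>\<^sub>M borel)"
      by (simp add: case_prod_beta')
  qed simp
  also have "\<dots> = (\<integral>y. of_real (real CARD('p) powi n) * (g y * cnj (indicator (padic_ball x (- n)) y)) \<partial>m)"
  proof (intro Bochner_Integration.integral_cong refl)
    fix y
    have "(\<integral>\<xi>. \<phi> \<xi> * padic_char (\<xi> * y) \<partial>m)
        = (\<integral>\<xi>. indicator (padic_ball 0 n) \<xi> * padic_char (\<xi> * (y - x)) \<partial>m)"
      by (simp add: \<phi>_def right_diff_distrib padic_char_diff mult_ac)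
    also have "\<dots> = of_real (real CARD('p) powi n) * indicator (padic_ball x (- n)) y"
      unfolding integral_char_ball by (simp add: indicator_def padic_ball_def)
    finally show "(\<integral>\<xi>. \<phi> \<xi> * padic_char (\<xi> * y) \<partial>m) * g y
        = of_real (real CARD('p) powi n) * (g y * cnj (indicator (padic_ball x (- n)) y))"
      by (simp add: indicator_def)
  qed
  also have "\<dots> = avg n g x" by (simp add: avg_def inner_L2_def)
  finally show ?thesis .
qed

text \<open>The truncated inversion formula is paired with \<open>g\<close> itself.\<close>

lemma truncated_Plancherel:
  assumes g: "integrable m g" and g2: "g \<in> L2 m"
  shows "(\<lambda>\<xi>. indicator (padic_ball 0 n) \<xi> * fourier_L1 m g \<xi>) \<in> L2 m"
    and "of_real ((norm_L2 m (\<lambda>\<xi>. indicator (padic_ball 0 n) \<xi> * fourier_L1 m g \<xi>))\<^sup>2) = inner_L2 m (avg n g) g"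
proof -
  define G where "G \<xi> = indicator (padic_ball 0 n) \<xi> * fourier_L1 m g \<xi>" for \<xi>
  have Fm [measurable]: "fourier_L1 m g \<in> borel_measurable borel" by (rule measurable_fourier_L1[OF g])
  have Gm: "G \<in> borel_measurable borel" unfolding G_def by measurable
  have b: "cmod (G \<xi>) \<le> (\<integral>x. cmod (g x) \<partial>m) * cmod (indicator (padic_ball 0 n) \<xi> :: complex)" for \<xi>
    using cmod_fourier_L1_le[of g \<xi>] by (simp add: G_def indicator_def)
  have GL2: "G \<in> L2 m"
    by (rule L2_dominated(1)[OF ball_indicator_L2[of 0 n]]) (use Gm b in auto)
  then show "(\<lambda>\<xi>. indicator (padic_ball 0 n) \<xi> * fourier_L1 m g \<xi>) \<in> L2 m" by (simp add: G_def[abs_def])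
  have Gi: "integrable m G"
  proof (rule Bochner_Integration.integrable_bound)
    show "integrable m (\<lambda>\<xi>. (\<integral>x. cmod (g x) \<partial>m) * cmod (indicator (padic_ball 0 n) \<xi> :: complex))"
      using integrable_norm[OF integrable_indicator_ball[of 0 n]] by simp
    show "AE \<xi> in m. norm (G \<xi>) \<le> norm ((\<integral>x. cmod (g x) \<partial>m) * cmod (indicator (padic_ball 0 n) \<xi> :: complex))"
      using b by (auto simp: abs_mult intro: order_trans)
  qed (use Gm in simp)
  have "of_real ((norm_L2 m G)\<^sup>2) = inner_L2 m G G" by (rule inner_L2_self[symmetric])
  also have "\<dots> = (\<integral>\<xi>. G \<xi> * (\<integral>y. cnj (padic_char (\<xi> * y)) * cnj (g y) \<partial>m) \<partial>m)"
    unfolding inner_L2_def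
  proof (intro Bochner_Integration.integral_cong refl)
    fix \<xi>
    have "cnj (fourier_L1 m g \<xi>) = (\<integral>y. cnj (padic_char (\<xi> * y)) * cnj (g y) \<partial>m)"
      by (simp add: fourier_L1_def flip: Bochner_Integration.integral_cnj)
    then show "G \<xi> * cnj (G \<xi>) = G \<xi> * (\<integral>y. cnj (padic_char (\<xi> * y)) * cnj (g y) \<partial>m)"
      by (simp add: G_def indicator_def)
  qed
  also have "\<dots> = (\<integral>y. (\<integral>\<xi>. G \<xi> * cnj (padic_char (\<xi> * y)) \<partial>m) * cnj (g y) \<partial>m)"
    by (rule Fubini_bounded_kernel[OF Gi]) (use g in \<open>auto\<close>)
  also have "\<dots> = inner_L2 m (avg n g) g"
    unfolding G_def truncated_inversion[OF g] inner_L2_def ..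
  finally show "of_real ((norm_L2 m (\<lambda>\<xi>. indicator (padic_ball 0 n) \<xi> * fourier_L1 m g \<xi>))\<^sup>2) = inner_L2 m (avg n g) g"
    by (simp add: G_def[abs_def])
qed

lemma tendsto_ball_mult:
  assumes f: "f \<in> L2 m"
  shows "tendsto_L2 m (\<lambda>n x. indicator (padic_ball 0 (int n)) x * f x) f"
proof (rule tendsto_L2_dominated[OF _ f f])
  note [measurable] = L2_measurable[OF f]
  show "(\<lambda>x. indicator (padic_ball 0 (int n)) x * f x) \<in> borel_measurable m" for n by measurable
  show "AE x in m. (\<lambda>n. indicator (padic_ball 0 (int n)) x * f x) \<longlonglongrightarrow> f x"
  proof (rule AE_I2)
    fix x
    show "(\<lambda>n. indicator (padic_ball 0 (int n)) x * f x) \<longlonglongrightarrow> f x"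
      using tendsto_mult[OF indicator_ball_tendsto[of x] tendsto_const[of "f x"]] by simp
  qed
qed (auto simp: indicator_def)

text \<open>The squared norms of the truncated transforms are \<open>inner_L2 m (avg n g) g\<close>,
  bounded by the contraction property. Fatou yields membership; then both sides converge, by
  truncation on the frequency side and by convergence of averages on the other.\<close>

theorem Plancherel:
  assumes g: "integrable m g" and g2: "g \<in> L2 m"
  shows "fourier_L1 m g \<in> L2 m" "norm_L2 m (fourier_L1 m g) = norm_L2 m g"
proof -
  let ?F = "fourier_L1 m g" and ?u = "\<lambda>n \<xi>. indicator (padic_ball 0 (int n)) \<xi> * fourier_L1 m g \<xi>"
  have Fm [measurable]: "?F \<in> borel_measurable borel" by (rule measurable_fourier_L1[OF g])
  have nrm: "(norm_L2 m (?u n))\<^sup>2 = Re (inner_L2 m (avg (int n) g) g)" for n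
    using arg_cong[OF truncated_Plancherel(2)[OF assms, of "int n"], of Re] by simp
  have le: "(norm_L2 m (?u n))\<^sup>2 \<le> (norm_L2 m g)\<^sup>2" for n
  proof -
    have "(norm_L2 m (?u n))\<^sup>2 \<le> norm_L2 m (avg (int n) g) * norm_L2 m g"
      unfolding nrm using cmod_inner_L2_le[OF avg_L2(1)[OF g2, of "int n"] g2] complex_Re_le_cmod order_trans by blast
    also have "\<dots> \<le> norm_L2 m g * norm_L2 m g" by (intro mult_right_mono avg_L2 g2) simp
    finally show ?thesis by (simp add: power2_eq_square)
  qed
  show L2: "?F \<in> L2 m"
  proof (rule L2_Fatou(1)[of ?u])
    show "?u n \<in> L2 m" for n by (rule truncated_Plancherel(1)[OF assms])
    show "AE \<xi> in m. (\<lambda>n. ?u n \<xi>) \<longlonglongrightarrow> ?F \<xi>"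
    proof (rule AE_I2)
      fix \<xi>
      show "(\<lambda>n. ?u n \<xi>) \<longlonglongrightarrow> ?F \<xi>"
        using tendsto_mult[OF indicator_ball_tendsto[of \<xi>] tendsto_const[of "?F \<xi>"]] by simp
    qed
    show "\<forall>\<^sub>F n in sequentially. (norm_L2 m (?u n))\<^sup>2 \<le> (norm_L2 m g)\<^sup>2" using le by simp
  qed simp
  have "(\<lambda>n. norm_L2 m (?u n)) \<longlonglongrightarrow> norm_L2 m ?F"
    by (rule tendsto_norm_L2[OF truncated_Plancherel(1)[OF assms] L2 tendsto_ball_mult[OF L2]])
  then have 1: "(\<lambda>n. (norm_L2 m (?u n))\<^sup>2) \<longlonglongrightarrow> (norm_L2 m ?F)\<^sup>2" by (rule tendsto_power)
  have "(\<lambda>n. inner_L2 m (avg (int n) g) g - inner_L2 m g g) \<longlonglongrightarrow> 0"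
  proof (rule Lim_null_comparison)
    have "cmod (inner_L2 m (avg (int n) g) g - inner_L2 m g g) \<le> norm_L2 m (\<lambda>x. avg (int n) g x - g x) * norm_L2 m g" for n
      using cmod_inner_L2_le[OF L2_diff[OF avg_L2(1)[OF g2] g2] g2, of "int n"]
        inner_L2_diff_left[OF avg_L2(1)[OF g2] g2 g2, of "int n"] by simp
    then show "\<forall>\<^sub>F n in sequentially. norm (inner_L2 m (avg (int n) g) g - inner_L2 m g g)
        \<le> norm_L2 m (\<lambda>x. avg (int n) g x - g x) * norm_L2 m g" by simp
    show "(\<lambda>n. norm_L2 m (\<lambda>x. avg (int n) g x - g x) * norm_L2 m g) \<longlonglongrightarrow> 0"
      using avg_tendsto[OF g2] unfolding tendsto_L2_def by (rule tendsto_mult_left_zero)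
  qed
  then have "(\<lambda>n. inner_L2 m (avg (int n) g) g) \<longlonglongrightarrow> inner_L2 m g g" by (rule LIM_zero_cancel)
  then have 2: "(\<lambda>n. (norm_L2 m (?u n))\<^sup>2) \<longlonglongrightarrow> (norm_L2 m g)\<^sup>2"
    unfolding nrm using tendsto_Re by (fastforce simp: inner_L2_self)
  from LIMSEQ_unique[OF 1 2] show "norm_L2 m ?F = norm_L2 m g" by simp
qed

text \<open>Two conjugations turn the kernel into its conjugate; in this form the facts about
  \<open>fourier_L1\<close> apply directly.\<close>

definition inverse_fourier :: "('p padic \<Rightarrow> complex) \<Rightarrow> 'p padic \<Rightarrow> complex" where
  "inverse_fourier G x = cnj (fourier_L1 m (\<lambda>\<xi>. cnj (G \<xi>)) x)"

lemma L2_cnj: "f \<in> L2 M \<Longrightarrow> (\<lambda>x. cnj (f x)) \<in> L2 M"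
  by (rule L2_dominated(1)[of f M _ 1]) (auto dest: L2_measurable)

lemma avg_cnj: "avg n (\<lambda>x. cnj (g x)) x = cnj (avg n g x)"
proof -
  have "inner_L2 m (\<lambda>x. cnj (g x)) (indicator (padic_ball x (- n))) = cnj (inner_L2 m g (indicator (padic_ball x (- n))))"
    unfolding inner_L2_def by (subst Bochner_Integration.integral_cnj[symmetric]) simp
  then show ?thesis by (simp add: avg_def)
qed

text \<open>Truncated inversion with the two variables exchanged. It exhibits the averages of
  \<open>G\<close> as transforms, which is how surjectivity of the transform is reached.\<close>

lemma fourier_truncated_inverse:
  assumes G: "integrable m G"
  shows "fourier_L1 m (\<lambda>x. indicator (padic_ball 0 n) x * inverse_fourier G x) \<xi> = avg n G \<xi>"
proof -
  have "integrable m (\<lambda>\<xi>. cnj (G \<xi>))" using G by simp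
  from truncated_inversion[OF this, of n \<xi>]
  have "cnj (\<integral>x. indicator (padic_ball 0 n) x * fourier_L1 m (\<lambda>\<xi>. cnj (G \<xi>)) x * cnj (padic_char (x * \<xi>)) \<partial>m) = avg n G \<xi>"
    by (simp add: avg_cnj)
  moreover have "cnj (\<integral>x. indicator (padic_ball 0 n) x * fourier_L1 m (\<lambda>\<xi>. cnj (G \<xi>)) x * cnj (padic_char (x * \<xi>)) \<partial>m)
      = fourier_L1 m (\<lambda>x. indicator (padic_ball 0 n) x * inverse_fourier G x) \<xi>"
    unfolding fourier_L1_def[of m _ \<xi>] inverse_fourier_def
    by (subst Bochner_Integration.integral_cnj[symmetric]) (simp add: mult_ac)
  ultimately show ?thesis by simp
qed

lemma inverse_fourier_L2:
  assumes "integrable m G" "G \<in> L2 m"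
  shows "inverse_fourier G \<in> L2 m"
  unfolding inverse_fourier_def[abs_def] using assms by (intro L2_cnj Plancherel) (auto intro: L2_cnj)

section \<open>The transform on L2 as a closed relation\<close>

lemma has_fourier_L2D: "has_fourier_L2 m f F \<Longrightarrow> f \<in> L2 m" "has_fourier_L2 m f F \<Longrightarrow> F \<in> L2 m"
  by (simp_all add: has_fourier_L2_def)

lemma has_fourier_L2_integrable:
  assumes "integrable m g" "g \<in> L2 m"
  shows "has_fourier_L2 m g (fourier_L1 m g)"
  unfolding has_fourier_L2_def using Plancherel[OF assms] assms
  by (auto intro!: exI[of _ "\<lambda>_. g"] simp: tendsto_L2_def)

lemma has_fourier_L2I:
  assumes "f \<in> L2 m" "F \<in> L2 m" "\<And>n. g n \<in> L2 m" "\<And>n. integrable m (g n)"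
    and "tendsto_L2 m g f" "tendsto_L2 m (\<lambda>n. fourier_L1 m (g n)) F"
  shows "has_fourier_L2 m f F"
  unfolding has_fourier_L2_def using assms Plancherel(1)[OF assms(4,3)]
  by (intro conjI exI[of _ g] allI) auto

lemma has_fourier_L2_norm:
  assumes "has_fourier_L2 m f F" shows "norm_L2 m F = norm_L2 m f"
proof -
  obtain g where g: "\<And>n. g n \<in> L2 m" "\<And>n. integrable m (g n)"
    and lim: "tendsto_L2 m g f" "tendsto_L2 m (\<lambda>n. fourier_L1 m (g n)) F"
    using assms by (auto simp: has_fourier_L2_def)
  note fF = has_fourier_L2D[OF assms]
  have "(\<lambda>n. norm_L2 m (fourier_L1 m (g n))) \<longlonglongrightarrow> norm_L2 m F"
    by (rule tendsto_norm_L2[OF Plancherel(1)[OF g(2,1)] fF(2) lim(2)])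
  then have "(\<lambda>n. norm_L2 m (g n)) \<longlonglongrightarrow> norm_L2 m F" by (simp add: Plancherel(2)[OF g(2,1)])
  from LIMSEQ_unique[OF this tendsto_norm_L2[OF g(1) fF(1) lim(1)]] show ?thesis .
qed

lemma has_fourier_L2_lincomb:
  assumes "has_fourier_L2 m f F" "has_fourier_L2 m f' F'"
  shows "has_fourier_L2 m (\<lambda>x. a * f x + b * f' x) (\<lambda>\<xi>. a * F \<xi> + b * F' \<xi>)"
proof -
  obtain g where g: "\<And>n. g n \<in> L2 m" "\<And>n. integrable m (g n)"
    and lim: "tendsto_L2 m g f" "tendsto_L2 m (\<lambda>n. fourier_L1 m (g n)) F"
    using assms(1) by (auto simp: has_fourier_L2_def)
  obtain g' where g': "\<And>n. g' n \<in> L2 m" "\<And>n. integrable m (g' n)"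
    and lim': "tendsto_L2 m g' f'" "tendsto_L2 m (\<lambda>n. fourier_L1 m (g' n)) F'"
    using assms(2) by (auto simp: has_fourier_L2_def)
  note L = has_fourier_L2D[OF assms(1)] has_fourier_L2D[OF assms(2)]
  let ?h = "\<lambda>n x. a * g n x + b * g' n x"
  have h: "?h n \<in> L2 m" "integrable m (?h n)" for n
    using g g' by (auto intro: L2_lincomb)
  have 1: "tendsto_L2 m ?h (\<lambda>x. a * f x + b * f' x)"
    by (rule tendsto_L2_lincomb) (use g g' lim lim' L in auto)
  have 2: "tendsto_L2 m (\<lambda>n. fourier_L1 m (?h n)) (\<lambda>\<xi>. a * F \<xi> + b * F' \<xi>)"
    unfolding fourier_L1_lincomb[OF g(2) g'(2)]
    by (rule tendsto_L2_lincomb) (use Plancherel(1)[OF g(2,1)] Plancherel(1)[OF g'(2,1)] lim lim' L in auto)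
  show ?thesis by (rule has_fourier_L2I[OF L2_lincomb[OF L(1,3)] L2_lincomb[OF L(2,4)] h 1 2])
qed

lemma has_fourier_L2_diff:
  "has_fourier_L2 m f F \<Longrightarrow> has_fourier_L2 m f' F' \<Longrightarrow> has_fourier_L2 m (\<lambda>x. f x - f' x) (\<lambda>\<xi>. F \<xi> - F' \<xi>)"
  using has_fourier_L2_lincomb[of f F f' F' 1 "-1"] by simp

lemma tendsto_L2_cong_AE:
  assumes "\<And>n. u n \<in> L2 M" "f \<in> L2 M" "g \<in> borel_measurable M" "AE x in M. f x = g x" "tendsto_L2 M u f"
  shows "tendsto_L2 M u g"
proof -
  note [measurable] = assms(1,2)[THEN L2_measurable] assms(3)
  have "norm_L2 M (\<lambda>x. u n x - f x) = norm_L2 M (\<lambda>x. u n x - g x)" for n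
    by (rule norm_L2_cong_AE) (use assms(4) in auto)
  with assms(5) show ?thesis by (simp add: tendsto_L2_def)
qed

lemma has_fourier_L2_cong_AE:
  assumes "has_fourier_L2 m f F" "f' \<in> borel_measurable borel" "F' \<in> borel_measurable borel"
    "AE x in m. f x = f' x" "AE x in m. F x = F' x"
  shows "has_fourier_L2 m f' F'"
proof -
  obtain g where g: "\<And>n. g n \<in> L2 m \<and> integrable m (g n) \<and> fourier_L1 m (g n) \<in> L2 m"
    and lim: "tendsto_L2 m g f" "tendsto_L2 m (\<lambda>n. fourier_L1 m (g n)) F"
    using assms(1) by (auto simp: has_fourier_L2_def)
  note L = has_fourier_L2D[OF assms(1)]
  have "f' \<in> L2 m" "F' \<in> L2 m" using L2_cong_AE[OF L(1) _ assms(4)] L2_cong_AE[OF L(2) _ assms(5)] assms(2,3) by simp_all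
  moreover have "tendsto_L2 m g f'" by (rule tendsto_L2_cong_AE[OF _ L(1) _ assms(4) lim(1)]) (use g assms in auto)
  moreover have "tendsto_L2 m (\<lambda>n. fourier_L1 m (g n)) F'"
    by (rule tendsto_L2_cong_AE[OF _ L(2) _ assms(5) lim(2)]) (use g assms in auto)
  ultimately show ?thesis using g unfolding has_fourier_L2_def by blast
qed

lemma has_fourier_L2_unique:
  assumes "has_fourier_L2 m f F" "has_fourier_L2 m f' F'" "AE x in m. f x = f' x"
  shows "AE \<xi> in m. F \<xi> = F' \<xi>"
proof -
  note d = has_fourier_L2_diff[OF assms(1,2)]
  have "norm_L2 m (\<lambda>\<xi>. F \<xi> - F' \<xi>) = 0"
    using has_fourier_L2_norm[OF d] norm_L2_eq_0_iff[OF has_fourier_L2D(1)[OF d]] assms(3) by simp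
  then show ?thesis using norm_L2_eq_0_iff[OF has_fourier_L2D(2)[OF d]] by simp
qed

lemma has_fourier_L2_inject:
  assumes "has_fourier_L2 m f F" "has_fourier_L2 m f' F'" "AE \<xi> in m. F \<xi> = F' \<xi>"
  shows "AE x in m. f x = f' x"
proof -
  note d = has_fourier_L2_diff[OF assms(1,2)]
  have "norm_L2 m (\<lambda>x. f x - f' x) = 0"
    using has_fourier_L2_norm[OF d] norm_L2_eq_0_iff[OF has_fourier_L2D(2)[OF d]] assms(3) by simp
  then show ?thesis using norm_L2_eq_0_iff[OF has_fourier_L2D(1)[OF d]] by simp
qed

text \<open>Polarisation of the norm identity; the factors \<open>1\<close> and
  \<open>- \<i>\<close> extract the real and the imaginary part.\<close>

lemma has_fourier_L2_inner:
  assumes "has_fourier_L2 m f F" "has_fourier_L2 m g G"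
  shows "inner_L2 m F G = inner_L2 m f g"
proof -
  note L = has_fourier_L2D[OF assms(1)] has_fourier_L2D[OF assms(2)]
  have "Re (b * inner_L2 m F G) = Re (b * inner_L2 m f g)" if b: "cmod b = 1" for b
  proof -
    have "norm_L2 m (\<lambda>\<xi>. b * F \<xi> + 1 * G \<xi>) = norm_L2 m (\<lambda>x. b * f x + 1 * g x)"
      by (rule has_fourier_L2_norm[OF has_fourier_L2_lincomb[OF assms]])
    then have "Re (inner_L2 m (\<lambda>\<xi>. b * F \<xi> + 1 * G \<xi>) (\<lambda>\<xi>. b * F \<xi> + 1 * G \<xi>))
        = Re (inner_L2 m (\<lambda>x. b * f x + 1 * g x) (\<lambda>x. b * f x + 1 * g x))"
      by (simp only: inner_L2_self)
    then show ?thesis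
      unfolding hform.Q_expand[OF hform_L2 L(2,4)] hform.Q_expand[OF hform_L2 L(1,3)]
      by (simp add: inner_L2_self has_fourier_L2_norm[OF assms(1)] has_fourier_L2_norm[OF assms(2)])
  qed
  from this[of 1] this[of "- \<i>"] show ?thesis by (simp add: complex_eq_iff)
qed

text \<open>A diagonal choice: the definition admits only approximation by integrable functions, so
  each \<open>f n\<close> is replaced by such a function within \<open>1 / (n + 1)\<close>,
  simultaneously for the transforms.\<close>

lemma has_fourier_L2_closed:
  assumes FT: "\<And>n. has_fourier_L2 m (f n) (F n)"
    and f: "f\<^sub>0 \<in> L2 m" "tendsto_L2 m f f\<^sub>0" and F: "F\<^sub>0 \<in> L2 m" "tendsto_L2 m F F\<^sub>0"
  shows "has_fourier_L2 m f\<^sub>0 F\<^sub>0"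
proof -
  have ex: "\<exists>g. g \<in> L2 m \<and> integrable m g \<and> norm_L2 m (\<lambda>x. g x - f n x) < 1 / real (Suc n)
      \<and> norm_L2 m (\<lambda>x. fourier_L1 m g x - F n x) < 1 / real (Suc n)" for n
  proof -
    obtain g where g: "\<And>k. g k \<in> L2 m" "\<And>k. integrable m (g k)"
      and lim: "tendsto_L2 m g (f n)" "tendsto_L2 m (\<lambda>k. fourier_L1 m (g k)) (F n)"
      using FT[of n] by (auto simp: has_fourier_L2_def)
    have p: "0 < 1 / real (Suc n)" by simp
    have "\<forall>\<^sub>F k in sequentially. norm_L2 m (\<lambda>x. g k x - f n x) < 1 / real (Suc n)
        \<and> norm_L2 m (\<lambda>x. fourier_L1 m (g k) x - F n x) < 1 / real (Suc n)"
      using order_tendstoD(2)[OF lim(1)[unfolded tendsto_L2_def] p] order_tendstoD(2)[OF lim(2)[unfolded tendsto_L2_def] p]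
      by (rule eventually_conj)
    from eventually_happens'[OF sequentially_bot this] show ?thesis using g by blast
  qed
  from choice[OF allI[OF ex]] obtain g where
    "\<forall>n. g n \<in> L2 m \<and> integrable m (g n) \<and> norm_L2 m (\<lambda>x. g n x - f n x) < 1 / real (Suc n)
      \<and> norm_L2 m (\<lambda>x. fourier_L1 m (g n) x - F n x) < 1 / real (Suc n)" ..
  then have g: "\<And>n. g n \<in> L2 m" "\<And>n. integrable m (g n)"
    and le: "\<And>n. norm_L2 m (\<lambda>x. g n x - f n x) < 1 / real (Suc n)"
      "\<And>n. norm_L2 m (\<lambda>x. fourier_L1 m (g n) x - F n x) < 1 / real (Suc n)" by blast+
  note gF = Plancherel(1)[OF g(2,1)]
  have *: "tendsto_L2 m h h\<^sub>0"
    if "\<And>n. h n \<in> L2 m" "\<And>n. u n \<in> L2 m" "h\<^sub>0 \<in> L2 m" "tendsto_L2 m u h\<^sub>0"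
      "\<And>n. norm_L2 m (\<lambda>x. h n x - u n x) < 1 / real (Suc n)" for h u h\<^sub>0
    unfolding tendsto_L2_def
  proof (rule Lim_null_comparison)
    have "norm_L2 m (\<lambda>x. h n x - h\<^sub>0 x) \<le> 1 / real (Suc n) + norm_L2 m (\<lambda>x. u n x - h\<^sub>0 x)" for n
      using norm_L2_triangle[OF that(1)[of n] that(2)[of n] that(3)] that(5)[of n] by simp
    then show "\<forall>\<^sub>F n in sequentially. norm (norm_L2 m (\<lambda>x. h n x - h\<^sub>0 x)) \<le> 1 / real (Suc n) + norm_L2 m (\<lambda>x. u n x - h\<^sub>0 x)"
      by simp
    show "(\<lambda>n. 1 / real (Suc n) + norm_L2 m (\<lambda>x. u n x - h\<^sub>0 x)) \<longlonglongrightarrow> 0"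
      using tendsto_add[OF LIMSEQ_Suc[OF lim_1_over_n] that(4)[unfolded tendsto_L2_def]] by simp
  qed
  have "tendsto_L2 m g f\<^sub>0" by (rule *[OF g(1) has_fourier_L2D(1)[OF FT] f le(1)])
  moreover have "tendsto_L2 m (\<lambda>n. fourier_L1 m (g n)) F\<^sub>0" by (rule *[OF gF has_fourier_L2D(2)[OF FT] F le(2)])
  ultimately show ?thesis by (rule has_fourier_L2I[OF f(1) F(1) g])
qed

lemma has_fourier_L2_inverse:
  assumes G: "integrable m G" "G \<in> L2 m"
  shows "has_fourier_L2 m (inverse_fourier G) G"
proof (rule has_fourier_L2_closed)
  note L = inverse_fourier_L2[OF G]
  show "has_fourier_L2 m (\<lambda>x. indicator (padic_ball 0 (int n)) x * inverse_fourier G x) (avg (int n) G)" for n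
  proof -
    have "fourier_L1 m (\<lambda>x. indicator (padic_ball 0 (int n)) x * inverse_fourier G x) = avg (int n) G"
      by (rule ext) (rule fourier_truncated_inverse[OF G(1)])
    then show ?thesis
      using has_fourier_L2_integrable[OF integrable_ball_mult[OF L, of 0 "int n"] L2_indicator_mult[OF L, of "padic_ball 0 (int n)"]]
      by simp
  qed
  show "inverse_fourier G \<in> L2 m" "G \<in> L2 m" by (fact L G(2))+
  show "tendsto_L2 m (\<lambda>n x. indicator (padic_ball 0 (int n)) x * inverse_fourier G x) (inverse_fourier G)"
    by (rule tendsto_ball_mult[OF L])
  show "tendsto_L2 m (\<lambda>n. avg (int n) G) G" by (rule avg_tendsto[OF G(2)])
qed

lemma has_fourier_L2_ex:
  assumes f: "f \<in> L2 m" obtains F where "has_fourier_L2 m f F"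
proof -
  define u where "u n x = indicator (padic_ball 0 (int n)) x * f x" for n :: nat and x
  have u: "u n \<in> L2 m" "integrable m (u n)" for n
    unfolding u_def by (auto intro: L2_indicator_mult[OF f] integrable_ball_mult[OF f])
  have lim: "tendsto_L2 m u f" unfolding u_def[abs_def] by (rule tendsto_ball_mult[OF f])
  note FT = has_fourier_L2_integrable[OF u(2,1)]
  note FL = has_fourier_L2D(2)[OF FT]
  have eq: "norm_L2 m (\<lambda>x. fourier_L1 m (u k) x - fourier_L1 m (u n) x) = norm_L2 m (\<lambda>x. u k x - u n x)" for k n
    by (rule has_fourier_L2_norm[OF has_fourier_L2_diff[OF FT FT]])
  obtain F where F: "F \<in> L2 m" "tendsto_L2 m (\<lambda>n. fourier_L1 m (u n)) F"
    by (rule L2_complete[OF FL]) (use eq tendsto_L2_Cauchy[OF u(1) f lim] in auto)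
  show ?thesis by (rule that[OF has_fourier_L2_closed[OF FT f lim F]])
qed

lemma has_fourier_L2_ex_inverse:
  assumes F: "F \<in> L2 m" obtains f where "has_fourier_L2 m f F"
proof -
  define u where "u n x = indicator (padic_ball 0 (int n)) x * F x" for n :: nat and x
  have u: "u n \<in> L2 m" "integrable m (u n)" for n
    unfolding u_def by (auto intro: L2_indicator_mult[OF F] integrable_ball_mult[OF F])
  have lim: "tendsto_L2 m u F" unfolding u_def[abs_def] by (rule tendsto_ball_mult[OF F])
  note FT = has_fourier_L2_inverse[OF u(2,1)]
  note FL = has_fourier_L2D(1)[OF FT]
  have eq: "norm_L2 m (\<lambda>x. inverse_fourier (u k) x - inverse_fourier (u n) x) = norm_L2 m (\<lambda>x. u k x - u n x)" for k n
    by (rule has_fourier_L2_norm[OF has_fourier_L2_diff[OF FT FT], symmetric])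
  obtain f where f: "f \<in> L2 m" "tendsto_L2 m (\<lambda>n. inverse_fourier (u n)) f"
    by (rule L2_complete[OF FL]) (use eq tendsto_L2_Cauchy[OF u(1) F lim] in auto)
  show ?thesis by (rule that[OF has_fourier_L2_closed[OF FT f F lim]])
qed

text \<open>\<open>f\<close> is the inverse integral of \<open>F\<close> over a ball of volume
  \<open>p^k\<close>, so its supremum is at most the L1 norm of \<open>F\<close> there, which
  Cauchy-Schwarz bounds by the square root of the volume times the L2 norm.\<close>

lemma band_limited_bounded:
  assumes FT: "has_fourier_L2 m f F" and supp: "AE \<xi> in m. \<xi> \<notin> padic_ball 0 k \<longrightarrow> F \<xi> = 0"
  shows "AE x in m. (cmod (f x))\<^sup>2 \<le> real CARD('p) powi k * (norm_L2 m F)\<^sup>2"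
proof -
  note L = has_fourier_L2D[OF FT]
  define G where "G \<xi> = indicator (padic_ball 0 k) \<xi> * F \<xi>" for \<xi>
  have G: "G \<in> L2 m" "integrable m G"
    unfolding G_def by (auto intro: L2_indicator_mult[OF L(2)] integrable_ball_mult[OF L(2)])
  have "AE \<xi> in m. F \<xi> = G \<xi>" using supp by eventually_elim (auto simp: G_def indicator_def)
  from has_fourier_L2_inject[OF FT has_fourier_L2_inverse[OF G(2,1)] this]
  have ae: "AE x in m. f x = inverse_fourier G x" .
  have GF: "norm_L2 m G \<le> norm_L2 m F"
  proof (rule power2_le_imp_le)
    show "(norm_L2 m G)\<^sup>2 \<le> (norm_L2 m F)\<^sup>2"
      using L2_dominated(2)[OF L(2) L2_measurable[OF G(1)], of 1] by (simp add: G_def indicator_def)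
  qed simp
  have "cmod (inverse_fourier G x) \<le> norm_L2 m F * sqrt (real CARD('p) powi k)" for x
  proof -
    define a where "a \<xi> = complex_of_real (cmod (F \<xi>))" for \<xi>
    have aL: "a \<in> L2 m" unfolding a_def
      by (rule L2_dominated(1)[OF L(2), of _ 1]) (use L2_measurable[OF L(2)] in auto)
    have na: "norm_L2 m a = norm_L2 m F" by (simp add: norm_L2_def a_def)
    have nb: "norm_L2 m (indicator (padic_ball 0 k)) = sqrt (real CARD('p) powi k)"
      using norm_L2_indicator[of "padic_ball 0 k" m] by (metis measure_ball norm_L2_nonneg padic_ball_borel real_sqrt_unique sets_m)
    have "cmod (inverse_fourier G x) \<le> (\<integral>\<xi>. cmod (G \<xi>) \<partial>m)"
      using cmod_fourier_L1_le[of "\<lambda>\<xi>. cnj (G \<xi>)" x] by (simp add: inverse_fourier_def)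
    also have "\<dots> = Re (\<integral>\<xi>. complex_of_real (cmod (G \<xi>)) \<partial>m)" by simp
    also have "(\<integral>\<xi>. complex_of_real (cmod (G \<xi>)) \<partial>m) = inner_L2 m a (indicator (padic_ball 0 k))"
      unfolding inner_L2_def by (intro Bochner_Integration.integral_cong) (auto simp: G_def a_def indicator_def)
    also have "Re \<dots> \<le> norm_L2 m F * sqrt (real CARD('p) powi k)"
      using order_trans[OF complex_Re_le_cmod cmod_inner_L2_le[OF aL ball_indicator_L2[of 0 k]]] unfolding na nb .
    finally show ?thesis .
  qed
  then have "(cmod (inverse_fourier G x))\<^sup>2 \<le> (norm_L2 m F * sqrt (real CARD('p) powi k))\<^sup>2" for x
    by (intro power_mono) auto
  then have b: "(cmod (inverse_fourier G x))\<^sup>2 \<le> real CARD('p) powi k * (norm_L2 m F)\<^sup>2" for x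
    by (simp add: power_mult_distrib mult.commute)
  show ?thesis using ae by eventually_elim (use b in simp)
qed

end

section \<open>The Taibleson--Vladimirov operator\<close>

lemma linear_operatorD:
  assumes "linear_operator M T"
  shows "(u, w) \<in> T \<Longrightarrow> u \<in> L2 M" "(u, w) \<in> T \<Longrightarrow> w \<in> L2 M"
    and "(u, w) \<in> T \<Longrightarrow> (u', w') \<in> T \<Longrightarrow> ((\<lambda>x. a * u x + b * u' x), (\<lambda>x. a * w x + b * w' x)) \<in> T"
    and "(u, w) \<in> T \<Longrightarrow> u'' \<in> borel_measurable M \<Longrightarrow> w'' \<in> borel_measurable M \<Longrightarrow>
      AE x in M. u x = u'' x \<Longrightarrow> AE x in M. w x = w'' x \<Longrightarrow> (u'', w'') \<in> T"
  using assms unfolding linear_operator_def by blast+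

lemma inner_L2_weight:
  "inner_L2 M (\<lambda>x. complex_of_real (w x) * F x) F = of_real (\<integral>x. w x * (cmod (F x))\<^sup>2 \<partial>M)"
proof -
  have "(\<lambda>x. complex_of_real (w x) * F x * cnj (F x)) = (\<lambda>x. complex_of_real (w x * (cmod (F x))\<^sup>2))"
    by (rule ext) (simp only: of_real_mult complex_norm_square mult.assoc)
  then show ?thesis unfolding inner_L2_def by (simp only: integral_complex_of_real)
qed

context haar
begin

definition weight :: "real \<Rightarrow> ('p padic \<Rightarrow> complex) \<Rightarrow> 'p padic \<Rightarrow> complex" where
  "weight \<alpha> F \<xi> = complex_of_real (norm_padic \<xi> powr \<alpha>) * F \<xi>"

lemma weight_measurable [measurable]: "F \<in> borel_measurable borel \<Longrightarrow> weight \<alpha> F \<in> borel_measurable borel"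
  unfolding weight_def[abs_def] by measurable

lemma weight_lincomb: "weight \<alpha> (\<lambda>\<xi>. a * F \<xi> + b * G \<xi>) = (\<lambda>\<xi>. a * weight \<alpha> F \<xi> + b * weight \<alpha> G \<xi>)"
  by (auto simp: weight_def algebra_simps)

lemma weight_weight: "weight \<alpha> (weight \<beta> F) = weight (\<alpha> + \<beta>) F"
  by (auto simp: weight_def powr_add)

lemma taibleson_vladimirovI:
  assumes "has_fourier_L2 m f F" "has_fourier_L2 m g (weight \<alpha> F)"
  shows "(f, g) \<in> taibleson_vladimirov m \<alpha>"
  using assms by (auto simp: taibleson_vladimirov_def weight_def[abs_def])

text \<open>Transforms are unique a.e., so the existentially quantified transform in the definition
  may be traded for any given transform of \<open>f\<close>.\<close>

lemma taibleson_vladimirovD: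
  assumes "(f, g) \<in> taibleson_vladimirov m \<alpha>" "has_fourier_L2 m f F"
  shows "has_fourier_L2 m g (weight \<alpha> F)"
proof -
  obtain F' G where F': "has_fourier_L2 m f F'" "has_fourier_L2 m g G" and ae: "AE \<xi> in m. G \<xi> = weight \<alpha> F' \<xi>"
    using assms(1) by (auto simp: taibleson_vladimirov_def weight_def)
  have "AE \<xi> in m. F' \<xi> = F \<xi>" by (rule has_fourier_L2_unique[OF F'(1) assms(2)]) simp
  with ae have "AE \<xi> in m. G \<xi> = weight \<alpha> F \<xi>" by eventually_elim (simp add: weight_def)
  moreover have "weight \<alpha> F \<in> borel_measurable borel" "g \<in> borel_measurable borel"
    using L2_measurable[OF has_fourier_L2D(2)[OF assms(2)]] L2_measurable[OF has_fourier_L2D(1)[OF F'(2)]]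
    by (auto intro: weight_measurable)
  ultimately show ?thesis by (intro has_fourier_L2_cong_AE[OF F'(2)]) auto
qed

lemma taibleson_vladimirovE:
  assumes "(f, g) \<in> taibleson_vladimirov m \<alpha>"
  obtains F where "has_fourier_L2 m f F" "has_fourier_L2 m g (weight \<alpha> F)"
  using assms taibleson_vladimirovD[OF assms] by (auto simp: taibleson_vladimirov_def)

lemma Domain_taibleson_vladimirov:
  assumes "has_fourier_L2 m f F"
  shows "f \<in> Domain (taibleson_vladimirov m \<alpha>) \<longleftrightarrow> weight \<alpha> F \<in> L2 m"
proof
  assume "f \<in> Domain (taibleson_vladimirov m \<alpha>)"
  then show "weight \<alpha> F \<in> L2 m" using taibleson_vladimirovD[OF _ assms] has_fourier_L2D(2) by blast
next
  assume "weight \<alpha> F \<in> L2 m"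
  then obtain g where "has_fourier_L2 m g (weight \<alpha> F)" by (rule has_fourier_L2_ex_inverse)
  then show "f \<in> Domain (taibleson_vladimirov m \<alpha>)" using taibleson_vladimirovI[OF assms] by blast
qed

lemma linear_taibleson_vladimirov: "linear_operator m (taibleson_vladimirov m \<alpha>)"
  unfolding linear_operator_def
proof (intro conjI)
  let ?T = "taibleson_vladimirov m \<alpha>"
  have sub: "u \<in> L2 m \<and> w \<in> L2 m" if "(u, w) \<in> ?T" for u w
    using that by (auto elim!: taibleson_vladimirovE dest: has_fourier_L2D)
  then show "?T \<subseteq> L2 m \<times> L2 m" by auto
  have "has_fourier_L2 m (\<lambda>_. 0) (\<lambda>_. 0)"
    by (rule has_fourier_L2I[of _ _ "\<lambda>_ _. 0"]) (simp_all add: tendsto_L2_def fourier_L1_def)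
  then show "((\<lambda>_. 0), (\<lambda>_. 0)) \<in> ?T"
    by (intro taibleson_vladimirovI[of _ "\<lambda>_. 0"]) (auto simp: weight_def[abs_def])
  have "((\<lambda>x. a * u x + b * u' x), (\<lambda>x. a * w x + b * w' x)) \<in> ?T" if uw: "(u, w) \<in> ?T" "(u', w') \<in> ?T" for u w u' w' a b
  proof -
    obtain U where U: "has_fourier_L2 m u U" "has_fourier_L2 m w (weight \<alpha> U)" using uw(1) by (rule taibleson_vladimirovE)
    obtain U' where U': "has_fourier_L2 m u' U'" "has_fourier_L2 m w' (weight \<alpha> U')" using uw(2) by (rule taibleson_vladimirovE)
    show ?thesis
      by (rule taibleson_vladimirovI[OF has_fourier_L2_lincomb[OF U(1) U'(1)]])
         (unfold weight_lincomb, rule has_fourier_L2_lincomb[OF U(2) U'(2)])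
  qed
  then show "\<forall>(u, w)\<in>?T. \<forall>(u', w')\<in>?T. \<forall>a b. ((\<lambda>x. a * u x + b * u' x), (\<lambda>x. a * w x + b * w' x)) \<in> ?T"
    by auto
  have main: "AE x in m. w x = w' x" if uw: "(u, w) \<in> ?T" "(u', w') \<in> ?T" and ae: "AE x in m. u x = u' x" for u w u' w'
  proof -
    obtain U where U: "has_fourier_L2 m u U" "has_fourier_L2 m w (weight \<alpha> U)" using uw(1) by (rule taibleson_vladimirovE)
    obtain U' where U': "has_fourier_L2 m u' U'" "has_fourier_L2 m w' (weight \<alpha> U')" using uw(2) by (rule taibleson_vladimirovE)
    have "AE \<xi> in m. U \<xi> = U' \<xi>" by (rule has_fourier_L2_unique[OF U(1) U'(1) ae])
    then have "AE \<xi> in m. weight \<alpha> U \<xi> = weight \<alpha> U' \<xi>" by eventually_elim (simp add: weight_def)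
    then show ?thesis by (rule has_fourier_L2_inject[OF U(2) U'(2)])
  qed
  show "\<forall>(u, w)\<in>?T. \<forall>(u', w')\<in>?T. (AE x in m. u x = u' x) \<longrightarrow> (AE x in m. w x = w' x)"
    unfolding Ball_def split_paired_All case_prod_conv by (intro allI impI) (rule main)
  have "(u', w') \<in> ?T" if uw: "(u, w) \<in> ?T" and "u' \<in> borel_measurable m" "w' \<in> borel_measurable m"
    "AE x in m. u x = u' x" "AE x in m. w x = w' x" for u w u' w'
  proof -
    obtain U where U: "has_fourier_L2 m u U" "has_fourier_L2 m w (weight \<alpha> U)" using uw by (rule taibleson_vladimirovE)
    have b: "U \<in> borel_measurable borel" "weight \<alpha> U \<in> borel_measurable borel"
      using L2_measurable[OF has_fourier_L2D(2)[OF U(1)]] L2_measurable[OF has_fourier_L2D(2)[OF U(2)]] by auto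
    show ?thesis
      by (rule taibleson_vladimirovI[OF has_fourier_L2_cong_AE[OF U(1), of u' U]
          has_fourier_L2_cong_AE[OF U(2), of w' "weight \<alpha> U"]])
         (use that b in auto)
  qed
  then show "\<forall>(u, w)\<in>?T. \<forall>u'\<in>borel_measurable m. \<forall>w'\<in>borel_measurable m.
      (AE x in m. u x = u' x) \<longrightarrow> (AE x in m. w x = w' x) \<longrightarrow> (u', w') \<in> ?T" by blast
qed

lemma weight_ball_L2:
  assumes F: "F \<in> L2 m" and \<alpha>: "\<alpha> \<ge> 0"
  shows "weight \<alpha> (\<lambda>\<xi>. indicator (padic_ball 0 n) \<xi> * F \<xi>) \<in> L2 m"
proof (rule L2_dominated(1)[OF F])
  note [measurable] = L2_measurable[OF F]
  show "weight \<alpha> (\<lambda>\<xi>. indicator (padic_ball 0 n) \<xi> * F \<xi>) \<in> borel_measurable m" by measurable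
  show "AE \<xi> in m. cmod (weight \<alpha> (\<lambda>\<xi>. indicator (padic_ball 0 n) \<xi> * F \<xi>) \<xi>)
      \<le> (real CARD('p) powi n) powr \<alpha> * cmod (F \<xi>)"
    using \<alpha> by (auto simp: weight_def indicator_def norm_mult padic_ball_def intro!: mult_right_mono powr_mono2)
qed

lemma dense_Domain_taibleson_vladimirov:
  assumes "\<alpha> \<ge> 0" shows "dense_L2 m (Domain (taibleson_vladimirov m \<alpha>))"
  unfolding dense_L2_def
proof (intro ballI allI impI)
  fix f and e :: real assume f: "f \<in> L2 m" and e: "e > 0"
  obtain F where F: "has_fourier_L2 m f F" using has_fourier_L2_ex[OF f] by blast
  note FL = has_fourier_L2D(2)[OF F]
  let ?G = "\<lambda>n \<xi>. indicator (padic_ball 0 (int n)) \<xi> * F \<xi>"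
  obtain n where n: "norm_L2 m (\<lambda>\<xi>. ?G n \<xi> - F \<xi>) < e"
    using eventually_happens'[OF sequentially_bot order_tendstoD(2)[OF tendsto_ball_mult[OF FL, unfolded tendsto_L2_def] e]]
    by blast
  obtain u where u: "has_fourier_L2 m u (?G n)"
    using has_fourier_L2_ex_inverse[OF L2_indicator_mult[OF FL, of "padic_ball 0 (int n)"]] by auto
  have "norm_L2 m (\<lambda>x. f x - u x) < e"
    using has_fourier_L2_norm[OF has_fourier_L2_diff[OF u F]] n norm_L2_diff_commute[of m f u] by simp
  moreover have "u \<in> Domain (taibleson_vladimirov m \<alpha>)"
    unfolding Domain_taibleson_vladimirov[OF u] by (rule weight_ball_L2[OF FL assms])
  ultimately show "\<exists>u\<in>Domain (taibleson_vladimirov m \<alpha>). norm_L2 m (\<lambda>x. f x - u x) < e" by blast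
qed

lemma inner_weight: "inner_L2 m (weight \<alpha> F) G = inner_L2 m F (weight \<alpha> G)"
  by (simp add: inner_L2_def weight_def mult_ac)

text \<open>Symmetry of the weight gives one inclusion. For the other, the test vectors have
  frequencies in a ball, where the weight is bounded; the balls then exhaust the field.\<close>

lemma adjoint_taibleson_vladimirov:
  assumes \<alpha>: "\<alpha> \<ge> 0" shows "adjoint_op m (taibleson_vladimirov m \<alpha>) = taibleson_vladimirov m \<alpha>"
proof (intro equalityI subrelI)
  let ?T = "taibleson_vladimirov m \<alpha>"
  fix v w assume vw: "(v, w) \<in> ?T"
  then obtain F where F: "has_fourier_L2 m v F" "has_fourier_L2 m w (weight \<alpha> F)" by (rule taibleson_vladimirovE)
  have "inner_L2 m z v = inner_L2 m u w" if "(u, z) \<in> ?T" for u z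
  proof -
    obtain G where G: "has_fourier_L2 m u G" "has_fourier_L2 m z (weight \<alpha> G)" using \<open>(u, z) \<in> ?T\<close> by (rule taibleson_vladimirovE)
    show ?thesis
      using has_fourier_L2_inner[OF G(2) F(1)] has_fourier_L2_inner[OF G(1) F(2)] by (simp add: inner_weight)
  qed
  then show "(v, w) \<in> adjoint_op m ?T"
    using has_fourier_L2D(1)[OF F(1)] has_fourier_L2D(1)[OF F(2)] by (auto simp: adjoint_op_def)
next
  let ?T = "taibleson_vladimirov m \<alpha>"
  fix v w assume "(v, w) \<in> adjoint_op m ?T"
  then have L: "v \<in> L2 m" "w \<in> L2 m" and adj: "\<And>u z. (u, z) \<in> ?T \<Longrightarrow> inner_L2 m z v = inner_L2 m u w"
    by (auto simp: adjoint_op_def)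
  obtain F where F: "has_fourier_L2 m v F" using has_fourier_L2_ex[OF L(1)] by blast
  obtain G where G: "has_fourier_L2 m w G" using has_fourier_L2_ex[OF L(2)] by blast
  note FL = has_fourier_L2D(2)[OF F] and GL = has_fourier_L2D(2)[OF G]
  have "AE \<xi> in m. \<xi> \<in> padic_ball 0 (int n) \<longrightarrow> weight \<alpha> F \<xi> = G \<xi>" for n
  proof -
    let ?c = "\<lambda>H \<xi>. indicator (padic_ball 0 (int n)) \<xi> * H \<xi>"
    \<comment> \<open>The discrepancy between \<open>weight \<alpha> F\<close> and \<open>G\<close>
      on the ball serves as its own test function, which makes the pairing its squared norm.\<close>
    define U where "U \<xi> = weight \<alpha> (?c F) \<xi> - ?c G \<xi>" for \<xi>
    have cG: "?c G \<in> L2 m" by (rule L2_indicator_mult[OF GL]) simp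
    have U: "U \<in> L2 m" unfolding U_def by (rule L2_diff[OF weight_ball_L2[OF FL \<alpha>] cG])
    have cU: "?c U = U" by (auto simp: U_def weight_def indicator_def)
    have wU: "weight \<alpha> U \<in> L2 m" using weight_ball_L2[OF U \<alpha>, of "int n"] unfolding cU .
    obtain u where u: "has_fourier_L2 m u U" using has_fourier_L2_ex_inverse[OF U] by blast
    obtain z where z: "has_fourier_L2 m z (weight \<alpha> U)" using has_fourier_L2_ex_inverse[OF wU] by blast
    have "inner_L2 m (weight \<alpha> U) F = inner_L2 m U G"
      using adj[OF taibleson_vladimirovI[OF u z]] has_fourier_L2_inner[OF z F] has_fourier_L2_inner[OF u G] by simp
    moreover have "inner_L2 m (weight \<alpha> U) F = inner_L2 m U (weight \<alpha> (?c F))"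
      unfolding inner_L2_def by (intro Bochner_Integration.integral_cong) (auto simp: U_def weight_def indicator_def)
    moreover have "inner_L2 m U G = inner_L2 m U (?c G)"
      unfolding inner_L2_def by (intro Bochner_Integration.integral_cong) (auto simp: U_def weight_def indicator_def)
    ultimately have "inner_L2 m U (\<lambda>\<xi>. weight \<alpha> (?c F) \<xi> - ?c G \<xi>) = 0"
      unfolding inner_L2_diff_right[OF U weight_ball_L2[OF FL \<alpha>] cG] by simp
    then have "norm_L2 m U = 0" by (simp add: inner_L2_self U_def[abs_def, symmetric])
    then have "AE \<xi> in m. U \<xi> = 0" using norm_L2_eq_0_iff[OF U] by simp
    then show ?thesis by eventually_elim (auto simp: U_def weight_def)
  qed
  then have "AE \<xi> in m. \<forall>n. \<xi> \<in> padic_ball 0 (int n) \<longrightarrow> weight \<alpha> F \<xi> = G \<xi>" by (subst AE_all_countable) blast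
  then have "AE \<xi> in m. G \<xi> = weight \<alpha> F \<xi>"
    by eventually_elim (metis ball_exhaust)
  then show "(v, w) \<in> ?T" using F G by (auto simp: taibleson_vladimirov_def weight_def)
qed

lemma self_adjoint_taibleson_vladimirov: "\<alpha> \<ge> 0 \<Longrightarrow> self_adjoint m (taibleson_vladimirov m \<alpha>)"
  by (simp add: self_adjoint_def linear_taibleson_vladimirov dense_Domain_taibleson_vladimirov adjoint_taibleson_vladimirov)

lemma nonneg_taibleson_vladimirov: "op_nonneg m (taibleson_vladimirov m \<alpha>)"
  unfolding op_nonneg_def
proof clarify
  fix u w assume "(u, w) \<in> taibleson_vladimirov m \<alpha>"
  then obtain F where F: "has_fourier_L2 m u F" "has_fourier_L2 m w (weight \<alpha> F)" by (rule taibleson_vladimirovE)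
  show "0 \<le> Re (inner_L2 m w u)"
    unfolding has_fourier_L2_inner[OF F(2,1), symmetric] weight_def[abs_def] inner_L2_weight by simp
qed

text \<open>Intermediate powers are controlled by the extreme ones through
  \<open>t powr \<alpha> \<le> 1 + t powr \<beta>\<close>. This supplies the intermediate vector in
  the operator square.\<close>

lemma weight_le_L2:
  assumes F: "F \<in> L2 m" "weight \<beta> F \<in> L2 m" and "0 \<le> \<alpha>" "\<alpha> \<le> \<beta>"
  shows "weight \<alpha> F \<in> L2 m"
proof -
  have le: "t powr \<alpha> \<le> 1 + t powr \<beta>" if "t \<ge> 0" for t :: real
  proof (cases "t \<le> 1")
    case True
    then have "t powr \<alpha> \<le> 1 powr \<alpha>" using assms that by (intro powr_mono2) auto
    then show ?thesis by (simp add: add_increasing2)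
  next
    case False
    then have "t powr \<alpha> \<le> t powr \<beta>" using assms by (intro powr_mono) auto
    then show ?thesis by simp
  qed
  have absL: "(\<lambda>\<xi>. complex_of_real (cmod (H \<xi>))) \<in> L2 m" if "H \<in> L2 m" for H
    by (rule L2_dominated(1)[OF that, of _ 1]) (use L2_measurable[OF that] in auto)
  have sumL: "(\<lambda>\<xi>. complex_of_real (cmod (F \<xi>)) + complex_of_real (cmod (weight \<beta> F \<xi>))) \<in> L2 m"
    by (intro L2_add absL F)
  show ?thesis
  proof (rule L2_dominated(1)[OF sumL, of _ 1])
    show "weight \<alpha> F \<in> borel_measurable m" using weight_measurable L2_measurable[OF F(1)] by simp
    have "cmod (weight \<alpha> F \<xi>) \<le> cmod (complex_of_real (cmod (F \<xi>)) + complex_of_real (cmod (weight \<beta> F \<xi>)))" for \<xi>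
      using mult_right_mono[OF le[of "norm_padic \<xi>"], of "cmod (F \<xi>)"]
      by (simp add: weight_def norm_mult algebra_simps flip: of_real_add del: of_real_mult)
    then show "AE \<xi> in m. cmod (weight \<alpha> F \<xi>) \<le> 1 * cmod (complex_of_real (cmod (F \<xi>)) + complex_of_real (cmod (weight \<beta> F \<xi>)))"
      by simp
  qed
qed

lemma square_taibleson_vladimirov:
  assumes "\<gamma> > 0"
  shows "taibleson_vladimirov m (\<gamma> / 2) O taibleson_vladimirov m (\<gamma> / 2) = taibleson_vladimirov m \<gamma>"
proof (intro equalityI subrelI)
  fix f h assume "(f, h) \<in> taibleson_vladimirov m (\<gamma> / 2) O taibleson_vladimirov m (\<gamma> / 2)"
  then obtain g where g: "(f, g) \<in> taibleson_vladimirov m (\<gamma> / 2)" "(g, h) \<in> taibleson_vladimirov m (\<gamma> / 2)" by auto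
  obtain F where F: "has_fourier_L2 m f F" "has_fourier_L2 m g (weight (\<gamma> / 2) F)" using g(1) by (rule taibleson_vladimirovE)
  have "has_fourier_L2 m h (weight (\<gamma> / 2) (weight (\<gamma> / 2) F))" by (rule taibleson_vladimirovD[OF g(2) F(2)])
  then show "(f, h) \<in> taibleson_vladimirov m \<gamma>" by (intro taibleson_vladimirovI[OF F(1)]) (simp add: weight_weight)
next
  fix f h assume "(f, h) \<in> taibleson_vladimirov m \<gamma>"
  then obtain F where F: "has_fourier_L2 m f F" "has_fourier_L2 m h (weight \<gamma> F)" by (rule taibleson_vladimirovE)
  have "weight (\<gamma> / 2) F \<in> L2 m"
    by (rule weight_le_L2[OF has_fourier_L2D(2)[OF F(1)] has_fourier_L2D(2)[OF F(2)]]) (use assms in auto)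
  then obtain g where g: "has_fourier_L2 m g (weight (\<gamma> / 2) F)" by (rule has_fourier_L2_ex_inverse)
  have "(f, g) \<in> taibleson_vladimirov m (\<gamma> / 2)" by (rule taibleson_vladimirovI[OF F(1) g])
  moreover have "(g, h) \<in> taibleson_vladimirov m (\<gamma> / 2)"
    by (rule taibleson_vladimirovI[OF g]) (use F(2) in \<open>simp add: weight_weight\<close>)
  ultimately show "(f, h) \<in> taibleson_vladimirov m (\<gamma> / 2) O taibleson_vladimirov m (\<gamma> / 2)" by auto
qed

section \<open>Uniqueness of the non-negative square root\<close>

definition padic_sphere :: "int \<Rightarrow> 'p padic set" where
  "padic_sphere k = {\<xi>. norm_padic \<xi> = real CARD('p) powi k}"

lemma padic_sphere_borel [measurable, simp]: "padic_sphere k \<in> sets borel"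
  unfolding padic_sphere_def by measurable

text \<open>The origin is null because it lies in balls of volume \<open>p^(-n)\<close>; elsewhere
  the norm is a power of \<open>p\<close>.\<close>

lemma AE_padic_sphere: "AE \<xi> in m. \<exists>k. \<xi> \<in> padic_sphere k"
proof -
  have "emeasure m {0 :: 'p padic} \<le> ennreal e" if e: "e > 0" for e
  proof -
    obtain n where n: "real CARD('p) powi (- int n) < e" by (rule powi_arbitrarily_small[OF e])
    have "emeasure m {0} \<le> emeasure m (padic_ball 0 (- int n))" by (rule emeasure_mono) auto
    also have "\<dots> \<le> ennreal e" using n by (simp add: ennreal_leI)
    finally show ?thesis .
  qed
  then have "emeasure m {0 :: 'p padic} = 0"
    by (metis ennreal_le_epsilon add_0 le_zero_eq)
  then have "AE \<xi> in m. \<xi> \<noteq> 0" by (intro AE_I[of _ _ "{0}"]) auto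
  then show ?thesis by eventually_elim (metis norm_padic_powi padic_sphere_def mem_Collect_eq)
qed

text \<open>Functions with Fourier transform supported on a sphere are eigenvectors of the operator, for an eigenvalue
  \<open>\<mu>\<^sup>2\<close>. If \<open>S\<close> is any non-negative square root and \<open>v = S e - \<mu> e\<close>, then \<open>S v = - \<mu> v\<close>, so \<open>v = 0\<close>.\<close>

lemma sqrt_on_sphere:
  assumes \<gamma>: "\<gamma> > 0" and S: "self_adjoint m S" "op_nonneg m S" "S O S = taibleson_vladimirov m \<gamma>"
    and FT: "has_fourier_L2 m e E" and supp: "\<And>\<xi>. \<xi> \<notin> padic_sphere k \<Longrightarrow> E \<xi> = 0"
  shows "(e, \<lambda>x. of_real ((real CARD('p) powi k) powr (\<gamma> / 2)) * e x) \<in> S"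
proof -
  define \<mu> where "\<mu> = (real CARD('p) powi k) powr (\<gamma> / 2)"
  have \<mu>: "\<mu> > 0" by (simp add: \<mu>_def)
  have lin: "linear_operator m S" using S(1) by (simp add: self_adjoint_def)
  note linD = linear_operatorD[OF lin]
  have "weight \<gamma> E = (\<lambda>\<xi>. of_real (\<mu> * \<mu>) * E \<xi> + 0 * E \<xi>)"
  proof
    fix \<xi>
    have "\<mu> * \<mu> = (real CARD('p) powi k) powr \<gamma>" by (simp add: \<mu>_def flip: powr_add)
    then show "weight \<gamma> E \<xi> = of_real (\<mu> * \<mu>) * E \<xi> + 0 * E \<xi>"
      using supp[of \<xi>] by (cases "\<xi> \<in> padic_sphere k") (simp_all add: weight_def padic_sphere_def)
  qed
  then have "has_fourier_L2 m (\<lambda>x. of_real (\<mu> * \<mu>) * e x + 0 * e x) (weight \<gamma> E)"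
    using has_fourier_L2_lincomb[OF FT FT, of "of_real (\<mu> * \<mu>)" 0] by simp
  then have "(e, \<lambda>x. of_real (\<mu> * \<mu>) * e x) \<in> S O S" unfolding S(3) by (intro taibleson_vladimirovI[OF FT]) simp
  \<comment> \<open>Relational composition yields only some \<open>w\<close> between
    \<open>e\<close> and \<open>\<mu>\<^sup>2 e\<close>; that it equals \<open>\<mu> e\<close> has
    to come from non-negativity.\<close>
  then obtain w where w: "(e, w) \<in> S" "(w, \<lambda>x. of_real (\<mu> * \<mu>) * e x) \<in> S" by auto
  note L = linD(1)[OF w(1)] linD(2)[OF w(1)]
  define v where "v x = 1 * w x + (- of_real \<mu>) * e x" for x
  have vL: "v \<in> L2 m" unfolding v_def by (rule L2_lincomb[OF L(2,1)])
  have "(v, \<lambda>x. 1 * (of_real (\<mu> * \<mu>) * e x) + (- of_real \<mu>) * w x) \<in> S"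
    unfolding v_def by (rule linD(3)[OF w(2,1)])
  also have "(\<lambda>x. 1 * (of_real (\<mu> * \<mu>) * e x) + (- of_real \<mu>) * w x) = (\<lambda>x. (- of_real \<mu>) * v x + 0 * v x)"
    by (auto simp: v_def algebra_simps)
  finally have "0 \<le> Re (inner_L2 m (\<lambda>x. (- of_real \<mu>) * v x + 0 * v x) v)"
    using S(2) by (auto simp: op_nonneg_def)
  then have "\<mu> * (norm_L2 m v)\<^sup>2 \<le> 0"
    unfolding inner_L2_lincomb_left[OF vL vL vL] by (simp add: inner_L2_self)
  then have "norm_L2 m v = 0" using \<mu> by (simp add: mult_le_0_iff)
  then have "AE x in m. v x = 0" using norm_L2_eq_0_iff[OF vL] by simp
  then have "AE x in m. w x = of_real \<mu> * e x" by eventually_elim (simp add: v_def)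
  then show ?thesis
    unfolding \<mu>_def[symmetric]
    by (intro linD(4)[OF w(1)]) (use L2_measurable[OF L(1)] in auto)
qed

text \<open>Pairing \<open>(u, w)\<close> in \<open>S\<close> with the eigenvectors of all spheres
  determines the transform of \<open>w\<close> and places \<open>S\<close> inside the multiplier.
  Equality follows because passing to adjoints reverses the inclusion and leaves both sides
  unchanged.\<close>

lemma sqrt_unique:
  assumes \<gamma>: "\<gamma> > 0" and S: "self_adjoint m S" "op_nonneg m S" "S O S = taibleson_vladimirov m \<gamma>"
  shows "S = taibleson_vladimirov m (\<gamma> / 2)"
proof -
  let ?A = "taibleson_vladimirov m (\<gamma> / 2)"
  have adjS: "adjoint_op m S = S" using S(1) by (simp add: self_adjoint_def)
  have adjA: "adjoint_op m ?A = ?A" by (rule adjoint_taibleson_vladimirov) (use \<gamma> in simp)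
  have SA: "S \<subseteq> ?A"
  proof (rule subrelI)
    fix u w assume "(u, w) \<in> S"
    then have "(u, w) \<in> adjoint_op m S" by (simp only: adjS)
    then have L: "u \<in> L2 m" "w \<in> L2 m" and adj: "\<And>e z. (e, z) \<in> S \<Longrightarrow> inner_L2 m z u = inner_L2 m e w"
      by (auto simp: adjoint_op_def)
    obtain U where U: "has_fourier_L2 m u U" using has_fourier_L2_ex[OF L(1)] by blast
    obtain W where W: "has_fourier_L2 m w W" using has_fourier_L2_ex[OF L(2)] by blast
    note UL = has_fourier_L2D(2)[OF U] and WL = has_fourier_L2D(2)[OF W]
    have "AE \<xi> in m. \<xi> \<in> padic_sphere k \<longrightarrow> W \<xi> = weight (\<gamma> / 2) U \<xi>" for k
    proof -
      define \<mu> where "\<mu> = (real CARD('p) powi k) powr (\<gamma> / 2)"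
      define H where "H \<xi> = 1 * W \<xi> + (- of_real \<mu>) * U \<xi>" for \<xi>
      have HL: "H \<in> L2 m" unfolding H_def by (rule L2_lincomb[OF WL UL])
      \<comment> \<open>The residual on one sphere, to be tested against itself.\<close>
      define E where "E \<xi> = indicator (padic_sphere k) \<xi> * H \<xi>" for \<xi>
      have EL: "E \<in> L2 m" unfolding E_def by (rule L2_indicator_mult[OF HL]) simp
      obtain e where e: "has_fourier_L2 m e E" using has_fourier_L2_ex_inverse[OF EL] by blast
      note eL = has_fourier_L2D(1)[OF e]
      have "(e, \<lambda>x. of_real \<mu> * e x) \<in> S"
        unfolding \<mu>_def by (rule sqrt_on_sphere[OF \<gamma> S e]) (simp add: E_def)
      from adj[OF this] have "of_real \<mu> * inner_L2 m e u = inner_L2 m e w"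
        using inner_L2_lincomb_left[OF eL eL L(1), of "of_real \<mu>" 0] by simp
      then have "of_real \<mu> * inner_L2 m E U = inner_L2 m E W"
        by (simp only: has_fourier_L2_inner[OF e U] has_fourier_L2_inner[OF e W])
      then have "inner_L2 m E H = 0"
        unfolding H_def[abs_def] inner_L2_lincomb_right[OF EL WL UL] by simp
      moreover have "inner_L2 m E E = inner_L2 m E H"
        unfolding inner_L2_def by (intro Bochner_Integration.integral_cong) (auto simp: E_def indicator_def)
      ultimately have "norm_L2 m E = 0" by (simp add: inner_L2_self)
      then have "AE \<xi> in m. E \<xi> = 0" using norm_L2_eq_0_iff[OF EL] by simp
      then show ?thesis
        by eventually_elim (auto simp: E_def H_def weight_def \<mu>_def padic_sphere_def)
    qed
    then have "AE \<xi> in m. \<forall>k. \<xi> \<in> padic_sphere k \<longrightarrow> W \<xi> = weight (\<gamma> / 2) U \<xi>" by (subst AE_all_countable) blast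
    with AE_padic_sphere have "AE \<xi> in m. W \<xi> = weight (\<gamma> / 2) U \<xi>" by eventually_elim blast
    then show "(u, w) \<in> ?A" using U W by (auto simp: taibleson_vladimirov_def weight_def)
  qed
  have "adjoint_op m ?A \<subseteq> adjoint_op m S" using SA by (auto simp: adjoint_op_def)
  with SA show ?thesis unfolding adjA adjS by (rule equalityI)
qed

theorem op_sqrt_taibleson_vladimirov:
  assumes "\<gamma> > 0"
  shows "op_sqrt m (taibleson_vladimirov m \<gamma>) = taibleson_vladimirov m (\<gamma> / 2)"
  unfolding op_sqrt_def
proof (rule the_equality)
  show "self_adjoint m (taibleson_vladimirov m (\<gamma> / 2)) \<and> op_nonneg m (taibleson_vladimirov m (\<gamma> / 2))
      \<and> taibleson_vladimirov m (\<gamma> / 2) O taibleson_vladimirov m (\<gamma> / 2) = taibleson_vladimirov m \<gamma>"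
    using assms by (intro conjI self_adjoint_taibleson_vladimirov nonneg_taibleson_vladimirov square_taibleson_vladimirov) auto
qed (use sqrt_unique[OF assms] in blast)

section \<open>The form of the operator on the Fourier side\<close>

lemma dom_QL_iff:
  assumes "\<gamma> > 0" "has_fourier_L2 m u U"
  shows "u \<in> dom_QL m (taibleson_vladimirov m \<gamma>) \<longleftrightarrow> weight (\<gamma> / 2) U \<in> L2 m"
  unfolding dom_QL_def op_sqrt_taibleson_vladimirov[OF assms(1)] by (rule Domain_taibleson_vladimirov[OF assms(2)])

lemma dom_QL_L2:
  assumes "\<gamma> > 0" shows "dom_QL m (taibleson_vladimirov m \<gamma>) \<subseteq> L2 m"
  unfolding dom_QL_def op_sqrt_taibleson_vladimirov[OF assms]
  using linear_operatorD(1)[OF linear_taibleson_vladimirov] by blast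

text \<open>\<open>op_app\<close> picks some value of the operator; all values share their transform
  up to null sets, so the choice drops out.\<close>

lemma QL_eq:
  assumes "\<gamma> > 0" and u: "u \<in> dom_QL m (taibleson_vladimirov m \<gamma>)" "has_fourier_L2 m u U"
    and v: "v \<in> dom_QL m (taibleson_vladimirov m \<gamma>)" "has_fourier_L2 m v V"
  shows "QL m (taibleson_vladimirov m \<gamma>) u v = inner_L2 m (weight (\<gamma> / 2) U) (weight (\<gamma> / 2) V)"
proof -
  let ?A = "taibleson_vladimirov m (\<gamma> / 2)"
  have "has_fourier_L2 m (op_app ?A f) (weight (\<gamma> / 2) F)"
    if "f \<in> dom_QL m (taibleson_vladimirov m \<gamma>)" "has_fourier_L2 m f F" for f F
  proof -
    have "\<exists>g. (f, g) \<in> ?A" using that(1) by (auto simp: dom_QL_def op_sqrt_taibleson_vladimirov[OF assms(1)])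
    then have "(f, op_app ?A f) \<in> ?A" unfolding op_app_def by (rule someI_ex)
    then show ?thesis by (rule taibleson_vladimirovD[OF _ that(2)])
  qed
  from has_fourier_L2_inner[OF this[OF u] this[OF v]]
  show ?thesis by (simp add: QL_def op_sqrt_taibleson_vladimirov[OF assms(1)])
qed

end

section \<open>Relative boundedness of potentials\<close>

text \<open>The weights \<open>a\<close> will be geometric, so that summing over frequencies costs
  only a convergent series.\<close>

lemma weighted_Cauchy_Schwarz:
  fixes z :: "'i \<Rightarrow> complex"
  assumes a: "\<And>i. i \<in> I \<Longrightarrow> a i > (0::real)"
  shows "(cmod (\<Sum>i\<in>I. z i))\<^sup>2 \<le> (\<Sum>i\<in>I. a i) * (\<Sum>i\<in>I. (cmod (z i))\<^sup>2 / a i)"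
proof -
  have "(cmod (\<Sum>i\<in>I. z i))\<^sup>2 \<le> (\<Sum>i\<in>I. cmod (z i))\<^sup>2"
    by (intro power_mono norm_sum) simp
  also have "(\<Sum>i\<in>I. cmod (z i)) = (\<Sum>i\<in>I. sqrt (a i) * (cmod (z i) / sqrt (a i)))"
  proof (rule sum.cong)
    fix i assume "i \<in> I"
    then show "cmod (z i) = sqrt (a i) * (cmod (z i) / sqrt (a i))" using a[of i] by simp
  qed simp
  also have "\<dots>\<^sup>2 \<le> (\<Sum>i\<in>I. (sqrt (a i))\<^sup>2) * (\<Sum>i\<in>I. (cmod (z i) / sqrt (a i))\<^sup>2)"
    by (rule Cauchy_Schwarz_ineq_sum)
  also have "\<dots> = (\<Sum>i\<in>I. a i) * (\<Sum>i\<in>I. (cmod (z i))\<^sup>2 / a i)"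
    using a by (intro arg_cong2[where f = "(*)"] sum.cong) (auto simp: power_divide less_imp_le)
  finally show ?thesis .
qed

text \<open>Up to the threshold \<open>w\<close> is at most \<open>t\<close>; above it
  \<open>(w / t) powr (r - 1) \<ge> 1\<close>. It stands in for cutting the potential into a bounded
  and an unbounded part at each frequency.\<close>

lemma le_threshold_powr:
  fixes w t r :: real
  assumes "w \<ge> 0" "t > 0" "r \<ge> 1"
  shows "w \<le> t + t powr (1 - r) * w powr r"
proof (cases "w \<le> t")
  case True
  then show ?thesis by (simp add: add_increasing2)
next
  case False
  then have "w = w powr (1 - r) * w powr r" using assms by (simp flip: powr_add)
  also have "\<dots> \<le> t powr (1 - r) * w powr r"
    using False assms by (intro mult_right_mono powr_mono2') auto
  finally show ?thesis using assms by simp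
qed

context haar
begin

text \<open>The summand \<open>t\<close> costs \<open>t\<close> times the squared norm, the one with
  \<open>W powr r\<close> costs \<open>t powr (1 - r) * P\<close> by the supremum bound;
  \<open>t = P powr (1 / r)\<close> equates the two.\<close>

lemma band_limited_potential_bound:
  assumes W [measurable]: "W \<in> borel_measurable borel" and W0: "\<And>x. W x \<ge> (0::real)"
    and r: "r \<ge> 1" and Wr: "integrable m (\<lambda>x. W x powr r)"
    and FT: "has_fourier_L2 m e E" and supp: "AE \<xi> in m. \<xi> \<notin> padic_ball 0 k \<longrightarrow> E \<xi> = 0"
  shows "(\<lambda>x. complex_of_real (sqrt (W x)) * e x) \<in> L2 m"
    and "(norm_L2 m (\<lambda>x. complex_of_real (sqrt (W x)) * e x))\<^sup>2
      \<le> (real CARD('p) powi k) powr (1 / r) * (1 + (\<integral>x. W x powr r \<partial>m)) * (norm_L2 m E)\<^sup>2"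
proof -
  note L = has_fourier_L2D[OF FT]
  note [measurable] = L2_measurable[OF L(1)]
  define P where "P = real CARD('p) powi k"
  have P: "P > 0" by (simp add: P_def)
  define t where "t = P powr (1 / r)"
  have t: "t > 0" using P by (simp add: t_def)
  have tP: "t powr (1 - r) * P = t"
  proof -
    have "P = t powr r" using P r by (simp add: t_def powr_powr)
    then show ?thesis using t by (simp flip: powr_add)
  qed
  let ?g = "\<lambda>x. complex_of_real (sqrt (W x)) * e x"
  let ?h = "\<lambda>x. t * (cmod (e x))\<^sup>2 + t powr (1 - r) * (P * (norm_L2 m E)\<^sup>2) * W x powr r"
  have sq: "(cmod (?g x))\<^sup>2 = W x * (cmod (e x))\<^sup>2" for x
    using W0[of x] by (simp add: norm_mult power_mult_distrib)
  have le: "AE x in m. (cmod (?g x))\<^sup>2 \<le> ?h x"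
    using band_limited_bounded[OF FT supp]
  proof eventually_elim
    case (elim x)
    have "(cmod (?g x))\<^sup>2 \<le> (t + t powr (1 - r) * W x powr r) * (cmod (e x))\<^sup>2"
      unfolding sq by (intro mult_right_mono le_threshold_powr W0 t r) simp
    also have "\<dots> = t * (cmod (e x))\<^sup>2 + t powr (1 - r) * W x powr r * (cmod (e x))\<^sup>2" by (simp add: distrib_right)
    also have "\<dots> \<le> t * (cmod (e x))\<^sup>2 + t powr (1 - r) * W x powr r * (P * (norm_L2 m E)\<^sup>2)"
      using elim by (intro add_left_mono mult_left_mono) (auto simp: P_def)
    finally show ?case by (simp add: mult_ac)
  qed
  have hi: "integrable m ?h" using L2_integrable[OF L(1)] Wr by auto
  have gi: "integrable m (\<lambda>x. (cmod (?g x))\<^sup>2)"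
    by (rule Bochner_Integration.integrable_bound[OF hi], measurable, use le in eventually_elim) simp
  show "?g \<in> L2 m" by (rule L2_I[OF _ gi]) measurable
  have "(norm_L2 m ?g)\<^sup>2 \<le> (\<integral>x. ?h x \<partial>m)"
    unfolding norm_L2_power2[of m ?g] by (rule integral_mono_AE[OF gi hi le])
  also have "\<dots> = t * (norm_L2 m e)\<^sup>2 + t powr (1 - r) * (P * (norm_L2 m E)\<^sup>2) * (\<integral>x. W x powr r \<partial>m)"
    using L2_integrable[OF L(1)] Wr by (simp add: norm_L2_power2)
  also have "norm_L2 m e = norm_L2 m E" by (rule has_fourier_L2_norm[OF FT, symmetric])
  also have "t powr (1 - r) * (P * (norm_L2 m E)\<^sup>2) = t * (norm_L2 m E)\<^sup>2" by (simp flip: mult.assoc add: tP)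
  finally show "(norm_L2 m ?g)\<^sup>2 \<le> (real CARD('p) powi k) powr (1 / r) * (1 + (\<integral>x. W x powr r \<partial>m)) * (norm_L2 m E)\<^sup>2"
    by (simp add: t_def P_def algebra_simps)
qed

section \<open>Decomposition into frequency bands\<close>

lemma has_fourier_L2_sum:
  assumes "\<And>i. has_fourier_L2 m (e i) (E i)"
  shows "has_fourier_L2 m (\<lambda>x. \<Sum>i<n. e i x) (\<lambda>\<xi>. \<Sum>i<(n::nat). E i \<xi>)"
proof (induction n)
  case 0
  show ?case using has_fourier_L2_lincomb[OF assms assms, of 0 _ 0] by simp
next
  case (Suc n)
  from has_fourier_L2_lincomb[OF Suc assms[of n], of 1 1] show ?case by simp
qed

text \<open>Low frequencies are collected in block 0, the ball of radius \<open>p^K\<close>, and the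
  spheres follow from exponent \<open>K + 1\<close> on. Every index \<open>K + i\<close> is then at
  least \<open>K\<close>, where the geometric factor is already small.\<close>

definition band :: "nat \<Rightarrow> nat \<Rightarrow> 'p padic set" where
  "band K i = (if i = 0 then padic_ball 0 (int K) else padic_sphere (int (K + i)))"

lemma band_borel [measurable, simp]: "band K i \<in> sets borel"
  by (simp add: band_def)

lemma band_subset_ball: "band K i \<subseteq> padic_ball 0 (int (K + i))"
  by (auto simp: band_def padic_ball_def padic_sphere_def)

lemma ball_Suc_split:
  "indicator (padic_ball 0 (int (K + Suc n))) \<xi>
    = indicator (padic_ball 0 (int (K + n))) \<xi> + (indicator (band K (Suc n)) \<xi> :: 'b::linordered_idom)"
  "\<xi> \<in> band K (Suc n) \<Longrightarrow> \<xi> \<notin> padic_ball 0 (int (K + n))"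
proof -
  have *: "norm_padic \<xi> < real CARD('p) powi (int (K + Suc n)) \<longleftrightarrow> norm_padic \<xi> \<le> real CARD('p) powi (int (K + n))"
    using norm_padic_less_powi_iff[of \<xi> "int (K + n)"] by (simp add: add_ac)
  then show "indicator (padic_ball 0 (int (K + Suc n))) \<xi>
    = indicator (padic_ball 0 (int (K + n))) \<xi> + (indicator (band K (Suc n)) \<xi> :: 'b::linordered_idom)"
    "\<xi> \<in> band K (Suc n) \<Longrightarrow> \<xi> \<notin> padic_ball 0 (int (K + n))"
    by (auto simp: indicator_def padic_ball_def band_def padic_sphere_def)
qed

lemma sum_band:
  "(\<Sum>i<Suc n. indicator (band K i) \<xi> * U \<xi>) = indicator (padic_ball 0 (int (K + n))) \<xi> * (U \<xi> :: complex)"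
proof -
  have "(\<Sum>i<Suc n. indicator (band K i) \<xi> :: real) = indicator (padic_ball 0 (int (K + n))) \<xi>"
  proof (induction n)
    case (Suc n)
    then show ?case using ball_Suc_split(1)[of K n \<xi>, where 'b = real] by simp
  qed (simp add: band_def)
  then have "of_real (\<Sum>i<Suc n. indicator (band K i) \<xi> :: real) = (complex_of_real (indicator (padic_ball 0 (int (K + n))) \<xi>))"
    by (rule arg_cong)
  then have "(\<Sum>i<Suc n. indicator (band K i) \<xi> :: complex) = indicator (padic_ball 0 (int (K + n))) \<xi>"
    by (simp only: of_real_sum of_real_indicator)
  then show ?thesis by (simp only: sum_distrib_right[symmetric])
qed

text \<open>A given \<open>\<xi>\<close> lies in at most one block. On a sphere the coefficient is
  exactly the weight of \<open>\<xi>\<close>; on block 0 it is the constant that the first summand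
  pays for.\<close>

lemma sum_weighted_band:
  assumes \<alpha>: "\<alpha> > 0"
  shows "(\<Sum>i<Suc n. real CARD('p) powr (\<alpha> * real (K + i)) * (indicator (band K i) \<xi> :: real))
    \<le> real CARD('p) powr (\<alpha> * real K) + norm_padic \<xi> powr \<alpha>"
proof -
  define f where "f i = real CARD('p) powr (\<alpha> * real (K + i)) * (indicator (band K i) \<xi> :: real)" for i
  define c where "c = real CARD('p) powr (\<alpha> * real K) + norm_padic \<xi> powr \<alpha>"
  have "(\<Sum>i<Suc n. f i) \<le> indicator (padic_ball 0 (int (K + n))) \<xi> * c"
  proof (induction n)
    case 0
    show ?case by (simp add: f_def c_def band_def indicator_def)
  next
    case (Suc n)
    have step: "(\<Sum>i<Suc (Suc n). f i) = (\<Sum>i<Suc n. f i) + f (Suc n)" by (rule sum.lessThan_Suc)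
    show ?case
    proof (cases "\<xi> \<in> band K (Suc n)")
      case True
      then have "norm_padic \<xi> = real CARD('p) ^ (K + Suc n)"
        by (simp add: band_def padic_sphere_def del: of_nat_add of_nat_Suc power_Suc add_Suc_right)
      then have "norm_padic \<xi> = real CARD('p) powr real (K + Suc n)"
        using CARD_gt_1[where 'a = 'p] by (simp only: powr_realpow)
      then have "f (Suc n) = norm_padic \<xi> powr \<alpha>"
        using True by (simp add: f_def powr_powr mult.commute)
      then have "f (Suc n) \<le> c" by (simp add: c_def)
      then show ?thesis
        using Suc ball_Suc_split(1)[of K n \<xi>, where 'b = real] ball_Suc_split(2)[OF True] True unfolding step by simp
    next
      case False
      then show ?thesis
        using Suc ball_Suc_split(1)[of K n \<xi>, where 'b = real] unfolding step by (simp add: f_def[of "Suc n"])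
    qed
  qed
  also have "\<dots> \<le> c" by (simp add: indicator_def c_def)
  finally show ?thesis by (simp only: f_def c_def)
qed

text \<open>With \<open>\<theta> = \<alpha> - 1 / r > 0\<close>, the frequency bands are summed by the Cauchy--Schwarz inequality with the weights
  \<open>p powr (- \<theta> j)\<close>; the tail of this geometric series supplies the small constant.\<close>

theorem potential_bound:
  assumes \<alpha>: "\<alpha> > 0" and r: "r \<ge> 1" "r > 1 / \<alpha>"
    and W [measurable]: "W \<in> borel_measurable borel" and W0: "\<And>x. W x \<ge> (0::real)"
    and Wr: "integrable m (\<lambda>x. W x powr r)" and \<epsilon>: "\<epsilon> > 0"
  obtains C where "C \<ge> 0"
    and "\<And>u U. has_fourier_L2 m u U \<Longrightarrow> weight (\<alpha> / 2) U \<in> L2 m \<Longrightarrow> (\<lambda>x. complex_of_real (sqrt (W x)) * u x) \<in> L2 m"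
    and "\<And>u U. has_fourier_L2 m u U \<Longrightarrow> weight (\<alpha> / 2) U \<in> L2 m \<Longrightarrow>
      (norm_L2 m (\<lambda>x. complex_of_real (sqrt (W x)) * u x))\<^sup>2
        \<le> \<epsilon> * (norm_L2 m (weight (\<alpha> / 2) U))\<^sup>2 + C * (norm_L2 m u)\<^sup>2"
proof -
  define b where "b = real CARD('p)"
  have b: "b > 1" unfolding b_def by (rule CARD_gt_1)
  define \<theta> where "\<theta> = \<alpha> - 1 / r"
  have \<theta>: "\<theta> > 0" using r \<alpha> by (simp add: \<theta>_def field_simps)
  define q where "q = b powr (- \<theta>)"
  have q: "0 < q" "q < 1" using b \<theta> by (auto simp: q_def powr_less_one)
  define B where "B = 1 + (\<integral>x. W x powr r \<partial>m)"
  have B: "B \<ge> 1" unfolding B_def by (simp add: integral_nonneg_AE)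
  have "\<epsilon> * (1 - q) / B > 0" using \<epsilon> q B by simp
  \<comment> \<open>The tail \<open>q ^ K / (1 - q)\<close> of the geometric series, times
    \<open>B\<close>, is to stay below \<open>\<epsilon>\<close>.\<close>
  then obtain K where K: "q ^ K < \<epsilon> * (1 - q) / B" using real_arch_pow_inv q by blast
  \<comment> \<open>The price of block 0, where the coefficient is
    \<open>p^(\<alpha> K)\<close>.\<close>
  define C where "C = \<epsilon> * b powr (\<alpha> * real K)"
  have main: "(\<lambda>x. complex_of_real (sqrt (W x)) * u x) \<in> L2 m \<and>
      (norm_L2 m (\<lambda>x. complex_of_real (sqrt (W x)) * u x))\<^sup>2
        \<le> \<epsilon> * (norm_L2 m (weight (\<alpha> / 2) U))\<^sup>2 + C * (norm_L2 m u)\<^sup>2"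
    if FT: "has_fourier_L2 m u U" and wU: "weight (\<alpha> / 2) U \<in> L2 m" for u U
  proof -
    note L = has_fourier_L2D[OF FT]
    note [measurable] = L2_measurable[OF L(1)] L2_measurable[OF L(2)]
    define E where "E i \<xi> = indicator (band K i) \<xi> * U \<xi>" for i \<xi>
    have EL: "E i \<in> L2 m" for i unfolding E_def by (rule L2_indicator_mult[OF L(2)]) simp
    have "\<exists>e. has_fourier_L2 m e (E i)" for i using has_fourier_L2_ex_inverse[OF EL] by blast
    then obtain e where e: "\<And>i. has_fourier_L2 m (e i) (E i)" by metis
    define s where "s n x = (\<Sum>i<Suc n. e i x)" for n x
    have FTs: "has_fourier_L2 m (s n) (\<lambda>\<xi>. indicator (padic_ball 0 (int (K + n))) \<xi> * U \<xi>)" for n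
      using has_fourier_L2_sum[of e E "Suc n", OF e] unfolding s_def[abs_def] E_def sum_band .
    note sL = has_fourier_L2D(1)[OF FTs]
    have eqn: "norm_L2 m (\<lambda>x. s n x - u x) = norm_L2 m (\<lambda>\<xi>. indicator (padic_ball 0 (int (K + n))) \<xi> * U \<xi> - U \<xi>)" for n
      by (rule has_fourier_L2_norm[OF has_fourier_L2_diff[OF FTs FT], symmetric])
    have "tendsto_L2 m s u"
      unfolding tendsto_L2_def eqn
      using LIMSEQ_ignore_initial_segment[OF tendsto_ball_mult[OF L(2), unfolded tendsto_L2_def], of K]
      by (simp only: add.commute[of K])
    \<comment> \<open>Pointwise convergence along a subsequence lets Fatou carry the uniform bound
      from the partial sums to \<open>u\<close>.\<close>
    from tendsto_L2_AE_subseq[OF sL L(1) this] obtain \<rho> where \<rho>: "strict_mono \<rho>" "AE x in m. (\<lambda>n. s (\<rho> n) x) \<longlonglongrightarrow> u x"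
      by blast
    let ?w = "\<lambda>f x. complex_of_real (sqrt (W x)) * f x"
    define M where "M = \<epsilon> * (norm_L2 m (weight (\<alpha> / 2) U))\<^sup>2 + C * (norm_L2 m u)\<^sup>2"
    have supp: "AE \<xi> in m. \<xi> \<notin> padic_ball 0 (int (K + i)) \<longrightarrow> E i \<xi> = 0" for i
      using band_subset_ball[of K i] by (intro AE_I2) (auto simp: E_def indicator_def simp del: of_nat_add)
    have we: "?w (e i) \<in> L2 m"
      "(norm_L2 m (?w (e i)))\<^sup>2 \<le> b powr (real (K + i) / r) * B * (norm_L2 m (E i))\<^sup>2" for i
    proof -
      show "?w (e i) \<in> L2 m" by (rule band_limited_potential_bound(1)[OF W W0 r(1) Wr e supp])
      have "b powi (int (K + i)) = b powr real (K + i)"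
        using b by (simp add: powr_realpow del: of_nat_add)
      then have "(b powi (int (K + i))) powr (1 / r) = b powr (real (K + i) / r)" by (simp add: powr_powr)
      then show "(norm_L2 m (?w (e i)))\<^sup>2 \<le> b powr (real (K + i) / r) * B * (norm_L2 m (E i))\<^sup>2"
        using band_limited_potential_bound(2)[OF W W0 r(1) Wr e supp, of i] unfolding b_def B_def by simp
    qed
    have ws: "?w (s n) = (\<lambda>x. \<Sum>i<Suc n. ?w (e i) x)" for n
      unfolding s_def sum_distrib_left ..
    have wsL: "?w (s n) \<in> L2 m" for n
      unfolding ws by (intro L2_sum we) auto
    have bound: "(norm_L2 m (?w (s n)))\<^sup>2 \<le> M" for n
    proof -
      let ?I = "{..<Suc n}"
      define A where "A = (\<Sum>i\<in>?I. q ^ (K + i))"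
      have A0: "A \<ge> 0" unfolding A_def using q by (intro sum_nonneg) auto
      have "(\<Sum>i\<in>?I. q ^ i) \<le> 1 / (1 - q)" using q by (simp add: sum_gp_strict divide_right_mono del: power_Suc sum.lessThan_Suc)
      then have "A \<le> q ^ K * (1 / (1 - q))"
        unfolding A_def power_add sum_distrib_left[symmetric] using q by (intro mult_left_mono) auto
      also have "\<dots> \<le> \<epsilon> * (1 - q) / B * (1 / (1 - q))" using K q by (intro mult_right_mono) auto
      also have "\<dots> = \<epsilon> / B" using q by simp
      finally have AB: "A * B \<le> \<epsilon>" using B by (simp add: field_simps)
      have int1: "integrable m (\<lambda>x. (cmod (?w (e i) x))\<^sup>2)" for i by (rule L2_integrable[OF we(1)])
      have "(norm_L2 m (?w (s n)))\<^sup>2 \<le> (\<integral>x. A * (\<Sum>i\<in>?I. (cmod (?w (e i) x))\<^sup>2 / q ^ (K + i)) \<partial>m)"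
        unfolding norm_L2_power2
      proof (rule integral_mono[OF L2_integrable[OF wsL]])
        show "integrable m (\<lambda>x. A * (\<Sum>i\<in>?I. (cmod (?w (e i) x))\<^sup>2 / q ^ (K + i)))" using int1 by auto
        show "(cmod (?w (s n) x))\<^sup>2 \<le> A * (\<Sum>i\<in>?I. (cmod (?w (e i) x))\<^sup>2 / q ^ (K + i))" for x
          unfolding fun_cong[OF ws] A_def using q by (intro weighted_Cauchy_Schwarz) auto
      qed
      also have "\<dots> = A * (\<Sum>i\<in>?I. (norm_L2 m (?w (e i)))\<^sup>2 / q ^ (K + i))"
        using int1 by (simp add: norm_L2_power2 del: sum.lessThan_Suc)
      also have "\<dots> \<le> A * (\<Sum>i\<in>?I. B * (b powr (\<alpha> * real (K + i)) * (norm_L2 m (E i))\<^sup>2))"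
      proof (intro mult_left_mono sum_mono A0)
        fix i
        have qi: "q ^ (K + i) = b powr (- \<theta> * real (K + i))"
          unfolding q_def using b by (simp add: powr_powr flip: powr_realpow)
        have "(norm_L2 m (?w (e i)))\<^sup>2 / q ^ (K + i) \<le> b powr (real (K + i) / r) * B * (norm_L2 m (E i))\<^sup>2 / q ^ (K + i)"
          using we(2)[of i] q by (intro divide_right_mono) auto
        also have "\<dots> = B * ((b powr (real (K + i) / r) / b powr (- \<theta> * real (K + i))) * (norm_L2 m (E i))\<^sup>2)"
          unfolding qi by simp
        also have "b powr (real (K + i) / r) / b powr (- \<theta> * real (K + i)) = b powr (real (K + i) / r - (- \<theta> * real (K + i)))"
          by (rule powr_diff[symmetric])
        \<comment> \<open>By the choice of \<open>\<theta>\<close> the exponents of the band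
          estimate and of the geometric weight add up to that of the operator.\<close>
        also have "real (K + i) / r - (- \<theta> * real (K + i)) = \<alpha> * real (K + i)"
          by (simp add: \<theta>_def algebra_simps add_divide_distrib)
        finally show "(norm_L2 m (?w (e i)))\<^sup>2 / q ^ (K + i) \<le> B * (b powr (\<alpha> * real (K + i)) * (norm_L2 m (E i))\<^sup>2)" .
      qed
      also have "\<dots> = A * B * (\<Sum>i\<in>?I. b powr (\<alpha> * real (K + i)) * (norm_L2 m (E i))\<^sup>2)"
        by (simp only: sum_distrib_left mult.assoc)
      also have "\<dots> \<le> \<epsilon> * (\<Sum>i\<in>?I. b powr (\<alpha> * real (K + i)) * (norm_L2 m (E i))\<^sup>2)"
        by (intro mult_right_mono AB sum_nonneg) auto
      also have "(\<Sum>i\<in>?I. b powr (\<alpha> * real (K + i)) * (norm_L2 m (E i))\<^sup>2)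
          = (\<integral>\<xi>. (\<Sum>i\<in>?I. b powr (\<alpha> * real (K + i)) * (cmod (E i \<xi>))\<^sup>2) \<partial>m)"
        using L2_integrable[OF EL] by (simp add: norm_L2_power2 del: sum.lessThan_Suc)
      also have "\<dots> \<le> (\<integral>\<xi>. b powr (\<alpha> * real K) * (cmod (U \<xi>))\<^sup>2 + (cmod (weight (\<alpha> / 2) U \<xi>))\<^sup>2 \<partial>m)"
      proof (rule integral_mono)
        show "integrable m (\<lambda>\<xi>. \<Sum>i\<in>?I. b powr (\<alpha> * real (K + i)) * (cmod (E i \<xi>))\<^sup>2)"
          using L2_integrable[OF EL] by auto
        show "integrable m (\<lambda>\<xi>. b powr (\<alpha> * real K) * (cmod (U \<xi>))\<^sup>2 + (cmod (weight (\<alpha> / 2) U \<xi>))\<^sup>2)"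
          using L2_integrable[OF L(2)] L2_integrable[OF wU] by auto
        fix \<xi>
        have "(cmod (E i \<xi>))\<^sup>2 = indicator (band K i) \<xi> * (cmod (U \<xi>))\<^sup>2" for i
          by (simp add: E_def indicator_def)
        then have "(\<Sum>i\<in>?I. b powr (\<alpha> * real (K + i)) * (cmod (E i \<xi>))\<^sup>2)
            = (\<Sum>i\<in>?I. b powr (\<alpha> * real (K + i)) * indicator (band K i) \<xi>) * (cmod (U \<xi>))\<^sup>2"
          by (simp only: sum_distrib_right mult.assoc)
        also have "\<dots> \<le> (b powr (\<alpha> * real K) + norm_padic \<xi> powr \<alpha>) * (cmod (U \<xi>))\<^sup>2"
          unfolding b_def by (intro mult_right_mono sum_weighted_band \<alpha>) simp
        also have "norm_padic \<xi> powr \<alpha> * (cmod (U \<xi>))\<^sup>2 = (cmod (weight (\<alpha> / 2) U \<xi>))\<^sup>2"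
          by (simp add: weight_def norm_mult power_mult_distrib power2_eq_square[of "_ powr _"] flip: powr_add)
        then have "(b powr (\<alpha> * real K) + norm_padic \<xi> powr \<alpha>) * (cmod (U \<xi>))\<^sup>2
            = b powr (\<alpha> * real K) * (cmod (U \<xi>))\<^sup>2 + (cmod (weight (\<alpha> / 2) U \<xi>))\<^sup>2"
          by (simp add: distrib_right)
        finally show "(\<Sum>i\<in>?I. b powr (\<alpha> * real (K + i)) * (cmod (E i \<xi>))\<^sup>2)
            \<le> b powr (\<alpha> * real K) * (cmod (U \<xi>))\<^sup>2 + (cmod (weight (\<alpha> / 2) U \<xi>))\<^sup>2" .
      qed
      also have "\<dots> = b powr (\<alpha> * real K) * (norm_L2 m U)\<^sup>2 + (norm_L2 m (weight (\<alpha> / 2) U))\<^sup>2"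
        using L2_integrable[OF L(2)] L2_integrable[OF wU] by (simp add: norm_L2_power2)
      finally show ?thesis
        using \<epsilon> unfolding M_def C_def has_fourier_L2_norm[OF FT] by (simp add: algebra_simps)
    qed
    have lim: "AE x in m. (\<lambda>n. ?w (s (\<rho> n)) x) \<longlonglongrightarrow> ?w u x"
      using \<rho>(2) by eventually_elim (intro tendsto_intros)
    have wm: "?w u \<in> borel_measurable m" by measurable
    have ev: "eventually (\<lambda>n. (norm_L2 m (?w (s (\<rho> n))))\<^sup>2 \<le> M) sequentially" using bound by simp
    show ?thesis using L2_Fatou[OF wsL wm lim ev] unfolding M_def by blast
  qed
  show ?thesis
  proof (rule that[of C])
    show "C \<ge> 0" using \<epsilon> by (simp add: C_def)
  qed (use main in blast)+
qed

end

section \<open>Schroedinger forms\<close>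

lemma dom_QV_integrable:
  assumes V: "V \<in> borel_measurable M" and u: "u \<in> dom_QV M V" and v: "v \<in> dom_QV M V"
  shows "integrable M (\<lambda>x. complex_of_real (V x) * u x * cnj (v x))"
proof (rule Bochner_Integration.integrable_bound)
  have L: "u \<in> L2 M" "v \<in> L2 M" using u v by (auto simp: dom_QV_def)
  note [measurable] = V L2_measurable[OF L(1)] L2_measurable[OF L(2)]
  show "integrable M (\<lambda>x. \<bar>V x\<bar> * (cmod (u x))\<^sup>2 + \<bar>V x\<bar> * (cmod (v x))\<^sup>2)"
    using u v by (auto simp: dom_QV_def)
  show "(\<lambda>x. complex_of_real (V x) * u x * cnj (v x)) \<in> borel_measurable M" by measurable
  have "norm (complex_of_real (V x) * u x * cnj (v x)) \<le> norm (\<bar>V x\<bar> * (cmod (u x))\<^sup>2 + \<bar>V x\<bar> * (cmod (v x))\<^sup>2)" for x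
  proof -
    have "cmod (u x) * cmod (v x) \<le> (cmod (u x))\<^sup>2 + (cmod (v x))\<^sup>2"
      using sum_squares_bound[of "cmod (u x)" "cmod (v x)"]
        mult_nonneg_nonneg[OF norm_ge_zero[of "u x"] norm_ge_zero[of "v x"]] by linarith
    then have "\<bar>V x\<bar> * (cmod (u x) * cmod (v x)) \<le> \<bar>V x\<bar> * ((cmod (u x))\<^sup>2 + (cmod (v x))\<^sup>2)"
      by (intro mult_left_mono) auto
    then show ?thesis by (simp add: norm_mult mult.assoc distrib_left)
  qed
  then show "AE x in M. norm (complex_of_real (V x) * u x * cnj (v x))
      \<le> norm (\<bar>V x\<bar> * (cmod (u x))\<^sup>2 + \<bar>V x\<bar> * (cmod (v x))\<^sup>2)" by simp
qed

lemma QV_left: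
  assumes V: "V \<in> borel_measurable M" and u: "u \<in> dom_QV M V" "u' \<in> dom_QV M V" "v \<in> dom_QV M V"
  shows "QV M V (\<lambda>x. a * u x + b * u' x) v = a * QV M V u v + b * QV M V u' v"
proof -
  have "QV M V (\<lambda>x. a * u x + b * u' x) v
      = (\<integral>x. a * (complex_of_real (V x) * u x * cnj (v x)) + b * (complex_of_real (V x) * u' x * cnj (v x)) \<partial>M)"
    by (simp add: QV_def algebra_simps)
  also have "\<dots> = a * QV M V u v + b * QV M V u' v"
    using dom_QV_integrable[OF V u(1,3)] dom_QV_integrable[OF V u(2,3)] by (simp add: QV_def)
  finally show ?thesis .
qed

lemma QV_cnj: "QV M V v u = cnj (QV M V u v)"
  unfolding QV_def by (subst Bochner_Integration.integral_cnj[symmetric]) (simp add: mult_ac)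

lemma cmod_QV_le:
  "cmod (QV M V u u) \<le> (\<integral>x. \<bar>V x\<bar> * (cmod (u x))\<^sup>2 \<partial>M)"
  unfolding QV_def
  by (rule order_trans[OF integral_norm_bound]) (simp add: norm_mult mult.assoc power2_eq_square)

context haar
begin

text \<open>The bounded part of \<open>V\<close> only adds to the constant; the small factor comes
  from \<open>potential_bound\<close> for the part \<open>V'\<close> with
  \<open>W = \<bar>V'\<bar>\<close>.\<close>

lemma potential_form_bound:
  assumes \<gamma>: "\<gamma> > 0" and V: "V \<in> borel_measurable borel" and q: "q \<ge> 1" "q > 1 / \<gamma>"
    and Vq: "in_Lq_plus_Linf m q V" and \<epsilon>: "\<epsilon> > 0"
  obtains C where "C \<ge> 0"
    and "\<And>u U. has_fourier_L2 m u U \<Longrightarrow> weight (\<gamma> / 2) U \<in> L2 m \<Longrightarrow> integrable m (\<lambda>x. \<bar>V x\<bar> * (cmod (u x))\<^sup>2)"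
    and "\<And>u U. has_fourier_L2 m u U \<Longrightarrow> weight (\<gamma> / 2) U \<in> L2 m \<Longrightarrow>
      (\<integral>x. \<bar>V x\<bar> * (cmod (u x))\<^sup>2 \<partial>m) \<le> \<epsilon> * (norm_L2 m (weight (\<gamma> / 2) U))\<^sup>2 + C * (norm_L2 m u)\<^sup>2"
proof -
  obtain V' V'' C\<^sub>0 where V': "V' \<in> borel_measurable borel" "integrable m (\<lambda>x. \<bar>V' x\<bar> powr q)"
    and V'': "AE x in m. \<bar>V'' x\<bar> \<le> C\<^sub>0" and dec: "AE x in m. V x = V' x + V'' x"
    using Vq by (auto simp: in_Lq_plus_Linf_def)
  note [measurable] = V V'(1)
  obtain C where C: "C \<ge> 0"
    and CL: "\<And>u U. has_fourier_L2 m u U \<Longrightarrow> weight (\<gamma> / 2) U \<in> L2 m \<Longrightarrow> (\<lambda>x. complex_of_real (sqrt \<bar>V' x\<bar>) * u x) \<in> L2 m"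
    and Cb: "\<And>u U. has_fourier_L2 m u U \<Longrightarrow> weight (\<gamma> / 2) U \<in> L2 m \<Longrightarrow>
      (norm_L2 m (\<lambda>x. complex_of_real (sqrt \<bar>V' x\<bar>) * u x))\<^sup>2
        \<le> \<epsilon> * (norm_L2 m (weight (\<gamma> / 2) U))\<^sup>2 + C * (norm_L2 m u)\<^sup>2"
    by (rule potential_bound[OF \<gamma> q, of "\<lambda>x. \<bar>V' x\<bar>" \<epsilon>]) (use V'(2) \<epsilon> in auto)
  have main: "integrable m (\<lambda>x. \<bar>V x\<bar> * (cmod (u x))\<^sup>2) \<and>
      (\<integral>x. \<bar>V x\<bar> * (cmod (u x))\<^sup>2 \<partial>m) \<le> \<epsilon> * (norm_L2 m (weight (\<gamma> / 2) U))\<^sup>2 + (C + \<bar>C\<^sub>0\<bar>) * (norm_L2 m u)\<^sup>2"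
    if FT: "has_fourier_L2 m u U" and wU: "weight (\<gamma> / 2) U \<in> L2 m" for u U
  proof -
    note uL = has_fourier_L2D(1)[OF FT]
    note [measurable] = L2_measurable[OF uL]
    let ?g = "\<lambda>x. complex_of_real (sqrt \<bar>V' x\<bar>) * u x"
    have sq: "(cmod (?g x))\<^sup>2 = \<bar>V' x\<bar> * (cmod (u x))\<^sup>2" for x by (simp add: norm_mult power_mult_distrib)
    let ?h = "\<lambda>x. (cmod (?g x))\<^sup>2 + \<bar>C\<^sub>0\<bar> * (cmod (u x))\<^sup>2"
    have gi: "integrable m (\<lambda>x. (cmod (?g x))\<^sup>2)" by (rule L2_integrable[OF CL[OF that]])
    have hi: "integrable m ?h" using gi L2_integrable[OF uL] by auto
    have le: "AE x in m. \<bar>V x\<bar> * (cmod (u x))\<^sup>2 \<le> ?h x"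
      using V'' dec
    proof eventually_elim
      case (elim x)
      then have "\<bar>V x\<bar> * (cmod (u x))\<^sup>2 \<le> (\<bar>V' x\<bar> + \<bar>C\<^sub>0\<bar>) * (cmod (u x))\<^sup>2" by (intro mult_right_mono) auto
      then show ?case unfolding sq by (simp add: distrib_right)
    qed
    have vi: "integrable m (\<lambda>x. \<bar>V x\<bar> * (cmod (u x))\<^sup>2)"
      by (rule Bochner_Integration.integrable_bound[OF hi], measurable, use le in eventually_elim) simp
    have "(\<integral>x. \<bar>V x\<bar> * (cmod (u x))\<^sup>2 \<partial>m) \<le> (\<integral>x. ?h x \<partial>m)" by (rule integral_mono_AE[OF vi hi le])
    also have "\<dots> = (norm_L2 m ?g)\<^sup>2 + \<bar>C\<^sub>0\<bar> * (norm_L2 m u)\<^sup>2"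
      using gi L2_integrable[OF uL] by (simp add: norm_L2_power2)
    finally show ?thesis using vi Cb[OF that] by (simp add: algebra_simps)
  qed
  show ?thesis
    by (rule that[of "C + \<bar>C\<^sub>0\<bar>"]) (use C main in auto)
qed

text \<open>\<open>q \<ge> 2\<close> makes \<open>q / 2\<close> an admissible exponent, and for
  \<open>\<alpha> = 2 \<gamma>\<close> the weight \<open>\<alpha> / 2\<close> in
  \<open>potential_bound\<close> is the full \<open>\<gamma>\<close>.\<close>

lemma potential_operator_bound:
  assumes \<gamma>: "\<gamma> > 0" and V: "V \<in> borel_measurable borel" and q: "q \<ge> 2" "q > 1 / \<gamma>"
    and Vq: "in_Lq_plus_Linf m q V" and \<epsilon>: "\<epsilon> > 0"
  obtains C where "C \<ge> 0"
    and "\<And>u U. has_fourier_L2 m u U \<Longrightarrow> weight \<gamma> U \<in> L2 m \<Longrightarrow> (\<lambda>x. complex_of_real (V x) * u x) \<in> L2 m"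
    and "\<And>u U. has_fourier_L2 m u U \<Longrightarrow> weight \<gamma> U \<in> L2 m \<Longrightarrow>
      (norm_L2 m (\<lambda>x. complex_of_real (V x) * u x))\<^sup>2 \<le> \<epsilon> * (norm_L2 m (weight \<gamma> U))\<^sup>2 + C * (norm_L2 m u)\<^sup>2"
proof -
  obtain V' V'' C\<^sub>0 where V': "V' \<in> borel_measurable borel" "integrable m (\<lambda>x. \<bar>V' x\<bar> powr q)"
    and V'': "V'' \<in> borel_measurable borel" "AE x in m. \<bar>V'' x\<bar> \<le> C\<^sub>0" and dec: "AE x in m. V x = V' x + V'' x"
    using Vq by (auto simp: in_Lq_plus_Linf_def)
  note [measurable] = V V'(1) V''(1)
  have pw: "(V' x)\<^sup>2 powr (q / 2) = \<bar>V' x\<bar> powr q" for x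
  proof (cases "V' x = 0")
    case False
    then have "(V' x)\<^sup>2 powr (q / 2) = (\<bar>V' x\<bar> powr 2) powr (q / 2)" by simp
    also have "\<dots> = \<bar>V' x\<bar> powr q" by (simp only: powr_powr) simp
    finally show ?thesis .
  qed simp
  \<comment> \<open>\<open>\<epsilon> / 2\<close> compensates for the factor 2 lost when the
    contributions of \<open>V'\<close> and \<open>V''\<close> are added inside a square.\<close>
  have "2 * \<gamma> > 0" "q / 2 \<ge> 1" "q / 2 > 1 / (2 * \<gamma>)" "\<epsilon> / 2 > 0" using \<gamma> q \<epsilon> by (auto simp: field_simps)
  from potential_bound[OF this(1,2,3), of "\<lambda>x. (V' x)\<^sup>2" "\<epsilon> / 2"] this(4) V'(2) obtain C where C: "C \<ge> 0"
    and CL: "\<And>u U. has_fourier_L2 m u U \<Longrightarrow> weight \<gamma> U \<in> L2 m \<Longrightarrow> (\<lambda>x. complex_of_real \<bar>V' x\<bar> * u x) \<in> L2 m"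
    and Cb: "\<And>u U. has_fourier_L2 m u U \<Longrightarrow> weight \<gamma> U \<in> L2 m \<Longrightarrow>
      (norm_L2 m (\<lambda>x. complex_of_real \<bar>V' x\<bar> * u x))\<^sup>2 \<le> \<epsilon> / 2 * (norm_L2 m (weight \<gamma> U))\<^sup>2 + C * (norm_L2 m u)\<^sup>2"
    by (auto simp: pw)
  have main: "(\<lambda>x. complex_of_real (V x) * u x) \<in> L2 m \<and>
      (norm_L2 m (\<lambda>x. complex_of_real (V x) * u x))\<^sup>2 \<le> \<epsilon> * (norm_L2 m (weight \<gamma> U))\<^sup>2 + (2 * C + 2 * C\<^sub>0\<^sup>2) * (norm_L2 m u)\<^sup>2"
    if FT: "has_fourier_L2 m u U" and wU: "weight \<gamma> U \<in> L2 m" for u U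
  proof -
    note uL = has_fourier_L2D(1)[OF FT]
    note [measurable] = L2_measurable[OF uL]
    let ?a = "\<lambda>x. complex_of_real (V' x) * u x" and ?b = "\<lambda>x. complex_of_real (V'' x) * u x"
    have a: "?a \<in> L2 m" "(norm_L2 m ?a)\<^sup>2 \<le> 1\<^sup>2 * (norm_L2 m (\<lambda>x. complex_of_real \<bar>V' x\<bar> * u x))\<^sup>2"
      by (rule L2_dominated[OF CL[OF that], where C = 1]; auto simp: norm_mult)+
    have "AE x in m. cmod (?b x) \<le> C\<^sub>0 * cmod (u x)"
      using V''(2) by eventually_elim (simp add: norm_mult mult_right_mono)
    then have b: "?b \<in> L2 m" "(norm_L2 m ?b)\<^sup>2 \<le> C\<^sub>0\<^sup>2 * (norm_L2 m u)\<^sup>2"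
      using L2_dominated[OF uL, of ?b C\<^sub>0] by auto
    have a2: "(norm_L2 m ?a)\<^sup>2 \<le> \<epsilon> / 2 * (norm_L2 m (weight \<gamma> U))\<^sup>2 + C * (norm_L2 m u)\<^sup>2"
      by (rule order_trans[OF a(2)]) (use Cb[OF that] in simp)
    have ae: "AE x in m. ?a x + ?b x = complex_of_real (V x) * u x"
      using dec by eventually_elim (simp add: distrib_right)
    have vm: "(\<lambda>x. complex_of_real (V x) * u x) \<in> borel_measurable m" by measurable
    have eq: "norm_L2 m (\<lambda>x. ?a x + ?b x) = norm_L2 m (\<lambda>x. complex_of_real (V x) * u x)"
      by (rule norm_L2_cong_AE[OF _ vm ae]) measurable
    have "(norm_L2 m (\<lambda>x. complex_of_real (V x) * u x))\<^sup>2 \<le> 2 * (norm_L2 m ?a)\<^sup>2 + 2 * (norm_L2 m ?b)\<^sup>2"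
      unfolding eq[symmetric] by (rule norm_L2_add_power2_le[OF a(1) b(1)])
    also have "\<dots> \<le> 2 * (\<epsilon> / 2 * (norm_L2 m (weight \<gamma> U))\<^sup>2 + C * (norm_L2 m u)\<^sup>2) + 2 * (C\<^sub>0\<^sup>2 * (norm_L2 m u)\<^sup>2)"
      by (intro add_mono mult_left_mono a2 b(2)) auto
    finally show ?thesis using L2_cong_AE[OF L2_add[OF a(1) b(1)] vm ae] by (simp add: algebra_simps)
  qed
  show ?thesis
    by (rule that[of "2 * C + 2 * C\<^sub>0\<^sup>2"]) (use C main in auto)
qed

end

section \<open>The Schroedinger form and its operator\<close>

locale schroedinger = haar m for m :: "'p::prime_card padic measure" +
  fixes V :: "'p padic \<Rightarrow> real" and \<gamma> q :: real
  assumes \<gamma>: "\<gamma> > 0" and V: "V \<in> borel_measurable borel" and q: "q \<ge> 1" "q > 1 / \<gamma>"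
    and Vq: "in_Lq_plus_Linf m q V"
begin

abbreviation "L \<equiv> taibleson_vladimirov m \<gamma>"
abbreviation "D \<equiv> dom_Q m L V"
abbreviation "Q \<equiv> Q_form m L V"

text \<open>Form boundedness of \<open>V\<close> makes the second domain condition automatic, so the
  potential does not shrink the form domain.\<close>

lemma D_eq: "D = dom_QL m L"
proof -
  obtain C where C: "\<And>u U. has_fourier_L2 m u U \<Longrightarrow> weight (\<gamma> / 2) U \<in> L2 m \<Longrightarrow> integrable m (\<lambda>x. \<bar>V x\<bar> * (cmod (u x))\<^sup>2)"
    by (rule potential_form_bound[OF \<gamma> V q Vq zero_less_one]) blast
  have "u \<in> dom_QV m V" if u: "u \<in> dom_QL m L" for u
  proof -
    have uL: "u \<in> L2 m" using u dom_QL_L2[OF \<gamma>] by blast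
    obtain U where U: "has_fourier_L2 m u U" using has_fourier_L2_ex[OF uL] by blast
    have "weight (\<gamma> / 2) U \<in> L2 m" using u dom_QL_iff[OF \<gamma> U] by simp
    from C[OF U this] uL show ?thesis by (simp add: dom_QV_def)
  qed
  then show ?thesis by (auto simp: dom_Q_def)
qed

lemma D_fourier:
  assumes "u \<in> D" obtains U where "has_fourier_L2 m u U" "weight (\<gamma> / 2) U \<in> L2 m"
proof -
  have uL: "u \<in> L2 m" using assms dom_QL_L2[OF \<gamma>] unfolding D_eq by blast
  obtain U where U: "has_fourier_L2 m u U" using has_fourier_L2_ex[OF uL] by blast
  with assms show ?thesis using dom_QL_iff[OF \<gamma> U] that unfolding D_eq by blast
qed

lemma D_I: "has_fourier_L2 m u U \<Longrightarrow> weight (\<gamma> / 2) U \<in> L2 m \<Longrightarrow> u \<in> D"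
  unfolding D_eq using dom_QL_iff[OF \<gamma>] by blast

lemma Q_eq:
  assumes "u \<in> D" "has_fourier_L2 m u U" "v \<in> D" "has_fourier_L2 m v W"
  shows "Q u v = inner_L2 m (weight (\<gamma> / 2) U) (weight (\<gamma> / 2) W) + QV m V u v"
  using QL_eq[OF \<gamma> _ assms(2) _ assms(4)] assms(1,3) unfolding Q_form_def D_eq by simp

lemma D_QV: "u \<in> D \<Longrightarrow> u \<in> dom_QV m V"
  by (simp add: dom_Q_def)

lemma hermitian_Q: "hermitian_form m D Q"
proof -
  have Vm: "V \<in> borel_measurable m" using V by simp
  let ?w = "weight (\<gamma> / 2)"
  note lin = linear_operatorD[OF linear_taibleson_vladimirov[of "\<gamma> / 2"]]
  \<comment> \<open>As the domain of a linear operator, \<open>D\<close> inherits its subspace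
    properties, including closure under a.e. equality.\<close>
  have dom: "D = Domain (taibleson_vladimirov m (\<gamma> / 2))"
    unfolding D_eq dom_QL_def op_sqrt_taibleson_vladimirov[OF \<gamma>] ..
  have DL: "u \<in> L2 m" if "u \<in> D" for u using that lin(1) unfolding dom by blast
  have comb: "(\<lambda>x. a * u x + b * v x) \<in> D" if "u \<in> D" "v \<in> D" for u v a b
    using that lin(3) unfolding dom by blast
  have cong: "v \<in> D" if u: "u \<in> D" and v: "v \<in> borel_measurable m" "AE x in m. u x = v x" for u v
  proof -
    obtain w where w: "(u, w) \<in> taibleson_vladimirov m (\<gamma> / 2)" using u unfolding dom by blast
    have "(v, w) \<in> taibleson_vladimirov m (\<gamma> / 2)"
      by (rule lin(4)[OF w v(1) L2_measurable[OF lin(2)[OF w]] v(2)]) simp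
    then show ?thesis unfolding dom by blast
  qed
  have zero: "(\<lambda>_. 0) \<in> D" unfolding dom using linear_taibleson_vladimirov[of "\<gamma> / 2"] by (auto simp: linear_operator_def)
  show ?thesis
    unfolding hermitian_form_def
  proof (intro conjI ballI allI impI)
    show "subspace_L2 m D"
      unfolding subspace_L2_def using DL zero comb cong by blast
    fix u u' v a b assume D: "u \<in> D" "u' \<in> D" "v \<in> D"
    obtain U where U: "has_fourier_L2 m u U" "?w U \<in> L2 m" using D(1) by (rule D_fourier)
    obtain U' where U': "has_fourier_L2 m u' U'" "?w U' \<in> L2 m" using D(2) by (rule D_fourier)
    obtain W where W: "has_fourier_L2 m v W" "?w W \<in> L2 m" using D(3) by (rule D_fourier)
    show "Q (\<lambda>x. a * u x + b * u' x) v = a * Q u v + b * Q u' v"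
      unfolding Q_eq[OF comb[OF D(1,2)] has_fourier_L2_lincomb[OF U(1) U'(1)] D(3) W(1)]
        Q_eq[OF D(1) U(1) D(3) W(1)] Q_eq[OF D(2) U'(1) D(3) W(1)]
        weight_lincomb inner_L2_lincomb_left[OF U(2) U'(2) W(2)] QV_left[OF Vm D[THEN D_QV]]
      by (simp add: algebra_simps)
  next
    fix u v assume D: "u \<in> D" "v \<in> D"
    obtain U where U: "has_fourier_L2 m u U" "?w U \<in> L2 m" using D(1) by (rule D_fourier)
    obtain W where W: "has_fourier_L2 m v W" "?w W \<in> L2 m" using D(2) by (rule D_fourier)
    show "Q v u = cnj (Q u v)"
      unfolding Q_eq[OF D(1) U(1) D(2) W(1)] Q_eq[OF D(2) W(1) D(1) U(1)]
        inner_L2_cnj[of m "?w W" "?w U"] QV_cnj[of m V v u] by simp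
  next
    fix u u' v assume D: "u \<in> D" "u' \<in> D" "v \<in> D" and ae: "AE x in m. u x = u' x"
    obtain U where U: "has_fourier_L2 m u U" "?w U \<in> L2 m" using D(1) by (rule D_fourier)
    obtain W where W: "has_fourier_L2 m v W" "?w W \<in> L2 m" using D(3) by (rule D_fourier)
    note [measurable] = V L2_measurable[OF has_fourier_L2D(2)[OF U(1)]] D[THEN DL, THEN L2_measurable]
    have U': "has_fourier_L2 m u' U"
      by (rule has_fourier_L2_cong_AE[OF U(1) _ _ ae]) auto
    have "QV m V u v = QV m V u' v"
      unfolding QV_def by (rule integral_cong_AE) (measurable, use ae in eventually_elim, simp)
    then show "Q u v = Q u' v"
      unfolding Q_eq[OF D(1) U(1) D(3) W(1)] Q_eq[OF D(2) U' D(3) W(1)] by simp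
  qed
qed

lemma dense_D: "dense_L2 m D"
  using dense_Domain_taibleson_vladimirov[of "\<gamma> / 2"] \<gamma>
  unfolding D_eq dom_QL_def op_sqrt_taibleson_vladimirov[OF \<gamma>] by simp

text \<open>With relative bound 1/2, \<open>Q\<close> is equivalent to the form of \<open>L\<close>
  alone up to multiples of the squared norm. Lower boundedness and closedness are both read off from
  this.\<close>

lemma Q_estimates:
  obtains C where "C \<ge> 0"
    and "\<And>u U. has_fourier_L2 m u U \<Longrightarrow> weight (\<gamma> / 2) U \<in> L2 m \<Longrightarrow>
      (norm_L2 m (weight (\<gamma> / 2) U))\<^sup>2 \<le> 2 * Re (Q u u) + C * (norm_L2 m u)\<^sup>2"
    and "\<And>u U. has_fourier_L2 m u U \<Longrightarrow> weight (\<gamma> / 2) U \<in> L2 m \<Longrightarrow>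
      cmod (Q u u) \<le> 2 * (norm_L2 m (weight (\<gamma> / 2) U))\<^sup>2 + C * (norm_L2 m u)\<^sup>2"
proof -
  have half: "(1 / 2 :: real) > 0" by simp
  obtain C where C: "C \<ge> 0"
    and Cb: "\<And>u U. has_fourier_L2 m u U \<Longrightarrow> weight (\<gamma> / 2) U \<in> L2 m \<Longrightarrow>
      (\<integral>x. \<bar>V x\<bar> * (cmod (u x))\<^sup>2 \<partial>m) \<le> 1 / 2 * (norm_L2 m (weight (\<gamma> / 2) U))\<^sup>2 + C * (norm_L2 m u)\<^sup>2"
    by (rule potential_form_bound[OF \<gamma> V q Vq half]) blast
  have main: "(norm_L2 m (weight (\<gamma> / 2) U))\<^sup>2 \<le> 2 * Re (Q u u) + 2 * C * (norm_L2 m u)\<^sup>2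
      \<and> cmod (Q u u) \<le> 2 * (norm_L2 m (weight (\<gamma> / 2) U))\<^sup>2 + 2 * C * (norm_L2 m u)\<^sup>2"
    if U: "has_fourier_L2 m u U" and w: "weight (\<gamma> / 2) U \<in> L2 m" for u U
  proof -
    let ?N = "(norm_L2 m (weight (\<gamma> / 2) U))\<^sup>2"
    have u: "u \<in> D" by (rule D_I[OF that])
    have eq: "Q u u = of_real ?N + QV m V u u" unfolding Q_eq[OF u U u U] inner_L2_self ..
    have v: "cmod (QV m V u u) \<le> 1 / 2 * ?N + C * (norm_L2 m u)\<^sup>2"
      by (rule order_trans[OF cmod_QV_le Cb[OF that]])
    have "- cmod (QV m V u u) \<le> Re (QV m V u u)" using abs_Re_le_cmod[of "QV m V u u"] by linarith
    then have "?N \<le> 2 * Re (Q u u) + 2 * C * (norm_L2 m u)\<^sup>2" unfolding eq using v by simp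
    moreover have "cmod (Q u u) \<le> cmod (of_real ?N) + cmod (QV m V u u)" unfolding eq by (rule norm_triangle_ineq)
    then have "cmod (Q u u) \<le> ?N + (1 / 2 * ?N + C * (norm_L2 m u)\<^sup>2)" using v unfolding norm_of_real by simp
    moreover have "?N \<ge> 0" "C * (norm_L2 m u)\<^sup>2 \<ge> 0" using C by auto
    ultimately show ?thesis unfolding mult.assoc by linarith
  qed
  show ?thesis by (rule that[of "2 * C"]) (use C main in auto)
qed

lemma bounded_below_Q: "form_bounded_below m D Q"
proof -
  obtain C where C: "\<And>u U. has_fourier_L2 m u U \<Longrightarrow> weight (\<gamma> / 2) U \<in> L2 m \<Longrightarrow>
      (norm_L2 m (weight (\<gamma> / 2) U))\<^sup>2 \<le> 2 * Re (Q u u) + C * (norm_L2 m u)\<^sup>2"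
    by (rule Q_estimates) blast
  have "(- C / 2) * (norm_L2 m u)\<^sup>2 \<le> Re (Q u u)" if u: "u \<in> D" for u
  proof -
    obtain U where U: "has_fourier_L2 m u U" "weight (\<gamma> / 2) U \<in> L2 m" using u by (rule D_fourier)
    show ?thesis using order_trans[OF zero_le_power2 C[OF U]] by simp
  qed
  then show ?thesis unfolding form_bounded_below_def by blast
qed

text \<open>A sequence that is Cauchy for \<open>Q\<close> and convergent in L2 has Cauchy weighted
  transforms. Their limit is identified as \<open>weight (\<gamma> / 2) F\<close> by Fatou along an
  a.e. convergent subsequence of the transforms.\<close>

lemma closed_Q: "form_closed m D Q"
  unfolding form_closed_def
proof (intro allI impI)
  fix u f assume uD: "\<forall>n. u n \<in> D" and f: "f \<in> L2 m" and lim: "tendsto_L2 m u f"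
    and cau: "\<forall>e>0. \<exists>N. \<forall>k\<ge>N. \<forall>n\<ge>N. cmod (Q (\<lambda>x. u k x - u n x) (\<lambda>x. u k x - u n x)) < e"
  let ?w = "weight (\<gamma> / 2)"
  obtain C where C: "C \<ge> 0"
    and C1: "\<And>u U. has_fourier_L2 m u U \<Longrightarrow> ?w U \<in> L2 m \<Longrightarrow>
      (norm_L2 m (?w U))\<^sup>2 \<le> 2 * Re (Q u u) + C * (norm_L2 m u)\<^sup>2"
    and C2: "\<And>u U. has_fourier_L2 m u U \<Longrightarrow> ?w U \<in> L2 m \<Longrightarrow>
      cmod (Q u u) \<le> 2 * (norm_L2 m (?w U))\<^sup>2 + C * (norm_L2 m u)\<^sup>2"
    by (rule Q_estimates) blast
  have "\<forall>n. \<exists>U. has_fourier_L2 m (u n) U \<and> ?w U \<in> L2 m" using uD D_fourier by blast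
  then obtain U where U: "\<And>n. has_fourier_L2 m (u n) (U n)" and wU: "\<And>n. ?w (U n) \<in> L2 m" by metis
  have uL: "u n \<in> L2 m" for n by (rule has_fourier_L2D(1)[OF U])
  have UL: "U n \<in> L2 m" for n by (rule has_fourier_L2D(2)[OF U])
  obtain F where F: "has_fourier_L2 m f F" using has_fourier_L2_ex[OF f] by blast
  note FL = has_fourier_L2D(2)[OF F]
  have "tendsto_L2 m U F"
    using lim has_fourier_L2_norm[OF has_fourier_L2_diff[OF U F]] by (simp add: tendsto_L2_def)
  from tendsto_L2_AE_subseq[OF UL FL this] obtain \<rho> where
    \<rho>: "strict_mono \<rho>" "AE \<xi> in m. (\<lambda>n. U (\<rho> n) \<xi>) \<longlonglongrightarrow> F \<xi>" by blast
  have wdiff: "?w (\<lambda>\<xi>. G \<xi> - H \<xi>) = (\<lambda>\<xi>. ?w G \<xi> - ?w H \<xi>)" for G H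
    using weight_lincomb[of "\<gamma> / 2" 1 G "-1" H] by simp
  have wcau: "\<exists>N. \<forall>k\<ge>N. \<forall>n\<ge>N. (norm_L2 m (\<lambda>\<xi>. ?w (U n) \<xi> - ?w (U k) \<xi>))\<^sup>2 \<le> e" if e: "e > 0" for e
  proof -
    obtain N where N: "\<And>k n. k \<ge> N \<Longrightarrow> n \<ge> N \<Longrightarrow> cmod (Q (\<lambda>x. u k x - u n x) (\<lambda>x. u k x - u n x)) < e / 4"
      using cau e by (meson divide_pos_pos zero_less_numeral)
    \<comment> \<open>Makes \<open>C\<close> times the squared norm of the differences at most
      \<open>e / 2\<close>; the other half is \<open>2 * (e / 4)\<close> from the form.\<close>
    have "sqrt (e / (2 * (C + 1))) > 0" using e C by simp
    from tendsto_L2_Cauchy[OF uL f lim this] obtain N' where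
      N': "\<And>k n. k \<ge> N' \<Longrightarrow> n \<ge> N' \<Longrightarrow> norm_L2 m (\<lambda>x. u k x - u n x) < sqrt (e / (2 * (C + 1)))" by blast
    have "(norm_L2 m (\<lambda>\<xi>. ?w (U n) \<xi> - ?w (U k) \<xi>))\<^sup>2 \<le> e" if kn: "k \<ge> max N N'" "n \<ge> max N N'" for k n
    proof -
      have "(norm_L2 m (\<lambda>x. u n x - u k x))\<^sup>2 < (sqrt (e / (2 * (C + 1))))\<^sup>2"
        by (rule power_strict_mono) (use N'[of n k] kn in auto)
      then have "(norm_L2 m (\<lambda>x. u n x - u k x))\<^sup>2 < e / (2 * (C + 1))" using e C by simp
      then have "(C + 1) * (norm_L2 m (\<lambda>x. u n x - u k x))\<^sup>2 \<le> (C + 1) * (e / (2 * (C + 1)))"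
        using C by (intro mult_left_mono) auto
      also have "\<dots> = e / 2"
      proof -
        have "a * (e / (2 * a)) = e / 2" if "a \<noteq> 0" for a :: real using that by simp
        from this[of "C + 1"] show ?thesis using C by linarith
      qed
      finally have "C * (norm_L2 m (\<lambda>x. u n x - u k x))\<^sup>2 \<le> e / 2"
        unfolding distrib_right mult_1 using zero_le_power2[of "norm_L2 m (\<lambda>x. u n x - u k x)"] by linarith
      moreover have "2 * Re (Q (\<lambda>x. u n x - u k x) (\<lambda>x. u n x - u k x)) \<le> e / 2"
        using N[of n k] kn complex_Re_le_cmod[of "Q (\<lambda>x. u n x - u k x) (\<lambda>x. u n x - u k x)"] by simp
      moreover have "?w (\<lambda>\<xi>. U n \<xi> - U k \<xi>) \<in> L2 m" unfolding wdiff by (rule L2_diff[OF wU wU])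
      from C1[OF has_fourier_L2_diff[OF U U] this]
      have "(norm_L2 m (?w (\<lambda>\<xi>. U n \<xi> - U k \<xi>)))\<^sup>2
          \<le> 2 * Re (Q (\<lambda>x. u n x - u k x) (\<lambda>x. u n x - u k x)) + C * (norm_L2 m (\<lambda>x. u n x - u k x))\<^sup>2" .
      ultimately show ?thesis unfolding wdiff by simp
    qed
    then show ?thesis by blast
  qed
  have wFm: "?w F \<in> borel_measurable m" using weight_measurable L2_measurable[OF FL] by simp
  have wconv: "\<exists>N. \<forall>n\<ge>N. (\<lambda>\<xi>. ?w (U n) \<xi> - ?w F \<xi>) \<in> L2 m \<and> (norm_L2 m (\<lambda>\<xi>. ?w (U n) \<xi> - ?w F \<xi>))\<^sup>2 \<le> e" if e: "e > 0" for e
  proof -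
    obtain N where N: "\<And>k n. k \<ge> N \<Longrightarrow> n \<ge> N \<Longrightarrow> (norm_L2 m (\<lambda>\<xi>. ?w (U n) \<xi> - ?w (U k) \<xi>))\<^sup>2 \<le> e"
      using wcau[OF e] by blast
    show ?thesis
    proof (intro exI[of _ N] allI impI)
      fix n assume n: "n \<ge> N"
      have d: "(\<lambda>\<xi>. ?w (U n) \<xi> - ?w (U (\<rho> j)) \<xi>) \<in> L2 m" for j by (intro L2_diff wU)
      have mm: "(\<lambda>\<xi>. ?w (U n) \<xi> - ?w F \<xi>) \<in> borel_measurable m"
        by (intro borel_measurable_diff L2_measurable[OF wU] wFm)
      have l: "AE \<xi> in m. (\<lambda>j. ?w (U n) \<xi> - ?w (U (\<rho> j)) \<xi>) \<longlonglongrightarrow> ?w (U n) \<xi> - ?w F \<xi>"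
        using \<rho>(2) by eventually_elim (unfold weight_def, intro tendsto_intros)
      have ev: "eventually (\<lambda>j. (norm_L2 m (\<lambda>\<xi>. ?w (U n) \<xi> - ?w (U (\<rho> j)) \<xi>))\<^sup>2 \<le> e) sequentially"
        using eventually_ge_at_top[of N]
      proof eventually_elim
        case (elim j)
        then have "\<rho> j \<ge> N" using seq_suble[OF \<rho>(1), of j] by linarith
        then show ?case using N[OF _ n] by blast
      qed
      show "(\<lambda>\<xi>. ?w (U n) \<xi> - ?w F \<xi>) \<in> L2 m \<and> (norm_L2 m (\<lambda>\<xi>. ?w (U n) \<xi> - ?w F \<xi>))\<^sup>2 \<le> e"
        using L2_Fatou[OF d mm l ev] by blast
    qed
  qed
  obtain n where "(\<lambda>\<xi>. ?w (U n) \<xi> - ?w F \<xi>) \<in> L2 m" using wconv[OF zero_less_one] by blast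
  from L2_diff[OF wU[of n] this] have wF: "?w F \<in> L2 m" by simp
  have fD: "f \<in> D" by (rule D_I[OF F wF])
  have n1: "(\<lambda>n. (norm_L2 m (\<lambda>\<xi>. ?w (U n) \<xi> - ?w F \<xi>))\<^sup>2) \<longlonglongrightarrow> 0"
  proof (rule LIMSEQ_I)
    fix e :: real assume "e > 0"
    then obtain N where "\<forall>n\<ge>N. (norm_L2 m (\<lambda>\<xi>. ?w (U n) \<xi> - ?w F \<xi>))\<^sup>2 \<le> e / 2" using wconv[of "e/2"] by (meson half_gt_zero)
    with \<open>e > 0\<close> show "\<exists>N. \<forall>n\<ge>N. norm ((norm_L2 m (\<lambda>\<xi>. ?w (U n) \<xi> - ?w F \<xi>))\<^sup>2 - 0) < e"
      by (intro exI[of _ N]) (auto intro: le_less_trans)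
  qed
  have "(\<lambda>n. Q (\<lambda>x. u n x - f x) (\<lambda>x. u n x - f x)) \<longlonglongrightarrow> 0"
  proof (rule Lim_null_comparison)
    have "cmod (Q (\<lambda>x. u n x - f x) (\<lambda>x. u n x - f x))
        \<le> 2 * (norm_L2 m (\<lambda>\<xi>. ?w (U n) \<xi> - ?w F \<xi>))\<^sup>2 + C * (norm_L2 m (\<lambda>x. u n x - f x))\<^sup>2" for n
      using C2[OF has_fourier_L2_diff[OF U F], of n] unfolding wdiff using L2_diff[OF wU wF] by blast
    then show "\<forall>\<^sub>F n in sequentially. norm (Q (\<lambda>x. u n x - f x) (\<lambda>x. u n x - f x))
        \<le> 2 * (norm_L2 m (\<lambda>\<xi>. ?w (U n) \<xi> - ?w F \<xi>))\<^sup>2 + C * (norm_L2 m (\<lambda>x. u n x - f x))\<^sup>2" by simp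
    have "(\<lambda>n. 2 * (norm_L2 m (\<lambda>\<xi>. ?w (U n) \<xi> - ?w F \<xi>))\<^sup>2 + C * (norm_L2 m (\<lambda>x. u n x - f x))\<^sup>2)
        \<longlonglongrightarrow> 2 * 0 + C * 0\<^sup>2"
      using lim unfolding tendsto_L2_def by (intro tendsto_intros n1)
    then show "(\<lambda>n. 2 * (norm_L2 m (\<lambda>\<xi>. ?w (U n) \<xi> - ?w F \<xi>))\<^sup>2 + C * (norm_L2 m (\<lambda>x. u n x - f x))\<^sup>2)
        \<longlonglongrightarrow> 0" by simp
  qed
  with fD show "f \<in> D \<and> (\<lambda>n. Q (\<lambda>x. u n x - f x) (\<lambda>x. u n x - f x)) \<longlonglongrightarrow> 0" by blast
qed

sublocale form: hform m D Q
  by (rule hform.intro) (rule hermitian_Q)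

abbreviation "H \<equiv> form_operator m D Q"

text \<open>If \<open>V\<close> is bounded relative to \<open>L\<close> with bound less than 1, then \<open>L + V + \<kappa>\<close> is onto for large \<open>\<kappa>\<close>: solve
  \<open>g = f - V (L + \<kappa>)\<inverse> g\<close> by contraction. Hence \<open>H\<close> has no larger domain than \<open>L + V\<close>.\<close>

theorem Domain_form_operator:
  assumes q2: "q \<ge> 2"
  shows "Domain H = Domain L"
proof -
  have quarter: "(1 / 4 :: real) > 0" by simp
  obtain C where C: "C \<ge> 0"
    and VL: "\<And>u U. has_fourier_L2 m u U \<Longrightarrow> weight \<gamma> U \<in> L2 m \<Longrightarrow> (\<lambda>x. complex_of_real (V x) * u x) \<in> L2 m"
    and Vb: "\<And>u U. has_fourier_L2 m u U \<Longrightarrow> weight \<gamma> U \<in> L2 m \<Longrightarrow>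
      (norm_L2 m (\<lambda>x. complex_of_real (V x) * u x))\<^sup>2 \<le> 1 / 4 * (norm_L2 m (weight \<gamma> U))\<^sup>2 + C * (norm_L2 m u)\<^sup>2"
    by (rule potential_operator_bound[OF \<gamma> V q2 q(2) Vq quarter]) blast
  \<comment> \<open>\<open>L + V\<close> is a restriction of \<open>H\<close>: the symmetric weight
    \<open>\<gamma> / 2\<close> is moved from one factor of the form to the other.\<close>
  have sum: "(u, \<lambda>x. l x + complex_of_real (V x) * u x) \<in> H"
    if U: "has_fourier_L2 m u U" and l: "has_fourier_L2 m l (weight \<gamma> U)" for u U l
  proof -
    have wL: "weight \<gamma> U \<in> L2 m" by (rule has_fourier_L2D(2)[OF l])
    have w2: "weight (\<gamma> / 2) U \<in> L2 m"
      by (rule weight_le_L2[OF has_fourier_L2D(2)[OF U] wL]) (use \<gamma> in auto)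
    have uD: "u \<in> D" by (rule D_I[OF U w2])
    note VuL = VL[OF U wL] and lL = has_fourier_L2D(1)[OF l]
    have "Q u v = inner_L2 m (\<lambda>x. l x + complex_of_real (V x) * u x) v" if v: "v \<in> D" for v
    proof -
      obtain W where W: "has_fourier_L2 m v W" "weight (\<gamma> / 2) W \<in> L2 m" using v by (rule D_fourier)
      have "Q u v = inner_L2 m (weight \<gamma> U) W + QV m V u v"
        unfolding Q_eq[OF uD U v W(1)] inner_weight[symmetric, of _ _ W] weight_weight by simp
      also have "inner_L2 m (weight \<gamma> U) W = inner_L2 m l v" by (rule has_fourier_L2_inner[OF l W(1)])
      also have "QV m V u v = inner_L2 m (\<lambda>x. complex_of_real (V x) * u x) v" by (simp add: QV_def inner_L2_def)
      finally show ?thesis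
        using inner_L2_lincomb_left[OF lL VuL has_fourier_L2D(1)[OF W(1)], of 1 1] by simp
    qed
    then show ?thesis using uD L2_add[OF lL VuL] by (simp add: form_operator_def)
  qed
  show ?thesis
  proof (intro equalityI subsetI)
    fix u assume "u \<in> Domain L"
    then obtain l where "(u, l) \<in> L" by blast
    then obtain U where "has_fourier_L2 m u U" "has_fourier_L2 m l (weight \<gamma> U)" by (rule taibleson_vladimirovE)
    from sum[OF this] show "u \<in> Domain H" by blast
  next
    fix u assume "u \<in> Domain H"
    then obtain w where uw: "(u, w) \<in> H" by blast
    then have uL: "u \<in> L2 m" and wL: "w \<in> L2 m" using form.D_L2 by (auto simp: form_operator_def)
    obtain c where c: "\<And>u. u \<in> D \<Longrightarrow> c * (norm_L2 m u)\<^sup>2 \<le> Re (Q u u)"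
      using bounded_below_Q unfolding form_bounded_below_def by blast
    \<comment> \<open>The summand \<open>4 * C\<close> makes
      \<open>C / \<kappa>\<^sup>2 \<le> 1 / 4\<close>; with the relative bound 1/4 this gives the
      squared contraction factor 1/2. The other summands give \<open>\<kappa> \<ge> 1\<close> and
      \<open>\<kappa> + c > 0\<close>.\<close>
    define \<kappa> where "\<kappa> = 1 + \<bar>c\<bar> + 4 * C"
    have \<kappa>: "\<kappa> \<ge> 1" "\<kappa> + c > 0" "C / \<kappa>\<^sup>2 \<le> 1 / 4"
    proof -
      show k1: "\<kappa> \<ge> 1" and "\<kappa> + c > 0" using C by (auto simp: \<kappa>_def)
      have "4 * C \<le> \<kappa> * 1" by (simp add: \<kappa>_def)
      also have "\<dots> \<le> \<kappa> * \<kappa>" using k1 by (intro mult_left_mono) auto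
      finally show "C / \<kappa>\<^sup>2 \<le> 1 / 4" using k1 by (simp add: power2_eq_square field_simps)
    qed
    define f where "f x = w x + of_real \<kappa> * u x" for x
    have fL: "f \<in> L2 m" unfolding f_def using L2_lincomb[OF wL uL, of 1] by simp
    \<comment> \<open>The resolvent of \<open>L\<close> at \<open>- \<kappa>\<close> on the Fourier
      side; it has norm at most \<open>1 / \<kappa>\<close>, and at most 1 when followed by the
      weight.\<close>
    define R where "R G \<xi> = complex_of_real (1 / (norm_padic \<xi> powr \<gamma> + \<kappa>)) * G \<xi>" for G :: "'p padic \<Rightarrow> complex" and \<xi>
    have den: "norm_padic \<xi> powr \<gamma> + \<kappa> > 0" for \<xi> :: "'p padic" using \<kappa>(1) by (simp add: add_nonneg_pos)
    have R: "R G \<in> L2 m" "(norm_L2 m (R G))\<^sup>2 \<le> (1 / \<kappa>)\<^sup>2 * (norm_L2 m G)\<^sup>2"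
      "weight \<gamma> (R G) \<in> L2 m" "(norm_L2 m (weight \<gamma> (R G)))\<^sup>2 \<le> 1\<^sup>2 * (norm_L2 m G)\<^sup>2" if G: "G \<in> L2 m" for G
    proof -
      note [measurable] = L2_measurable[OF G]
      have m1: "R G \<in> borel_measurable m" unfolding R_def[abs_def] by measurable
      have m2: "weight \<gamma> (R G) \<in> borel_measurable m" using m1 weight_measurable by simp
      have "cmod (R G \<xi>) \<le> 1 / \<kappa> * cmod (G \<xi>)" for \<xi>
      proof -
        have "1 / (norm_padic \<xi> powr \<gamma> + \<kappa>) \<le> 1 / \<kappa>" using \<kappa>(1) den[of \<xi>] by (intro divide_left_mono mult_pos_pos) auto
        then have "1 / (norm_padic \<xi> powr \<gamma> + \<kappa>) * cmod (G \<xi>) \<le> 1 / \<kappa> * cmod (G \<xi>)" by (intro mult_right_mono) auto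
        then show ?thesis using den[of \<xi>] by (simp add: R_def norm_mult del: of_real_divide)
      qed
      then have le1: "AE \<xi> in m. cmod (R G \<xi>) \<le> 1 / \<kappa> * cmod (G \<xi>)" by simp
      have "cmod (weight \<gamma> (R G) \<xi>) \<le> 1 * cmod (G \<xi>)" for \<xi>
      proof -
        have "norm_padic \<xi> powr \<gamma> * (1 / (norm_padic \<xi> powr \<gamma> + \<kappa>)) \<le> 1" using den[of \<xi>] \<kappa>(1) by simp
        then have "norm_padic \<xi> powr \<gamma> * (1 / (norm_padic \<xi> powr \<gamma> + \<kappa>)) * cmod (G \<xi>) \<le> 1 * cmod (G \<xi>)"
          by (intro mult_right_mono) auto
        then show ?thesis using den[of \<xi>] by (simp add: R_def weight_def norm_mult mult.assoc del: of_real_divide)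
      qed
      then have le2: "AE \<xi> in m. cmod (weight \<gamma> (R G) \<xi>) \<le> 1 * cmod (G \<xi>)" by simp
      show "R G \<in> L2 m" "(norm_L2 m (R G))\<^sup>2 \<le> (1 / \<kappa>)\<^sup>2 * (norm_L2 m G)\<^sup>2"
        by (rule L2_dominated[OF G m1 le1])+
      show "weight \<gamma> (R G) \<in> L2 m" "(norm_L2 m (weight \<gamma> (R G)))\<^sup>2 \<le> 1\<^sup>2 * (norm_L2 m G)\<^sup>2"
        by (rule L2_dominated[OF G m2 le2])+
    qed
    have Rdiff: "R (\<lambda>\<xi>. G \<xi> - G' \<xi>) = (\<lambda>\<xi>. R G \<xi> - R G' \<xi>)" for G G'
      by (auto simp: R_def right_diff_distrib)
    \<comment> \<open>\<open>r g\<close> is to be a chosen representative of the resolvent applied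
      to \<open>g\<close>. The choice may fail to be linear; differences are compared through their
      transforms.\<close>
    have "\<exists>r G. has_fourier_L2 m g G \<and> has_fourier_L2 m r (R G)" if "g \<in> L2 m" for g
      using has_fourier_L2_ex[OF that] has_fourier_L2_ex_inverse R(1) has_fourier_L2D(2) by metis
    then obtain r G where rG: "\<And>g. g \<in> L2 m \<Longrightarrow> has_fourier_L2 m g (G g)" "\<And>g. g \<in> L2 m \<Longrightarrow> has_fourier_L2 m (r g) (R (G g))"
      by metis
    define T where "T g x = f x - complex_of_real (V x) * r g x" for g x
    have Vr: "(\<lambda>x. complex_of_real (V x) * r g x) \<in> L2 m" if "g \<in> L2 m" for g
      by (rule VL[OF rG(2)[OF that] R(3)[OF has_fourier_L2D(2)[OF rG(1)[OF that]]]])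
    have TL: "T g \<in> L2 m" if "g \<in> L2 m" for g
      unfolding T_def by (rule L2_diff[OF fL Vr[OF that]])
    have contr: "norm_L2 m (\<lambda>x. T g x - T h x) \<le> sqrt (1 / 2) * norm_L2 m (\<lambda>x. g x - h x)"
      if g: "g \<in> L2 m" and h: "h \<in> L2 m" for g h
    proof -
      let ?d = "\<lambda>x. r g x - r h x" and ?E = "\<lambda>\<xi>. G g \<xi> - G h \<xi>"
      have FTd: "has_fourier_L2 m ?d (R ?E)"
        unfolding Rdiff by (rule has_fourier_L2_diff[OF rG(2)[OF g] rG(2)[OF h]])
      have FTe: "has_fourier_L2 m (\<lambda>x. g x - h x) ?E"
        by (rule has_fourier_L2_diff[OF rG(1)[OF g] rG(1)[OF h]])
      note E = R[OF has_fourier_L2D(2)[OF FTe]]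
      let ?N = "(norm_L2 m (\<lambda>x. g x - h x))\<^sup>2"
      have nE: "norm_L2 m ?E = norm_L2 m (\<lambda>x. g x - h x)" by (rule has_fourier_L2_norm[OF FTe])
      have nd: "(norm_L2 m ?d)\<^sup>2 \<le> (1 / \<kappa>)\<^sup>2 * ?N"
        using E(2) unfolding has_fourier_L2_norm[OF FTd] nE .
      have "norm_L2 m (\<lambda>x. T g x - T h x) = norm_L2 m (\<lambda>x. complex_of_real (V x) * ?d x)"
        unfolding norm_L2_diff_commute[of m "T g" "T h"] by (simp add: T_def right_diff_distrib)
      then have "(norm_L2 m (\<lambda>x. T g x - T h x))\<^sup>2 \<le> 1 / 4 * (norm_L2 m (weight \<gamma> (R ?E)))\<^sup>2 + C * (norm_L2 m ?d)\<^sup>2"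
        using Vb[OF FTd E(3)] by simp
      also have "\<dots> \<le> 1 / 4 * ?N + C * ((1 / \<kappa>)\<^sup>2 * ?N)"
        using E(4) nd C unfolding nE by (intro add_mono mult_left_mono) auto
      also have "C * ((1 / \<kappa>)\<^sup>2 * ?N) = C / \<kappa>\<^sup>2 * ?N" by (simp add: power_divide)
      also have "1 / 4 * ?N + C / \<kappa>\<^sup>2 * ?N \<le> 1 / 4 * ?N + 1 / 4 * ?N"
        using \<kappa>(3) by (intro add_left_mono mult_right_mono) auto
      also have "\<dots> = (sqrt (1 / 2) * norm_L2 m (\<lambda>x. g x - h x))\<^sup>2" by (simp add: power_mult_distrib)
      finally show ?thesis by (rule power2_le_imp_le) simp
    qed
    have s: "0 \<le> sqrt (1 / 2)" "sqrt (1 / 2) < 1" by simp_all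
    obtain g where g: "g \<in> L2 m" and Tg: "AE x in m. T g x = g x"
      by (rule L2_contraction_fixpoint[OF _ s, where M = m and T = T]) (erule TL | erule (1) contr | blast)+
    let ?u = "r g" and ?U = "R (G g)"
    note Gg = rG(1)[OF g] and U = rG(2)[OF g]
    obtain l where l: "has_fourier_L2 m l (weight \<gamma> ?U)"
      using has_fourier_L2_ex_inverse[OF R(3)[OF has_fourier_L2D(2)[OF Gg]]] by blast
    have "(\<lambda>\<xi>. 1 * weight \<gamma> ?U \<xi> + of_real \<kappa> * ?U \<xi>) = G g"
    proof
      fix \<xi>
      have "1 * weight \<gamma> ?U \<xi> + of_real \<kappa> * ?U \<xi>
          = of_real ((norm_padic \<xi> powr \<gamma> + \<kappa>) * (1 / (norm_padic \<xi> powr \<gamma> + \<kappa>))) * G g \<xi>"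
        unfolding weight_def R_def of_real_mult of_real_add by (simp only: distrib_right mult.assoc mult_1)
      also have "(norm_padic \<xi> powr \<gamma> + \<kappa>) * (1 / (norm_padic \<xi> powr \<gamma> + \<kappa>)) = 1" using den[of \<xi>] by simp
      finally show "1 * weight \<gamma> ?U \<xi> + of_real \<kappa> * ?U \<xi> = G g \<xi>" by simp
    qed
    then have "has_fourier_L2 m (\<lambda>x. 1 * l x + of_real \<kappa> * ?u x) (G g)"
      using has_fourier_L2_lincomb[OF l U, of 1 "of_real \<kappa>"] by simp
    from has_fourier_L2_inject[OF this Gg] have "AE x in m. 1 * l x + of_real \<kappa> * ?u x = g x" by simp
    \<comment> \<open>Both \<open>u\<close> and \<open>?u\<close> solve the equation for
      \<open>H + \<kappa>\<close> with right-hand side \<open>f\<close>, up to null sets.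
      Injectivity identifies them, and \<open>?u\<close> lies in the domain of \<open>L\<close> by
      construction.\<close>
    with Tg have eq: "AE x in m. w x + of_real \<kappa> * u x = (l x + complex_of_real (V x) * ?u x) + of_real \<kappa> * ?u x"
      by eventually_elim (simp add: T_def f_def algebra_simps)
    have "AE x in m. u x = ?u x"
      by (rule form.form_operator_resolvent_unique[OF _ \<kappa>(2) uw sum[OF U l] eq]) (rule c)
    then have ae: "AE x in m. ?u x = u x" by eventually_elim simp
    have "(?u, l) \<in> L" by (rule taibleson_vladimirovI[OF U l])
    from linear_operatorD(4)[OF linear_taibleson_vladimirov this L2_measurable[OF uL] L2_measurable[OF has_fourier_L2D(1)[OF l]] ae]
    show "u \<in> Domain L" by auto
  qed
qed

end

theorem theorem3p7:
  fixes m :: "'p::prime_card padic measure"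
    and V :: "'p padic \<Rightarrow> real"
    and \<gamma> q :: real
  assumes "normalized_haar_measure m"
    and "\<gamma> > 0"
    and "V \<in> borel_measurable m"
    and "q \<ge> 1" and "q > 1 / \<gamma>"
    and "in_Lq_plus_Linf m q V"
  shows "let L = taibleson_vladimirov m \<gamma>;
             D = dom_Q m L V;
             Q = Q_form m L V;
             H = form_operator m D Q
         in (hermitian_form m D Q \<and> dense_L2 m D \<and> form_closed m D Q \<and> form_bounded_below m D Q \<and>
             self_adjoint m H \<and> op_bounded_below m H) \<and>
            (2 \<le> 1 / \<gamma> \<and> 1 / \<gamma> < q \<longrightarrow> Domain H = Domain L) \<and>
            (1 / \<gamma> < 2 \<and> q = 2 \<longrightarrow> Domain H = Domain L)"
proof -
  interpret haar m by (rule haar.intro) (rule assms(1))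
  interpret schroedinger m V \<gamma> q
    by unfold_locales (use assms in auto)
  \<comment> \<open>Both conditions of the second claim give \<open>q \<ge> 2\<close>, which
    \<open>Domain_form_operator\<close> asks for; the first does so because
    \<open>q > 1 / \<gamma> \<ge> 2\<close>.\<close>
  show ?thesis
    unfolding Let_def
    using hermitian_Q dense_D closed_Q bounded_below_Q
      form.form_operator_self_adjoint[OF dense_D closed_Q bounded_below_Q] Domain_form_operator
    by auto
qed

end
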